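(* Let $n\ge3$. Any free boundary minimal annulus in $\mathbb B^n$ that is sufficiently $C^2$-close to the critical catenoid is a rotation of the critical catenoid. That is, there is $\delta>0$ such that if $u:A\to\mathbb B^n$ is a free boundary minimal immersion of the annulus $A=[-T_{1,0},T_{1,0}]\times\mathbb S^1$ with $\|u-u_0\|_{C^2(A)}<\delta$, where $u_0$ is the standard parametrization of the critical catenoid, then $u(A)$ is the image of the critical catenoid under an orthogonal transformation of $\mathbb R^n$.
   Context: $\mathbb B^n$ is the closed unit ball in $\mathbb R^n$. A free boundary minimal surface in $\mathbb B^n$ is a properly immersed minimal surface with boundary ($u^{-1}(\partial\mathbb B^n)=\partial A$) that meets $\partial\mathbb B^n$ orthogonally along its boundary. The critical catenoid is the unique portion of a suitably scaled catenoid which defines a free boundary minimal surface in $\mathbb B^3$. Explicitly, let $T=T_{1,0}$ be the unique positive solution of $t=\coth t$; the critical catenoid is the image of $u_0:[-T,T]\times\mathbb S^1\to\mathbb B^3$, $$u_0(t,\theta)=\frac{1}{\sqrt{\cosh^2T+T^2}}\,(\cosh t\cos\theta,\ \cosh t\sin\theta,\ t).$$ For $n>3$ it is regarded as a surface in $\mathbb B^n$ via the standard inclusion $\mathbb R^3\subset\mathbb R^n$. *)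

theory Defs
  imports "HOL-Analysis.Analysis"
begin

lemma critical_T_ex1: "\<exists>!t::real. t > 0 \<and> t = cosh t / sinh t"
proof -
  let ?f = "\<lambda>t::real. t * sinh t - cosh t"
  have mono: "?f s < ?f t" if "0 \<le> s" "s < t" for s t
  proof (rule DERIV_pos_imp_increasing_open[OF that(2)])
    fix x assume "s < x" "x < t"
    then have "x * cosh x > 0" using that by simp
    moreover have "(?f has_real_derivative x * cosh x) (at x)"
      by (auto intro!: derivative_eq_intros)
    ultimately show "\<exists>y. (?f has_real_derivative y) (at x) \<and> y > 0" by blast
  qed (auto intro!: continuous_intros)
  have eq: "(t > 0 \<and> t = cosh t / sinh t) \<longleftrightarrow> (t > 0 \<and> ?f t = 0)" for t :: real
    by (auto simp: field_simps)
  have "exp (2::real) > 3" using exp_lower_Taylor_quadratic[of "2::real"] by simp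
  moreover have "exp (-2::real) < 1" by simp
  moreover have "?f 2 = exp 2 / 2 - 3 / 2 * exp (-2)"
    by (simp add: sinh_def cosh_def field_simps)
  ultimately have "?f 2 > 0" by linarith
  moreover have "?f 0 < 0" by simp
  ultimately have "\<exists>t. 0 \<le> t \<and> t \<le> 2 \<and> ?f t = 0"
    by (intro IVT') (auto intro!: continuous_intros)
  then obtain t where t: "0 \<le> t" "?f t = 0" by blast
  then have "t > 0" by (cases "t = 0") auto
  show ?thesis unfolding eq
  proof (rule ex1I[of _ t])
    fix s assume "s > 0 \<and> ?f s = 0"
    then show "s = t" using mono[of s t] mono[of t s] t by (cases s t rule: linorder_cases) auto
  qed (use t \<open>t > 0\<close> in auto)
qed

definition critical_T :: real where
  "critical_T = (THE t. t > 0 \<and> t = cosh t / sinh t)"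

text \<open>
  The circle is the unit circle of the complex plane. A map \<open>u\<close> on the annulus is
  differentiated through its lift \<open>(t, \<theta>) \<mapsto> u (t, cis \<theta>)\<close> to the
  closed strip that covers the annulus.
\<close>

definition annulus :: "real \<Rightarrow> (real \<times> complex) set" where
  "annulus T = {-T..T} \<times> sphere 0 1"

definition annulus_boundary :: "real \<Rightarrow> (real \<times> complex) set" where
  "annulus_boundary T = {-T, T} \<times> sphere 0 1"

definition strip :: "real \<Rightarrow> (real \<times> real) set" where
  "strip T = {-T..T} \<times> UNIV"

definition lift :: "(real \<times> complex \<Rightarrow> 'a) \<Rightarrow> real \<times> real \<Rightarrow> 'a" where
  "lift u = (\<lambda>(t, \<theta>). u (t, cis \<theta>))"

text \<open>
  Derivatives are taken within \<open>S\<close>, hence are one-sided at boundary points. They are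
  only meaningful where they are unique, for instance on a convex \<open>S\<close> with nonempty
  interior such as \<open>strip T\<close> for \<open>T > 0\<close>.
\<close>

definition partial :: "'b set \<Rightarrow> 'b \<Rightarrow> ('b::euclidean_space \<Rightarrow> 'a::real_normed_vector) \<Rightarrow> 'b \<Rightarrow> 'a" where
  "partial S e f p = frechet_derivative f (at p within S) e"

primrec Ck_on :: "nat \<Rightarrow> 'b set \<Rightarrow> ('b::euclidean_space \<Rightarrow> 'a::real_normed_vector) \<Rightarrow> bool" where
  "Ck_on 0 S f \<longleftrightarrow> continuous_on S f"
| "Ck_on (Suc k) S f \<longleftrightarrow> f differentiable_on S \<and> (\<forall>e\<in>Basis. Ck_on k S (partial S e f))"

definition smooth_annulus_map :: "real \<Rightarrow> (real \<times> complex \<Rightarrow> 'a::real_normed_vector) \<Rightarrow> bool" where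
  "smooth_annulus_map T u \<longleftrightarrow> (\<forall>k. Ck_on k (strip T) (lift u))"

text \<open>
  The suprema range over the strip; by periodicity in \<open>\<theta>\<close> they are the suprema over
  the compact annulus, finite for every map that is twice continuously differentiable up to the
  boundary.
\<close>

definition sup_norm_on :: "'b set \<Rightarrow> ('b \<Rightarrow> 'a::real_normed_vector) \<Rightarrow> real" where
  "sup_norm_on S f = (SUP p\<in>S. norm (f p))"

definition C2_norm :: "real \<Rightarrow> (real \<times> complex \<Rightarrow> 'a::real_normed_vector) \<Rightarrow> real" where
  "C2_norm T u =
     sup_norm_on (strip T) (lift u)
   + (\<Sum>e\<in>Basis. sup_norm_on (strip T) (partial (strip T) e (lift u)))
   + (\<Sum>e\<in>Basis. \<Sum>e'\<in>Basis.
        sup_norm_on (strip T) (partial (strip T) e (partial (strip T) e' (lift u))))"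

definition d_t :: "real \<Rightarrow> (real \<times> real \<Rightarrow> 'a::real_normed_vector) \<Rightarrow> real \<times> real \<Rightarrow> 'a" where
  "d_t T = partial (strip T) (1, 0)"

definition d_theta :: "real \<Rightarrow> (real \<times> real \<Rightarrow> 'a::real_normed_vector) \<Rightarrow> real \<times> real \<Rightarrow> 'a" where
  "d_theta T = partial (strip T) (0, 1)"

definition tangent_plane :: "real \<Rightarrow> (real \<times> real \<Rightarrow> 'a::euclidean_space) \<Rightarrow> real \<times> real \<Rightarrow> 'a set" where
  "tangent_plane T U p = range (frechet_derivative U (at p within strip T))"

definition immersion :: "real \<Rightarrow> (real \<times> complex \<Rightarrow> 'a::euclidean_space) \<Rightarrow> bool" where
  "immersion T u \<longleftrightarrow> smooth_annulus_map T u \<and>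
     (\<forall>p\<in>strip T. inj (frechet_derivative (lift u) (at p within strip T)))"

text \<open>On a subspace, \<^const>\<open>closest_point\<close> is the orthogonal projection.\<close>

definition normal_part :: "real \<Rightarrow> (real \<times> real \<Rightarrow> 'a::euclidean_space) \<Rightarrow> real \<times> real \<Rightarrow> 'a \<Rightarrow> 'a" where
  "normal_part T U p v = v - closest_point (tangent_plane T U p) v"

text \<open>
  The mean curvature vector is the trace, with respect to the induced metric
  \<open>E dt\<^sup>2 + 2 F dt d\<theta> + G d\<theta>\<^sup>2\<close>, of the second fundamental form, whose
  coefficients are the normal parts of the second partial derivatives.
\<close>

definition mean_curvature :: "real \<Rightarrow> (real \<times> real \<Rightarrow> 'a::euclidean_space) \<Rightarrow> real \<times> real \<Rightarrow> 'a" where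
  "mean_curvature T U p =
     (let E = d_t T U p \<bullet> d_t T U p;
          F = d_t T U p \<bullet> d_theta T U p;
          G = d_theta T U p \<bullet> d_theta T U p;
          II_tt = normal_part T U p (d_t T (d_t T U) p);
          II_t\<theta> = normal_part T U p (d_t T (d_theta T U) p);
          II_\<theta>\<theta> = normal_part T U p (d_theta T (d_theta T U) p)
      in (1 / (E * G - F\<^sup>2)) *\<^sub>R (G *\<^sub>R II_tt - (2 * F) *\<^sub>R II_t\<theta> + E *\<^sub>R II_\<theta>\<theta>))"

definition minimal_immersion :: "real \<Rightarrow> (real \<times> complex \<Rightarrow> 'a::euclidean_space) \<Rightarrow> bool" where
  "minimal_immersion T u \<longleftrightarrow> immersion T u \<and> (\<forall>p\<in>strip T. mean_curvature T (lift u) p = 0)"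

text \<open>
  Along the boundary, the conormal directions of the surface (tangent to it and perpendicular to
  the boundary curve) are perpendicular to the tangent space of the unit sphere, which at
  \<open>x\<close> consists of all \<open>v\<close> perpendicular to \<open>x\<close>.
\<close>

definition meets_sphere_orthogonally ::
    "real \<Rightarrow> (real \<times> complex \<Rightarrow> 'a::euclidean_space) \<Rightarrow> bool" where
  "meets_sphere_orthogonally T u \<longleftrightarrow>
     (\<forall>p\<in>{-T, T} \<times> UNIV. \<forall>\<eta>\<in>tangent_plane T (lift u) p.
        orthogonal \<eta> (d_theta T (lift u) p) \<longrightarrow>
        (\<forall>v. orthogonal v (lift u p) \<longrightarrow> orthogonal \<eta> v))"

definition free_boundary_minimal_immersion ::
    "real \<Rightarrow> (real \<times> complex \<Rightarrow> 'a::euclidean_space) \<Rightarrow> bool" where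
  "free_boundary_minimal_immersion T u \<longleftrightarrow>
     minimal_immersion T u \<and>
     u ` annulus T \<subseteq> cball 0 1 \<and>
     {p \<in> annulus T. u p \<in> sphere 0 1} = annulus_boundary T \<and>
     meets_sphere_orthogonally T u"

definition critical_catenoid :: "real \<times> complex \<Rightarrow> real ^ 3" where
  "critical_catenoid = (\<lambda>(t, z).
     (1 / sqrt ((cosh critical_T)\<^sup>2 + critical_T\<^sup>2)) *\<^sub>R
       vector [cosh t * Re z, cosh t * Im z, t])"

text \<open>
  The coordinates of \<open>real ^ 'n\<close> carry no order, so the standard inclusion of
  three-space is given by an injective choice \<open>\<sigma>\<close> of three coordinates.
\<close>

definition coord_inclusion :: "(3 \<Rightarrow> 'n) \<Rightarrow> real ^ 3 \<Rightarrow> real ^ 'n::finite" where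
  "coord_inclusion \<sigma> x = (\<Sum>k\<in>UNIV. (x $ k) *\<^sub>R axis (\<sigma> k) 1)"

end

theory Submission
  imports Defs
begin

text \<open>
  The proof is a rigidity argument that counts dimensions twice. It rests on two quadratic forms on
  functions \<open>f\<close> on the annulus. For a free boundary minimal surface \<open>u\<close> the first is the Steklov
  form \<open>\<integral> |\<nabla>f|\<^sup>2 - \<integral> f\<^sup>2\<close> (the second integral over the boundary); the second is the second
  variation of area in three-space, which adds the potential \<open>2 K\<close>, with \<open>K\<close> the Gauss curvature.
  Their coefficients are continuous functions of the first and second derivatives of \<open>u\<close>, so if \<open>u\<close>
  is close to the critical catenoid they are uniformly close to those of the catenoid
  (\<open>jets_near_catenoid\<close>, \<open>jets_of_close_map\<close>).

  On the catenoid, in its conformal parametrization, the forms split into Fourier modes. The Steklov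
  form is coercive under four linear conditions on \<open>f\<close> and the second variation under six: the low
  modes reduce to inequalities on an interval, which use \<open>T\<^sup>2 < 2\<close>, and for all higher modes a
  Wirtinger inequality suffices, since \<open>tanh\<close> is concave and \<open>tanh T = 1 / T\<close>. Coercivity in \<open>H\<^sup>1\<close>
  survives a small change of the coefficients (\<open>steklov_coercive_near\<close>, \<open>jacobi_coercive_near\<close>).

  First count. The coordinate functions of \<open>u\<close> are Steklov eigenfunctions with eigenvalue one, that
  is, they lie in the kernel of the Steklov form, which is negative on constants. So the form is not
  positive on the span of the coordinates and the constants, whose dimension is therefore at most
  four: the image of \<open>u\<close> lies in a three-dimensional subspace (\<open>dim_image_le_3\<close>). An isometry moves
  it to three-space.

  Second count. There, each infinitesimal rotation has a normal component that lies in the kernel of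
  the second variation. Together with the coordinates and the constants, on which the second
  variation is negative, these are seven parameters against six conditions. Hence some nonzero
  rotation is tangent to the surface (\<open>exists_tangent_rotation\<close>).

  A minimal surface to which a rotation field is tangent, and which is not flat, lies on a catenoid
  with the same axis: its profile satisfies first order equations that integrate explicitly
  (\<open>profile_is_catenary\<close>). The free boundary condition at the two boundary curves leaves only the
  critical catenoid, once the boundary heights are known to be below \<open>1 / \<surd>2\<close>, which follows from
  closeness (\<open>on_critical_catenoid\<close>). Finally the image is closed, and open in the catenoid away
  from its boundary, so by connectedness it is the whole critical catenoid (\<open>fills_catenoid\<close>). The
  isometry from the three-dimensional subspace extends to an orthogonal transformation of the
  ambient space.
\<close>

section \<open>The critical parameter and energies on an interval\<close>

lemma critical_T_pos: "critical_T > 0"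
  and critical_T_eq: "critical_T = cosh critical_T / sinh critical_T"
  using theI'[OF critical_T_ex1] unfolding critical_T_def by auto

lemma tanh_critical_T: "tanh critical_T = 1 / critical_T"
  using critical_T_eq by (metis inverse_divide inverse_eq_divide tanh_def)

lemma critical_T_gt_1: "critical_T > 1"
proof -
  have "sinh critical_T > 0" using critical_T_pos by simp
  moreover have "cosh critical_T > sinh critical_T" by (rule sinh_less_cosh_real)
  ultimately have "cosh critical_T / sinh critical_T > 1" by simp
  then show ?thesis using critical_T_eq by simp
qed

text \<open>
  Written with exponentials, \<open>T = coth T\<close> says \<open>exp (2 T) (T - 1) = T + 1\<close>; three terms of the
  exponential series give \<open>T\<^sup>3 \<le> T + 1\<close>, which excludes \<open>T\<^sup>2 \<ge> 2\<close> because \<open>T > 1\<close>.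
\<close>
lemma critical_T_square_lt_2: "critical_T\<^sup>2 < 2"
proof (rule ccontr)
  let ?T = critical_T
  assume "\<not> ?T\<^sup>2 < 2"
  then have T2: "?T\<^sup>2 \<ge> 2" by simp
  have T1: "?T > 1" by (rule critical_T_gt_1)
  have "sinh ?T > 0" using critical_T_pos by simp
  then have "?T * sinh ?T = cosh ?T" using critical_T_eq by (metis nonzero_eq_divide_eq less_irrefl)
  then have "?T * (exp ?T - exp (- ?T)) = exp ?T + exp (- ?T)"
    by (simp add: sinh_field_def cosh_field_def field_simps)
  then have "exp ?T * (?T * (exp ?T - exp (- ?T))) = exp ?T * (exp ?T + exp (- ?T))" by simp
  moreover have "exp ?T * exp (- ?T) = 1" by (simp add: exp_minus)
  moreover have "exp ?T * exp ?T = exp (2 * ?T)" by (simp add: exp_add [symmetric])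
  ultimately have e: "exp (2 * ?T) * (?T - 1) = ?T + 1" by algebra
  have "1 + 2 * ?T + (2 * ?T)\<^sup>2 / 2 \<le> exp (2 * ?T)"
    by (rule exp_lower_Taylor_quadratic) (use T1 in simp)
  then have "(1 + 2 * ?T + (2 * ?T)\<^sup>2 / 2) * (?T - 1) \<le> ?T + 1"
    using mult_right_mono[of _ "exp (2 * ?T)" "?T - 1"] T1 e by fastforce
  then have "?T * ?T\<^sup>2 \<le> ?T + 1" by (simp add: power2_eq_square algebra_simps)
  moreover have "?T * ?T\<^sup>2 \<ge> ?T * 2" using T2 T1 by (intro mult_left_mono) auto
  ultimately show False using T1 by simp
qed

text \<open>
  Integrate \<open>(h' - A h)\<^sup>2 \<ge> 0\<close>, where the mixed term is part of the derivative of \<open>A h\<^sup>2\<close>. The lower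
  bounds for energies on an interval come from weights \<open>A\<close> for which \<open>A' + A\<^sup>2\<close> is the potential at
  hand.
\<close>
lemma square_completion:
  fixes h h' A A' :: "real \<Rightarrow> real"
  assumes ab: "a \<le> b"
    and h: "\<And>x. x \<in> {a..b} \<Longrightarrow> (h has_real_derivative h' x) (at x within {a..b})"
    and ch: "continuous_on {a..b} h'"
    and A: "\<And>x. x \<in> {a..b} \<Longrightarrow> (A has_real_derivative A' x) (at x within {a..b})"
    and cA: "continuous_on {a..b} A'"
  shows "A b * (h b)\<^sup>2 - A a * (h a)\<^sup>2 \<le> integral {a..b} (\<lambda>x. (h' x)\<^sup>2 + (A' x + (A x)\<^sup>2) * (h x)\<^sup>2)"
proof -
  have cont: "continuous_on {a..b} h" "continuous_on {a..b} A"
    by (auto intro!: DERIV_continuous_on h A)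
  have "((\<lambda>x. A' x * (h x)\<^sup>2 + 2 * A x * h x * h' x) has_integral A b * (h b)\<^sup>2 - A a * (h a)\<^sup>2) {a..b}"
  proof (rule fundamental_theorem_of_calculus[OF ab])
    fix x assume "x \<in> {a..b}"
    then have "((\<lambda>x. A x * (h x)\<^sup>2) has_real_derivative A' x * (h x)\<^sup>2 + 2 * A x * h x * h' x) (at x within {a..b})"
      by (auto intro!: derivative_eq_intros h A simp: power2_eq_square algebra_simps)
    then show "((\<lambda>x. A x * (h x)\<^sup>2) has_vector_derivative A' x * (h x)\<^sup>2 + 2 * A x * h x * h' x) (at x within {a..b})"
      by (simp add: has_real_derivative_iff_has_vector_derivative)
  qed
  then have "A b * (h b)\<^sup>2 - A a * (h a)\<^sup>2 = integral {a..b} (\<lambda>x. A' x * (h x)\<^sup>2 + 2 * A x * h x * h' x)"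
    by (simp add: integral_unique)
  also have "\<dots> \<le> integral {a..b} (\<lambda>x. (h' x)\<^sup>2 + (A' x + (A x)\<^sup>2) * (h x)\<^sup>2)"
  proof (rule integral_le)
    show "(\<lambda>x. A' x * (h x)\<^sup>2 + 2 * A x * h x * h' x) integrable_on {a..b}"
      by (intro integrable_continuous_interval continuous_intros cont ch cA)
    show "(\<lambda>x. (h' x)\<^sup>2 + (A' x + (A x)\<^sup>2) * (h x)\<^sup>2) integrable_on {a..b}"
      by (intro integrable_continuous_interval continuous_intros cont ch cA)
    fix x
    have "0 \<le> (h' x - A x * h x)\<^sup>2" by simp
    then show "A' x * (h x)\<^sup>2 + 2 * A x * h x * h' x \<le> (h' x)\<^sup>2 + (A' x + (A x)\<^sup>2) * (h x)\<^sup>2"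
      by (simp add: power2_eq_square algebra_simps)
  qed
  finally show ?thesis .
qed

text \<open>
  The weight \<open>1 / (x - a)\<close> satisfies \<open>A' + A\<^sup>2 = 0\<close>. It is singular at the zero of \<open>h\<close>, hence the
  shift by \<open>e\<close>.
\<close>
lemma bounded_by_energy_left:
  fixes h h' :: "real \<Rightarrow> real"
  assumes ab: "a \<le> b"
    and h: "\<And>x. x \<in> {a..b} \<Longrightarrow> (h has_real_derivative h' x) (at x within {a..b})"
    and ch: "continuous_on {a..b} h'"
    and ha: "h a = 0"
  shows "(h b)\<^sup>2 \<le> (b - a) * integral {a..b} (\<lambda>x. (h' x)\<^sup>2)"
proof -
  let ?J = "integral {a..b} (\<lambda>x. (h' x)\<^sup>2)"
  have J: "?J \<ge> 0" by (rule integral_nonneg) (auto intro!: integrable_continuous_interval continuous_intros ch)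
  have "(h b)\<^sup>2 \<le> (b - a) * ?J + \<epsilon>" if "\<epsilon> > 0" for \<epsilon>
  proof -
    define e where "e = \<epsilon> / (?J + 1)"
    have e: "e > 0" using that J by (simp add: e_def)
    let ?A = "\<lambda>x. 1 / (x - a + e)" and ?A' = "\<lambda>x. - 1 / (x - a + e)\<^sup>2"
    have "?A b * (h b)\<^sup>2 - ?A a * (h a)\<^sup>2 \<le> integral {a..b} (\<lambda>x. (h' x)\<^sup>2 + (?A' x + (?A x)\<^sup>2) * (h x)\<^sup>2)"
    proof (rule square_completion[OF ab h ch])
      fix x assume "x \<in> {a..b}"
      then show "(?A has_real_derivative ?A' x) (at x within {a..b})"
        using e by (auto intro!: derivative_eq_intros simp: power2_eq_square)
    next
      show "continuous_on {a..b} ?A'" using e by (intro continuous_intros) (auto simp: add_pos_nonneg)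
    qed
    also have "\<dots> = ?J" by (simp add: power_divide)
    finally have "(h b)\<^sup>2 \<le> (b - a + e) * ?J" using e ab ha by (simp add: field_simps)
    also have "\<dots> \<le> (b - a) * ?J + \<epsilon>"
      using J that by (simp add: e_def algebra_simps divide_le_eq)
    finally show ?thesis .
  qed
  then show ?thesis by (rule field_le_epsilon)
qed

lemma bounded_by_energy_right:
  fixes h h' :: "real \<Rightarrow> real"
  assumes ab: "a \<le> b"
    and h: "\<And>x. x \<in> {a..b} \<Longrightarrow> (h has_real_derivative h' x) (at x within {a..b})"
    and ch: "continuous_on {a..b} h'"
    and hb: "h b = 0"
  shows "(h a)\<^sup>2 \<le> (b - a) * integral {a..b} (\<lambda>x. (h' x)\<^sup>2)"
proof -
  have im: "uminus ` {-b..-a} = {a..b}" by simp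
  have h2: "((\<lambda>x. h (- x)) has_real_derivative - h' (- x)) (at x within {-b..-a})"
    if "x \<in> {-b..-a}" for x
  proof -
    have "((\<lambda>x. h (- x)) has_real_derivative h' (- x) * (- 1)) (at x within {-b..-a})"
      by (rule DERIV_image_chain[where f = h and g = uminus, unfolded o_def])
        (use that im h in \<open>auto intro!: derivative_eq_intros simp del: image_uminus_atLeastAtMost\<close>)
    then show ?thesis by simp
  qed
  have "(h (- (-a)))\<^sup>2 \<le> (- a - - b) * integral {-b..-a} (\<lambda>x. (- h' (- x))\<^sup>2)"
    by (rule bounded_by_energy_left[OF _ h2])
      (use ab hb in \<open>auto intro!: continuous_intros continuous_on_compose2[OF ch]\<close>)
  also have "integral {-b..-a} (\<lambda>x. (- h' (- x))\<^sup>2) = integral {a..b} (\<lambda>x. (h' x)\<^sup>2)"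
    using Henstock_Kurzweil_Integration.integral_reflect_real[of b a "\<lambda>x. (h' x)\<^sup>2"] by simp
  finally show ?thesis by simp
qed

lemma integral_subinterval_le:
  fixes f :: "real \<Rightarrow> real"
  assumes "continuous_on {a..b} f" "\<And>x. x \<in> {a..b} \<Longrightarrow> f x \<ge> 0" "{c..d} \<subseteq> {a..b}"
  shows "integral {c..d} f \<le> integral {a..b} f"
  by (rule integral_subset_le)
    (use assms in \<open>auto intro!: integrable_continuous_interval intro: continuous_on_subset\<close>)

lemma poincare_left:
  fixes h h' :: "real \<Rightarrow> real"
  assumes ab: "a \<le> b"
    and h: "\<And>x. x \<in> {a..b} \<Longrightarrow> (h has_real_derivative h' x) (at x within {a..b})"
    and ch: "continuous_on {a..b} h'"
    and ha: "h a = 0"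
  shows "integral {a..b} (\<lambda>x. (h x)\<^sup>2) \<le> (b - a)\<^sup>2 / 2 * integral {a..b} (\<lambda>x. (h' x)\<^sup>2)"
proof -
  let ?J = "integral {a..b} (\<lambda>x. (h' x)\<^sup>2)"
  have ch0: "continuous_on {a..b} h" by (auto intro!: DERIV_continuous_on h)
  have le: "(h x)\<^sup>2 \<le> (x - a) * ?J" if x: "x \<in> {a..b}" for x
  proof -
    have "(h x)\<^sup>2 \<le> (x - a) * integral {a..x} (\<lambda>x. (h' x)\<^sup>2)"
      by (rule bounded_by_energy_left)
        (use x ha in \<open>auto intro!: continuous_on_subset[OF ch] DERIV_subset[OF h]\<close>)
    also have "\<dots> \<le> (x - a) * ?J"
      using x by (intro mult_left_mono integral_subinterval_le continuous_intros ch) auto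
    finally show ?thesis .
  qed
  have I: "((\<lambda>x. (x - a) * ?J) has_integral ((b - a)\<^sup>2 / 2 * ?J - (a - a)\<^sup>2 / 2 * ?J)) {a..b}"
    by (rule fundamental_theorem_of_calculus[OF ab])
      (auto intro!: derivative_eq_intros simp flip: has_real_derivative_iff_has_vector_derivative)
  have "integral {a..b} (\<lambda>x. (h x)\<^sup>2) \<le> integral {a..b} (\<lambda>x. (x - a) * ?J)"
    by (rule integral_le) (auto intro!: integrable_continuous_interval continuous_intros ch0 le)
  also have "\<dots> = (b - a)\<^sup>2 / 2 * ?J" using integral_unique[OF I] by simp
  finally show ?thesis .
qed

lemma poincare_right:
  fixes h h' :: "real \<Rightarrow> real"
  assumes ab: "a \<le> b"
    and h: "\<And>x. x \<in> {a..b} \<Longrightarrow> (h has_real_derivative h' x) (at x within {a..b})"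
    and ch: "continuous_on {a..b} h'"
    and hb: "h b = 0"
  shows "integral {a..b} (\<lambda>x. (h x)\<^sup>2) \<le> (b - a)\<^sup>2 / 2 * integral {a..b} (\<lambda>x. (h' x)\<^sup>2)"
proof -
  let ?J = "integral {a..b} (\<lambda>x. (h' x)\<^sup>2)"
  have ch0: "continuous_on {a..b} h" by (auto intro!: DERIV_continuous_on h)
  have le: "(h x)\<^sup>2 \<le> (b - x) * ?J" if x: "x \<in> {a..b}" for x
  proof -
    have "(h x)\<^sup>2 \<le> (b - x) * integral {x..b} (\<lambda>x. (h' x)\<^sup>2)"
      by (rule bounded_by_energy_right)
        (use x hb in \<open>auto intro!: continuous_on_subset[OF ch] DERIV_subset[OF h]\<close>)
    also have "\<dots> \<le> (b - x) * ?J"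
      using x by (intro mult_left_mono integral_subinterval_le continuous_intros ch) auto
    finally show ?thesis .
  qed
  have I: "((\<lambda>x. (b - x) * ?J) has_integral (- ((b - b)\<^sup>2 / 2 * ?J) - - ((b - a)\<^sup>2 / 2 * ?J))) {a..b}"
    by (rule fundamental_theorem_of_calculus[OF ab])
      (auto intro!: derivative_eq_intros simp: field_simps simp flip: has_real_derivative_iff_has_vector_derivative)
  have "integral {a..b} (\<lambda>x. (h x)\<^sup>2) \<le> integral {a..b} (\<lambda>x. (b - x) * ?J)"
    by (rule integral_le) (auto intro!: integrable_continuous_interval continuous_intros ch0 le)
  also have "\<dots> = (b - a)\<^sup>2 / 2 * ?J" using integral_unique[OF I] by simp
  finally show ?thesis .
qed

text \<open>
  The zeros and the midpoint cut the interval into four pieces of length \<open>T / 2\<close>, on each of which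
  \<open>h\<close> vanishes at one end. Half of the gradient term dominates the boundary values and the other
  half the \<open>L\<^sup>2\<close>-norm.
\<close>
lemma energy_two_interior_zeros:
  fixes h h' :: "real \<Rightarrow> real"
  assumes T: "T > 0"
    and h: "\<And>x. x \<in> {-T..T} \<Longrightarrow> (h has_real_derivative h' x) (at x within {-T..T})"
    and ch: "continuous_on {-T..T} h'"
    and zero: "h (T / 2) = 0" "h (- T / 2) = 0"
  shows "(4 / T\<^sup>2 - 2) * integral {-T..T} (\<lambda>x. (h x)\<^sup>2) \<le>
    integral {-T..T} (\<lambda>x. (h' x)\<^sup>2) - 2 * integral {-T..T} (\<lambda>x. (h x)\<^sup>2)
      - ((h T)\<^sup>2 + (h (-T))\<^sup>2) / T"
proof -
  have ch0: "continuous_on {-T..T} h" by (auto intro!: DERIV_continuous_on h)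
  let ?J = "\<lambda>a b. integral {a..b} (\<lambda>x. (h' x)\<^sup>2)"
  let ?I = "\<lambda>a b. integral {a..b} (\<lambda>x. (h x)\<^sup>2)"
  have D: "(h has_real_derivative h' x) (at x within {a..b})"
    if "-T \<le> a" "b \<le> T" "x \<in> {a..b}" for a b x
    by (rule DERIV_subset[OF h]) (use that in auto)
  have C: "continuous_on {a..b} h'" "continuous_on {a..b} h" if "-T \<le> a" "b \<le> T" for a b
    using that by (auto intro: continuous_on_subset[OF ch] continuous_on_subset[OF ch0])
  have split: "integral {-T..T} f = integral {-T..-T/2} f + integral {-T/2..0} f + integral {0..T/2} f + integral {T/2..T} f"
    if f: "continuous_on {-T..T} f" for f :: "real \<Rightarrow> real"
  proof -
    have i: "f integrable_on {a..b}" if "-T \<le> a" "b \<le> T" for a b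
      using that by (auto intro!: integrable_continuous_interval intro: continuous_on_subset[OF f])
    show ?thesis
      using Henstock_Kurzweil_Integration.integral_combine[of "-T" "-T/2" T f]
        Henstock_Kurzweil_Integration.integral_combine[of "-T/2" 0 T f]
        Henstock_Kurzweil_Integration.integral_combine[of 0 "T/2" T f] T i by simp
  qed
  have J: "?J (-T) T = ?J (-T) (-T/2) + ?J (-T/2) 0 + ?J 0 (T/2) + ?J (T/2) T"
    by (rule split) (intro continuous_intros ch)
  have I: "?I (-T) T = ?I (-T) (-T/2) + ?I (-T/2) 0 + ?I 0 (T/2) + ?I (T/2) T"
    by (rule split) (intro continuous_intros ch0)
  have "?I (-T) (-T/2) \<le> (-T/2 - -T)\<^sup>2 / 2 * ?J (-T) (-T/2)"
    by (rule poincare_right) (use T D C zero in auto)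
  then have 1: "?I (-T) (-T/2) \<le> T\<^sup>2 / 8 * ?J (-T) (-T/2)" by (simp add: power_divide)
  have "?I (-T/2) 0 \<le> (0 - -T/2)\<^sup>2 / 2 * ?J (-T/2) 0"
    by (rule poincare_left) (use T D C zero in auto)
  then have 2: "?I (-T/2) 0 \<le> T\<^sup>2 / 8 * ?J (-T/2) 0" by (simp add: power_divide)
  have "?I 0 (T/2) \<le> (T/2 - 0)\<^sup>2 / 2 * ?J 0 (T/2)"
    by (rule poincare_right) (use T D C zero in auto)
  then have 3: "?I 0 (T/2) \<le> T\<^sup>2 / 8 * ?J 0 (T/2)" by (simp add: power_divide)
  have "?I (T/2) T \<le> (T - T/2)\<^sup>2 / 2 * ?J (T/2) T"
    by (rule poincare_left) (use T D C zero in auto)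
  then have 4: "?I (T/2) T \<le> T\<^sup>2 / 8 * ?J (T/2) T" by (simp add: power_divide)
  have IJ: "?I (-T) T \<le> T\<^sup>2 / 8 * ?J (-T) T"
    using 1 2 3 4 unfolding I J by (simp add: algebra_simps)
  have "(h T)\<^sup>2 \<le> (T - T/2) * ?J (T/2) T"
    by (rule bounded_by_energy_left) (use T D C zero in auto)
  moreover have "(h (-T))\<^sup>2 \<le> (-T/2 - -T) * ?J (-T) (-T/2)"
    by (rule bounded_by_energy_right) (use T D C zero in auto)
  moreover have "?J (-T/2) 0 \<ge> 0" "?J 0 (T/2) \<ge> 0"
    using T by (auto intro!: integral_nonneg integrable_continuous_interval continuous_intros C)
  ultimately have bdry: "((h T)\<^sup>2 + (h (-T))\<^sup>2) / T \<le> ?J (-T) T / 2"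
  proof -
    assume a: "(h T)\<^sup>2 \<le> (T - T/2) * ?J (T/2) T" "(h (-T))\<^sup>2 \<le> (-T/2 - -T) * ?J (-T) (-T/2)"
      and n: "?J (-T/2) 0 \<ge> 0" "?J 0 (T/2) \<ge> 0"
    have "(h T)\<^sup>2 + (h (-T))\<^sup>2 \<le> T / 2 * ?J (T/2) T + T / 2 * ?J (-T) (-T/2)"
      using a by simp
    also have "\<dots> = T / 2 * (?J (T/2) T + ?J (-T) (-T/2))" by (simp add: algebra_simps)
    also have "\<dots> \<le> T / 2 * ?J (-T) T"
      unfolding J using n T by (intro mult_left_mono) auto
    finally show ?thesis using T by (simp add: field_simps)
  qed
  have "4 / T\<^sup>2 * ?I (-T) T \<le> ?J (-T) T / 2"
    using IJ T by (simp add: field_simps)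
  with bdry show ?thesis unfolding left_diff_distrib by linarith
qed

lemma energy_zero_at_centre:
  fixes h h' :: "real \<Rightarrow> real"
  assumes T: "T > 0"
    and h: "\<And>x. x \<in> {-T..T} \<Longrightarrow> (h has_real_derivative h' x) (at x within {-T..T})"
    and ch: "continuous_on {-T..T} h'"
    and zero: "h 0 = 0"
  shows "((h T)\<^sup>2 + (h (-T))\<^sup>2) / T \<le> integral {-T..T} (\<lambda>x. (h' x)\<^sup>2)"
proof -
  have D: "(h has_real_derivative h' x) (at x within {a..b})"
    if "-T \<le> a" "b \<le> T" "x \<in> {a..b}" for a b x
    by (rule DERIV_subset[OF h]) (use that in auto)
  have C: "continuous_on {a..b} h'" if "-T \<le> a" "b \<le> T" for a b
    using that by (auto intro: continuous_on_subset[OF ch])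
  let ?J = "\<lambda>a b. integral {a..b} (\<lambda>x. (h' x)\<^sup>2)"
  have sum: "?J (-T) 0 + ?J 0 T = ?J (-T) T"
    by (rule Henstock_Kurzweil_Integration.integral_combine)
      (use T in \<open>auto intro!: integrable_continuous_interval continuous_intros C\<close>)
  have "(h T)\<^sup>2 \<le> (T - 0) * ?J 0 T"
    by (rule bounded_by_energy_left) (use T D C zero in auto)
  moreover have "(h (-T))\<^sup>2 \<le> (0 - -T) * ?J (-T) 0"
    by (rule bounded_by_energy_right) (use T D C zero in auto)
  ultimately have "(h T)\<^sup>2 + (h (-T))\<^sup>2 \<le> T * (?J 0 T + ?J (-T) 0)"
    by (simp add: algebra_simps)
  then have "(h T)\<^sup>2 + (h (-T))\<^sup>2 \<le> T * ?J (-T) T" using sum by (simp add: add.commute)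
  then show ?thesis using T by (simp add: field_simps)
qed

text \<open>
  The weight \<open>t / T\<^sup>2\<close> takes the values \<open>\<plusminus> 1 / T\<close> at the ends, which are exactly the boundary
  weights.
\<close>
lemma robin_energy_lower_bound:
  fixes h h' :: "real \<Rightarrow> real"
  assumes T: "T > 0"
    and h: "\<And>x. x \<in> {-T..T} \<Longrightarrow> (h has_real_derivative h' x) (at x within {-T..T})"
    and ch: "continuous_on {-T..T} h'"
  shows "((h T)\<^sup>2 + (h (-T))\<^sup>2) / T \<le>
    integral {-T..T} (\<lambda>t. (h' t)\<^sup>2 + (1 / T\<^sup>2 + (t / T\<^sup>2)\<^sup>2) * (h t)\<^sup>2)"
proof -
  have "T / T\<^sup>2 * (h T)\<^sup>2 - (- T) / T\<^sup>2 * (h (-T))\<^sup>2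
      \<le> integral {-T..T} (\<lambda>t. (h' t)\<^sup>2 + (1 / T\<^sup>2 + (t / T\<^sup>2)\<^sup>2) * (h t)\<^sup>2)"
    by (rule square_completion[OF _ h ch, where A = "\<lambda>t. t / T\<^sup>2"])
      (use T in \<open>auto intro!: derivative_eq_intros continuous_intros simp: power2_eq_square field_simps\<close>)
  then show ?thesis using T by (simp add: power2_eq_square field_simps)
qed

text \<open>
  The concave function \<open>tanh\<close> lies above its chord over \<open>[0, T]\<close>, and \<open>tanh T = 1 / T\<close>.
\<close>
lemma tanh_ge_chord:
  assumes t: "\<bar>t\<bar> \<le> critical_T"
  shows "(t / critical_T\<^sup>2)\<^sup>2 \<le> (tanh t)\<^sup>2"
proof -
  let ?T = critical_T
  have T: "?T > 0" by (rule critical_T_pos)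
  have cvx: "convex_on {0..?T} (\<lambda>x. - tanh x)"
  proof (rule f''_ge0_imp_convex[where f' = "\<lambda>x. - (1 - (tanh x)\<^sup>2)"
        and f'' = "\<lambda>x. 2 * tanh x * (1 - (tanh x)\<^sup>2)"])
    fix x assume "x \<in> {0..?T}"
    show "DERIV (\<lambda>x. - tanh x) x :> - (1 - (tanh x)\<^sup>2)"
      by (auto intro!: derivative_eq_intros)
    show "DERIV (\<lambda>x. - (1 - (tanh x)\<^sup>2)) x :> 2 * tanh x * (1 - (tanh x)\<^sup>2)"
      by (auto intro!: derivative_eq_intros simp: algebra_simps)
    have "(tanh x)\<^sup>2 \<le> 1" using tanh_real_bounds[of x] by (intro abs_square_le_1[THEN iffD2]) auto
    then show "0 \<le> 2 * tanh x * (1 - (tanh x)\<^sup>2)" using \<open>x \<in> _\<close> by simp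
  qed simp
  have pos: "s / ?T\<^sup>2 \<le> tanh s" if s: "0 \<le> s" "s \<le> ?T" for s
  proof -
    have "- tanh ((1 - s / ?T) *\<^sub>R 0 + (s / ?T) *\<^sub>R ?T) \<le> (1 - s / ?T) * (- tanh 0) + s / ?T * (- tanh ?T)"
      by (rule convex_onD[OF cvx]) (use s T in auto)
    then show ?thesis using T by (simp add: tanh_critical_T power2_eq_square)
  qed
  have "\<bar>t\<bar> / ?T\<^sup>2 \<le> tanh \<bar>t\<bar>" by (rule pos) (use t in auto)
  then have "(\<bar>t\<bar> / ?T\<^sup>2)\<^sup>2 \<le> (tanh \<bar>t\<bar>)\<^sup>2" by (intro power_mono) auto
  moreover have "(tanh \<bar>t\<bar>)\<^sup>2 = (tanh t)\<^sup>2" by (cases "t \<ge> 0") auto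
  ultimately show ?thesis by (simp add: power_divide)
qed

text \<open>
  As \<open>1 / cosh\<^sup>2 = 1 - tanh\<^sup>2\<close>, the chord bound for \<open>tanh\<close> applies. The number three is the
  Wirtinger constant of the modes beyond the first; these keep the margin \<open>1 - 1 / T\<^sup>2 > 0\<close> over the
  Robin bound.
\<close>
lemma jacobi_potential_bound:
  assumes "\<bar>t\<bar> \<le> critical_T"
  shows "1 / critical_T\<^sup>2 + (t / critical_T\<^sup>2)\<^sup>2 + (1 - 1 / critical_T\<^sup>2) \<le> 3 - 2 / (cosh t)\<^sup>2"
proof -
  have "1 / (cosh t)\<^sup>2 = 1 - (tanh t)\<^sup>2"
  proof -
    have "(sinh t)\<^sup>2 + 1 \<noteq> 0" by (metis cosh_real_nonzero cosh_square_eq power_not_zero)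
    then show ?thesis by (simp add: tanh_def power_divide cosh_square_eq field_simps)
  qed
  moreover have "2 / (cosh t)\<^sup>2 = 2 * (1 / (cosh t)\<^sup>2)" by simp
  moreover have "0 \<le> (tanh t)\<^sup>2" by simp
  ultimately show ?thesis using tanh_ge_chord[OF assms] by argo
qed

section \<open>Periodic functions beyond the first harmonics\<close>

text \<open>
  The weight \<open>A = - \<lambda> tan (\<lambda> (x - m))\<close>, with \<open>m\<close> the midpoint, satisfies \<open>A' + A\<^sup>2 = - \<lambda>\<^sup>2\<close>; it is
  smooth on the interval as long as \<open>\<lambda> < \<pi> / (b - a)\<close>.
\<close>
lemma dirichlet_eigenvalue_bound:
  fixes h h' :: "real \<Rightarrow> real"
  assumes ab: "a < b"
    and h: "\<And>x. x \<in> {a..b} \<Longrightarrow> (h has_real_derivative h' x) (at x within {a..b})"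
    and ch: "continuous_on {a..b} h'"
    and zero: "h a = 0" "h b = 0"
  shows "(pi / (b - a))\<^sup>2 * integral {a..b} (\<lambda>x. (h x)\<^sup>2) \<le> integral {a..b} (\<lambda>x. (h' x)\<^sup>2)"
proof -
  have ch0: "continuous_on {a..b} h" by (auto intro!: DERIV_continuous_on h)
  have "z * ((pi / (b - a))\<^sup>2 * integral {a..b} (\<lambda>x. (h x)\<^sup>2)) \<le> integral {a..b} (\<lambda>x. (h' x)\<^sup>2)"
    if z: "0 < z" "z < 1" for z
  proof -
    define l where "l = sqrt z * pi / (b - a)"
    define m where "m = (a + b) / 2"
    have l0: "l > 0" using z ab by (simp add: l_def)
    have l2: "l\<^sup>2 = z * (pi / (b - a))\<^sup>2" using z by (simp add: l_def power_divide power_mult_distrib)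
    have "sqrt z < 1" using z by simp
    then have "l * (b - a) < pi" using ab by (simp add: l_def)
    have cos0: "cos (l * (x - m)) > 0" if x: "x \<in> {a..b}" for x
    proof (rule cos_gt_zero_pi)
      have "l * (x - m) \<le> l * ((b - a) / 2)" "l * (x - m) \<ge> l * (- (b - a) / 2)"
        using l0 x by (auto intro!: mult_left_mono simp: m_def field_simps)
      then show "- (pi / 2) < l * (x - m)" "l * (x - m) < pi / 2"
        using \<open>l * (b - a) < pi\<close> by (auto simp: field_simps)
    qed
    let ?A = "\<lambda>x. - l * tan (l * (x - m))"
    let ?A' = "\<lambda>x. - l\<^sup>2 * (1 + (tan (l * (x - m)))\<^sup>2)"
    have "?A b * (h b)\<^sup>2 - ?A a * (h a)\<^sup>2 \<le> integral {a..b} (\<lambda>x. (h' x)\<^sup>2 + (?A' x + (?A x)\<^sup>2) * (h x)\<^sup>2)"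
    proof (rule square_completion[OF _ h ch])
      fix x assume x: "x \<in> {a..b}"
      have c: "cos (l * (x - m)) \<noteq> 0" using cos0[OF x] by simp
      have "inverse ((cos (l * (x - m)))\<^sup>2) = 1 + (tan (l * (x - m)))\<^sup>2"
        using tan_sec[OF c] by (simp add: power_inverse)
      then show "(?A has_real_derivative ?A' x) (at x within {a..b})"
        using c by (auto intro!: derivative_eq_intros simp: power2_eq_square)
    next
      show "continuous_on {a..b} ?A'"
        using cos0 by (intro continuous_intros) (auto simp: less_imp_neq[symmetric])
    qed (use ab in auto)
    also have "\<dots> = integral {a..b} (\<lambda>x. (h' x)\<^sup>2 - l\<^sup>2 * (h x)\<^sup>2)"
      by (simp add: algebra_simps power_mult_distrib)
    also have "\<dots> = integral {a..b} (\<lambda>x. (h' x)\<^sup>2) - l\<^sup>2 * integral {a..b} (\<lambda>x. (h x)\<^sup>2)"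
      by (subst integral_diff) (auto intro!: integrable_continuous_interval continuous_intros ch ch0)
    finally show ?thesis using zero l2 by simp
  qed
  then show ?thesis by (rule field_le_mult_one_interval)
qed

lemma integral_over_shifted_period:
  fixes f :: "real \<Rightarrow> real"
  assumes f: "continuous_on UNIV f" and per: "\<And>x. f (x + p) = f x" and a: "0 \<le> a" "a \<le> p"
  shows "integral {a..a + p} f = integral {0..p} f"
proof -
  have i: "f integrable_on {c..d}" for c d
    by (rule integrable_continuous_interval) (rule continuous_on_subset[OF f], simp)
  have "integral {a..p} f + integral {p..a + p} f = integral {a..a + p} f"
    by (rule Henstock_Kurzweil_Integration.integral_combine) (use a i in auto)
  moreover have "integral {0..a} f + integral {a..p} f = integral {0..p} f"
    by (rule Henstock_Kurzweil_Integration.integral_combine) (use a i in auto)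
  moreover have "integral {p..a + p} f = integral {0..a} f"
  proof -
    have "integral {0..a} (\<lambda>x. f (x + p)) = integral {0 + p..a + p} f"
      using integral_shift[where a = 0 and b = a and c = p and f = f] continuous_on_subset[OF f]
      by (simp add: o_def)
    then show ?thesis by (simp add: per)
  qed
  ultimately show ?thesis by simp
qed

text \<open>
  The values of \<open>g\<close> at \<open>x\<close> and \<open>x + \<pi> / 2\<close> agree for some \<open>x\<close>; subtracting this value,
  \<open>g\<close> vanishes at the ends of two intervals of length \<open>\<pi> / 2\<close> that fill a period.
\<close>
lemma wirtinger_period_pi:
  fixes g g' :: "real \<Rightarrow> real"
  assumes g: "\<And>x. (g has_real_derivative g' x) (at x)"
    and cg': "continuous_on UNIV g'"
    and per: "\<And>x. g (x + pi) = g x"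
    and mean: "integral {0..pi} g = 0"
  shows "4 * integral {0..pi} (\<lambda>x. (g x)\<^sup>2) \<le> integral {0..pi} (\<lambda>x. (g' x)\<^sup>2)"
proof -
  have cg: "continuous_on UNIV g" by (rule DERIV_continuous_on) (use g in auto)
  have cg2: "continuous_on S g" "continuous_on S g'" for S
    using cg cg' continuous_on_subset by blast+
  have per': "g' (x + pi) = g' x" for x
  proof -
    have "((\<lambda>x. g (x + pi)) has_real_derivative g' (x + pi)) (at x)"
      using DERIV_shift[of g "g' (x + pi)" x pi] g by simp
    then show ?thesis using DERIV_unique[OF g] by (simp add: per)
  qed
  obtain x0 where x0: "0 \<le> x0" "x0 \<le> pi / 2" "g (x0 + pi / 2) = g x0"
  proof -
    let ?d = "\<lambda>x. g (x + pi / 2) - g x"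
    have d: "?d (pi / 2) = - ?d 0" using per[of 0] by simp
    have c: "continuous_on {0..pi / 2} ?d"
      by (intro continuous_intros continuous_on_compose2[OF cg]) auto
    have "\<exists>x. 0 \<le> x \<and> x \<le> pi / 2 \<and> ?d x = 0"
    proof (cases "?d 0 \<le> 0")
      case True
      then show ?thesis by (intro IVT') (use d c in auto)
    next
      case False
      then show ?thesis by (intro IVT2') (use d c in auto)
    qed
    then show ?thesis using that by fastforce
  qed
  define c where "c = g x0"
  have half: "4 * integral {a..a + pi / 2} (\<lambda>x. (g x - c)\<^sup>2) \<le> integral {a..a + pi / 2} (\<lambda>x. (g' x)\<^sup>2)"
    if "g a = c" "g (a + pi / 2) = c" for a
  proof -
    have "(pi / (a + pi / 2 - a))\<^sup>2 * integral {a..a + pi / 2} (\<lambda>x. (g x - c)\<^sup>2)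
        \<le> integral {a..a + pi / 2} (\<lambda>x. (g' x)\<^sup>2)"
      by (rule dirichlet_eigenvalue_bound)
        (use that in \<open>auto intro!: derivative_eq_intros has_field_derivative_at_within[OF g] cg2\<close>)
    then show ?thesis by simp
  qed
  have comb: "integral {x0..x0 + pi} f = integral {x0..x0 + pi / 2} f + integral {x0 + pi / 2..x0 + pi / 2 + pi / 2} f"
    if "continuous_on UNIV f" for f :: "real \<Rightarrow> real"
    using Henstock_Kurzweil_Integration.integral_combine[of x0 "x0 + pi / 2" "x0 + pi" f]
      integrable_continuous_interval[OF continuous_on_subset[OF that]] by (simp add: algebra_simps)
  have cc: "continuous_on UNIV (\<lambda>x. (g x - c)\<^sup>2)" "continuous_on UNIV (\<lambda>x. (g' x)\<^sup>2)"
    by (intro continuous_intros cg cg')+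
  have "4 * integral {x0..x0 + pi} (\<lambda>x. (g x - c)\<^sup>2) \<le> integral {x0..x0 + pi} (\<lambda>x. (g' x)\<^sup>2)"
    unfolding comb[OF cc(1)] comb[OF cc(2)]
    using half[of x0] half[of "x0 + pi / 2"] x0(3) per[of x0] by (simp add: c_def add.commute)
  also have "integral {x0..x0 + pi} (\<lambda>x. (g' x)\<^sup>2) = integral {0..pi} (\<lambda>x. (g' x)\<^sup>2)"
    by (rule integral_over_shifted_period) (use x0 cc per' in auto)
  also have "integral {x0..x0 + pi} (\<lambda>x. (g x - c)\<^sup>2) = integral {0..pi} (\<lambda>x. (g x - c)\<^sup>2)"
    by (rule integral_over_shifted_period) (use x0 cc per in auto)
  also have "integral {0..pi} (\<lambda>x. (g x - c)\<^sup>2) = integral {0..pi} (\<lambda>x. (g x)\<^sup>2) + c\<^sup>2 * pi"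
  proof (rule integral_unique)
    have "(g has_integral 0) {0..pi}"
      using mean integrable_continuous_interval[OF cg2(1)] by (metis integrable_integral)
    moreover have "((\<lambda>x. (g x)\<^sup>2) has_integral integral {0..pi} (\<lambda>x. (g x)\<^sup>2)) {0..pi}"
      by (intro integrable_integral integrable_continuous_interval continuous_intros cg2)
    moreover have "((\<lambda>x. c\<^sup>2) has_integral c\<^sup>2 * pi) {0..pi}"
      using has_integral_const_real[of "c\<^sup>2" 0 pi] by (simp add: mult.commute)
    ultimately have "((\<lambda>x. (g x)\<^sup>2 + (- 2 * c) * g x + c\<^sup>2) has_integral
        integral {0..pi} (\<lambda>x. (g x)\<^sup>2) + (- 2 * c) * 0 + c\<^sup>2 * pi) {0..pi}"
      by (intro has_integral_add has_integral_mult_right)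
    then show "((\<lambda>x. (g x - c)\<^sup>2) has_integral integral {0..pi} (\<lambda>x. (g x)\<^sup>2) + c\<^sup>2 * pi) {0..pi}"
      by (simp add: power2_eq_square algebra_simps)
  qed
  finally show ?thesis using pi_gt_zero zero_le_power2[of c]
    by (smt (verit) mult_nonneg_nonneg)
qed

lemma integral_two_halves:
  fixes f :: "real \<Rightarrow> real"
  assumes "continuous_on UNIV f"
  shows "integral {0..2 * pi} f = integral {0..pi} (\<lambda>x. f x + f (x + pi))"
proof -
  have i: "f integrable_on {c..d}" for c d
    by (rule integrable_continuous_interval) (rule continuous_on_subset[OF assms], simp)
  have "integral {0..pi} f + integral {pi..2 * pi} f = integral {0..2 * pi} f"
    by (rule Henstock_Kurzweil_Integration.integral_combine) (use i in auto)
  moreover have "integral ((\<lambda>x. x + pi) ` {0..pi}) f = integral {0..pi} (\<lambda>x. f (x + pi))"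
    using integral_shift[of 0 pi pi f] assms by (auto simp: continuous_on_subset o_def)
  then have "integral {pi..2 * pi} f = integral {0..pi} (\<lambda>x. f (x + pi))" by simp
  ultimately show ?thesis
    by (subst integral_add)
      (auto intro!: i integrable_continuous_interval continuous_on_compose2[OF assms] continuous_intros)
qed

text \<open>
  The part of \<open>f\<close> that is even under the half turn has period \<open>\<pi>\<close>. The odd part \<open>q\<close> becomes
  \<open>\<pi>\<close>-periodic after multiplication by \<open>cos\<close> or \<open>sin\<close>. The squares of the derivatives of these two
  products add up to \<open>q'\<^sup>2 + q\<^sup>2\<close>, which costs one of the four units.
\<close>
lemma wirtinger_beyond_first_harmonics:
  fixes f f' :: "real \<Rightarrow> real"
  assumes f: "\<And>x. (f has_real_derivative f' x) (at x)"
    and cf': "continuous_on UNIV f'"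
    and per: "\<And>x. f (x + 2 * pi) = f x"
    and orth: "integral {0..2 * pi} f = 0" "integral {0..2 * pi} (\<lambda>x. f x * cos x) = 0"
      "integral {0..2 * pi} (\<lambda>x. f x * sin x) = 0"
  shows "3 * integral {0..2 * pi} (\<lambda>x. (f x)\<^sup>2) \<le> integral {0..2 * pi} (\<lambda>x. (f' x)\<^sup>2)"
proof -
  have cf: "continuous_on UNIV f" by (rule DERIV_continuous_on) (use f in auto)
  have fs: "((\<lambda>x. f (x + pi)) has_real_derivative f' (x + pi)) (at x)" for x
    using DERIV_shift[of f "f' (x + pi)" x pi] f by simp
  have cs: "continuous_on S (\<lambda>x. f (x + pi))" "continuous_on S (\<lambda>x. f' (x + pi))"
      "continuous_on S f" "continuous_on S f'" for S
    by (auto intro!: continuous_intros continuous_on_compose2[OF cf] continuous_on_compose2[OF cf']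
        continuous_on_subset[OF cf] continuous_on_subset[OF cf'])
  have per2: "f (x + pi + pi) = f x" for x using per[of x] by (simp add: add.assoc)
  define e q e' q' where "e = (\<lambda>x. (f x + f (x + pi)) / 2)" and "q = (\<lambda>x. (f x - f (x + pi)) / 2)"
    and "e' = (\<lambda>x. (f' x + f' (x + pi)) / 2)" and "q' = (\<lambda>x. (f' x - f' (x + pi)) / 2)"
  note defs = e_def e'_def q_def q'_def
  have ce: "continuous_on S e" "continuous_on S e'" "continuous_on S q" "continuous_on S q'" for S
    unfolding defs by (auto intro!: continuous_intros cs)
  have de: "(e has_real_derivative e' x) (at x)" "(q has_real_derivative q' x) (at x)" for x
    unfolding defs by (auto intro!: derivative_eq_intros f fs)
  have E: "4 * integral {0..pi} (\<lambda>x. (e x)\<^sup>2) \<le> integral {0..pi} (\<lambda>x. (e' x)\<^sup>2)"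
  proof (rule wirtinger_period_pi)
    have "integral {0..pi} (\<lambda>x. f x + f (x + pi)) = 0"
      using orth(1) integral_two_halves[OF cf] by simp
    then show "integral {0..pi} e = 0" unfolding e_def by simp
  qed (use de ce per2 in \<open>auto simp: e_def\<close>)
  have C: "4 * integral {0..pi} (\<lambda>x. (q x * cos x)\<^sup>2) \<le> integral {0..pi} (\<lambda>x. (q' x * cos x - q x * sin x)\<^sup>2)"
  proof (rule wirtinger_period_pi)
    have "integral {0..pi} (\<lambda>x. f x * cos x + f (x + pi) * cos (x + pi)) = 0"
      using orth(2) integral_two_halves[of "\<lambda>x. f x * cos x"] cf by (simp add: continuous_intros)
    moreover have "(\<lambda>x. q x * cos x) = (\<lambda>x. (f x * cos x + f (x + pi) * cos (x + pi)) / 2)"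
      by (auto simp: q_def algebra_simps diff_divide_distrib)
    ultimately show "integral {0..pi} (\<lambda>x. q x * cos x) = 0" by simp
    show "((\<lambda>x. q x * cos x) has_real_derivative q' x * cos x - q x * sin x) (at x)" for x
      by (auto intro!: derivative_eq_intros de)
    show "continuous_on UNIV (\<lambda>x. q' x * cos x - q x * sin x)" by (intro continuous_intros ce)
    show "q (x + pi) * cos (x + pi) = q x * cos x" for x
      unfolding q_def per2 by (simp add: left_diff_distrib diff_divide_distrib)
  qed
  have S: "4 * integral {0..pi} (\<lambda>x. (q x * sin x)\<^sup>2) \<le> integral {0..pi} (\<lambda>x. (q' x * sin x + q x * cos x)\<^sup>2)"
  proof (rule wirtinger_period_pi)
    have "integral {0..pi} (\<lambda>x. f x * sin x + f (x + pi) * sin (x + pi)) = 0"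
      using orth(3) integral_two_halves[of "\<lambda>x. f x * sin x"] cf by (simp add: continuous_intros)
    moreover have "(\<lambda>x. q x * sin x) = (\<lambda>x. (f x * sin x + f (x + pi) * sin (x + pi)) / 2)"
      by (auto simp: q_def algebra_simps diff_divide_distrib)
    ultimately show "integral {0..pi} (\<lambda>x. q x * sin x) = 0" by simp
    show "((\<lambda>x. q x * sin x) has_real_derivative q' x * sin x + q x * cos x) (at x)" for x
      by (auto intro!: derivative_eq_intros de)
    show "continuous_on UNIV (\<lambda>x. q' x * sin x + q x * cos x)" by (intro continuous_intros ce)
    show "q (x + pi) * sin (x + pi) = q x * sin x" for x
      unfolding q_def per2 by (simp add: left_diff_distrib diff_divide_distrib)
  qed
  have sc: "cos x * cos x + sin x * sin x = 1" for x :: real by (rule sin_cos_squared_add3)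
  have "(q x * cos x)\<^sup>2 + (q x * sin x)\<^sup>2 = (q x)\<^sup>2" for x using sc[of x] by algebra
  then have "integral {0..pi} (\<lambda>x. (q x * cos x)\<^sup>2) + integral {0..pi} (\<lambda>x. (q x * sin x)\<^sup>2)
      = integral {0..pi} (\<lambda>x. (q x)\<^sup>2)"
    by (subst integral_add[symmetric]) (auto intro!: integrable_continuous_interval continuous_intros ce)
  moreover have "(q' x * cos x - q x * sin x)\<^sup>2 + (q' x * sin x + q x * cos x)\<^sup>2 = (q' x)\<^sup>2 + (q x)\<^sup>2" for x
    using sc[of x] by algebra
  then have "integral {0..pi} (\<lambda>x. (q' x * cos x - q x * sin x)\<^sup>2) + integral {0..pi} (\<lambda>x. (q' x * sin x + q x * cos x)\<^sup>2)
      = integral {0..pi} (\<lambda>x. (q' x)\<^sup>2) + integral {0..pi} (\<lambda>x. (q x)\<^sup>2)"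
    by (subst (1 2) integral_add[symmetric]) (auto intro!: integrable_continuous_interval continuous_intros ce)
  ultimately have O: "3 * integral {0..pi} (\<lambda>x. (q x)\<^sup>2) \<le> integral {0..pi} (\<lambda>x. (q' x)\<^sup>2)"
    using C S by linarith
  have nonneg: "integral {0..pi} (\<lambda>x. (e x)\<^sup>2) \<ge> 0"
    by (intro integral_nonneg integrable_continuous_interval continuous_intros ce) auto
  have sum: "integral {0..2 * pi} (\<lambda>x. (k x)\<^sup>2) = 2 * (integral {0..pi} (\<lambda>x. ((k x + k (x + pi)) / 2)\<^sup>2)
      + integral {0..pi} (\<lambda>x. ((k x - k (x + pi)) / 2)\<^sup>2))"
    if k: "continuous_on UNIV k" for k :: "real \<Rightarrow> real"
  proof -
    have ck: "continuous_on S k" "continuous_on S (\<lambda>x. k (x + pi))" for S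
      by (auto intro!: continuous_intros continuous_on_compose2[OF k] continuous_on_subset[OF k])
    have "2 * (integral {0..pi} (\<lambda>x. ((k x + k (x + pi)) / 2)\<^sup>2) + integral {0..pi} (\<lambda>x. ((k x - k (x + pi)) / 2)\<^sup>2))
      = integral {0..pi} (\<lambda>x. 2 * (((k x + k (x + pi)) / 2)\<^sup>2 + ((k x - k (x + pi)) / 2)\<^sup>2))"
      unfolding integral_mult_right
      by (subst integral_add) (auto intro!: integrable_continuous_interval continuous_intros ck)
    also have "\<dots> = integral {0..pi} (\<lambda>x. (k x)\<^sup>2 + (k (x + pi))\<^sup>2)"
      by (intro integral_cong) (simp add: power2_eq_square field_simps)
    also have "\<dots> = integral {0..2 * pi} (\<lambda>x. (k x)\<^sup>2)"
      by (rule integral_two_halves[symmetric]) (intro continuous_intros k)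
    finally show ?thesis by simp
  qed
  have "integral {0..2 * pi} (\<lambda>x. (f x)\<^sup>2) = 2 * (integral {0..pi} (\<lambda>x. (e x)\<^sup>2) + integral {0..pi} (\<lambda>x. (q x)\<^sup>2))"
    unfolding e_def q_def by (rule sum[OF cf])
  moreover have "integral {0..2 * pi} (\<lambda>x. (f' x)\<^sup>2) = 2 * (integral {0..pi} (\<lambda>x. (e' x)\<^sup>2) + integral {0..pi} (\<lambda>x. (q' x)\<^sup>2))"
    unfolding e'_def q'_def by (rule sum[OF cf'])
  ultimately show ?thesis using E O nonneg by argo
qed

definition harmonic0 :: "(real \<Rightarrow> real) \<Rightarrow> real" where
  "harmonic0 f = integral {0..2 * pi} f / (2 * pi)"

definition harmonic_cos :: "(real \<Rightarrow> real) \<Rightarrow> real" where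
  "harmonic_cos f = integral {0..2 * pi} (\<lambda>\<theta>. f \<theta> * cos \<theta>) / pi"

definition harmonic_sin :: "(real \<Rightarrow> real) \<Rightarrow> real" where
  "harmonic_sin f = integral {0..2 * pi} (\<lambda>\<theta>. f \<theta> * sin \<theta>) / pi"

definition beyond_first :: "(real \<Rightarrow> real) \<Rightarrow> real \<Rightarrow> real" where
  "beyond_first f \<theta> = f \<theta> - harmonic0 f - harmonic_cos f * cos \<theta> - harmonic_sin f * sin \<theta>"

lemma trig_integrals:
  "(cos has_integral 0) {0..2 * pi}" "(sin has_integral 0) {0..2 * pi}"
  "((\<lambda>x. (cos x)\<^sup>2) has_integral pi) {0..2 * pi}" "((\<lambda>x. (sin x)\<^sup>2) has_integral pi) {0..2 * pi}"
  "((\<lambda>x. sin x * cos x) has_integral 0) {0..2 * pi}"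
proof -
  have ftc: "(g has_integral G (2 * pi) - G 0) {0..2 * pi}"
    if "\<And>x. (G has_real_derivative g x) (at x)" for g G :: "real \<Rightarrow> real"
    by (rule fundamental_theorem_of_calculus)
      (auto intro: has_field_derivative_at_within[OF that] simp flip: has_real_derivative_iff_has_vector_derivative)
  show "(cos has_integral 0) {0..2 * pi}" using ftc[of sin cos] by (simp add: DERIV_sin)
  have "((\<lambda>x. - cos x) has_real_derivative sin x) (at x)" for x :: real
    by (auto intro!: derivative_eq_intros)
  from ftc[OF this] show "(sin has_integral 0) {0..2 * pi}" by simp
  have "((\<lambda>x. (x + sin x * cos x) / 2) has_real_derivative (cos x)\<^sup>2) (at x)" for x :: real
  proof -
    have "((\<lambda>x. (x + sin x * cos x) / 2) has_real_derivative (1 + (cos x * cos x - sin x * sin x)) / 2) (at x)"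
      by (auto intro!: derivative_eq_intros)
    moreover have "(1 + (cos x * cos x - sin x * sin x)) / 2 = (cos x)\<^sup>2"
      using sin_cos_squared_add3[of x] by algebra
    ultimately show ?thesis by simp
  qed
  from ftc[OF this] show "((\<lambda>x. (cos x)\<^sup>2) has_integral pi) {0..2 * pi}" by simp
  have "((\<lambda>x. (x - sin x * cos x) / 2) has_real_derivative (sin x)\<^sup>2) (at x)" for x :: real
  proof -
    have "((\<lambda>x. (x - sin x * cos x) / 2) has_real_derivative (1 - (cos x * cos x - sin x * sin x)) / 2) (at x)"
      by (auto intro!: derivative_eq_intros)
    moreover have "(1 - (cos x * cos x - sin x * sin x)) / 2 = (sin x)\<^sup>2"
      using sin_cos_squared_add3[of x] by algebra
    ultimately show ?thesis by simp
  qed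
  from ftc[OF this] show "((\<lambda>x. (sin x)\<^sup>2) has_integral pi) {0..2 * pi}" by simp
  have "((\<lambda>x. (sin x)\<^sup>2 / 2) has_real_derivative sin x * cos x) (at x)" for x :: real
    by (auto intro!: derivative_eq_intros)
  from ftc[OF this] show "((\<lambda>x. sin x * cos x) has_integral 0) {0..2 * pi}" by simp
qed

lemma integral_square_split:
  assumes f: "continuous_on {0..2 * pi} f"
  shows "integral {0..2 * pi} (\<lambda>x. (f x)\<^sup>2) = 2 * pi * (harmonic0 f)\<^sup>2 + pi * (harmonic_cos f)\<^sup>2
      + pi * (harmonic_sin f)\<^sup>2 + integral {0..2 * pi} (\<lambda>x. (beyond_first f x)\<^sup>2)"
    and "integral {0..2 * pi} (beyond_first f) = 0"
    and "integral {0..2 * pi} (\<lambda>x. beyond_first f x * cos x) = 0"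
    and "integral {0..2 * pi} (\<lambda>x. beyond_first f x * sin x) = 0"
proof -
  define a b c where abc: "a = harmonic0 f" "b = harmonic_cos f" "c = harmonic_sin f"
  have i: "(f has_integral 2 * pi * a) {0..2 * pi}" "((\<lambda>x. f x * cos x) has_integral pi * b) {0..2 * pi}"
    "((\<lambda>x. f x * sin x) has_integral pi * c) {0..2 * pi}"
    by (auto simp: abc harmonic0_def harmonic_cos_def harmonic_sin_def
        intro!: integrable_integral integrable_continuous_interval continuous_intros f)
  have i2: "((\<lambda>x. (f x)\<^sup>2) has_integral integral {0..2 * pi} (\<lambda>x. (f x)\<^sup>2)) {0..2 * pi}"
    by (intro integrable_integral integrable_continuous_interval continuous_intros f)
  have one: "((\<lambda>x::real. 1) has_integral 2 * pi) {0..2 * pi}"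
    using has_integral_const_real[of "1::real" 0 "2 * pi"] by simp
  have "((\<lambda>x. (f x)\<^sup>2 + (- 2 * a) * f x + (- 2 * b) * (f x * cos x) + (- 2 * c) * (f x * sin x)
        + a\<^sup>2 * 1 + (2 * a * b) * cos x + (2 * a * c) * sin x
        + b\<^sup>2 * (cos x)\<^sup>2 + c\<^sup>2 * (sin x)\<^sup>2 + (2 * b * c) * (sin x * cos x)) has_integral
      integral {0..2 * pi} (\<lambda>x. (f x)\<^sup>2) + (- 2 * a) * (2 * pi * a) + (- 2 * b) * (pi * b) + (- 2 * c) * (pi * c)
        + a\<^sup>2 * (2 * pi) + (2 * a * b) * 0 + (2 * a * c) * 0 + b\<^sup>2 * pi + c\<^sup>2 * pi + (2 * b * c) * 0) {0..2 * pi}"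
    by (intro has_integral_add has_integral_mult_right i i2 trig_integrals one)
  moreover have "(\<lambda>x. (f x)\<^sup>2 + (- 2 * a) * f x + (- 2 * b) * (f x * cos x) + (- 2 * c) * (f x * sin x)
        + a\<^sup>2 * 1 + (2 * a * b) * cos x + (2 * a * c) * sin x
        + b\<^sup>2 * (cos x)\<^sup>2 + c\<^sup>2 * (sin x)\<^sup>2 + (2 * b * c) * (sin x * cos x)) = (\<lambda>x. (beyond_first f x)\<^sup>2)"
    by (auto simp: beyond_first_def abc[symmetric] power2_eq_square algebra_simps)
  ultimately show "integral {0..2 * pi} (\<lambda>x. (f x)\<^sup>2) = 2 * pi * (harmonic0 f)\<^sup>2 + pi * (harmonic_cos f)\<^sup>2
      + pi * (harmonic_sin f)\<^sup>2 + integral {0..2 * pi} (\<lambda>x. (beyond_first f x)\<^sup>2)"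
    by (simp add: integral_unique abc[symmetric] power2_eq_square algebra_simps)
  have "((\<lambda>x. f x + (- a) * 1 + (- b) * cos x + (- c) * sin x) has_integral
      2 * pi * a + (- a) * (2 * pi) + (- b) * 0 + (- c) * 0) {0..2 * pi}"
    by (intro has_integral_add has_integral_mult_right i trig_integrals one)
  moreover have "(\<lambda>x. f x + (- a) * 1 + (- b) * cos x + (- c) * sin x) = beyond_first f"
    by (auto simp: beyond_first_def abc[symmetric])
  ultimately show "integral {0..2 * pi} (beyond_first f) = 0" by (simp add: integral_unique)
  have "((\<lambda>x. f x * cos x + (- a) * cos x + (- b) * (cos x)\<^sup>2 + (- c) * (sin x * cos x)) has_integral
      pi * b + (- a) * 0 + (- b) * pi + (- c) * 0) {0..2 * pi}"
    by (intro has_integral_add has_integral_mult_right i trig_integrals one)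
  moreover have "(\<lambda>x. f x * cos x + (- a) * cos x + (- b) * (cos x)\<^sup>2 + (- c) * (sin x * cos x)) = (\<lambda>x. beyond_first f x * cos x)"
    by (auto simp: beyond_first_def abc[symmetric] power2_eq_square algebra_simps)
  ultimately show "integral {0..2 * pi} (\<lambda>x. beyond_first f x * cos x) = 0" by (simp add: integral_unique)
  have "((\<lambda>x. f x * sin x + (- a) * sin x + (- b) * (sin x * cos x) + (- c) * (sin x)\<^sup>2) has_integral
      pi * c + (- a) * 0 + (- b) * 0 + (- c) * pi) {0..2 * pi}"
    by (intro has_integral_add has_integral_mult_right i trig_integrals one)
  moreover have "(\<lambda>x. f x * sin x + (- a) * sin x + (- b) * (sin x * cos x) + (- c) * (sin x)\<^sup>2) = (\<lambda>x. beyond_first f x * sin x)"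
    by (auto simp: beyond_first_def abc[symmetric] power2_eq_square algebra_simps)
  ultimately show "integral {0..2 * pi} (\<lambda>x. beyond_first f x * sin x) = 0" by (simp add: integral_unique)
qed

text \<open>
  The derivative splits in the same way as \<open>f\<close>: integration by parts shows that its remainder is
  orthogonal to \<open>cos\<close> and \<open>sin\<close>.
\<close>
lemma integral_derivative_square_bound:
  fixes f f' :: "real \<Rightarrow> real"
  assumes f: "\<And>x. (f has_real_derivative f' x) (at x)"
    and cf': "continuous_on UNIV f'"
    and per: "\<And>x. f (x + 2 * pi) = f x"
  shows "pi * (harmonic_cos f)\<^sup>2 + pi * (harmonic_sin f)\<^sup>2
      + 3 * integral {0..2 * pi} (\<lambda>x. (beyond_first f x)\<^sup>2) \<le> integral {0..2 * pi} (\<lambda>x. (f' x)\<^sup>2)"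
proof -
  have cf: "continuous_on UNIV f" by (rule DERIV_continuous_on) (use f in auto)
  have c: "continuous_on S f" "continuous_on S f'" for S using cf cf' continuous_on_subset by blast+
  define a b d where abd: "a = harmonic0 f" "b = harmonic_cos f" "d = harmonic_sin f"
  have i: "((\<lambda>x. f x * cos x) has_integral pi * b) {0..2 * pi}"
    "((\<lambda>x. f x * sin x) has_integral pi * d) {0..2 * pi}"
    by (auto simp: abd harmonic0_def harmonic_cos_def harmonic_sin_def
        intro!: integrable_integral integrable_continuous_interval continuous_intros c)
  have ftc: "(g has_integral G (2 * pi) - G 0) {0..2 * pi}"
    if "\<And>x. (G has_real_derivative g x) (at x)" for g G :: "real \<Rightarrow> real"
    by (rule fundamental_theorem_of_calculus)
      (auto intro: has_field_derivative_at_within[OF that] simp flip: has_real_derivative_iff_has_vector_derivative)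
  have "((\<lambda>x. f' x * cos x + (- 1) * (f x * sin x)) has_integral f (2 * pi) * cos (2 * pi) - f 0 * cos 0) {0..2 * pi}"
    by (rule ftc) (auto intro!: derivative_eq_intros f)
  from has_integral_add[OF this i(2)]
  have fc: "((\<lambda>x. f' x * cos x) has_integral pi * d) {0..2 * pi}" using per[of 0] by simp
  have "((\<lambda>x. f' x * sin x + f x * cos x) has_integral f (2 * pi) * sin (2 * pi) - f 0 * sin 0) {0..2 * pi}"
    by (rule ftc) (auto intro!: derivative_eq_intros f)
  from has_integral_diff[OF this i(1)]
  have fs: "((\<lambda>x. f' x * sin x) has_integral - (pi * b)) {0..2 * pi}" by simp
  have i2: "((\<lambda>x. (f' x)\<^sup>2) has_integral integral {0..2 * pi} (\<lambda>x. (f' x)\<^sup>2)) {0..2 * pi}"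
    by (intro integrable_integral integrable_continuous_interval continuous_intros c)
  let ?g' = "\<lambda>x. f' x + b * sin x - d * cos x"
  have "((\<lambda>x. (f' x)\<^sup>2 + (2 * b) * (f' x * sin x) + (- 2 * d) * (f' x * cos x) + b\<^sup>2 * (sin x)\<^sup>2
        + d\<^sup>2 * (cos x)\<^sup>2 + (- 2 * b * d) * (sin x * cos x)) has_integral
      integral {0..2 * pi} (\<lambda>x. (f' x)\<^sup>2) + (2 * b) * (- (pi * b)) + (- 2 * d) * (pi * d) + b\<^sup>2 * pi + d\<^sup>2 * pi
        + (- 2 * b * d) * 0) {0..2 * pi}"
    by (intro has_integral_add has_integral_mult_right i2 fc fs trig_integrals)
  moreover have "(\<lambda>x. (f' x)\<^sup>2 + (2 * b) * (f' x * sin x) + (- 2 * d) * (f' x * cos x) + b\<^sup>2 * (sin x)\<^sup>2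
        + d\<^sup>2 * (cos x)\<^sup>2 + (- 2 * b * d) * (sin x * cos x)) = (\<lambda>x. (?g' x)\<^sup>2)"
    by (auto simp: power2_eq_square algebra_simps)
  ultimately have "integral {0..2 * pi} (\<lambda>x. (?g' x)\<^sup>2) = integral {0..2 * pi} (\<lambda>x. (f' x)\<^sup>2) - pi * b\<^sup>2 - pi * d\<^sup>2"
    by (simp add: integral_unique power2_eq_square algebra_simps)
  moreover have "3 * integral {0..2 * pi} (\<lambda>x. (beyond_first f x)\<^sup>2) \<le> integral {0..2 * pi} (\<lambda>x. (?g' x)\<^sup>2)"
  proof (rule wirtinger_beyond_first_harmonics)
    show "(beyond_first f has_real_derivative ?g' x) (at x)" for x
      unfolding beyond_first_def[abs_def] abd[symmetric] by (auto intro!: derivative_eq_intros f)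
    show "continuous_on UNIV ?g'" by (intro continuous_intros c)
    show "beyond_first f (x + 2 * pi) = beyond_first f x" for x by (simp add: beyond_first_def per)
  qed (use integral_square_split[of f] c in auto)
  ultimately show ?thesis by (simp add: abd)
qed

section \<open>Quadratic forms on the annulus\<close>

text \<open>
  As in \<open>d_t\<close> and \<open>d_theta\<close>, derivatives are taken within the strip, so the notion includes the
  one-sided derivatives at the boundary.
\<close>
definition has_partials ::
    "real \<Rightarrow> (real \<times> real \<Rightarrow> 'a::real_normed_vector) \<Rightarrow> (real \<times> real \<Rightarrow> 'a) \<Rightarrow> (real \<times> real \<Rightarrow> 'a) \<Rightarrow> bool" where
  "has_partials T f fx fy \<longleftrightarrow>
     (\<forall>p\<in>strip T. (f has_derivative (\<lambda>h. fst h *\<^sub>R fx p + snd h *\<^sub>R fy p)) (at p within strip T))"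

definition C1_annulus ::
    "real \<Rightarrow> (real \<times> real \<Rightarrow> 'a::real_normed_vector) \<Rightarrow> (real \<times> real \<Rightarrow> 'a) \<Rightarrow> (real \<times> real \<Rightarrow> 'a) \<Rightarrow> bool" where
  "C1_annulus T f fx fy \<longleftrightarrow> has_partials T f fx fy \<and> continuous_on (strip T) fx \<and> continuous_on (strip T) fy
     \<and> (\<forall>t\<in>{-T..T}. \<forall>\<theta>. f (t, \<theta> + 2 * pi) = f (t, \<theta>))"

abbreviation rect :: "real \<Rightarrow> (real \<times> real) set" where
  "rect T \<equiv> cbox (-T, 0) (T, 2 * pi)"

lemma mem_strip [simp]: "(t, \<theta>) \<in> strip T \<longleftrightarrow> -T \<le> t \<and> t \<le> T"
  by (simp add: strip_def)

lemma rect_subset_strip: "rect T \<subseteq> strip T"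
  by (auto simp: strip_def cbox_Pair_eq)

lemma has_partials_continuous: "has_partials T f fx fy \<Longrightarrow> continuous_on (strip T) f"
  unfolding has_partials_def
  by (meson continuous_on_eq_continuous_within has_derivative_continuous)

lemma has_partials_t:
  assumes "has_partials T f fx fy" "t \<in> {-T..T}"
  shows "((\<lambda>s. f (s, \<theta>)) has_vector_derivative fx (t, \<theta>)) (at t within {-T..T})"
proof -
  have "((\<lambda>s. f (s, \<theta>)) has_derivative (\<lambda>h. fst (h, 0::real) *\<^sub>R fx (t, \<theta>) + snd (h, 0) *\<^sub>R fy (t, \<theta>))) (at t within {-T..T})"
  proof (rule has_derivative_in_compose2[where g = f and f = "\<lambda>s. (s, \<theta>)" and t = "strip T"])
    show "(f has_derivative (\<lambda>h. fst h *\<^sub>R fx x + snd h *\<^sub>R fy x)) (at x within strip T)" if "x \<in> strip T" for x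
      using assms(1) that by (simp add: has_partials_def)
    then show "((\<lambda>s. (s, \<theta>)) has_derivative (\<lambda>h. (h, 0))) (at t within {-T..T})"
      by (auto intro!: derivative_eq_intros)
  qed (use assms in auto)
  then show ?thesis by (simp add: has_vector_derivative_def)
qed

lemma has_partials_theta:
  assumes "has_partials T f fx fy" "t \<in> {-T..T}"
  shows "((\<lambda>s. f (t, s)) has_vector_derivative fy (t, \<theta>)) (at \<theta>)"
proof -
  have "((\<lambda>s. f (t, s)) has_derivative (\<lambda>h. fst (0::real, h) *\<^sub>R fx (t, \<theta>) + snd (0::real, h) *\<^sub>R fy (t, \<theta>))) (at \<theta> within UNIV)"
  proof (rule has_derivative_in_compose2[where g = f and f = "\<lambda>s. (t, s)" and t = "strip T"])
    show "(f has_derivative (\<lambda>h. fst h *\<^sub>R fx x + snd h *\<^sub>R fy x)) (at x within strip T)" if "x \<in> strip T" for x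
      using assms(1) that by (simp add: has_partials_def)
    then show "((\<lambda>s. (t, s)) has_derivative (\<lambda>h. (0, h))) (at \<theta> within UNIV)"
      by (auto intro!: derivative_eq_intros)
  qed (use assms in auto)
  then show ?thesis by (simp add: has_vector_derivative_def)
qed

lemma strip_slice_continuous:
  assumes "continuous_on (strip T) g"
  shows "t \<in> {-T..T} \<Longrightarrow> continuous_on S (\<lambda>\<theta>. g (t, \<theta>))"
    and "continuous_on {-T..T} (\<lambda>t. g (t, \<theta>))"
  by (auto intro!: continuous_on_compose2[OF assms] continuous_intros)

lemma strip_integral_continuous:
  fixes g :: "real \<times> real \<Rightarrow> real"
  assumes "continuous_on (strip T) g"
  shows "continuous_on {-T..T} (\<lambda>t. integral {0..2 * pi} (\<lambda>\<theta>. g (t, \<theta>)))"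
    and "continuous_on {0..2 * pi} (\<lambda>\<theta>. integral {-T..T} (\<lambda>t. g (t, \<theta>)))"
proof -
  have "continuous_on ({-T..T} \<times> cbox 0 (2 * pi)) (\<lambda>(t, \<theta>). g (t, \<theta>))"
    by (rule continuous_on_subset[OF _ ]) (use assms in \<open>auto simp: strip_def intro: continuous_on_subset\<close>)
  from integral_continuous_on_param[OF this]
  show "continuous_on {-T..T} (\<lambda>t. integral {0..2 * pi} (\<lambda>\<theta>. g (t, \<theta>)))" by simp
  have "continuous_on ({0..2 * pi} \<times> cbox (-T) T) (\<lambda>(\<theta>, t). g (t, \<theta>))"
    unfolding case_prod_unfold by (auto intro!: continuous_on_compose2[OF assms] continuous_intros)
  from integral_continuous_on_param[OF this]
  show "continuous_on {0..2 * pi} (\<lambda>\<theta>. integral {-T..T} (\<lambda>t. g (t, \<theta>)))" by simp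
qed

lemma rect_integrable:
  fixes g :: "real \<times> real \<Rightarrow> real"
  shows "continuous_on (strip T) g \<Longrightarrow> g integrable_on rect T"
  by (rule integrable_continuous) (rule continuous_on_subset[OF _ rect_subset_strip])

lemma rect_integral_iterated:
  fixes g :: "real \<times> real \<Rightarrow> real"
  assumes "continuous_on (strip T) g"
  shows "integral (rect T) g = integral {-T..T} (\<lambda>t. integral {0..2 * pi} (\<lambda>\<theta>. g (t, \<theta>)))"
    and "integral (rect T) g = integral {0..2 * pi} (\<lambda>\<theta>. integral {-T..T} (\<lambda>t. g (t, \<theta>)))"
proof -
  have c: "continuous_on (rect T) g" using assms rect_subset_strip continuous_on_subset by blast
  show 1: "integral (rect T) g = integral {-T..T} (\<lambda>t. integral {0..2 * pi} (\<lambda>\<theta>. g (t, \<theta>)))"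
    using integral_prod_continuous[OF c] by simp
  have "continuous_on (rect T) (\<lambda>(x, y). g (x, y))" using c by simp
  from integral_swap_continuous[OF this]
  show "integral (rect T) g = integral {0..2 * pi} (\<lambda>\<theta>. integral {-T..T} (\<lambda>t. g (t, \<theta>)))"
    unfolding 1 by simp
qed

lemma strip_integral_derivative:
  fixes f :: "real \<times> real \<Rightarrow> real"
  assumes f: "has_partials T f fx fy" and cfx: "continuous_on (strip T) fx" and cw: "continuous_on UNIV w"
    and t: "t \<in> {-T..T}"
  shows "((\<lambda>t. integral {0..2 * pi} (\<lambda>\<theta>. f (t, \<theta>) * w \<theta>)) has_real_derivative
      integral {0..2 * pi} (\<lambda>\<theta>. fx (t, \<theta>) * w \<theta>)) (at t within {-T..T})"
proof -
  have cf: "continuous_on (strip T) f" by (rule has_partials_continuous[OF f])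
  have w: "continuous_on S w" for S using cw continuous_on_subset by blast
  have "((\<lambda>t. integral (cbox 0 (2 * pi)) (\<lambda>\<theta>. f (t, \<theta>) * w \<theta>)) has_field_derivative
      integral (cbox 0 (2 * pi)) (\<lambda>\<theta>. fx (t, \<theta>) * w \<theta>)) (at t within {-T..T})"
  proof (rule leibniz_rule_field_derivative)
    fix s \<theta> assume "s \<in> {-T..T}"
    then show "((\<lambda>t. f (t, \<theta>) * w \<theta>) has_real_derivative fx (s, \<theta>) * w \<theta>) (at s within {-T..T})"
      using has_partials_t[OF f] by (auto intro!: derivative_eq_intros simp: has_real_derivative_iff_has_vector_derivative)
  next
    fix s assume "s \<in> {-T..T}"
    then show "(\<lambda>\<theta>. f (s, \<theta>) * w \<theta>) integrable_on cbox 0 (2 * pi)"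
      by (auto intro!: integrable_continuous_interval continuous_intros w strip_slice_continuous[OF cf])
  next
    show "continuous_on ({-T..T} \<times> cbox 0 (2 * pi)) (\<lambda>(s, \<theta>). fx (s, \<theta>) * w \<theta>)"
      unfolding case_prod_unfold
      by (auto intro!: continuous_intros continuous_on_compose2[OF cfx] continuous_on_compose2[OF cw])
  qed (use t in auto)
  then show ?thesis by simp
qed

lemma harmonic_derivatives:
  fixes f :: "real \<times> real \<Rightarrow> real"
  assumes f: "has_partials T f fx fy" and cfx: "continuous_on (strip T) fx" and t: "t \<in> {-T..T}"
  shows "((\<lambda>t. harmonic0 (\<lambda>\<theta>. f (t, \<theta>))) has_real_derivative harmonic0 (\<lambda>\<theta>. fx (t, \<theta>))) (at t within {-T..T})"
    and "((\<lambda>t. harmonic_cos (\<lambda>\<theta>. f (t, \<theta>))) has_real_derivative harmonic_cos (\<lambda>\<theta>. fx (t, \<theta>))) (at t within {-T..T})"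
    and "((\<lambda>t. harmonic_sin (\<lambda>\<theta>. f (t, \<theta>))) has_real_derivative harmonic_sin (\<lambda>\<theta>. fx (t, \<theta>))) (at t within {-T..T})"
  unfolding harmonic0_def harmonic_cos_def harmonic_sin_def
  using DERIV_cdivide[OF strip_integral_derivative[OF f cfx, of "\<lambda>_. 1" t], of "2 * pi"]
    DERIV_cdivide[OF strip_integral_derivative[OF f cfx, of cos t], of pi]
    DERIV_cdivide[OF strip_integral_derivative[OF f cfx, of sin t], of pi] t
  by (simp_all add: continuous_intros)

lemma harmonic_continuous:
  fixes g :: "real \<times> real \<Rightarrow> real"
  assumes g: "continuous_on (strip T) g"
  shows "continuous_on {-T..T} (\<lambda>t. harmonic0 (\<lambda>\<theta>. g (t, \<theta>)))"
    and "continuous_on {-T..T} (\<lambda>t. harmonic_cos (\<lambda>\<theta>. g (t, \<theta>)))"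
    and "continuous_on {-T..T} (\<lambda>t. harmonic_sin (\<lambda>\<theta>. g (t, \<theta>)))"
proof -
  have c: "continuous_on (strip T) (\<lambda>p. g p * cos (snd p))" "continuous_on (strip T) (\<lambda>p. g p * sin (snd p))"
    by (intro continuous_intros g)+
  show "continuous_on {-T..T} (\<lambda>t. harmonic0 (\<lambda>\<theta>. g (t, \<theta>)))"
    "continuous_on {-T..T} (\<lambda>t. harmonic_cos (\<lambda>\<theta>. g (t, \<theta>)))"
    "continuous_on {-T..T} (\<lambda>t. harmonic_sin (\<lambda>\<theta>. g (t, \<theta>)))"
    unfolding harmonic0_def harmonic_cos_def harmonic_sin_def
    using strip_integral_continuous(1)[OF g] strip_integral_continuous(1)[OF c(1)] strip_integral_continuous(1)[OF c(2)]
    by (auto intro!: continuous_intros)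
qed

lemma beyond_first_continuous:
  fixes g :: "real \<times> real \<Rightarrow> real"
  assumes g: "continuous_on (strip T) g"
  shows "continuous_on (strip T) (\<lambda>p. beyond_first (\<lambda>\<theta>. g (fst p, \<theta>)) (snd p))"
  unfolding beyond_first_def
  by (intro continuous_intros continuous_on_compose2[OF harmonic_continuous(1)[OF g], of _ fst]
      continuous_on_compose2[OF harmonic_continuous(2)[OF g], of _ fst]
      continuous_on_compose2[OF harmonic_continuous(3)[OF g], of _ fst])
    (use g in \<open>auto simp: strip_def\<close>)

text \<open>
  If the matrix with entries \<open>\<alpha>\<close>, \<open>\<beta>\<close>, \<open>\<gamma>\<close> is the area density times the inverse metric, the first
  three terms are the Dirichlet integral of the surface. With boundary weight \<open>\<mu>\<close> the length
  density, \<open>\<kappa> = 0\<close> gives the Steklov form and \<open>\<kappa>\<close> equal to \<open>2 K\<close> times the area density the second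
  variation.
\<close>
definition energy ::
    "real \<Rightarrow> (real \<times> real \<Rightarrow> real) \<Rightarrow> (real \<times> real \<Rightarrow> real) \<Rightarrow> (real \<times> real \<Rightarrow> real) \<Rightarrow> (real \<times> real \<Rightarrow> real) \<Rightarrow> (real \<times> real \<Rightarrow> real)
      \<Rightarrow> (real \<times> real \<Rightarrow> real) \<Rightarrow> (real \<times> real \<Rightarrow> real) \<Rightarrow> (real \<times> real \<Rightarrow> real) \<Rightarrow> real" where
  "energy T \<alpha> \<beta> \<gamma> \<kappa> \<mu> f fx fy =
     integral (rect T) (\<lambda>p. \<alpha> p * (fx p)\<^sup>2 + 2 * \<beta> p * (fx p * fy p) + \<gamma> p * (fy p)\<^sup>2 + \<kappa> p * (f p)\<^sup>2)
     - integral {0..2 * pi} (\<lambda>\<theta>. \<mu> (T, \<theta>) * (f (T, \<theta>))\<^sup>2 + \<mu> (-T, \<theta>) * (f (-T, \<theta>))\<^sup>2)"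

text \<open>
  The catenoid is parametrized conformally, and its boundary circles have radius \<open>1 / T\<close>.
\<close>
definition model_energy ::
    "(real \<Rightarrow> real) \<Rightarrow> (real \<times> real \<Rightarrow> real) \<Rightarrow> (real \<times> real \<Rightarrow> real) \<Rightarrow> (real \<times> real \<Rightarrow> real) \<Rightarrow> real" where
  "model_energy q f fx fy =
     energy critical_T (\<lambda>_. 1) (\<lambda>_. 0) (\<lambda>_. 1) (\<lambda>p. - q (fst p)) (\<lambda>_. 1 / critical_T) f fx fy"

text \<open>
  The model energy of a function of \<open>t\<close> alone, divided by \<open>2 \<pi>\<close>.
\<close>
definition profile_energy :: "(real \<Rightarrow> real) \<Rightarrow> (real \<Rightarrow> real) \<Rightarrow> (real \<Rightarrow> real) \<Rightarrow> real" where
  "profile_energy q h h' = integral {-critical_T..critical_T} (\<lambda>t. (h' t)\<^sup>2 - q t * (h t)\<^sup>2)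
     - ((h critical_T)\<^sup>2 + (h (- critical_T))\<^sup>2) / critical_T"

text \<open>
  The term \<open>3 f\<^sup>2\<close> stands for the angular derivative of a function without the three lowest modes.
  On each line \<open>\<theta> = const\<close> the Robin bound controls the boundary term.
\<close>
lemma energy_high_harmonics:
  fixes f :: "real \<times> real \<Rightarrow> real"
  assumes f: "\<And>t \<theta>. t \<in> {-critical_T..critical_T} \<Longrightarrow>
        ((\<lambda>s. f (s, \<theta>)) has_real_derivative fx (t, \<theta>)) (at t within {-critical_T..critical_T})"
    and cf: "continuous_on (strip critical_T) f" and cfx: "continuous_on (strip critical_T) fx"
    and cq: "continuous_on {-critical_T..critical_T} q"
    and q: "\<And>t. t \<in> {-critical_T..critical_T} \<Longrightarrow> q t \<le> 2 / (cosh t)\<^sup>2"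
  shows "(1 - 1 / critical_T\<^sup>2) * integral (rect critical_T) (\<lambda>p. (f p)\<^sup>2)
    \<le> integral (rect critical_T) (\<lambda>p. (fx p)\<^sup>2 + (3 - q (fst p)) * (f p)\<^sup>2)
      - integral {0..2 * pi} (\<lambda>\<theta>. 1 / critical_T * (f (critical_T, \<theta>))\<^sup>2 + 1 / critical_T * (f (- critical_T, \<theta>))\<^sup>2)"
proof -
  let ?T = critical_T
  have T: "?T > 0" by (rule critical_T_pos)
  have cq': "continuous_on (strip ?T) (\<lambda>p. q (fst p))"
    by (intro continuous_on_compose2[OF cq] continuous_intros) (auto simp: strip_def)
  let ?g = "\<lambda>p. (fx p)\<^sup>2 + (1 / ?T\<^sup>2 + (fst p / ?T\<^sup>2)\<^sup>2) * (f p)\<^sup>2"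
  have cg: "continuous_on (strip ?T) ?g" using T by (intro continuous_intros cf cfx) auto
  have "integral {0..2 * pi} (\<lambda>\<theta>. 1 / ?T * (f (?T, \<theta>))\<^sup>2 + 1 / ?T * (f (- ?T, \<theta>))\<^sup>2)
      \<le> integral {0..2 * pi} (\<lambda>\<theta>. integral {-?T..?T} (\<lambda>t. ?g (t, \<theta>)))"
  proof (rule integral_le)
    show "(\<lambda>\<theta>. 1 / ?T * (f (?T, \<theta>))\<^sup>2 + 1 / ?T * (f (- ?T, \<theta>))\<^sup>2) integrable_on {0..2 * pi}"
      using T by (intro integrable_continuous_interval continuous_intros strip_slice_continuous[OF cf]) auto
    show "(\<lambda>\<theta>. integral {-?T..?T} (\<lambda>t. ?g (t, \<theta>))) integrable_on {0..2 * pi}"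
      by (intro integrable_continuous_interval strip_integral_continuous(2)[OF cg])
    show "1 / ?T * (f (?T, \<theta>))\<^sup>2 + 1 / ?T * (f (- ?T, \<theta>))\<^sup>2 \<le> integral {-?T..?T} (\<lambda>t. ?g (t, \<theta>))" for \<theta>
      using robin_energy_lower_bound[OF T f strip_slice_continuous(2)[OF cfx], of \<theta>]
      by (simp add: add_divide_distrib)
  qed
  also have "\<dots> = integral (rect ?T) ?g" by (rule rect_integral_iterated(2)[OF cg, symmetric])
  finally have 1: "integral {0..2 * pi} (\<lambda>\<theta>. 1 / ?T * (f (?T, \<theta>))\<^sup>2 + 1 / ?T * (f (- ?T, \<theta>))\<^sup>2) \<le> integral (rect ?T) ?g" .
  have "integral (rect ?T) (\<lambda>p. (1 - 1 / ?T\<^sup>2) * (f p)\<^sup>2) + integral (rect ?T) ?g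
      = integral (rect ?T) (\<lambda>p. (1 - 1 / ?T\<^sup>2) * (f p)\<^sup>2 + ?g p)"
    by (rule integral_add[symmetric]) (intro rect_integrable continuous_intros cf cg)+
  also have "\<dots> \<le> integral (rect ?T) (\<lambda>p. (fx p)\<^sup>2 + (3 - q (fst p)) * (f p)\<^sup>2)"
  proof (rule integral_le)
    fix p assume p: "p \<in> rect ?T"
    then have t: "\<bar>fst p\<bar> \<le> ?T" "fst p \<in> {-?T..?T}" by (auto simp: cbox_Pair_eq)
    have "(1 - 1 / ?T\<^sup>2) * (f p)\<^sup>2 + (1 / ?T\<^sup>2 + (fst p / ?T\<^sup>2)\<^sup>2) * (f p)\<^sup>2 \<le> (3 - q (fst p)) * (f p)\<^sup>2"
      unfolding distrib_right[symmetric]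
      by (rule mult_right_mono) (use jacobi_potential_bound[OF t(1)] q[OF t(2)] in auto)
    then show "(1 - 1 / ?T\<^sup>2) * (f p)\<^sup>2 + ?g p \<le> (fx p)\<^sup>2 + (3 - q (fst p)) * (f p)\<^sup>2"
      by argo
  qed (intro rect_integrable continuous_intros cf cg cfx cq')+
  finally show ?thesis using 1 by simp
qed

text \<open>
  Expanding along each circle \<open>t = const\<close>, the model energy is the sum of the energies of the three
  lowest Fourier coefficients and of the energy of the remainder, for which
  \<open>integral_derivative_square_bound\<close> replaces the \<open>\<theta>\<close>-derivative by a multiple of the function.
\<close>
lemma model_energy_harmonics:
  fixes f :: "real \<times> real \<Rightarrow> real"
  assumes f: "C1_annulus critical_T f fx fy"
    and cq: "continuous_on {-critical_T..critical_T} q"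
    and q: "\<And>t. t \<in> {-critical_T..critical_T} \<Longrightarrow> q t \<le> 2 / (cosh t)\<^sup>2"
    and c: "c \<le> 1 - 1 / critical_T\<^sup>2"
    and h0: "profile_energy q (\<lambda>t. harmonic0 (\<lambda>\<theta>. f (t, \<theta>))) (\<lambda>t. harmonic0 (\<lambda>\<theta>. fx (t, \<theta>)))
      \<ge> c * integral {-critical_T..critical_T} (\<lambda>t. (harmonic0 (\<lambda>\<theta>. f (t, \<theta>)))\<^sup>2)"
    and h1: "profile_energy (\<lambda>t. q t - 1) (\<lambda>t. harmonic_cos (\<lambda>\<theta>. f (t, \<theta>))) (\<lambda>t. harmonic_cos (\<lambda>\<theta>. fx (t, \<theta>)))
      \<ge> c * integral {-critical_T..critical_T} (\<lambda>t. (harmonic_cos (\<lambda>\<theta>. f (t, \<theta>)))\<^sup>2)"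
    and h2: "profile_energy (\<lambda>t. q t - 1) (\<lambda>t. harmonic_sin (\<lambda>\<theta>. f (t, \<theta>))) (\<lambda>t. harmonic_sin (\<lambda>\<theta>. fx (t, \<theta>)))
      \<ge> c * integral {-critical_T..critical_T} (\<lambda>t. (harmonic_sin (\<lambda>\<theta>. f (t, \<theta>)))\<^sup>2)"
  shows "c * integral (rect critical_T) (\<lambda>p. (f p)\<^sup>2) \<le> model_energy q f fx fy"
proof -
  let ?T = critical_T
  let ?I = "{-?T..?T}"
  have T: "?T > 0" by (rule critical_T_pos)
  have hp: "has_partials ?T f fx fy" and cfx: "continuous_on (strip ?T) fx" and cfy: "continuous_on (strip ?T) fy"
    and per: "\<And>t \<theta>. t \<in> ?I \<Longrightarrow> f (t, \<theta> + 2 * pi) = f (t, \<theta>)"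
    using f by (auto simp: C1_annulus_def)
  have cf: "continuous_on (strip ?T) f" by (rule has_partials_continuous[OF hp])
  have cq': "continuous_on (strip ?T) (\<lambda>p. q (fst p))"
    by (intro continuous_on_compose2[OF cq] continuous_intros) (auto simp: strip_def)
  define m0 m1 m2 where "m0 = (\<lambda>t. harmonic0 (\<lambda>\<theta>. f (t, \<theta>)))" and "m1 = (\<lambda>t. harmonic_cos (\<lambda>\<theta>. f (t, \<theta>)))"
    and "m2 = (\<lambda>t. harmonic_sin (\<lambda>\<theta>. f (t, \<theta>)))"
  define n0 n1 n2 where "n0 = (\<lambda>t. harmonic0 (\<lambda>\<theta>. fx (t, \<theta>)))" and "n1 = (\<lambda>t. harmonic_cos (\<lambda>\<theta>. fx (t, \<theta>)))"
    and "n2 = (\<lambda>t. harmonic_sin (\<lambda>\<theta>. fx (t, \<theta>)))"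
  note mn = m0_def m1_def m2_def n0_def n1_def n2_def
  define \<psi> \<psi>x where "\<psi> = (\<lambda>p. beyond_first (\<lambda>\<theta>. f (fst p, \<theta>)) (snd p))"
    and "\<psi>x = (\<lambda>p. beyond_first (\<lambda>\<theta>. fx (fst p, \<theta>)) (snd p))"
  have cm: "continuous_on ?I m0" "continuous_on ?I m1" "continuous_on ?I m2"
    "continuous_on ?I n0" "continuous_on ?I n1" "continuous_on ?I n2"
    unfolding mn by (rule harmonic_continuous[OF cf] harmonic_continuous[OF cfx])+
  have c\<psi>: "continuous_on (strip ?T) \<psi>" "continuous_on (strip ?T) \<psi>x"
    unfolding \<psi>_def \<psi>x_def by (rule beyond_first_continuous cf cfx)+
  have d\<psi>: "((\<lambda>s. \<psi> (s, \<theta>)) has_real_derivative \<psi>x (t, \<theta>)) (at t within ?I)" if "t \<in> ?I" for t \<theta>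
    unfolding \<psi>_def \<psi>x_def beyond_first_def fst_conv snd_conv
    using harmonic_derivatives[OF hp cfx that] has_partials_t[OF hp that, of \<theta>]
    by (auto intro!: derivative_eq_intros simp: has_real_derivative_iff_has_vector_derivative[symmetric])
  let ?P = "\<lambda>t. integral {0..2 * pi} (\<lambda>\<theta>. (\<psi> (t, \<theta>))\<^sup>2)"
  let ?Px = "\<lambda>t. integral {0..2 * pi} (\<lambda>\<theta>. (\<psi>x (t, \<theta>))\<^sup>2)"
  have cP: "continuous_on ?I ?P" "continuous_on ?I ?Px"
    by (rule strip_integral_continuous(1), intro continuous_intros c\<psi>)+
  have sq: "integral {0..2 * pi} (\<lambda>\<theta>. (f (t, \<theta>))\<^sup>2) = 2 * pi * (m0 t)\<^sup>2 + pi * (m1 t)\<^sup>2 + pi * (m2 t)\<^sup>2 + ?P t"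
    "integral {0..2 * pi} (\<lambda>\<theta>. (fx (t, \<theta>))\<^sup>2) = 2 * pi * (n0 t)\<^sup>2 + pi * (n1 t)\<^sup>2 + pi * (n2 t)\<^sup>2 + ?Px t"
    "pi * (m1 t)\<^sup>2 + pi * (m2 t)\<^sup>2 + 3 * ?P t \<le> integral {0..2 * pi} (\<lambda>\<theta>. (fy (t, \<theta>))\<^sup>2)"
    if t: "t \<in> ?I" for t
  proof -
    show "integral {0..2 * pi} (\<lambda>\<theta>. (f (t, \<theta>))\<^sup>2) = 2 * pi * (m0 t)\<^sup>2 + pi * (m1 t)\<^sup>2 + pi * (m2 t)\<^sup>2 + ?P t"
      using integral_square_split(1)[OF strip_slice_continuous(1)[OF cf t]] by (simp add: mn \<psi>_def)
    show "integral {0..2 * pi} (\<lambda>\<theta>. (fx (t, \<theta>))\<^sup>2) = 2 * pi * (n0 t)\<^sup>2 + pi * (n1 t)\<^sup>2 + pi * (n2 t)\<^sup>2 + ?Px t"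
      using integral_square_split(1)[OF strip_slice_continuous(1)[OF cfx t]] by (simp add: mn \<psi>x_def)
    show "pi * (m1 t)\<^sup>2 + pi * (m2 t)\<^sup>2 + 3 * ?P t \<le> integral {0..2 * pi} (\<lambda>\<theta>. (fy (t, \<theta>))\<^sup>2)"
      unfolding mn \<psi>_def fst_conv snd_conv
      by (rule integral_derivative_square_bound)
        (use has_partials_theta[OF hp t] strip_slice_continuous(1)[OF cfy t] per[OF t] in
          \<open>auto simp: has_real_derivative_iff_has_vector_derivative\<close>)
  qed
  define e0 e1 e2 where "e0 = integral ?I (\<lambda>t. (n0 t)\<^sup>2 - q t * (m0 t)\<^sup>2)"
    and "e1 = integral ?I (\<lambda>t. (n1 t)\<^sup>2 - (q t - 1) * (m1 t)\<^sup>2)"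
    and "e2 = integral ?I (\<lambda>t. (n2 t)\<^sup>2 - (q t - 1) * (m2 t)\<^sup>2)"
  define e3 where "e3 = integral (rect ?T) (\<lambda>p. (\<psi>x p)\<^sup>2 + (3 - q (fst p)) * (\<psi> p)\<^sup>2)"
  have bulk: "2 * pi * e0 + pi * e1 + pi * e2 + e3
    \<le> integral (rect ?T) (\<lambda>p. 1 * (fx p)\<^sup>2 + 2 * 0 * (fx p * fy p) + 1 * (fy p)\<^sup>2 + - q (fst p) * (f p)\<^sup>2)"
  proof -
    let ?R = "\<lambda>t. integral {0..2 * pi} (\<lambda>\<theta>. (\<psi>x (t, \<theta>))\<^sup>2 + (3 - q t) * (\<psi> (t, \<theta>))\<^sup>2)"
    have cR: "continuous_on (strip ?T) (\<lambda>p. (\<psi>x p)\<^sup>2 + (3 - q (fst p)) * (\<psi> p)\<^sup>2)"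
      by (intro continuous_intros c\<psi> cq')
    have "(?R has_integral e3) ?I"
      unfolding e3_def rect_integral_iterated(1)[OF cR] fst_conv
      using strip_integral_continuous(1)[OF cR]
      by (auto intro!: integrable_integral integrable_continuous_interval)
    moreover have "((\<lambda>t. (n0 t)\<^sup>2 - q t * (m0 t)\<^sup>2) has_integral e0) ?I"
      "((\<lambda>t. (n1 t)\<^sup>2 - (q t - 1) * (m1 t)\<^sup>2) has_integral e1) ?I"
      "((\<lambda>t. (n2 t)\<^sup>2 - (q t - 1) * (m2 t)\<^sup>2) has_integral e2) ?I"
      unfolding e0_def e1_def e2_def
      by (intro integrable_integral integrable_continuous_interval continuous_intros cm cq)+
    ultimately have L: "((\<lambda>t. 2 * pi * ((n0 t)\<^sup>2 - q t * (m0 t)\<^sup>2) + pi * ((n1 t)\<^sup>2 - (q t - 1) * (m1 t)\<^sup>2)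
        + pi * ((n2 t)\<^sup>2 - (q t - 1) * (m2 t)\<^sup>2) + ?R t) has_integral 2 * pi * e0 + pi * e1 + pi * e2 + e3) ?I"
      by (intro has_integral_add has_integral_mult_right)
    have cB: "continuous_on (strip ?T) (\<lambda>p. 1 * (fx p)\<^sup>2 + 2 * 0 * (fx p * fy p) + 1 * (fy p)\<^sup>2 + - q (fst p) * (f p)\<^sup>2)"
      by (intro continuous_intros cf cfx cfy cq')
    have "2 * pi * e0 + pi * e1 + pi * e2 + e3 \<le> integral ?I (\<lambda>t. integral {0..2 * pi}
        (\<lambda>\<theta>. 1 * (fx (t, \<theta>))\<^sup>2 + 2 * 0 * (fx (t, \<theta>) * fy (t, \<theta>)) + 1 * (fy (t, \<theta>))\<^sup>2 + - q (fst (t, \<theta>)) * (f (t, \<theta>))\<^sup>2))"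
    proof (rule has_integral_le[OF L integrable_integral])
      show "(\<lambda>t. integral {0..2 * pi} (\<lambda>\<theta>. 1 * (fx (t, \<theta>))\<^sup>2 + 2 * 0 * (fx (t, \<theta>) * fy (t, \<theta>)) + 1 * (fy (t, \<theta>))\<^sup>2
          + - q (fst (t, \<theta>)) * (f (t, \<theta>))\<^sup>2)) integrable_on ?I"
        by (rule integrable_continuous_interval, rule strip_integral_continuous(1)[OF cB])
      fix t assume t: "t \<in> ?I"
      have i: "((\<lambda>\<theta>. (fx (t, \<theta>))\<^sup>2) has_integral integral {0..2 * pi} (\<lambda>\<theta>. (fx (t, \<theta>))\<^sup>2)) {0..2 * pi}"
        "((\<lambda>\<theta>. (fy (t, \<theta>))\<^sup>2) has_integral integral {0..2 * pi} (\<lambda>\<theta>. (fy (t, \<theta>))\<^sup>2)) {0..2 * pi}"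
        "((\<lambda>\<theta>. (f (t, \<theta>))\<^sup>2) has_integral integral {0..2 * pi} (\<lambda>\<theta>. (f (t, \<theta>))\<^sup>2)) {0..2 * pi}"
        "((\<lambda>\<theta>. (\<psi>x (t, \<theta>))\<^sup>2) has_integral ?Px t) {0..2 * pi}"
        "((\<lambda>\<theta>. (\<psi> (t, \<theta>))\<^sup>2) has_integral ?P t) {0..2 * pi}"
        by (intro integrable_integral integrable_continuous_interval continuous_intros
            strip_slice_continuous(1)[OF _ t] cfx cfy cf c\<psi>)+
      have "integral {0..2 * pi} (\<lambda>\<theta>. 1 * (fx (t, \<theta>))\<^sup>2 + 2 * 0 * (fx (t, \<theta>) * fy (t, \<theta>)) + 1 * (fy (t, \<theta>))\<^sup>2
          + - q (fst (t, \<theta>)) * (f (t, \<theta>))\<^sup>2)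
        = integral {0..2 * pi} (\<lambda>\<theta>. (fx (t, \<theta>))\<^sup>2) + integral {0..2 * pi} (\<lambda>\<theta>. (fy (t, \<theta>))\<^sup>2)
          - q t * integral {0..2 * pi} (\<lambda>\<theta>. (f (t, \<theta>))\<^sup>2)"
        using integral_unique[OF has_integral_diff[OF has_integral_add[OF i(1,2)] has_integral_mult_right[OF i(3), of "q t"]]]
        by simp
      moreover have "?R t = ?Px t + (3 - q t) * ?P t"
        by (rule integral_unique) (intro has_integral_add has_integral_mult_right i)
      ultimately show "2 * pi * ((n0 t)\<^sup>2 - q t * (m0 t)\<^sup>2) + pi * ((n1 t)\<^sup>2 - (q t - 1) * (m1 t)\<^sup>2)
          + pi * ((n2 t)\<^sup>2 - (q t - 1) * (m2 t)\<^sup>2) + ?R t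
        \<le> integral {0..2 * pi} (\<lambda>\<theta>. 1 * (fx (t, \<theta>))\<^sup>2 + 2 * 0 * (fx (t, \<theta>) * fy (t, \<theta>)) + 1 * (fy (t, \<theta>))\<^sup>2
          + - q (fst (t, \<theta>)) * (f (t, \<theta>))\<^sup>2)"
        using sq(3)[OF t] unfolding sq(1,2)[OF t] by (simp add: algebra_simps)
    qed
    then show ?thesis unfolding rect_integral_iterated(1)[OF cB] .
  qed
  define b where "b = integral {0..2 * pi} (\<lambda>\<theta>. 1 / ?T * (\<psi> (?T, \<theta>))\<^sup>2 + 1 / ?T * (\<psi> (- ?T, \<theta>))\<^sup>2)"
  have bdry: "integral {0..2 * pi} (\<lambda>\<theta>. 1 / ?T * (f (?T, \<theta>))\<^sup>2 + 1 / ?T * (f (- ?T, \<theta>))\<^sup>2)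
    = 2 * pi * (((m0 ?T)\<^sup>2 + (m0 (- ?T))\<^sup>2) / ?T) + pi * (((m1 ?T)\<^sup>2 + (m1 (- ?T))\<^sup>2) / ?T)
      + pi * (((m2 ?T)\<^sup>2 + (m2 (- ?T))\<^sup>2) / ?T) + b"
  proof -
    have TI: "?T \<in> ?I" "- ?T \<in> ?I" using T by auto
    have i: "((\<lambda>\<theta>. (g (t, \<theta>))\<^sup>2) has_integral integral {0..2 * pi} (\<lambda>\<theta>. (g (t, \<theta>))\<^sup>2)) {0..2 * pi}"
      if "t \<in> ?I" "continuous_on (strip ?T) g" for t and g :: "real \<times> real \<Rightarrow> real"
      by (intro integrable_integral integrable_continuous_interval continuous_intros
            strip_slice_continuous(1)[OF _ that(1)] that(2))
    have lin: "integral {0..2 * pi} (\<lambda>\<theta>. 1 / ?T * (g (?T, \<theta>))\<^sup>2 + 1 / ?T * (g (- ?T, \<theta>))\<^sup>2)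
      = 1 / ?T * integral {0..2 * pi} (\<lambda>\<theta>. (g (?T, \<theta>))\<^sup>2) + 1 / ?T * integral {0..2 * pi} (\<lambda>\<theta>. (g (- ?T, \<theta>))\<^sup>2)"
      if "continuous_on (strip ?T) g" for g :: "real \<times> real \<Rightarrow> real"
      by (rule integral_unique) (intro has_integral_add has_integral_mult_right i TI that)
    show ?thesis
      unfolding b_def lin[OF cf] lin[OF c\<psi>(1)] sq(1)[OF TI(1)] sq(1)[OF TI(2)]
      by (simp add: add_divide_distrib distrib_left)
  qed
  have TS: "integral (rect ?T) (\<lambda>p. (f p)\<^sup>2) = 2 * pi * integral ?I (\<lambda>t. (m0 t)\<^sup>2) + pi * integral ?I (\<lambda>t. (m1 t)\<^sup>2)
      + pi * integral ?I (\<lambda>t. (m2 t)\<^sup>2) + integral (rect ?T) (\<lambda>p. (\<psi> p)\<^sup>2)"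
  proof -
    have c2: "continuous_on (strip ?T) (\<lambda>p. (f p)\<^sup>2)" "continuous_on (strip ?T) (\<lambda>p. (\<psi> p)\<^sup>2)"
      by (intro continuous_intros cf c\<psi>)+
    have "integral (rect ?T) (\<lambda>p. (f p)\<^sup>2) = integral ?I (\<lambda>t. 2 * pi * (m0 t)\<^sup>2 + pi * (m1 t)\<^sup>2 + pi * (m2 t)\<^sup>2 + ?P t)"
      unfolding rect_integral_iterated(1)[OF c2(1)] by (rule integral_cong) (rule sq(1))
    also have "\<dots> = 2 * pi * integral ?I (\<lambda>t. (m0 t)\<^sup>2) + pi * integral ?I (\<lambda>t. (m1 t)\<^sup>2)
      + pi * integral ?I (\<lambda>t. (m2 t)\<^sup>2) + integral ?I ?P"
      by (rule integral_unique)
        (intro has_integral_add has_integral_mult_right integrable_integral integrable_continuous_interval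
          continuous_intros cm cP)
    finally show ?thesis unfolding rect_integral_iterated(1)[OF c2(2)] .
  qed
  have H: "c * integral (rect ?T) (\<lambda>p. (\<psi> p)\<^sup>2) \<le> e3 - b"
  proof -
    have "integral (rect ?T) (\<lambda>p. (\<psi> p)\<^sup>2) \<ge> 0"
      by (intro integral_nonneg rect_integrable continuous_intros c\<psi>) auto
    then have "c * integral (rect ?T) (\<lambda>p. (\<psi> p)\<^sup>2) \<le> (1 - 1 / ?T\<^sup>2) * integral (rect ?T) (\<lambda>p. (\<psi> p)\<^sup>2)"
      by (rule mult_right_mono[OF c])
    also have "\<dots> \<le> e3 - b"
      unfolding e3_def b_def by (rule energy_high_harmonics[OF d\<psi> c\<psi> cq q])
    finally show ?thesis .
  qed
  have "2 * pi * (c * integral ?I (\<lambda>t. (m0 t)\<^sup>2)) \<le> 2 * pi * (e0 - ((m0 ?T)\<^sup>2 + (m0 (- ?T))\<^sup>2) / ?T)"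
    "pi * (c * integral ?I (\<lambda>t. (m1 t)\<^sup>2)) \<le> pi * (e1 - ((m1 ?T)\<^sup>2 + (m1 (- ?T))\<^sup>2) / ?T)"
    "pi * (c * integral ?I (\<lambda>t. (m2 t)\<^sup>2)) \<le> pi * (e2 - ((m2 ?T)\<^sup>2 + (m2 (- ?T))\<^sup>2) / ?T)"
    using h0 h1 h2 unfolding profile_energy_def e0_def e1_def e2_def mn
    by (auto intro!: mult_left_mono)
  then have "c * integral (rect ?T) (\<lambda>p. (f p)\<^sup>2) \<le> 2 * pi * (e0 - ((m0 ?T)\<^sup>2 + (m0 (- ?T))\<^sup>2) / ?T)
      + pi * (e1 - ((m1 ?T)\<^sup>2 + (m1 (- ?T))\<^sup>2) / ?T) + pi * (e2 - ((m2 ?T)\<^sup>2 + (m2 (- ?T))\<^sup>2) / ?T) + (e3 - b)"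
    using H unfolding TS by (simp add: algebra_simps)
  also have "\<dots> = 2 * pi * e0 + pi * e1 + pi * e2 + e3
      - integral {0..2 * pi} (\<lambda>\<theta>. 1 / ?T * (f (?T, \<theta>))\<^sup>2 + 1 / ?T * (f (- ?T, \<theta>))\<^sup>2)"
    unfolding bdry by (simp add: algebra_simps)
  also have "\<dots> \<le> model_energy q f fx fy"
    using bulk unfolding model_energy_def energy_def by simp
  finally show ?thesis .
qed

lemma harmonic_profile_continuous_derivative:
  fixes f :: "real \<times> real \<Rightarrow> real"
  assumes f: "C1_annulus T f fx fy"
  shows "\<And>t. t \<in> {-T..T} \<Longrightarrow> ((\<lambda>t. harmonic0 (\<lambda>\<theta>. f (t, \<theta>))) has_real_derivative harmonic0 (\<lambda>\<theta>. fx (t, \<theta>))) (at t within {-T..T})"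
    and "\<And>t. t \<in> {-T..T} \<Longrightarrow> ((\<lambda>t. harmonic_cos (\<lambda>\<theta>. f (t, \<theta>))) has_real_derivative harmonic_cos (\<lambda>\<theta>. fx (t, \<theta>))) (at t within {-T..T})"
    and "\<And>t. t \<in> {-T..T} \<Longrightarrow> ((\<lambda>t. harmonic_sin (\<lambda>\<theta>. f (t, \<theta>))) has_real_derivative harmonic_sin (\<lambda>\<theta>. fx (t, \<theta>))) (at t within {-T..T})"
    and "continuous_on {-T..T} (\<lambda>t. harmonic0 (\<lambda>\<theta>. fx (t, \<theta>)))"
    and "continuous_on {-T..T} (\<lambda>t. harmonic_cos (\<lambda>\<theta>. fx (t, \<theta>)))"
    and "continuous_on {-T..T} (\<lambda>t. harmonic_sin (\<lambda>\<theta>. fx (t, \<theta>)))"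
proof -
  have hp: "has_partials T f fx fy" and cfx: "continuous_on (strip T) fx"
    using f by (auto simp: C1_annulus_def)
  note d = harmonic_derivatives[OF hp cfx] harmonic_continuous[OF cfx]
  fix t assume t: "t \<in> {-T..T}"
  show "((\<lambda>t. harmonic0 (\<lambda>\<theta>. f (t, \<theta>))) has_real_derivative harmonic0 (\<lambda>\<theta>. fx (t, \<theta>))) (at t within {-T..T})"
    by (rule d(1)[OF t])
  show "((\<lambda>t. harmonic_cos (\<lambda>\<theta>. f (t, \<theta>))) has_real_derivative harmonic_cos (\<lambda>\<theta>. fx (t, \<theta>))) (at t within {-T..T})"
    by (rule d(2)[OF t])
  show "((\<lambda>t. harmonic_sin (\<lambda>\<theta>. f (t, \<theta>))) has_real_derivative harmonic_sin (\<lambda>\<theta>. fx (t, \<theta>))) (at t within {-T..T})"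
    by (rule d(3)[OF t])
next
  have cfx: "continuous_on (strip T) fx"
    using f by (auto simp: C1_annulus_def)
  show "continuous_on {-T..T} (\<lambda>t. harmonic0 (\<lambda>\<theta>. fx (t, \<theta>)))"
    "continuous_on {-T..T} (\<lambda>t. harmonic_cos (\<lambda>\<theta>. fx (t, \<theta>)))"
    "continuous_on {-T..T} (\<lambda>t. harmonic_sin (\<lambda>\<theta>. fx (t, \<theta>)))"
    by (rule harmonic_continuous[OF cfx])+
qed

lemma profile_energy_two_zeros:
  assumes h: "\<And>x. x \<in> {-critical_T..critical_T} \<Longrightarrow> (h has_real_derivative h' x) (at x within {-critical_T..critical_T})"
    and ch: "continuous_on {-critical_T..critical_T} h'"
    and zero: "h (critical_T / 2) = 0" "h (- critical_T / 2) = 0"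
    and cq: "continuous_on {-critical_T..critical_T} q"
    and q: "\<And>t. t \<in> {-critical_T..critical_T} \<Longrightarrow> q t \<le> 2"
  shows "(4 / critical_T\<^sup>2 - 2) * integral {-critical_T..critical_T} (\<lambda>t. (h t)\<^sup>2) \<le> profile_energy q h h'"
proof -
  let ?I = "{-critical_T..critical_T}"
  have ch0: "continuous_on ?I h" by (auto intro!: DERIV_continuous_on h)
  have "integral ?I (\<lambda>x. (h' x)\<^sup>2) - 2 * integral ?I (\<lambda>x. (h x)\<^sup>2) = integral ?I (\<lambda>x. (h' x)\<^sup>2 - 2 * (h x)\<^sup>2)"
    by (subst integral_diff) (auto intro!: integrable_continuous_interval continuous_intros ch ch0)
  also have "\<dots> \<le> integral ?I (\<lambda>t. (h' t)\<^sup>2 - q t * (h t)\<^sup>2)"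
    by (rule integral_le)
      (auto intro!: integrable_continuous_interval continuous_intros ch ch0 cq mult_right_mono q)
  finally show ?thesis
    using energy_two_interior_zeros[OF critical_T_pos h ch zero] unfolding profile_energy_def by simp
qed

lemma two_div_cosh_sq_le: "2 / (cosh (t::real))\<^sup>2 \<le> 2"
proof -
  have "(cosh t)\<^sup>2 \<ge> 1" using cosh_square_eq[of t] by simp
  then show ?thesis by (simp add: divide_le_eq)
qed

text \<open>
  Each of the three lowest Fourier coefficients vanishes at \<open>\<plusminus> T / 2\<close>. The constant \<open>4 / T\<^sup>2 - 2\<close> of
  the two-zeros bound is positive since \<open>T\<^sup>2 < 2\<close>.
\<close>
lemma jacobi_coercive_L2:
  obtains c where "c > 0"
    "\<And>f fx fy. C1_annulus critical_T f fx fy \<Longrightarrow>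
      (\<And>s. s \<in> {critical_T / 2, - critical_T / 2} \<Longrightarrow> harmonic0 (\<lambda>\<theta>. f (s, \<theta>)) = 0
        \<and> harmonic_cos (\<lambda>\<theta>. f (s, \<theta>)) = 0 \<and> harmonic_sin (\<lambda>\<theta>. f (s, \<theta>)) = 0) \<Longrightarrow>
      c * integral (rect critical_T) (\<lambda>p. (f p)\<^sup>2) \<le> model_energy (\<lambda>t. 2 / (cosh t)\<^sup>2) f fx fy"
proof
  let ?T = critical_T
  let ?c = "min (4 / ?T\<^sup>2 - 2) (1 - 1 / ?T\<^sup>2)"
  have "?T\<^sup>2 > 1" using critical_T_gt_1 by simp
  moreover have "?T\<^sup>2 > 0" using critical_T_pos by simp
  ultimately show "?c > 0" using critical_T_square_lt_2 by (simp add: less_divide_eq divide_less_eq)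
  fix f fx fy
  assume f: "C1_annulus critical_T f fx fy"
    and z: "\<And>s. s \<in> {critical_T / 2, - critical_T / 2} \<Longrightarrow> harmonic0 (\<lambda>\<theta>. f (s, \<theta>)) = 0
        \<and> harmonic_cos (\<lambda>\<theta>. f (s, \<theta>)) = 0 \<and> harmonic_sin (\<lambda>\<theta>. f (s, \<theta>)) = 0"
  have weaken: "?c * integral {-?T..?T} (\<lambda>t. (h t)\<^sup>2) \<le> (4 / ?T\<^sup>2 - 2) * integral {-?T..?T} (\<lambda>t. (h t)\<^sup>2)"
    if "\<And>t. t \<in> {-?T..?T} \<Longrightarrow> (h has_real_derivative h' t) (at t within {-?T..?T})" for h h' :: "real \<Rightarrow> real"
    using DERIV_continuous_on[of "{-?T..?T}" h h'] that
    by (intro mult_right_mono integral_nonneg integrable_continuous_interval continuous_intros) auto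
  have le: "2 / (cosh t)\<^sup>2 - 1 \<le> 2" for t :: real using two_div_cosh_sq_le[of t] by simp
  have cq: "continuous_on {-?T..?T} (\<lambda>t. 2 / (cosh t)\<^sup>2)"
    and cq': "continuous_on {-?T..?T} (\<lambda>t. 2 / (cosh t)\<^sup>2 - 1)" by (intro continuous_intros; simp)+
  note d = harmonic_profile_continuous_derivative[OF f]
  show "?c * integral (rect critical_T) (\<lambda>p. (f p)\<^sup>2) \<le> model_energy (\<lambda>t. 2 / (cosh t)\<^sup>2) f fx fy"
  proof (rule model_energy_harmonics[OF f])
    show "continuous_on {-?T..?T} (\<lambda>t. 2 / (cosh t)\<^sup>2)" by (rule cq)
    show "?c * integral {-?T..?T} (\<lambda>t. (harmonic0 (\<lambda>\<theta>. f (t, \<theta>)))\<^sup>2)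
        \<le> profile_energy (\<lambda>t. 2 / (cosh t)\<^sup>2) (\<lambda>t. harmonic0 (\<lambda>\<theta>. f (t, \<theta>))) (\<lambda>t. harmonic0 (\<lambda>\<theta>. fx (t, \<theta>)))"
      by (rule order_trans[OF weaken[OF d(1)] profile_energy_two_zeros[OF d(1) d(4) _ _ cq two_div_cosh_sq_le]])
        (simp_all add: z)
    show "?c * integral {-?T..?T} (\<lambda>t. (harmonic_cos (\<lambda>\<theta>. f (t, \<theta>)))\<^sup>2)
        \<le> profile_energy (\<lambda>t. 2 / (cosh t)\<^sup>2 - 1) (\<lambda>t. harmonic_cos (\<lambda>\<theta>. f (t, \<theta>))) (\<lambda>t. harmonic_cos (\<lambda>\<theta>. fx (t, \<theta>)))"
      by (rule order_trans[OF weaken[OF d(2)] profile_energy_two_zeros[OF d(2) d(5) _ _ cq' le]])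
        (simp_all add: z)
    show "?c * integral {-?T..?T} (\<lambda>t. (harmonic_sin (\<lambda>\<theta>. f (t, \<theta>)))\<^sup>2)
        \<le> profile_energy (\<lambda>t. 2 / (cosh t)\<^sup>2 - 1) (\<lambda>t. harmonic_sin (\<lambda>\<theta>. f (t, \<theta>))) (\<lambda>t. harmonic_sin (\<lambda>\<theta>. fx (t, \<theta>)))"
      by (rule order_trans[OF weaken[OF d(3)] profile_energy_two_zeros[OF d(3) d(6) _ _ cq' le]])
        (simp_all add: z)
  qed auto
qed

text \<open>
  Without a potential, the angular derivative adds the squared \<open>L\<^sup>2\<close>-norm to the energy of the first
  harmonics, and a single zero in the centre suffices for them.
\<close>
lemma steklov_coercive_L2:
  obtains c where "c > 0"
    "\<And>f fx fy. C1_annulus critical_T f fx fy \<Longrightarrow>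
      (\<And>s. s \<in> {critical_T / 2, - critical_T / 2} \<Longrightarrow> harmonic0 (\<lambda>\<theta>. f (s, \<theta>)) = 0) \<Longrightarrow>
      harmonic_cos (\<lambda>\<theta>. f (0, \<theta>)) = 0 \<Longrightarrow> harmonic_sin (\<lambda>\<theta>. f (0, \<theta>)) = 0 \<Longrightarrow>
      c * integral (rect critical_T) (\<lambda>p. (f p)\<^sup>2) \<le> model_energy (\<lambda>t. 0) f fx fy"
proof
  let ?T = critical_T
  let ?c = "min (4 / ?T\<^sup>2 - 2) (1 - 1 / ?T\<^sup>2)"
  have T2: "?T\<^sup>2 > 1" using critical_T_gt_1 by simp
  moreover have "?T\<^sup>2 > 0" using critical_T_pos by simp
  ultimately show "?c > 0" using critical_T_square_lt_2 by (simp add: less_divide_eq divide_less_eq)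
  fix f fx fy
  assume f: "C1_annulus critical_T f fx fy"
    and z: "\<And>s. s \<in> {critical_T / 2, - critical_T / 2} \<Longrightarrow> harmonic0 (\<lambda>\<theta>. f (s, \<theta>)) = 0"
      "harmonic_cos (\<lambda>\<theta>. f (0, \<theta>)) = 0" "harmonic_sin (\<lambda>\<theta>. f (0, \<theta>)) = 0"
  note d = harmonic_profile_continuous_derivative[OF f]
  have weaken: "?c * integral {-?T..?T} (\<lambda>t. (h t)\<^sup>2) \<le> b * integral {-?T..?T} (\<lambda>t. (h t)\<^sup>2)"
    if "?c \<le> b" "\<And>t. t \<in> {-?T..?T} \<Longrightarrow> (h has_real_derivative h' t) (at t within {-?T..?T})" for h h' :: "real \<Rightarrow> real" and b
    using DERIV_continuous_on[of "{-?T..?T}" h h'] that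
    by (intro mult_right_mono integral_nonneg integrable_continuous_interval continuous_intros) auto
  have one: "?c * integral {-?T..?T} (\<lambda>t. (h t)\<^sup>2) \<le> profile_energy (\<lambda>t. 0 - 1) h h'"
    if h: "\<And>t. t \<in> {-?T..?T} \<Longrightarrow> (h has_real_derivative h' t) (at t within {-?T..?T})"
      and ch: "continuous_on {-?T..?T} h'" and h0: "h 0 = 0" for h h' :: "real \<Rightarrow> real"
  proof -
    have ch0: "continuous_on {-?T..?T} h" by (auto intro!: DERIV_continuous_on h)
    have "?c * integral {-?T..?T} (\<lambda>t. (h t)\<^sup>2) \<le> 1 * integral {-?T..?T} (\<lambda>t. (h t)\<^sup>2)"
      by (rule weaken[OF _ h]) (use T2 in \<open>auto simp: min_def\<close>)
    moreover have "integral {-?T..?T} (\<lambda>t. (h' t)\<^sup>2 - (0 - 1) * (h t)\<^sup>2)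
        = integral {-?T..?T} (\<lambda>t. (h' t)\<^sup>2) + integral {-?T..?T} (\<lambda>t. (h t)\<^sup>2)"
      by (subst integral_add[symmetric]) (auto intro!: integrable_continuous_interval continuous_intros ch ch0)
    ultimately show ?thesis
      using energy_zero_at_centre[OF critical_T_pos h ch h0] unfolding profile_energy_def by simp
  qed
  show "?c * integral (rect critical_T) (\<lambda>p. (f p)\<^sup>2) \<le> model_energy (\<lambda>t. 0) f fx fy"
  proof (rule model_energy_harmonics[OF f])
    have "?c * integral {-?T..?T} (\<lambda>t. (harmonic0 (\<lambda>\<theta>. f (t, \<theta>)))\<^sup>2)
      \<le> (4 / ?T\<^sup>2 - 2) * integral {-?T..?T} (\<lambda>t. (harmonic0 (\<lambda>\<theta>. f (t, \<theta>)))\<^sup>2)"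
      by (rule weaken[OF _ d(1)]) auto
    also have "\<dots> \<le> profile_energy (\<lambda>t. 0) (\<lambda>t. harmonic0 (\<lambda>\<theta>. f (t, \<theta>))) (\<lambda>t. harmonic0 (\<lambda>\<theta>. fx (t, \<theta>)))"
      by (rule profile_energy_two_zeros[OF d(1) d(4)]) (simp_all add: z)
    finally show "?c * integral {-?T..?T} (\<lambda>t. (harmonic0 (\<lambda>\<theta>. f (t, \<theta>)))\<^sup>2) \<le> \<dots>" .
    show "?c * integral {-?T..?T} (\<lambda>t. (harmonic_cos (\<lambda>\<theta>. f (t, \<theta>)))\<^sup>2)
        \<le> profile_energy (\<lambda>t. 0 - 1) (\<lambda>t. harmonic_cos (\<lambda>\<theta>. f (t, \<theta>))) (\<lambda>t. harmonic_cos (\<lambda>\<theta>. fx (t, \<theta>)))"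
      by (rule one[OF d(2) d(5) z(2)])
    show "?c * integral {-?T..?T} (\<lambda>t. (harmonic_sin (\<lambda>\<theta>. f (t, \<theta>)))\<^sup>2)
        \<le> profile_energy (\<lambda>t. 0 - 1) (\<lambda>t. harmonic_sin (\<lambda>\<theta>. f (t, \<theta>))) (\<lambda>t. harmonic_sin (\<lambda>\<theta>. fx (t, \<theta>)))"
      by (rule one[OF d(3) d(6) z(3)])
  qed auto
qed

text \<open>
  The fundamental theorem of calculus for \<open>t / T\<^sup>2 f\<^sup>2\<close>, whose values at the two ends add up to the
  boundary term.
\<close>
lemma trace_inequality:
  fixes f :: "real \<times> real \<Rightarrow> real"
  assumes f: "C1_annulus critical_T f fx fy"
  shows "integral {0..2 * pi} (\<lambda>\<theta>. 1 / critical_T * (f (critical_T, \<theta>))\<^sup>2 + 1 / critical_T * (f (- critical_T, \<theta>))\<^sup>2)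
    \<le> integral (rect critical_T) (\<lambda>p. 3 * (f p)\<^sup>2 + 1 / 2 * (fx p)\<^sup>2)"
proof -
  let ?T = critical_T
  have T: "?T > 1" by (rule critical_T_gt_1)
  have hp: "has_partials ?T f fx fy" and cfx: "continuous_on (strip ?T) fx"
    using f by (auto simp: C1_annulus_def)
  have cf: "continuous_on (strip ?T) f" by (rule has_partials_continuous[OF hp])
  let ?g = "\<lambda>p. 3 * (f p)\<^sup>2 + 1 / 2 * (fx p)\<^sup>2"
  have cg: "continuous_on (strip ?T) ?g" by (intro continuous_intros cf cfx)
  have "1 / ?T * (f (?T, \<theta>))\<^sup>2 + 1 / ?T * (f (- ?T, \<theta>))\<^sup>2 \<le> integral {-?T..?T} (\<lambda>t. ?g (t, \<theta>))" for \<theta>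
  proof -
    let ?h = "\<lambda>t. 1 / ?T\<^sup>2 * (f (t, \<theta>))\<^sup>2 + 2 * (t / ?T\<^sup>2) * (f (t, \<theta>) * fx (t, \<theta>))"
    let ?H = "\<lambda>t. t / ?T\<^sup>2 * (f (t, \<theta>))\<^sup>2"
    have "(?h has_integral ?H ?T - ?H (- ?T)) {-?T..?T}"
    proof (rule fundamental_theorem_of_calculus)
      fix t assume t: "t \<in> {-?T..?T}"
      have "((\<lambda>s. f (s, \<theta>)) has_real_derivative fx (t, \<theta>)) (at t within {-?T..?T})"
        using has_partials_t[OF hp t] by (simp add: has_real_derivative_iff_has_vector_derivative)
      then have "(?H has_real_derivative ?h t) (at t within {-?T..?T})"
        using T by (auto intro!: derivative_eq_intros simp: power2_eq_square add_divide_distrib mult_ac)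
      then show "(?H has_vector_derivative ?h t) (at t within {-?T..?T})"
        by (simp add: has_real_derivative_iff_has_vector_derivative)
    qed (use T in auto)
    moreover have "?H ?T - ?H (- ?T) = 1 / ?T * (f (?T, \<theta>))\<^sup>2 + 1 / ?T * (f (- ?T, \<theta>))\<^sup>2"
      using T by (simp add: power2_eq_square)
    ultimately have "(?h has_integral 1 / ?T * (f (?T, \<theta>))\<^sup>2 + 1 / ?T * (f (- ?T, \<theta>))\<^sup>2) {-?T..?T}" by simp
    then show ?thesis
    proof (rule has_integral_le[OF _ integrable_integral])
      show "(\<lambda>t. ?g (t, \<theta>)) integrable_on {-?T..?T}"
        by (intro integrable_continuous_interval continuous_intros strip_slice_continuous(2) cf cfx)
      fix t assume t: "t \<in> {-?T..?T}"
      define a where "a = t / ?T\<^sup>2"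
      have "\<bar>a\<bar> \<le> ?T / ?T\<^sup>2" unfolding a_def abs_divide abs_power2 using t T by (intro divide_right_mono) auto
      also have "\<dots> \<le> 1" using T by (simp add: power2_eq_square)
      finally have "a\<^sup>2 \<le> 1" by (simp add: abs_square_le_1)
      have "1 / ?T\<^sup>2 \<le> 1" using T by simp
      then have "1 / ?T\<^sup>2 * (f (t, \<theta>))\<^sup>2 \<le> 1 * (f (t, \<theta>))\<^sup>2" by (rule mult_right_mono) simp
      moreover have "0 \<le> (fx (t, \<theta>) - 2 * a * f (t, \<theta>))\<^sup>2" by simp
      then have "2 * a * (f (t, \<theta>) * fx (t, \<theta>)) \<le> 1 / 2 * (fx (t, \<theta>))\<^sup>2 + 2 * (a\<^sup>2 * (f (t, \<theta>))\<^sup>2)"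
        by (simp add: power2_eq_square algebra_simps)
      moreover have "a\<^sup>2 * (f (t, \<theta>))\<^sup>2 \<le> 1 * (f (t, \<theta>))\<^sup>2"
        by (rule mult_right_mono[OF \<open>a\<^sup>2 \<le> 1\<close>]) simp
      ultimately show "?h t \<le> ?g (t, \<theta>)" unfolding a_def[symmetric] by argo
    qed
  qed
  then have "integral {0..2 * pi} (\<lambda>\<theta>. 1 / ?T * (f (?T, \<theta>))\<^sup>2 + 1 / ?T * (f (- ?T, \<theta>))\<^sup>2)
      \<le> integral {0..2 * pi} (\<lambda>\<theta>. integral {-?T..?T} (\<lambda>t. ?g (t, \<theta>)))"
    using T by (intro integral_le integrable_continuous_interval continuous_intros strip_slice_continuous[OF cf]
        strip_integral_continuous(2)[OF cg]) auto
  also have "\<dots> = integral (rect ?T) ?g" by (rule rect_integral_iterated(2)[OF cg, symmetric])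
  finally show ?thesis .
qed

definition h1_norm2 :: "(real \<times> real \<Rightarrow> real) \<Rightarrow> (real \<times> real \<Rightarrow> real) \<Rightarrow> (real \<times> real \<Rightarrow> real) \<Rightarrow> real" where
  "h1_norm2 f fx fy = integral (rect critical_T) (\<lambda>p. (f p)\<^sup>2 + (fx p)\<^sup>2 + (fy p)\<^sup>2)"

text \<open>
  By the trace inequality the boundary term costs at most half of the gradient term, up to a multiple
  of the \<open>L\<^sup>2\<close>-norm, so control of the latter gives control of the gradient.
\<close>
lemma coercive_H1:
  fixes f :: "real \<times> real \<Rightarrow> real"
  assumes f: "C1_annulus critical_T f fx fy"
    and cq: "continuous_on {-critical_T..critical_T} q"
    and q: "\<And>t. t \<in> {-critical_T..critical_T} \<Longrightarrow> q t \<le> 2"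
    and c: "c > 0" "c * integral (rect critical_T) (\<lambda>p. (f p)\<^sup>2) \<le> model_energy q f fx fy"
  shows "c / (2 * c + 11) * h1_norm2 f fx fy \<le> model_energy q f fx fy"
proof -
  let ?T = critical_T
  have hp: "has_partials ?T f fx fy" and cfx: "continuous_on (strip ?T) fx" and cfy: "continuous_on (strip ?T) fy"
    using f by (auto simp: C1_annulus_def)
  have cf: "continuous_on (strip ?T) f" by (rule has_partials_continuous[OF hp])
  have cq': "continuous_on (strip ?T) (\<lambda>p. q (fst p))"
    by (intro continuous_on_compose2[OF cq] continuous_intros) (auto simp: strip_def)
  let ?B = "model_energy q f fx fy" and ?L = "integral (rect ?T) (\<lambda>p. (f p)\<^sup>2)"
  let ?H = "h1_norm2 f fx fy"
  let ?g = "\<lambda>p. 3 * (f p)\<^sup>2 + 1 / 2 * (fx p)\<^sup>2"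
  let ?b = "\<lambda>p. 1 * (fx p)\<^sup>2 + 2 * 0 * (fx p * fy p) + 1 * (fy p)\<^sup>2 + - q (fst p) * (f p)\<^sup>2"
  have "1 / 2 * ?H + (- 11 / 2) * ?L = integral (rect ?T) (\<lambda>p. 1 / 2 * ((f p)\<^sup>2 + (fx p)\<^sup>2 + (fy p)\<^sup>2) + (- 11 / 2) * (f p)\<^sup>2)"
    unfolding h1_norm2_def
    by (rule integral_unique[symmetric])
      (intro has_integral_add has_integral_mult_right integrable_integral rect_integrable continuous_intros cf cfx cfy)
  also have "\<dots> \<le> integral (rect ?T) (\<lambda>p. ?b p - ?g p)"
  proof (rule integral_le)
    fix p assume p: "p \<in> rect ?T"
    then have "fst p \<in> {-?T..?T}" by (auto simp: cbox_Pair_eq)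
    then have "q (fst p) * (f p)\<^sup>2 \<le> 2 * (f p)\<^sup>2" by (intro mult_right_mono q) auto
    moreover have "(fy p)\<^sup>2 \<ge> 0" by simp
    ultimately show "1 / 2 * ((f p)\<^sup>2 + (fx p)\<^sup>2 + (fy p)\<^sup>2) + (- 11 / 2) * (f p)\<^sup>2 \<le> ?b p - ?g p"
      by argo
  qed (intro rect_integrable continuous_intros cf cfx cfy cq')+
  also have "\<dots> = integral (rect ?T) ?b - integral (rect ?T) ?g"
    by (rule integral_diff) (intro rect_integrable continuous_intros cf cfx cfy cq')+
  also have "\<dots> \<le> ?B"
    using trace_inequality[OF f] unfolding model_energy_def energy_def by simp
  finally have "?H \<le> 2 * ?B + 11 * ?L" by argo
  then have "c * ?H \<le> c * (2 * ?B + 11 * ?L)" using c(1) by simp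
  also have "\<dots> = 2 * c * ?B + 11 * (c * ?L)" by (simp add: algebra_simps)
  also have "\<dots> \<le> (2 * c + 11) * ?B" using c(2) by (simp add: algebra_simps)
  finally show ?thesis using c(1) by (simp add: field_simps)
qed

text \<open>
  The bulk terms change by at most \<open>2 \<epsilon>\<close> times the squared \<open>H\<^sup>1\<close>-norm. Since \<open>T < 2\<close>, the boundary
  term grows at most by the factor \<open>1 + 2 \<epsilon>\<close>, and the trace inequality bounds it by three times the
  squared norm.
\<close>
lemma energy_perturbation:
  fixes f :: "real \<times> real \<Rightarrow> real"
  assumes f: "C1_annulus critical_T f fx fy"
    and cq: "continuous_on {-critical_T..critical_T} q"
    and cont: "continuous_on (strip critical_T) \<alpha>" "continuous_on (strip critical_T) \<beta>" "continuous_on (strip critical_T) \<gamma>"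
      "continuous_on (strip critical_T) \<kappa>" "continuous_on (strip critical_T) \<mu>"
    and close: "\<And>p. p \<in> rect critical_T \<Longrightarrow> \<bar>\<alpha> p - 1\<bar> \<le> \<epsilon> \<and> \<bar>\<beta> p\<bar> \<le> \<epsilon> \<and> \<bar>\<gamma> p - 1\<bar> \<le> \<epsilon> \<and> \<bar>\<kappa> p + q (fst p)\<bar> \<le> \<epsilon>"
      "\<And>\<theta>. \<bar>\<mu> (critical_T, \<theta>) - 1 / critical_T\<bar> \<le> \<epsilon>" "\<And>\<theta>. \<bar>\<mu> (- critical_T, \<theta>) - 1 / critical_T\<bar> \<le> \<epsilon>"
  shows "model_energy q f fx fy - 8 * \<epsilon> * h1_norm2 f fx fy \<le> energy critical_T \<alpha> \<beta> \<gamma> \<kappa> \<mu> f fx fy"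
proof -
  let ?T = critical_T
  have T: "?T > 1" by (rule critical_T_gt_1)
  have "?T < 2"
  proof (rule ccontr)
    assume "\<not> ?T < 2"
    then have "?T * ?T \<ge> 2 * 2" by (intro mult_mono) auto
    then show False using critical_T_square_lt_2 by (simp add: power2_eq_square)
  qed
  have \<epsilon>: "\<epsilon> \<ge> 0" using close(2)[of 0] by simp
  have hp: "has_partials ?T f fx fy" and cfx: "continuous_on (strip ?T) fx" and cfy: "continuous_on (strip ?T) fy"
    using f by (auto simp: C1_annulus_def)
  have cf: "continuous_on (strip ?T) f" by (rule has_partials_continuous[OF hp])
  have cq': "continuous_on (strip ?T) (\<lambda>p. q (fst p))"
    by (intro continuous_on_compose2[OF cq] continuous_intros) (auto simp: strip_def)
  let ?H = "\<lambda>p. (f p)\<^sup>2 + (fx p)\<^sup>2 + (fy p)\<^sup>2"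
  let ?b = "\<lambda>p. 1 * (fx p)\<^sup>2 + 2 * 0 * (fx p * fy p) + 1 * (fy p)\<^sup>2 + - q (fst p) * (f p)\<^sup>2"
  let ?e = "\<lambda>p. \<alpha> p * (fx p)\<^sup>2 + 2 * \<beta> p * (fx p * fy p) + \<gamma> p * (fy p)\<^sup>2 + \<kappa> p * (f p)\<^sup>2"
  have "integral (rect ?T) ?b - 2 * \<epsilon> * integral (rect ?T) ?H = integral (rect ?T) (\<lambda>p. ?b p - 2 * \<epsilon> * ?H p)"
    by (rule integral_unique[symmetric])
      (intro has_integral_diff has_integral_mult_right integrable_integral rect_integrable continuous_intros cf cfx cfy cq')
  also have "\<dots> \<le> integral (rect ?T) ?e"
  proof (rule integral_le)
    fix p assume p: "p \<in> rect ?T"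
    have a: "- (\<epsilon> * (fx p)\<^sup>2) \<le> (\<alpha> p - 1) * (fx p)\<^sup>2"
      using mult_right_mono[of "- \<epsilon>" "\<alpha> p - 1" "(fx p)\<^sup>2"] close(1)[OF p] by fastforce
    have g: "- (\<epsilon> * (fy p)\<^sup>2) \<le> (\<gamma> p - 1) * (fy p)\<^sup>2"
      using mult_right_mono[of "- \<epsilon>" "\<gamma> p - 1" "(fy p)\<^sup>2"] close(1)[OF p] by fastforce
    have k: "- (\<epsilon> * (f p)\<^sup>2) \<le> (\<kappa> p + q (fst p)) * (f p)\<^sup>2"
      using mult_right_mono[of "- \<epsilon>" "\<kappa> p + q (fst p)" "(f p)\<^sup>2"] close(1)[OF p] by fastforce
    have "\<bar>\<beta> p * (fx p * fy p)\<bar> \<le> \<epsilon> * \<bar>fx p * fy p\<bar>"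
      unfolding abs_mult[of "\<beta> p"] by (intro mult_right_mono) (use close(1)[OF p] in auto)
    moreover have "\<epsilon> * (2 * \<bar>fx p * fy p\<bar>) \<le> \<epsilon> * ((fx p)\<^sup>2 + (fy p)\<^sup>2)"
    proof (rule mult_left_mono[OF _ \<epsilon>])
      have "0 \<le> (\<bar>fx p\<bar> - \<bar>fy p\<bar>)\<^sup>2" by simp
      then show "2 * \<bar>fx p * fy p\<bar> \<le> (fx p)\<^sup>2 + (fy p)\<^sup>2"
        by (simp add: power2_diff abs_mult)
    qed
    ultimately have b: "- (\<epsilon> * ((fx p)\<^sup>2 + (fy p)\<^sup>2)) \<le> 2 * (\<beta> p * (fx p * fy p))" by linarith
    have "\<epsilon> * (f p)\<^sup>2 \<ge> 0" using \<epsilon> by simp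
    then show "?b p - 2 * \<epsilon> * ?H p \<le> ?e p" using a g k b by (simp add: algebra_simps)
  qed (intro rect_integrable continuous_intros cf cfx cfy cq' cont)+
  finally have bulk: "integral (rect ?T) ?b - 2 * \<epsilon> * integral (rect ?T) ?H \<le> integral (rect ?T) ?e" .
  have TT: "-?T \<le> ?T" using T by simp
  let ?m = "\<lambda>\<theta>. 1 / ?T * (f (?T, \<theta>))\<^sup>2 + 1 / ?T * (f (- ?T, \<theta>))\<^sup>2"
  have cm: "continuous_on S ?m" for S using T by (intro continuous_intros strip_slice_continuous[OF cf]) auto
  have "integral {0..2 * pi} (\<lambda>\<theta>. \<mu> (?T, \<theta>) * (f (?T, \<theta>))\<^sup>2 + \<mu> (-?T, \<theta>) * (f (-?T, \<theta>))\<^sup>2)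
      \<le> integral {0..2 * pi} (\<lambda>\<theta>. (1 + 2 * \<epsilon>) * ?m \<theta>)"
  proof (rule integral_le)
    show "(\<lambda>\<theta>. \<mu> (?T, \<theta>) * (f (?T, \<theta>))\<^sup>2 + \<mu> (-?T, \<theta>) * (f (-?T, \<theta>))\<^sup>2) integrable_on {0..2 * pi}"
      using T by (intro integrable_continuous_interval continuous_intros strip_slice_continuous(1)[OF cont(5)]
          strip_slice_continuous(1)[OF cf]) auto
    show "(\<lambda>\<theta>. (1 + 2 * \<epsilon>) * ?m \<theta>) integrable_on {0..2 * pi}"
      by (intro integrable_continuous_interval continuous_intros cm)
    fix \<theta>
    have "\<epsilon> * 1 \<le> \<epsilon> * (2 * (1 / ?T))" using \<epsilon> T \<open>?T < 2\<close> by (intro mult_left_mono) (auto simp: field_simps)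
    then have "\<mu> (?T, \<theta>) \<le> (1 + 2 * \<epsilon>) * (1 / ?T)" "\<mu> (-?T, \<theta>) \<le> (1 + 2 * \<epsilon>) * (1 / ?T)"
      using close(2)[of \<theta>] close(3)[of \<theta>] unfolding abs_le_iff distrib_right by argo+
    from this[THEN mult_right_mono, OF zero_le_power2]
    have "\<mu> (?T, \<theta>) * (f (?T, \<theta>))\<^sup>2 \<le> (1 + 2 * \<epsilon>) * (1 / ?T) * (f (?T, \<theta>))\<^sup>2"
      "\<mu> (-?T, \<theta>) * (f (-?T, \<theta>))\<^sup>2 \<le> (1 + 2 * \<epsilon>) * (1 / ?T) * (f (-?T, \<theta>))\<^sup>2"
      by blast+
    then show "\<mu> (?T, \<theta>) * (f (?T, \<theta>))\<^sup>2 + \<mu> (-?T, \<theta>) * (f (-?T, \<theta>))\<^sup>2 \<le> (1 + 2 * \<epsilon>) * ?m \<theta>"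
      unfolding distrib_left mult.assoc by (rule add_mono)
  qed
  also have "\<dots> = integral {0..2 * pi} ?m + 2 * \<epsilon> * integral {0..2 * pi} ?m"
    by (subst integral_mult_right) (simp only: distrib_right mult_1)
  also have "\<dots> \<le> integral {0..2 * pi} ?m + 2 * \<epsilon> * (3 * integral (rect ?T) ?H)"
  proof (rule add_left_mono, rule mult_left_mono)
    have "integral {0..2 * pi} ?m \<le> integral (rect ?T) (\<lambda>p. 3 * (f p)\<^sup>2 + 1 / 2 * (fx p)\<^sup>2)"
      by (rule trace_inequality[OF f])
    also have "\<dots> \<le> integral (rect ?T) (\<lambda>p. 3 * ?H p)"
    proof (rule integral_le)
      fix p
      have "(fx p)\<^sup>2 \<ge> 0" "(fy p)\<^sup>2 \<ge> 0" by auto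
      then show "3 * (f p)\<^sup>2 + 1 / 2 * (fx p)\<^sup>2 \<le> 3 * ?H p" by argo
    qed (intro rect_integrable continuous_intros cf cfx cfy)+
    finally show "integral {0..2 * pi} ?m \<le> 3 * integral (rect ?T) ?H" by (simp only: integral_mult_right)
  qed (use \<epsilon> in auto)
  finally have bdry: "integral {0..2 * pi} (\<lambda>\<theta>. \<mu> (?T, \<theta>) * (f (?T, \<theta>))\<^sup>2 + \<mu> (-?T, \<theta>) * (f (-?T, \<theta>))\<^sup>2)
      \<le> integral {0..2 * pi} ?m + 2 * \<epsilon> * (3 * integral (rect ?T) ?H)" .
  have "A - M - 8 * \<epsilon> * H \<le> B - M'" if "A - 2 * \<epsilon> * H \<le> B" "M' \<le> M + 2 * \<epsilon> * (3 * H)" for A B H M M'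
    using that by (simp add: algebra_simps)
  from this[OF bulk bdry] show ?thesis
    unfolding model_energy_def energy_def h1_norm2_def .
qed

section \<open>Calculus up to the boundary of the strip\<close>

text \<open>
  From every point of the strip, including the boundary points, small steps in both coordinate
  directions stay inside.
\<close>
lemma has_derivative_strip_unique:
  fixes f :: "real \<times> real \<Rightarrow> 'a::real_normed_vector"
  assumes T: "T > 0" and p: "p \<in> strip T"
    and "(f has_derivative D1) (at p within strip T)" "(f has_derivative D2) (at p within strip T)"
  shows "D1 = D2"
proof (rule frechet_derivative_unique_within[OF assms(3,4)])
  fix i :: "real \<times> real" and e :: real assume i: "i \<in> Basis" and e: "e > 0"
  obtain t \<theta> where pt: "p = (t, \<theta>)" "-T \<le> t" "t \<le> T" using p by (cases p) auto
  show "\<exists>d. 0 < \<bar>d\<bar> \<and> \<bar>d\<bar> < e \<and> p + d *\<^sub>R i \<in> strip T"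
  proof (cases "t \<ge> 0")
    case True
    have "- min (e / 2) T < 0" using e T by auto
    moreover have "- min (e / 2) T \<ge> - T" "min (e / 2) T < e" using e by auto
    ultimately show ?thesis using True pt i e T
      by (intro exI[of _ "- min (e / 2) T"]) (auto simp: Basis_prod_def)
  next
    case False
    have "min (e / 2) T > 0" "min (e / 2) T < e" using e T by auto
    then show ?thesis using False pt i e T
      by (intro exI[of _ "min (e / 2) T"]) (auto simp: Basis_prod_def)
  qed
qed

lemma has_partials_unique:
  fixes f :: "real \<times> real \<Rightarrow> 'a::real_normed_vector"
  assumes T: "T > 0" and f: "has_partials T f fx fy" and p: "p \<in> strip T"
  shows "d_t T f p = fx p" "d_theta T f p = fy p"
    and "frechet_derivative f (at p within strip T) = (\<lambda>h. fst h *\<^sub>R fx p + snd h *\<^sub>R fy p)"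
proof -
  have D: "(f has_derivative (\<lambda>h. fst h *\<^sub>R fx p + snd h *\<^sub>R fy p)) (at p within strip T)"
    using f p by (simp add: has_partials_def)
  then have "(f has_derivative frechet_derivative f (at p within strip T)) (at p within strip T)"
    using frechet_derivative_works differentiable_def by blast
  then show eq: "frechet_derivative f (at p within strip T) = (\<lambda>h. fst h *\<^sub>R fx p + snd h *\<^sub>R fy p)"
    using has_derivative_strip_unique[OF T p _ D] by blast
  show "d_t T f p = fx p" "d_theta T f p = fy p"
    by (simp_all add: d_t_def d_theta_def partial_def eq)
qed

lemma has_partials_eq:
  fixes f :: "real \<times> real \<Rightarrow> 'a::real_normed_vector"
  assumes T: "T > 0" and f: "has_partials T f fx fy" and g: "has_partials T g gx gy"
    and eq: "\<And>p. p \<in> strip T \<Longrightarrow> f p = g p" and p: "p \<in> strip T"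
  shows "fx p = gx p" "fy p = gy p"
proof -
  have "has_partials T g fx fy"
    unfolding has_partials_def
  proof
    fix q assume q: "q \<in> strip T"
    show "(g has_derivative (\<lambda>h. fst h *\<^sub>R fx q + snd h *\<^sub>R fy q)) (at q within strip T)"
      by (rule has_derivative_transform[OF q eq[symmetric]]) (use f q in \<open>auto simp: has_partials_def\<close>)
  qed
  from has_partials_unique[OF T this p] has_partials_unique[OF T g p]
  show "fx p = gx p" "fy p = gy p" by auto
qed

lemma has_partials_periodic:
  fixes f :: "real \<times> real \<Rightarrow> 'a::real_normed_vector"
  assumes T: "T > 0" and f: "has_partials T f fx fy"
    and per: "\<And>t \<theta>. t \<in> {-T..T} \<Longrightarrow> f (t, \<theta> + 2 * pi) = f (t, \<theta>)" and t: "t \<in> {-T..T}"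
  shows "fx (t, \<theta> + 2 * pi) = fx (t, \<theta>)" "fy (t, \<theta> + 2 * pi) = fy (t, \<theta>)"
proof -
  let ?s = "\<lambda>p. (fst p, snd p + 2 * pi) :: real \<times> real"
  have "has_partials T (\<lambda>p. f (?s p)) (\<lambda>p. fx (?s p)) (\<lambda>p. fy (?s p))"
    unfolding has_partials_def
  proof
    fix p assume p: "p \<in> strip T"
    show "((\<lambda>p. f (?s p)) has_derivative (\<lambda>h. fst h *\<^sub>R fx (?s p) + snd h *\<^sub>R fy (?s p))) (at p within strip T)"
    proof (rule has_derivative_in_compose2[where g = f and f = ?s and t = "strip T" and f' = "\<lambda>h. h"
            and g' = "\<lambda>p h. fst h *\<^sub>R fx p + snd h *\<^sub>R fy p"])
      show "(?s has_derivative (\<lambda>h. h)) (at p within strip T)"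
        by (auto intro!: derivative_eq_intros)
    qed (use f p in \<open>auto simp: has_partials_def strip_def\<close>)
  qed
  from has_partials_eq[OF T this f, of "(t, \<theta>)"]
  show "fx (t, \<theta> + 2 * pi) = fx (t, \<theta>)" "fy (t, \<theta> + 2 * pi) = fy (t, \<theta>)"
    using per t by (auto simp: strip_def)
qed

text \<open>
  Integrating \<open>f\<^sub>y\<close> in \<open>y\<close> and differentiating under the integral sign gives
  \<open>f\<^sub>x(t, y) = f\<^sub>x(t, c) + \<integral>\<^sub>c\<^sup>y f\<^sub>y\<^sub>x\<close>, up to the boundary of the strip.
\<close>
lemma mixed_partials_eq:
  fixes f :: "real \<times> real \<Rightarrow> 'a::euclidean_space"
  assumes T: "T > 0" and f: "has_partials T f fx fy"
    and fx: "has_partials T fx fxx fxy" and fy: "has_partials T fy fyx fyy"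
    and cont: "continuous_on (strip T) fyx" and p: "p \<in> strip T"
  shows "fxy p = fyx p"
proof -
  obtain t \<theta> where pt: "p = (t, \<theta>)" and t: "t \<in> {-T..T}" using p by (cases p) auto
  define c where "c = \<theta> - 1"
  have cfy: "continuous_on (strip T) fy" by (rule has_partials_continuous[OF fy])
  have int: "fx (t, y) = fx (t, c) + integral {c..y} (\<lambda>s. fyx (t, s))" if y: "y \<ge> c" for y
  proof -
    have I: "f (s, y) = f (s, c) + integral {c..y} (\<lambda>r. fy (s, r))" if s: "s \<in> {-T..T}" for s
    proof -
      have "((\<lambda>r. fy (s, r)) has_integral f (s, y) - f (s, c)) {c..y}"
        by (rule fundamental_theorem_of_calculus[OF y])
          (auto intro: has_vector_derivative_at_within has_partials_theta[OF f s])
      then show ?thesis by (simp add: integral_unique)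
    qed
    have "((\<lambda>s. integral (cbox c y) (\<lambda>r. fy (s, r))) has_vector_derivative integral (cbox c y) (\<lambda>r. fyx (t, r)))
        (at t within {-T..T})"
    proof (rule leibniz_rule_vector_derivative)
      fix s r assume "s \<in> {-T..T}"
      then show "((\<lambda>s. fy (s, r)) has_vector_derivative fyx (s, r)) (at s within {-T..T})"
        by (rule has_partials_t[OF fy])
    next
      fix s assume "s \<in> {-T..T}"
      then show "(\<lambda>r. fy (s, r)) integrable_on cbox c y"
        by (auto intro!: integrable_continuous_interval strip_slice_continuous[OF cfy])
    next
      show "continuous_on ({-T..T} \<times> cbox c y) (\<lambda>(s, r). fyx (s, r))"
        by (auto intro!: continuous_on_subset[OF cont] simp: strip_def)
    qed (use t in auto)
    then have "((\<lambda>s. f (s, c) + integral {c..y} (\<lambda>r. fy (s, r))) has_vector_derivative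
        fx (t, c) + integral {c..y} (\<lambda>r. fyx (t, r))) (at t within {-T..T})"
      by (intro has_vector_derivative_add has_partials_t[OF f t]) simp
    then have "((\<lambda>s. f (s, y)) has_vector_derivative fx (t, c) + integral {c..y} (\<lambda>r. fyx (t, r))) (at t within {-T..T})"
      by (rule has_vector_derivative_transform[OF t, rotated]) (rule I)
    then show ?thesis
      using has_partials_t[OF f t, of y] T t
        vector_derivative_unique_within_closed_interval[of "-T" T t "\<lambda>s. f (s, y)"] by auto
  qed
  have "((\<lambda>y. integral {c..y} (\<lambda>s. fyx (t, s))) has_vector_derivative fyx (t, \<theta>)) (at \<theta> within {c..\<theta> + 1})"
    by (rule integral_has_vector_derivative) (use t in \<open>auto simp: c_def intro!: strip_slice_continuous[OF cont]\<close>)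
  then have "((\<lambda>y. fx (t, c) + integral {c..y} (\<lambda>s. fyx (t, s))) has_vector_derivative 0 + fyx (t, \<theta>)) (at \<theta> within {c..\<theta> + 1})"
    by (intro has_vector_derivative_add) auto
  then have "((\<lambda>y. fx (t, c) + integral {c..y} (\<lambda>s. fyx (t, s))) has_vector_derivative fyx (t, \<theta>)) (at \<theta> within {c..\<theta> + 1})"
    by simp
  then have "((\<lambda>y. fx (t, y)) has_vector_derivative fyx (t, \<theta>)) (at \<theta> within {c..\<theta> + 1})"
  proof (rule has_vector_derivative_transform[rotated 2])
    show "fx (t, y) = fx (t, c) + integral {c..y} (\<lambda>s. fyx (t, s))" if "y \<in> {c..\<theta> + 1}" for y
      by (rule int) (use that in simp)
  qed (simp add: c_def)
  moreover have "((\<lambda>y. fx (t, y)) has_vector_derivative fxy (t, \<theta>)) (at \<theta> within {c..\<theta> + 1})"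
    by (rule has_vector_derivative_at_within[OF has_partials_theta[OF fx t]])
  ultimately show ?thesis unfolding pt
    by (intro vector_derivative_unique_within_closed_interval[of c "\<theta> + 1" \<theta> "\<lambda>y. fx (t, y)"])
      (auto simp: c_def)
qed

definition is_C1 :: "real \<Rightarrow> (real \<times> real \<Rightarrow> 'a::real_normed_vector) \<Rightarrow> bool" where
  "is_C1 T f \<longleftrightarrow> (\<exists>fx fy. has_partials T f fx fy \<and> continuous_on (strip T) fx \<and> continuous_on (strip T) fy)"

lemma is_C1_partials:
  assumes T: "T > 0" and f: "is_C1 T f"
  shows "has_partials T f (d_t T f) (d_theta T f)"
    and "continuous_on (strip T) (d_t T f)" "continuous_on (strip T) (d_theta T f)"
proof -
  obtain fx fy where h: "has_partials T f fx fy" "continuous_on (strip T) fx" "continuous_on (strip T) fy"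
    using f by (auto simp: is_C1_def)
  note e = has_partials_unique[OF T h(1)]
  show "has_partials T f (d_t T f) (d_theta T f)" using h(1) by (simp add: has_partials_def e)
  show "continuous_on (strip T) (d_t T f)" "continuous_on (strip T) (d_theta T f)"
    using h(2,3) by (simp_all add: e cong: continuous_on_cong)
qed

lemma is_C1_I:
  "has_partials T f fx fy \<Longrightarrow> continuous_on (strip T) fx \<Longrightarrow> continuous_on (strip T) fy \<Longrightarrow> is_C1 T f"
  by (auto simp: is_C1_def)

lemma is_C1_continuous: "is_C1 T f \<Longrightarrow> continuous_on (strip T) f"
  by (auto simp: is_C1_def intro: has_partials_continuous)

lemma has_partials_bilinear:
  assumes "bounded_bilinear B" and f: "has_partials T f fx fy" and g: "has_partials T g gx gy"
  shows "has_partials T (\<lambda>p. B (f p) (g p)) (\<lambda>p. B (f p) (gx p) + B (fx p) (g p)) (\<lambda>p. B (f p) (gy p) + B (fy p) (g p))"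
  unfolding has_partials_def
proof
  interpret bounded_bilinear B by fact
  fix p assume "p \<in> strip T"
  with f g have d: "(f has_derivative (\<lambda>h. fst h *\<^sub>R fx p + snd h *\<^sub>R fy p)) (at p within strip T)"
    "(g has_derivative (\<lambda>h. fst h *\<^sub>R gx p + snd h *\<^sub>R gy p)) (at p within strip T)"
    by (auto simp: has_partials_def)
  show "((\<lambda>p. B (f p) (g p)) has_derivative (\<lambda>h. fst h *\<^sub>R (B (f p) (gx p) + B (fx p) (g p)) +
      snd h *\<^sub>R (B (f p) (gy p) + B (fy p) (g p)))) (at p within strip T)"
    using FDERIV[OF d] by (simp add: add_left add_right scaleR_left scaleR_right algebra_simps)
qed

lemmas has_partials_inner = has_partials_bilinear[OF bounded_bilinear_inner]
lemmas has_partials_mult = has_partials_bilinear[OF bounded_bilinear_mult]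
lemmas has_partials_scaleR = has_partials_bilinear[OF bounded_bilinear_scaleR]

lemma has_partials_add:
  "has_partials T f fx fy \<Longrightarrow> has_partials T g gx gy \<Longrightarrow> has_partials T (\<lambda>p. f p + g p) (\<lambda>p. fx p + gx p) (\<lambda>p. fy p + gy p)"
  unfolding has_partials_def by (auto intro!: derivative_eq_intros simp: algebra_simps)

lemma has_partials_diff:
  "has_partials T f fx fy \<Longrightarrow> has_partials T g gx gy \<Longrightarrow> has_partials T (\<lambda>p. f p - g p) (\<lambda>p. fx p - gx p) (\<lambda>p. fy p - gy p)"
  unfolding has_partials_def by (auto intro!: derivative_eq_intros simp: algebra_simps)

lemma has_partials_const: "has_partials T (\<lambda>p. k) (\<lambda>p. 0) (\<lambda>p. 0)"
  unfolding has_partials_def by auto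

lemma has_partials_linear:
  assumes "bounded_linear L" "has_partials T f fx fy"
  shows "has_partials T (\<lambda>p. L (f p)) (\<lambda>p. L (fx p)) (\<lambda>p. L (fy p))"
  unfolding has_partials_def
proof
  interpret bounded_linear L by fact
  fix p assume "p \<in> strip T"
  then have "(f has_derivative (\<lambda>h. fst h *\<^sub>R fx p + snd h *\<^sub>R fy p)) (at p within strip T)"
    using assms(2) by (simp add: has_partials_def)
  from has_derivative[OF this]
  show "((\<lambda>p. L (f p)) has_derivative (\<lambda>h. fst h *\<^sub>R L (fx p) + snd h *\<^sub>R L (fy p))) (at p within strip T)"
    by (simp add: add scaleR)
qed

lemma has_partials_real_compose:
  assumes g: "\<And>p. p \<in> strip T \<Longrightarrow> (g has_real_derivative g' (f p)) (at (f p))"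
    and f: "has_partials T f fx fy"
  shows "has_partials T (\<lambda>p. g (f p)) (\<lambda>p. g' (f p) * fx p) (\<lambda>p. g' (f p) * fy p)"
  unfolding has_partials_def
proof
  fix p assume p: "p \<in> strip T"
  then have d: "(f has_derivative (\<lambda>h. fst h *\<^sub>R fx p + snd h *\<^sub>R fy p)) (at p within strip T)"
    using f by (simp add: has_partials_def)
  have "(g has_derivative (\<lambda>h. g' (f p) * h)) (at (f p))"
    using g[OF p] by (simp add: has_field_derivative_def)
  from has_derivative_compose[OF d this]
  show "((\<lambda>p. g (f p)) has_derivative (\<lambda>h. fst h *\<^sub>R (g' (f p) * fx p) + snd h *\<^sub>R (g' (f p) * fy p))) (at p within strip T)"
    by (simp add: algebra_simps)
qed

lemma is_C1_bilinear:
  assumes b: "bounded_bilinear B" and f: "is_C1 T f" and g: "is_C1 T g"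
  shows "is_C1 T (\<lambda>p. B (f p) (g p))"
proof -
  obtain fx fy gx gy where h: "has_partials T f fx fy" "has_partials T g gx gy" and
    c: "continuous_on (strip T) fx" "continuous_on (strip T) fy" "continuous_on (strip T) gx" "continuous_on (strip T) gy"
    using f g by (auto simp: is_C1_def)
  show ?thesis
    by (rule is_C1_I[OF has_partials_bilinear[OF b h]])
      (intro continuous_on_add bounded_bilinear.continuous_on[OF b] c has_partials_continuous[OF h(1)] has_partials_continuous[OF h(2)])+
qed

lemmas is_C1_inner = is_C1_bilinear[OF bounded_bilinear_inner]
lemmas is_C1_mult = is_C1_bilinear[OF bounded_bilinear_mult]
lemmas is_C1_scaleR = is_C1_bilinear[OF bounded_bilinear_scaleR]

lemma is_C1_const: "is_C1 T (\<lambda>p. k)"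
  by (rule is_C1_I[OF has_partials_const]) auto

lemma is_C1_add:
  assumes f: "is_C1 T f" and g: "is_C1 T g"
  shows "is_C1 T (\<lambda>p. f p + g p)"
proof -
  obtain fx fy gx gy where h: "has_partials T f fx fy" "has_partials T g gx gy" and
    c: "continuous_on (strip T) fx" "continuous_on (strip T) fy" "continuous_on (strip T) gx" "continuous_on (strip T) gy"
    using f g by (auto simp: is_C1_def)
  show ?thesis by (rule is_C1_I[OF has_partials_add[OF h]]) (intro continuous_intros c)+
qed

lemma is_C1_diff:
  assumes f: "is_C1 T f" and g: "is_C1 T g"
  shows "is_C1 T (\<lambda>p. f p - g p)"
proof -
  obtain fx fy gx gy where h: "has_partials T f fx fy" "has_partials T g gx gy" and
    c: "continuous_on (strip T) fx" "continuous_on (strip T) fy" "continuous_on (strip T) gx" "continuous_on (strip T) gy"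
    using f g by (auto simp: is_C1_def)
  show ?thesis by (rule is_C1_I[OF has_partials_diff[OF h]]) (intro continuous_intros c)+
qed

lemma is_C1_real_compose:
  assumes g: "\<And>p. p \<in> strip T \<Longrightarrow> (g has_real_derivative g' (f p)) (at (f p))"
    and g': "continuous_on (strip T) (\<lambda>p. g' (f p))" and f: "is_C1 T f"
  shows "is_C1 T (\<lambda>p. g (f p))"
proof -
  obtain fx fy where h: "has_partials T f fx fy" and c: "continuous_on (strip T) fx" "continuous_on (strip T) fy"
    using f by (auto simp: is_C1_def)
  show ?thesis
    by (rule is_C1_I[OF has_partials_real_compose[OF g h]]) (auto intro!: continuous_intros g' c)
qed

lemma is_C1_divide:
  fixes f g :: "real \<times> real \<Rightarrow> real"
  assumes f: "is_C1 T f" and g: "is_C1 T g" and nz: "\<And>p. p \<in> strip T \<Longrightarrow> g p \<noteq> 0"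
  shows "is_C1 T (\<lambda>p. f p / g p)"
proof -
  have "is_C1 T (\<lambda>p. inverse (g p))"
  proof (rule is_C1_real_compose[OF _ _ g, where g' = "\<lambda>x. - (inverse x ^ Suc (Suc 0))"])
    show "(inverse has_real_derivative - (inverse (g p) ^ Suc (Suc 0))) (at (g p))" if "p \<in> strip T" for p
      by (rule DERIV_inverse[OF nz[OF that]])
  qed (use nz in \<open>auto intro!: continuous_intros is_C1_continuous[OF g]\<close>)
  from is_C1_mult[OF f this] show ?thesis by (simp add: divide_inverse)
qed

lemma is_C1_sqrt:
  fixes f :: "real \<times> real \<Rightarrow> real"
  assumes f: "is_C1 T f" and pos: "\<And>p. p \<in> strip T \<Longrightarrow> f p > 0"
  shows "is_C1 T (\<lambda>p. sqrt (f p))"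
  by (rule is_C1_real_compose[OF _ _ f, where g' = "\<lambda>x. inverse (sqrt x) / 2"])
    (use pos in \<open>auto intro!: DERIV_real_sqrt continuous_intros is_C1_continuous[OF f] simp: less_imp_neq[symmetric]\<close>)

text \<open>
  The contributions of the lines \<open>\<theta> = 0\<close> and \<open>\<theta> = 2 \<pi>\<close> cancel by periodicity.
\<close>
lemma divergence_theorem:
  fixes P Q \<psi> :: "real \<times> real \<Rightarrow> real"
  assumes T: "T > 0" and P: "is_C1 T P" and Q: "is_C1 T Q" and \<psi>: "C1_annulus T \<psi> \<psi>x \<psi>y"
    and perQ: "\<And>t \<theta>. t \<in> {-T..T} \<Longrightarrow> Q (t, \<theta> + 2 * pi) = Q (t, \<theta>)"
  shows "integral (rect T) (\<lambda>p. P p * \<psi>x p + Q p * \<psi>y p) =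
    integral {0..2 * pi} (\<lambda>\<theta>. P (T, \<theta>) * \<psi> (T, \<theta>) - P (-T, \<theta>) * \<psi> (-T, \<theta>))
    - integral (rect T) (\<lambda>p. (d_t T P p + d_theta T Q p) * \<psi> p)"
proof -
  have h\<psi>: "has_partials T \<psi> \<psi>x \<psi>y" and c\<psi>: "continuous_on (strip T) \<psi>x" "continuous_on (strip T) \<psi>y"
    and per: "\<And>t \<theta>. t \<in> {-T..T} \<Longrightarrow> \<psi> (t, \<theta> + 2 * pi) = \<psi> (t, \<theta>)"
    using \<psi> by (auto simp: C1_annulus_def)
  note hP = is_C1_partials[OF T P] and hQ = is_C1_partials[OF T Q]
  note c = c\<psi> hP(2,3) hQ(2,3) is_C1_continuous[OF P] is_C1_continuous[OF Q] has_partials_continuous[OF h\<psi>]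
  have p1: "has_partials T (\<lambda>p. P p * \<psi> p) (\<lambda>p. P p * \<psi>x p + d_t T P p * \<psi> p) (\<lambda>p. P p * \<psi>y p + d_theta T P p * \<psi> p)"
    and p2: "has_partials T (\<lambda>p. Q p * \<psi> p) (\<lambda>p. Q p * \<psi>x p + d_t T Q p * \<psi> p) (\<lambda>p. Q p * \<psi>y p + d_theta T Q p * \<psi> p)"
    by (rule has_partials_mult[OF hP(1) h\<psi>] has_partials_mult[OF hQ(1) h\<psi>])+
  let ?g = "\<lambda>p. P p * \<psi>x p + d_t T P p * \<psi> p" and ?h = "\<lambda>p. Q p * \<psi>y p + d_theta T Q p * \<psi> p"
  have cg: "continuous_on (strip T) ?g" and ch: "continuous_on (strip T) ?h" by (intro continuous_intros c)+
  have "integral (rect T) ?g = integral {0..2 * pi} (\<lambda>\<theta>. P (T, \<theta>) * \<psi> (T, \<theta>) - P (-T, \<theta>) * \<psi> (-T, \<theta>))"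
    unfolding rect_integral_iterated(2)[OF cg]
  proof (rule integral_cong, rule integral_unique, rule fundamental_theorem_of_calculus)
    fix \<theta> t assume "t \<in> {-T..T}"
    then show "((\<lambda>t. P (t, \<theta>) * \<psi> (t, \<theta>)) has_vector_derivative ?g (t, \<theta>)) (at t within {-T..T})"
      by (rule has_partials_t[OF p1])
  qed (use T in auto)
  moreover have "integral (rect T) ?h = integral {-T..T} (\<lambda>t. 0)"
    unfolding rect_integral_iterated(1)[OF ch]
  proof (rule integral_cong)
    fix t assume t: "t \<in> {-T..T}"
    have "((\<lambda>\<theta>. ?h (t, \<theta>)) has_integral Q (t, 2 * pi) * \<psi> (t, 2 * pi) - Q (t, 0) * \<psi> (t, 0)) {0..2 * pi}"
      by (rule fundamental_theorem_of_calculus)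
        (auto intro!: has_vector_derivative_at_within has_partials_theta[OF p2 t])
    moreover have "Q (t, 2 * pi) * \<psi> (t, 2 * pi) = Q (t, 0) * \<psi> (t, 0)"
      using perQ[OF t, of 0] per[OF t, of 0] by simp
    ultimately show "integral {0..2 * pi} (\<lambda>\<theta>. ?h (t, \<theta>)) = 0" by (simp add: integral_unique)
  qed
  ultimately have "integral (rect T) ?g + integral (rect T) ?h =
      integral {0..2 * pi} (\<lambda>\<theta>. P (T, \<theta>) * \<psi> (T, \<theta>) - P (-T, \<theta>) * \<psi> (-T, \<theta>))" by simp
  moreover have "integral (rect T) ?g + integral (rect T) ?h =
      integral (rect T) (\<lambda>p. P p * \<psi>x p + Q p * \<psi>y p) + integral (rect T) (\<lambda>p. (d_t T P p + d_theta T Q p) * \<psi> p)"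
  proof -
    have 1: "integral (rect T) ?g + integral (rect T) ?h = integral (rect T) (\<lambda>p. ?g p + ?h p)"
      by (rule integral_add[symmetric]) (intro rect_integrable continuous_intros c)+
    have 2: "integral (rect T) (\<lambda>p. P p * \<psi>x p + Q p * \<psi>y p) + integral (rect T) (\<lambda>p. (d_t T P p + d_theta T Q p) * \<psi> p)
        = integral (rect T) (\<lambda>p. (P p * \<psi>x p + Q p * \<psi>y p) + (d_t T P p + d_theta T Q p) * \<psi> p)"
      by (rule integral_add[symmetric]) (intro rect_integrable continuous_intros c)+
    show ?thesis unfolding 1 2 by (rule integral_cong) (simp add: algebra_simps)
  qed
  ultimately show ?thesis by simp
qed

lemma C1_annulus_add:
  "C1_annulus T f fx fy \<Longrightarrow> C1_annulus T g gx gy \<Longrightarrow>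
    C1_annulus T (\<lambda>p. f p + g p) (\<lambda>p. fx p + gx p) (\<lambda>p. fy p + gy p)"
  unfolding C1_annulus_def by (simp add: has_partials_add continuous_on_add)

text \<open>
  The pair \<open>(P, Q)\<close> is the flux of \<open>\<phi>\<close>; the hypotheses say that \<open>\<phi>\<close> solves the Euler-Lagrange
  equation of the energy with its natural boundary condition, so \<open>\<phi>\<close> lies in the kernel of the
  associated bilinear form.
\<close>
lemma energy_add_null:
  fixes \<phi> \<psi> :: "real \<times> real \<Rightarrow> real"
  assumes T: "T > 0" and \<phi>: "C1_annulus T \<phi> \<phi>x \<phi>y" and \<psi>: "C1_annulus T \<psi> \<psi>x \<psi>y"
    and cont: "continuous_on (strip T) \<alpha>" "continuous_on (strip T) \<beta>" "continuous_on (strip T) \<gamma>"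
      "continuous_on (strip T) \<kappa>" "continuous_on (strip T) \<mu>"
    and P: "is_C1 T P" and Q: "is_C1 T Q"
    and perQ: "\<And>t \<theta>. t \<in> {-T..T} \<Longrightarrow> Q (t, \<theta> + 2 * pi) = Q (t, \<theta>)"
    and Peq: "\<And>p. p \<in> strip T \<Longrightarrow> P p = \<alpha> p * \<phi>x p + \<beta> p * \<phi>y p"
    and Qeq: "\<And>p. p \<in> strip T \<Longrightarrow> Q p = \<beta> p * \<phi>x p + \<gamma> p * \<phi>y p"
    and eq: "\<And>p. p \<in> strip T \<Longrightarrow> d_t T P p + d_theta T Q p = \<kappa> p * \<phi> p"
    and bdry: "\<And>\<theta>. P (T, \<theta>) = \<mu> (T, \<theta>) * \<phi> (T, \<theta>)" "\<And>\<theta>. P (-T, \<theta>) = - \<mu> (-T, \<theta>) * \<phi> (-T, \<theta>)"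
  shows "energy T \<alpha> \<beta> \<gamma> \<kappa> \<mu> (\<lambda>p. \<phi> p + \<psi> p) (\<lambda>p. \<phi>x p + \<psi>x p) (\<lambda>p. \<phi>y p + \<psi>y p)
      = energy T \<alpha> \<beta> \<gamma> \<kappa> \<mu> \<psi> \<psi>x \<psi>y"
proof -
  have TI: "T \<in> {-T..T}" "-T \<in> {-T..T}" using T by auto
  have null: "integral (rect T) (\<lambda>p. P p * \<eta>x p + Q p * \<eta>y p + \<kappa> p * \<phi> p * \<eta> p) =
      integral {0..2 * pi} (\<lambda>\<theta>. \<mu> (T, \<theta>) * \<phi> (T, \<theta>) * \<eta> (T, \<theta>) + \<mu> (-T, \<theta>) * \<phi> (-T, \<theta>) * \<eta> (-T, \<theta>))"
    if \<eta>: "C1_annulus T \<eta> \<eta>x \<eta>y" for \<eta> \<eta>x \<eta>y :: "real \<times> real \<Rightarrow> real"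
  proof -
    have c: "continuous_on (strip T) \<eta>x" "continuous_on (strip T) \<eta>y" "continuous_on (strip T) \<eta>" "continuous_on (strip T) \<phi>"
      using \<eta> \<phi> by (auto simp: C1_annulus_def intro: has_partials_continuous)
    have "integral (rect T) (\<lambda>p. P p * \<eta>x p + Q p * \<eta>y p) + integral (rect T) (\<lambda>p. \<kappa> p * \<phi> p * \<eta> p)
        = integral (rect T) (\<lambda>p. P p * \<eta>x p + Q p * \<eta>y p + \<kappa> p * \<phi> p * \<eta> p)"
      by (rule integral_add[symmetric])
        (intro rect_integrable continuous_intros c cont is_C1_continuous[OF P] is_C1_continuous[OF Q])+
    moreover have "integral (rect T) (\<lambda>p. (d_t T P p + d_theta T Q p) * \<eta> p) = integral (rect T) (\<lambda>p. \<kappa> p * \<phi> p * \<eta> p)"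
      by (rule integral_cong) (use eq rect_subset_strip[of T] in auto)
    ultimately show ?thesis
      using divergence_theorem[OF T P Q \<eta> perQ] by (simp add: bdry)
  qed
  have c: "continuous_on (strip T) \<phi>x" "continuous_on (strip T) \<phi>y" "continuous_on (strip T) \<phi>"
    "continuous_on (strip T) \<psi>x" "continuous_on (strip T) \<psi>y" "continuous_on (strip T) \<psi>"
    using \<psi> \<phi> by (auto simp: C1_annulus_def intro: has_partials_continuous)
  note c1 = strip_slice_continuous(1)[OF c(3)] strip_slice_continuous(1)[OF c(6)] strip_slice_continuous(1)[OF cont(5)]
  let ?B = "\<lambda>f fx fy p. \<alpha> p * (fx p)\<^sup>2 + 2 * \<beta> p * (fx p * fy p) + \<gamma> p * (fy p)\<^sup>2 + \<kappa> p * (f p)\<^sup>2"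
  let ?m = "\<lambda>f \<theta>. \<mu> (T, \<theta>) * (f (T, \<theta>))\<^sup>2 + \<mu> (-T, \<theta>) * (f (-T, \<theta>))\<^sup>2"
  let ?\<eta> = "\<lambda>p. \<phi> p + (\<psi> p + \<psi> p)" and ?\<eta>x = "\<lambda>p. \<phi>x p + (\<psi>x p + \<psi>x p)" and ?\<eta>y = "\<lambda>p. \<phi>y p + (\<psi>y p + \<psi>y p)"
  have \<eta>: "C1_annulus T ?\<eta> ?\<eta>x ?\<eta>y" by (intro C1_annulus_add \<phi> \<psi>)
  have "integral (rect T) (?B (\<lambda>p. \<phi> p + \<psi> p) (\<lambda>p. \<phi>x p + \<psi>x p) (\<lambda>p. \<phi>y p + \<psi>y p))
      = integral (rect T) (\<lambda>p. P p * ?\<eta>x p + Q p * ?\<eta>y p + \<kappa> p * \<phi> p * ?\<eta> p + ?B \<psi> \<psi>x \<psi>y p)"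
    by (rule integral_cong) (use Peq Qeq rect_subset_strip[of T] in \<open>auto simp: power2_eq_square algebra_simps\<close>)
  also have "\<dots> = integral (rect T) (\<lambda>p. P p * ?\<eta>x p + Q p * ?\<eta>y p + \<kappa> p * \<phi> p * ?\<eta> p) + integral (rect T) (?B \<psi> \<psi>x \<psi>y)"
    by (rule integral_add)
      (intro rect_integrable continuous_intros c cont is_C1_continuous[OF P] is_C1_continuous[OF Q])+
  finally have 1: "integral (rect T) (?B (\<lambda>p. \<phi> p + \<psi> p) (\<lambda>p. \<phi>x p + \<psi>x p) (\<lambda>p. \<phi>y p + \<psi>y p))
      = integral {0..2 * pi} (\<lambda>\<theta>. \<mu> (T, \<theta>) * \<phi> (T, \<theta>) * ?\<eta> (T, \<theta>) + \<mu> (-T, \<theta>) * \<phi> (-T, \<theta>) * ?\<eta> (-T, \<theta>))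
        + integral (rect T) (?B \<psi> \<psi>x \<psi>y)"
    unfolding null[OF \<eta>] .
  have "integral {0..2 * pi} (?m (\<lambda>p. \<phi> p + \<psi> p))
      = integral {0..2 * pi} (\<lambda>\<theta>. (\<mu> (T, \<theta>) * \<phi> (T, \<theta>) * ?\<eta> (T, \<theta>) + \<mu> (-T, \<theta>) * \<phi> (-T, \<theta>) * ?\<eta> (-T, \<theta>)) + ?m \<psi> \<theta>)"
    by (rule integral_cong) (simp add: power2_eq_square algebra_simps)
  also have "\<dots> = integral {0..2 * pi} (\<lambda>\<theta>. \<mu> (T, \<theta>) * \<phi> (T, \<theta>) * ?\<eta> (T, \<theta>) + \<mu> (-T, \<theta>) * \<phi> (-T, \<theta>) * ?\<eta> (-T, \<theta>))
      + integral {0..2 * pi} (?m \<psi>)"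
    by (rule integral_add) (intro integrable_continuous_interval continuous_intros c1 TI)+
  finally show ?thesis unfolding energy_def 1 by simp
qed

section \<open>Free boundary minimal surfaces and the Steklov form\<close>

definition area_density :: "'a::real_inner \<Rightarrow> 'a \<Rightarrow> real" where
  "area_density x y = sqrt ((x \<bullet> x) * (y \<bullet> y) - (x \<bullet> y)\<^sup>2)"

text \<open>
  The lift of a free boundary minimal immersion, with its first and second derivatives as
  parameters, so that isometric images are again instances. The condition \<open>minimal\<close> says that the
  numerator of the mean curvature vector is tangential; the condition \<open>conormal\<close> says that the
  outward unit conormal on the boundary is the position vector.
\<close>
locale free_boundary_surface =
  fixes T :: real and u X Y Xx Xy Yy :: "real \<times> real \<Rightarrow> 'a::euclidean_space"
  assumes T_pos: "T > 0"
    and u: "has_partials T u X Y"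
    and X: "has_partials T X Xx Xy"
    and Y: "has_partials T Y Xy Yy"
    and second_C1: "is_C1 T Xx" "is_C1 T Xy" "is_C1 T Yy"
    and periodic: "\<And>t \<theta>. t \<in> {-T..T} \<Longrightarrow> u (t, \<theta> + 2 * pi) = u (t, \<theta>)"
    and regular: "\<And>p. p \<in> strip T \<Longrightarrow> (X p \<bullet> X p) * (Y p \<bullet> Y p) - (X p \<bullet> Y p)\<^sup>2 > 0"
    and minimal: "\<And>p. p \<in> strip T \<Longrightarrow>
      (Y p \<bullet> Y p) *\<^sub>R Xx p - (2 * (X p \<bullet> Y p)) *\<^sub>R Xy p + (X p \<bullet> X p) *\<^sub>R Yy p \<in> span {X p, Y p}"
    and conormal: "\<And>s \<theta>. s \<in> {1, -1} \<Longrightarrow>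
      (Y (s * T, \<theta>) \<bullet> Y (s * T, \<theta>)) *\<^sub>R X (s * T, \<theta>) - (X (s * T, \<theta>) \<bullet> Y (s * T, \<theta>)) *\<^sub>R Y (s * T, \<theta>)
        = (s * area_density (X (s * T, \<theta>)) (Y (s * T, \<theta>)) * norm (Y (s * T, \<theta>))) *\<^sub>R u (s * T, \<theta>)"
    and sphere: "\<And>p. p \<in> strip T \<Longrightarrow> norm (u p) \<le> 1"
      "\<And>p. p \<in> strip T \<Longrightarrow> norm (u p) = 1 \<longleftrightarrow> \<bar>fst p\<bar> = T"
begin

definition W :: "real \<times> real \<Rightarrow> real" where "W p = area_density (X p) (Y p)"

text \<open>
  The functions \<open>a\<close>, \<open>b\<close>, \<open>c\<close> are the entries of the area density times the inverse metric, and \<open>P\<close>,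
  \<open>Q\<close> the components of the flux of \<open>u\<close>, that is, of its gradient times the area density.
\<close>
definition a :: "real \<times> real \<Rightarrow> real" where "a p = (Y p \<bullet> Y p) / W p"

definition b :: "real \<times> real \<Rightarrow> real" where "b p = - (X p \<bullet> Y p) / W p"

definition c :: "real \<times> real \<Rightarrow> real" where "c p = (X p \<bullet> X p) / W p"

definition P :: "real \<times> real \<Rightarrow> 'a" where "P p = a p *\<^sub>R X p + b p *\<^sub>R Y p"

definition Q :: "real \<times> real \<Rightarrow> 'a" where "Q p = b p *\<^sub>R X p + c p *\<^sub>R Y p"

lemma W_pos: "p \<in> strip T \<Longrightarrow> W p > 0"
  using regular by (simp add: W_def area_density_def)

lemma W_square: "p \<in> strip T \<Longrightarrow> W p * W p = (X p \<bullet> X p) * (Y p \<bullet> Y p) - (X p \<bullet> Y p) * (X p \<bullet> Y p)"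
  using regular[of p] by (simp add: W_def area_density_def power2_eq_square)

lemma XY_C1: "is_C1 T u" "is_C1 T X" "is_C1 T Y"
  using is_C1_I[OF X is_C1_continuous is_C1_continuous] is_C1_I[OF Y is_C1_continuous is_C1_continuous]
    is_C1_I[OF u has_partials_continuous[OF X] has_partials_continuous[OF Y]] second_C1 by auto

lemma W_C1: "is_C1 T W"
  unfolding W_def[abs_def] area_density_def power2_eq_square
  by (intro is_C1_sqrt is_C1_diff is_C1_mult is_C1_inner XY_C1) (use regular in \<open>simp add: power2_eq_square\<close>)

lemma abc_C1: "is_C1 T a" "is_C1 T b" "is_C1 T c"
proof -
  have nz: "W p \<noteq> 0" if "p \<in> strip T" for p using W_pos[OF that] by simp
  have "is_C1 T (\<lambda>p. (0 - X p \<bullet> Y p) / W p)"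
    by (intro is_C1_divide W_C1 is_C1_inner XY_C1 nz is_C1_diff is_C1_const)
  then show "is_C1 T b" by (simp add: b_def[abs_def])
  show "is_C1 T a"
    unfolding a_def[abs_def] by (intro is_C1_divide W_C1 is_C1_inner XY_C1 nz)
  show "is_C1 T c"
    unfolding c_def[abs_def] by (intro is_C1_divide W_C1 is_C1_inner XY_C1 nz)
qed

lemma PQ_C1: "is_C1 T P" "is_C1 T Q"
  unfolding P_def[abs_def] Q_def[abs_def] by (intro is_C1_add is_C1_scaleR abc_C1 XY_C1)+

lemma XY_periodic:
  assumes t: "t \<in> {-T..T}"
  shows "X (t, \<theta> + 2 * pi) = X (t, \<theta>)" "Y (t, \<theta> + 2 * pi) = Y (t, \<theta>)"
  using has_partials_periodic[OF T_pos u periodic t] by auto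

lemma PQ_periodic:
  assumes t: "t \<in> {-T..T}"
  shows "P (t, \<theta> + 2 * pi) = P (t, \<theta>)" "Q (t, \<theta> + 2 * pi) = Q (t, \<theta>)"
  by (simp_all add: P_def Q_def a_def b_def c_def W_def XY_periodic[OF t])

lemma flux_products:
  assumes p: "p \<in> strip T"
  shows "P p \<bullet> X p = W p" "P p \<bullet> Y p = 0" "Q p \<bullet> X p = 0" "Q p \<bullet> Y p = W p"
proof -
  have W: "W p \<noteq> 0" using W_pos[OF p] by simp
  show "P p \<bullet> X p = W p" "Q p \<bullet> Y p = W p"
    using W W_square[OF p] by (simp_all add: P_def Q_def a_def b_def c_def inner_add_left inner_add_right inner_diff_left inner_diff_right inner_commute field_simps)
  show "P p \<bullet> Y p = 0" "Q p \<bullet> X p = 0"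
    using W by (simp_all add: P_def Q_def a_def b_def c_def inner_add_left inner_add_right inner_diff_left inner_diff_right inner_commute field_simps)
qed

lemma W_partials:
  assumes p: "p \<in> strip T"
  shows "W p * d_t T W p = (Y p \<bullet> Y p) * (X p \<bullet> Xx p) + (X p \<bullet> X p) * (Y p \<bullet> Xy p) - (X p \<bullet> Y p) * (Xx p \<bullet> Y p + X p \<bullet> Xy p)"
    and "W p * d_theta T W p = (Y p \<bullet> Y p) * (X p \<bullet> Xy p) + (X p \<bullet> X p) * (Y p \<bullet> Yy p) - (X p \<bullet> Y p) * (Xy p \<bullet> Y p + X p \<bullet> Yy p)"
proof -
  note hW = is_C1_partials(1)[OF T_pos W_C1]
  note h = has_partials_diff[OF has_partials_mult[OF has_partials_inner[OF X X] has_partials_inner[OF Y Y]]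
      has_partials_mult[OF has_partials_inner[OF X Y] has_partials_inner[OF X Y]]]
  note e = has_partials_eq[OF T_pos has_partials_mult[OF hW hW] h W_square p]
  show "W p * d_t T W p = (Y p \<bullet> Y p) * (X p \<bullet> Xx p) + (X p \<bullet> X p) * (Y p \<bullet> Xy p) - (X p \<bullet> Y p) * (Xx p \<bullet> Y p + X p \<bullet> Xy p)"
    using e(1) by (simp add: inner_commute algebra_simps)
  show "W p * d_theta T W p = (Y p \<bullet> Y p) * (X p \<bullet> Xy p) + (X p \<bullet> X p) * (Y p \<bullet> Yy p) - (X p \<bullet> Y p) * (Xy p \<bullet> Y p + X p \<bullet> Yy p)"
    using e(2) by (simp add: inner_commute algebra_simps)
qed

text \<open>
  The divergence of the flux is the area density times the Laplacian of the immersion. It is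
  orthogonal to the surface for every immersion, as one sees by differentiating \<open>flux_products\<close>. On
  the other hand its normal part is the mean curvature, so here it is tangential.
\<close>
lemma flux_divergence_free:
  assumes p: "p \<in> strip T"
  shows "d_t T P p + d_theta T Q p = 0"
proof -
  let ?D = "d_t T P p + d_theta T Q p"
  have W: "W p > 0" by (rule W_pos[OF p])
  note ha = is_C1_partials(1)[OF T_pos abc_C1(1)] and hb = is_C1_partials(1)[OF T_pos abc_C1(2)]
    and hc = is_C1_partials(1)[OF T_pos abc_C1(3)] and hP = is_C1_partials(1)[OF T_pos PQ_C1(1)]
    and hQ = is_C1_partials(1)[OF T_pos PQ_C1(2)] and hW = is_C1_partials(1)[OF T_pos W_C1]
  have Px: "d_t T P p = (a p *\<^sub>R Xx p + d_t T a p *\<^sub>R X p) + (b p *\<^sub>R Xy p + d_t T b p *\<^sub>R Y p)"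
    using has_partials_eq(1)[OF T_pos hP has_partials_add[OF has_partials_scaleR[OF ha X] has_partials_scaleR[OF hb Y]] _ p]
    by (simp add: P_def)
  have Qy: "d_theta T Q p = (b p *\<^sub>R Xy p + d_theta T b p *\<^sub>R X p) + (c p *\<^sub>R Yy p + d_theta T c p *\<^sub>R Y p)"
    using has_partials_eq(2)[OF T_pos hQ has_partials_add[OF has_partials_scaleR[OF hb X] has_partials_scaleR[OF hc Y]] _ p]
    by (simp add: Q_def)
  have "?D = (1 / W p) *\<^sub>R ((Y p \<bullet> Y p) *\<^sub>R Xx p - (2 * (X p \<bullet> Y p)) *\<^sub>R Xy p + (X p \<bullet> X p) *\<^sub>R Yy p)
      + ((d_t T a p + d_theta T b p) *\<^sub>R X p + (d_t T b p + d_theta T c p) *\<^sub>R Y p)"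
    unfolding Px Qy a_def b_def c_def
    by (simp add: scaleR_add_right scaleR_add_left scaleR_diff_right scaleR_diff_left flip: scaleR_2)
  also have "\<dots> \<in> span {X p, Y p}"
    by (intro span_add span_mul minimal[OF p]) (auto intro: span_base)
  finally have span: "?D \<in> span {X p, Y p}" .
  have eX: "d_t T P p \<bullet> X p + P p \<bullet> Xx p = d_t T W p"
    using has_partials_eq(1)[OF T_pos has_partials_inner[OF hP X] hW _ p] flux_products(1) by simp
  have eX': "d_theta T Q p \<bullet> X p + Q p \<bullet> Xy p = 0"
    using has_partials_eq(2)[OF T_pos has_partials_inner[OF hQ X] has_partials_const[of T 0] _ p] flux_products(3) by simp
  have eY: "d_t T P p \<bullet> Y p + P p \<bullet> Xy p = 0"
    using has_partials_eq(1)[OF T_pos has_partials_inner[OF hP Y] has_partials_const[of T 0] _ p] flux_products(2) by simp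
  have eY': "d_theta T Q p \<bullet> Y p + Q p \<bullet> Yy p = d_theta T W p"
    using has_partials_eq(2)[OF T_pos has_partials_inner[OF hQ Y] hW _ p] flux_products(4) by simp
  have "?D \<bullet> X p = d_t T W p - (P p \<bullet> Xx p + Q p \<bullet> Xy p)"
    using eX eX' by (simp add: inner_add_left)
  moreover have "W p * (P p \<bullet> Xx p + Q p \<bullet> Xy p) = W p * d_t T W p"
    unfolding W_partials[OF p] using W
    by (simp add: P_def Q_def a_def b_def c_def inner_add_left inner_add_right inner_diff_left inner_diff_right inner_commute field_simps)
  ultimately have "?D \<bullet> X p = 0" using W by simp
  moreover have "?D \<bullet> Y p = d_theta T W p - (P p \<bullet> Xy p + Q p \<bullet> Yy p)"
    using eY eY' by (simp add: inner_add_left)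
  moreover have "W p * (P p \<bullet> Xy p + Q p \<bullet> Yy p) = W p * d_theta T W p"
    unfolding W_partials[OF p] using W
    by (simp add: P_def Q_def a_def b_def c_def inner_add_left inner_add_right inner_diff_left inner_diff_right inner_commute field_simps)
  ultimately have "?D \<bullet> X p = 0" "?D \<bullet> Y p = 0" using W by simp_all
  then have "orthogonal ?D ?D"
    by (intro orthogonal_to_span[OF span]) (auto simp: orthogonal_def)
  then show ?thesis by (simp add: orthogonal_def)
qed

lemma flux_boundary:
  assumes s: "s \<in> {1, -1}"
  shows "P (s * T, \<theta>) = (s * norm (Y (s * T, \<theta>))) *\<^sub>R u (s * T, \<theta>)"
proof -
  have p: "(s * T, \<theta>) \<in> strip T" using s T_pos by auto
  have "P (s * T, \<theta>) = (1 / W (s * T, \<theta>)) *\<^sub>R ((Y (s * T, \<theta>) \<bullet> Y (s * T, \<theta>)) *\<^sub>R X (s * T, \<theta>)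
      - (X (s * T, \<theta>) \<bullet> Y (s * T, \<theta>)) *\<^sub>R Y (s * T, \<theta>))"
    by (simp add: P_def a_def b_def scaleR_diff_right)
  also have "\<dots> = (s * norm (Y (s * T, \<theta>))) *\<^sub>R u (s * T, \<theta>)"
    unfolding conormal[OF s] W_def[symmetric] using W_pos[OF p] by simp
  finally show ?thesis .
qed

lemma inner_C1_annulus: "C1_annulus T (\<lambda>p. v \<bullet> u p) (\<lambda>p. v \<bullet> X p) (\<lambda>p. v \<bullet> Y p)"
  using has_partials_linear[OF bounded_linear_inner_right u, of v] periodic
    has_partials_continuous[OF X] has_partials_continuous[OF Y]
  by (auto simp: C1_annulus_def intro!: continuous_intros)

lemma const_C1_annulus: "C1_annulus T (\<lambda>p. k) (\<lambda>p. 0) (\<lambda>p. 0)"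
  by (simp add: C1_annulus_def has_partials_const)

lemma coefficients_continuous:
  "continuous_on (strip T) a" "continuous_on (strip T) b" "continuous_on (strip T) c"
  "continuous_on (strip T) (\<lambda>p. norm (Y p))"
  using abc_C1 XY_C1 by (auto intro!: is_C1_continuous continuous_intros)

text \<open>
  The functions \<open>v \<bullet> u\<close> are harmonic, and by \<open>flux_boundary\<close> their conormal derivative equals their
  value.
\<close>
lemma energy_add_coordinate:
  assumes \<psi>: "C1_annulus T \<psi> \<psi>x \<psi>y"
  shows "energy T a b c (\<lambda>_. 0) (\<lambda>p. norm (Y p)) (\<lambda>p. v \<bullet> u p + \<psi> p) (\<lambda>p. v \<bullet> X p + \<psi>x p) (\<lambda>p. v \<bullet> Y p + \<psi>y p)
    = energy T a b c (\<lambda>_. 0) (\<lambda>p. norm (Y p)) \<psi> \<psi>x \<psi>y"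
proof (rule energy_add_null[OF T_pos inner_C1_annulus \<psi>])
  note hP = is_C1_partials(1)[OF T_pos PQ_C1(1)] and hQ = is_C1_partials(1)[OF T_pos PQ_C1(2)]
  let ?P = "\<lambda>p. v \<bullet> P p" and ?Q = "\<lambda>p. v \<bullet> Q p"
  show "is_C1 T ?P" "is_C1 T ?Q" by (intro is_C1_inner is_C1_const PQ_C1)+
  show "?Q (t, \<theta> + 2 * pi) = ?Q (t, \<theta>)" if "t \<in> {-T..T}" for t \<theta> using PQ_periodic[OF that] by simp
  show "?P p = a p * (v \<bullet> X p) + b p * (v \<bullet> Y p)" "?Q p = b p * (v \<bullet> X p) + c p * (v \<bullet> Y p)" for p
    by (simp_all add: P_def Q_def inner_add_right)
  show "d_t T ?P p + d_theta T ?Q p = 0 * (v \<bullet> u p)" if p: "p \<in> strip T" for p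
    using has_partials_unique(1)[OF T_pos has_partials_linear[OF bounded_linear_inner_right hP] p]
      has_partials_unique(2)[OF T_pos has_partials_linear[OF bounded_linear_inner_right hQ] p]
      flux_divergence_free[OF p] by (simp flip: inner_add_right)
  show "?P (T, \<theta>) = norm (Y (T, \<theta>)) * (v \<bullet> u (T, \<theta>))" for \<theta>
    using flux_boundary[of 1 \<theta>] by simp
  show "?P (-T, \<theta>) = - norm (Y (-T, \<theta>)) * (v \<bullet> u (-T, \<theta>))" for \<theta>
    using flux_boundary[of "-1" \<theta>] by simp
qed (auto intro!: coefficients_continuous)

lemma boundary_length_pos: "integral {0..2 * pi} (\<lambda>\<theta>. norm (Y (T, \<theta>)) + norm (Y (-T, \<theta>))) > 0"
proof -
  have c: "continuous_on {0..2 * pi} (\<lambda>\<theta>. norm (Y (T, \<theta>)) + norm (Y (-T, \<theta>)))"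
    using T_pos by (intro continuous_intros strip_slice_continuous(1)[OF has_partials_continuous[OF Y]]) auto
  have pos: "norm (Y (T, \<theta>)) > 0" for \<theta> using regular[of "(T, \<theta>)"] T_pos by auto
  have "integral {0..2 * pi} (\<lambda>\<theta>. norm (Y (T, \<theta>)) + norm (Y (-T, \<theta>))) \<noteq> 0"
  proof
    assume "integral {0..2 * pi} (\<lambda>\<theta>. norm (Y (T, \<theta>)) + norm (Y (-T, \<theta>))) = 0"
    then have "((\<lambda>\<theta>. norm (Y (T, \<theta>)) + norm (Y (-T, \<theta>))) has_integral 0) (cbox 0 (2 * pi))"
      using integrable_integral[OF integrable_continuous_interval[OF c]] by simp
    then have "norm (Y (T, 0)) + norm (Y (-T, 0)) = 0"
      by (rule has_integral_0_cbox_imp_0[rotated 2]) (use c pi_gt_zero in \<open>auto simp del: pi_gt_zero\<close>)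
    then show False using pos[of 0] norm_ge_zero[of "Y (-T, 0)"] by linarith
  qed
  moreover have "integral {0..2 * pi} (\<lambda>\<theta>. norm (Y (T, \<theta>)) + norm (Y (-T, \<theta>))) \<ge> 0"
    by (rule integral_nonneg) (auto intro!: integrable_continuous_interval c)
  ultimately show ?thesis by simp
qed

lemma energy_const:
  "energy T a b c (\<lambda>_. 0) (\<lambda>p. norm (Y p)) (\<lambda>_. k) (\<lambda>_. 0) (\<lambda>_. 0)
    = - k\<^sup>2 * integral {0..2 * pi} (\<lambda>\<theta>. norm (Y (T, \<theta>)) + norm (Y (-T, \<theta>)))"
proof -
  have "integral {0..2 * pi} (\<lambda>\<theta>. norm (Y (T, \<theta>)) * k\<^sup>2 + norm (Y (-T, \<theta>)) * k\<^sup>2)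
      = integral {0..2 * pi} (\<lambda>\<theta>. k\<^sup>2 * (norm (Y (T, \<theta>)) + norm (Y (-T, \<theta>))))"
    by (simp add: algebra_simps)
  then show ?thesis by (simp add: energy_def)
qed

lemma energy_affine:
  "energy T a b c (\<lambda>_. 0) (\<lambda>p. norm (Y p)) (\<lambda>p. v \<bullet> u p + k) (\<lambda>p. v \<bullet> X p) (\<lambda>p. v \<bullet> Y p)
    = - k\<^sup>2 * integral {0..2 * pi} (\<lambda>\<theta>. norm (Y (T, \<theta>)) + norm (Y (-T, \<theta>)))"
  using energy_add_coordinate[OF const_C1_annulus[of k], of v] energy_const[of k] by simp

lemma affine_C1_annulus: "C1_annulus T (\<lambda>p. v \<bullet> u p + k) (\<lambda>p. v \<bullet> X p) (\<lambda>p. v \<bullet> Y p)"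
  using C1_annulus_add[OF inner_C1_annulus[of v] const_C1_annulus[of k]] by simp

end

lemma h1_norm2_zero_imp:
  assumes f: "C1_annulus critical_T f fx fy" and zero: "h1_norm2 f fx fy \<le> 0" and p: "p \<in> rect critical_T"
  shows "f p = 0"
proof -
  let ?T = critical_T
  let ?g = "\<lambda>p. (f p)\<^sup>2 + (fx p)\<^sup>2 + (fy p)\<^sup>2"
  have "continuous_on (strip ?T) ?g"
    using f unfolding C1_annulus_def by (intro continuous_intros) (auto intro: has_partials_continuous)
  then have c: "continuous_on (rect ?T) ?g" "?g integrable_on rect ?T"
    using rect_subset_strip continuous_on_subset rect_integrable by blast+
  have "integral (rect ?T) ?g \<ge> 0" by (rule integral_nonneg[OF c(2)]) auto
  then have "(?g has_integral 0) (rect ?T)"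
    using zero integrable_integral[OF c(2)] by (simp add: h1_norm2_def)
  then have "?g p = 0"
    by (rule has_integral_0_cbox_imp_0[rotated 2])
      (use c p critical_T_pos in \<open>auto simp: box_ne_empty Basis_prod_def\<close>)
  moreover have "(f p)\<^sup>2 \<ge> 0" "(fx p)\<^sup>2 \<ge> 0" "(fy p)\<^sup>2 \<ge> 0" by auto
  ultimately have "(f p)\<^sup>2 = 0" by linarith
  then show ?thesis by simp
qed

lemma h1_norm2_nonneg:
  assumes f: "C1_annulus critical_T f fx fy"
  shows "h1_norm2 f fx fy \<ge> 0"
  unfolding h1_norm2_def
  by (rule integral_nonneg, rule rect_integrable)
    (use f in \<open>auto simp: C1_annulus_def intro!: continuous_intros intro: has_partials_continuous\<close>)

lemma linear_kernel_nontrivial: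
  fixes L :: "'a::euclidean_space \<Rightarrow> 'b::euclidean_space"
  assumes "linear L" "subspace S" "dim S > DIM('b)"
  obtains x where "x \<in> S" "x \<noteq> 0" "L x = 0"
proof -
  have "\<not> inj_on L S"
  proof
    assume "inj_on L S"
    then have "inj_on L (span S)" using assms(2) by (simp add: span_eq_iff[THEN iffD2])
    from dim_image_eq[OF assms(1) this] have "dim (L ` S) = dim S" .
    moreover have "dim (L ` S) \<le> DIM('b)" by (rule dim_subset_UNIV)
    ultimately show False using assms(3) by simp
  qed
  then show thesis
    using that linear_injective_on_subspace_0[OF assms(1,2)] by blast
qed

lemma harmonic_linear:
  assumes "continuous_on {0..2 * pi} f" "continuous_on {0..2 * pi} g"
  shows "harmonic0 (\<lambda>x. f x + g x) = harmonic0 f + harmonic0 g"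
    and "harmonic_cos (\<lambda>x. f x + g x) = harmonic_cos f + harmonic_cos g"
    and "harmonic_sin (\<lambda>x. f x + g x) = harmonic_sin f + harmonic_sin g"
    and "harmonic0 (\<lambda>x. r * f x) = r * harmonic0 f"
    and "harmonic_cos (\<lambda>x. r * f x) = r * harmonic_cos f"
    and "harmonic_sin (\<lambda>x. r * f x) = r * harmonic_sin f"
proof -
  have i: "f integrable_on {0..2 * pi}" "g integrable_on {0..2 * pi}"
    "(\<lambda>x. f x * cos x) integrable_on {0..2 * pi}" "(\<lambda>x. g x * cos x) integrable_on {0..2 * pi}"
    "(\<lambda>x. f x * sin x) integrable_on {0..2 * pi}" "(\<lambda>x. g x * sin x) integrable_on {0..2 * pi}"
    by (intro integrable_continuous_interval continuous_intros assms)+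
  show "harmonic0 (\<lambda>x. f x + g x) = harmonic0 f + harmonic0 g"
    "harmonic_cos (\<lambda>x. f x + g x) = harmonic_cos f + harmonic_cos g"
    "harmonic_sin (\<lambda>x. f x + g x) = harmonic_sin f + harmonic_sin g"
    unfolding harmonic0_def harmonic_cos_def harmonic_sin_def distrib_right
    by (simp_all only: integral_add i add_divide_distrib)
  show "harmonic0 (\<lambda>x. r * f x) = r * harmonic0 f"
    "harmonic_cos (\<lambda>x. r * f x) = r * harmonic_cos f"
    "harmonic_sin (\<lambda>x. r * f x) = r * harmonic_sin f"
    unfolding harmonic0_def harmonic_cos_def harmonic_sin_def mult.assoc
    by (simp_all only: integral_mult_right times_divide_eq_right)
qed

text \<open>
  On the functions \<open>v \<bullet> u + k\<close> the Steklov energy is \<open>- k\<^sup>2\<close> times the length of the boundary, hence not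
  positive. If the image spanned more than three dimensions, one of these functions would satisfy the
  four linear conditions under which the energy is coercive.
\<close>
lemma (in free_boundary_surface) dim_image_le_3:
  assumes T: "T = critical_T" and \<delta>: "\<delta> > 0"
    and coercive: "\<And>f fx fy. C1_annulus critical_T f fx fy \<Longrightarrow>
      (\<And>s. s \<in> {critical_T / 2, - critical_T / 2} \<Longrightarrow> harmonic0 (\<lambda>\<theta>. f (s, \<theta>)) = 0) \<Longrightarrow>
      harmonic_cos (\<lambda>\<theta>. f (0, \<theta>)) = 0 \<Longrightarrow> harmonic_sin (\<lambda>\<theta>. f (0, \<theta>)) = 0 \<Longrightarrow>
      \<delta> * h1_norm2 f fx fy \<le> energy critical_T a b c (\<lambda>_. 0) (\<lambda>p. norm (Y p)) f fx fy"
  shows "dim (u ` rect T) \<le> 3"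
proof (rule ccontr)
  assume "\<not> dim (u ` rect T) \<le> 3"
  let ?V = "span (u ` rect T)"
  let ?f = "\<lambda>x p. fst x \<bullet> u p + snd x :: real"
  let ?L = "\<lambda>x. (harmonic0 (\<lambda>\<theta>. ?f x (critical_T / 2, \<theta>)), harmonic0 (\<lambda>\<theta>. ?f x (- critical_T / 2, \<theta>)),
      harmonic_cos (\<lambda>\<theta>. ?f x (0, \<theta>)), harmonic_sin (\<lambda>\<theta>. ?f x (0, \<theta>)))"
  have cu: "continuous_on {0..2 * pi} (\<lambda>\<theta>. ?f x (t, \<theta>))" if "t \<in> {-T..T}" for x t
    by (intro continuous_intros strip_slice_continuous(1)[OF has_partials_continuous[OF u] that])
  have mem: "critical_T / 2 \<in> {-T..T}" "- critical_T / 2 \<in> {-T..T}" "0 \<in> {-T..T}"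
    using critical_T_pos by (auto simp: T)
  have lin: "linear ?L"
  proof (rule linearI)
    fix x y :: "'a \<times> real" and r :: real
    have e: "?f (x + y) p = ?f x p + ?f y p" "?f (r *\<^sub>R x) p = r * ?f x p" for p
      by (simp_all add: inner_add_left algebra_simps)
    show "?L (x + y) = ?L x + ?L y"
      unfolding e by (simp only: harmonic_linear(1-3)[OF cu[OF mem(1)] cu[OF mem(1)]]
          harmonic_linear(1-3)[OF cu[OF mem(2)] cu[OF mem(2)]] harmonic_linear(1-3)[OF cu[OF mem(3)] cu[OF mem(3)]] add_Pair)
    show "?L (r *\<^sub>R x) = r *\<^sub>R ?L x"
      unfolding e by (simp only: harmonic_linear(4-6)[OF cu[OF mem(1)] cu[OF mem(1)]]
          harmonic_linear(4-6)[OF cu[OF mem(2)] cu[OF mem(2)]] harmonic_linear(4-6)[OF cu[OF mem(3)] cu[OF mem(3)]]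
          scaleR_Pair real_scaleR_def)
  qed
  have sub: "subspace (?V \<times> (UNIV :: real set))" by (intro subspace_Times) auto
  have "dim (?V \<times> (UNIV :: real set)) = dim ?V + dim (UNIV :: real set)"
    by (rule dim_Times) auto
  also have "\<dots> > 4" using \<open>\<not> dim (u ` rect T) \<le> 3\<close> by simp
  finally have d: "dim (?V \<times> (UNIV :: real set)) > DIM(real \<times> real \<times> real \<times> real)" by simp
  obtain x where x: "x \<in> ?V \<times> (UNIV :: real set)" "x \<noteq> 0" "?L x = 0"
    by (rule linear_kernel_nontrivial[OF lin sub d])
  obtain v k where vk: "x = (v, k)" by (cases x)
  let ?g = "\<lambda>p. v \<bullet> u p + k"
  have C: "C1_annulus critical_T ?g (\<lambda>p. v \<bullet> X p) (\<lambda>p. v \<bullet> Y p)"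
    using affine_C1_annulus[of v k] by (simp add: T)
  have "\<delta> * h1_norm2 ?g (\<lambda>p. v \<bullet> X p) (\<lambda>p. v \<bullet> Y p)
      \<le> energy critical_T a b c (\<lambda>_. 0) (\<lambda>p. norm (Y p)) ?g (\<lambda>p. v \<bullet> X p) (\<lambda>p. v \<bullet> Y p)"
  proof (rule coercive[OF C])
    have z: "harmonic0 (\<lambda>\<theta>. ?g (critical_T / 2, \<theta>)) = 0" "harmonic0 (\<lambda>\<theta>. ?g (- critical_T / 2, \<theta>)) = 0"
      "harmonic_cos (\<lambda>\<theta>. ?g (0, \<theta>)) = 0" "harmonic_sin (\<lambda>\<theta>. ?g (0, \<theta>)) = 0"
      using x(3) unfolding vk by (simp_all add: zero_prod_def)
    show "harmonic_cos (\<lambda>\<theta>. ?g (0, \<theta>)) = 0" "harmonic_sin (\<lambda>\<theta>. ?g (0, \<theta>)) = 0" by (rule z)+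
    fix s assume "s \<in> {critical_T / 2, - critical_T / 2}"
    then show "harmonic0 (\<lambda>\<theta>. ?g (s, \<theta>)) = 0" by (elim insertE emptyE) (simp_all only: z)
  qed
  also have "\<dots> = - k\<^sup>2 * integral {0..2 * pi} (\<lambda>\<theta>. norm (Y (T, \<theta>)) + norm (Y (-T, \<theta>)))"
    using energy_affine[of v k] by (simp only: T)
  finally have le: "\<delta> * h1_norm2 ?g (\<lambda>p. v \<bullet> X p) (\<lambda>p. v \<bullet> Y p)
      + k\<^sup>2 * integral {0..2 * pi} (\<lambda>\<theta>. norm (Y (T, \<theta>)) + norm (Y (-T, \<theta>))) \<le> 0" by simp
  have n: "h1_norm2 ?g (\<lambda>p. v \<bullet> X p) (\<lambda>p. v \<bullet> Y p) \<ge> 0" by (rule h1_norm2_nonneg[OF C])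
  have "k = 0"
  proof (rule ccontr)
    assume "k \<noteq> 0"
    then have "k\<^sup>2 * integral {0..2 * pi} (\<lambda>\<theta>. norm (Y (T, \<theta>)) + norm (Y (-T, \<theta>))) > 0"
      using boundary_length_pos by simp
    moreover have "\<delta> * h1_norm2 ?g (\<lambda>p. v \<bullet> X p) (\<lambda>p. v \<bullet> Y p) \<ge> 0" using n \<delta> by simp
    ultimately show False using le by linarith
  qed
  then have "h1_norm2 ?g (\<lambda>p. v \<bullet> X p) (\<lambda>p. v \<bullet> Y p) \<le> 0"
    using le \<delta> by (simp add: mult_le_0_iff)
  from h1_norm2_zero_imp[OF C this] have "orthogonal v w" if "w \<in> u ` rect T" for w
    using that \<open>k = 0\<close> by (auto simp: orthogonal_def T)
  moreover have "v \<in> ?V" using x(1) vk by simp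
  ultimately have "orthogonal v v" using orthogonal_to_span by blast
  then show False using x(2) vk \<open>k = 0\<close> by (simp add: orthogonal_def zero_prod_def)
qed

section \<open>The second variation in three-space\<close>

unbundle cross3_syntax

lemma bounded_bilinear_cross3: "bounded_bilinear ((\<times>) :: real^3 \<Rightarrow> real^3 \<Rightarrow> real^3)"
  using bilinear_cross bilinear_conv_bounded_bilinear by blast

lemmas has_partials_cross = has_partials_bilinear[OF bounded_bilinear_cross3]
lemmas is_C1_cross = is_C1_bilinear[OF bounded_bilinear_cross3]

lemma periodic_reduce:
  fixes f :: "real \<Rightarrow> 'b"
  assumes per: "\<And>\<theta>. f (\<theta> + 2 * pi) = f \<theta>"
  shows "\<exists>\<theta>'\<in>{0..2 * pi}. f \<theta> = f \<theta>'"
proof -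
  have nat: "f (\<theta> + real n * (2 * pi)) = f \<theta>" for n \<theta>
    by (induction n) (use per[of "\<theta> + real _ * (2 * pi)"] in \<open>auto simp: algebra_simps\<close>)
  define k where "k = \<lfloor>\<theta> / (2 * pi)\<rfloor>"
  define \<theta>' where "\<theta>' = \<theta> - of_int k * (2 * pi)"
  have k: "of_int k * (2 * pi) \<le> \<theta>" "\<theta> \<le> (of_int k + 1) * (2 * pi)"
    using pos_le_divide_eq[of "2 * pi" "of_int k" \<theta>] of_int_floor_le[of "\<theta> / (2 * pi)"]
      pos_divide_le_eq[of "2 * pi" \<theta> "of_int k + 1"] real_of_int_floor_add_one_ge[of "\<theta> / (2 * pi)"]
    unfolding k_def[symmetric] by auto
  have "f \<theta> = f \<theta>'"
  proof (cases "k \<ge> 0")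
    case True
    then show ?thesis using nat[of \<theta>' "nat k"] by (simp add: \<theta>'_def)
  next
    case False
    then show ?thesis using nat[of \<theta> "nat (- k)"] by (simp add: \<theta>'_def)
  qed
  moreover have "\<theta>' \<in> {0..2 * pi}" using k by (auto simp: \<theta>'_def algebra_simps)
  ultimately show ?thesis by blast
qed

locale free_boundary_surface_3 = free_boundary_surface T u X Y Xx Xy Yy
  for T :: real and u X Y Xx Xy Yy :: "real \<times> real \<Rightarrow> real^3"
begin

definition N :: "real \<times> real \<Rightarrow> real^3" where "N p = (1 / W p) *\<^sub>R (X p \<times> Y p)"

definition l :: "real \<times> real \<Rightarrow> real" where "l p = N p \<bullet> Xx p"

definition m :: "real \<times> real \<Rightarrow> real" where "m p = N p \<bullet> Xy p"

definition n :: "real \<times> real \<Rightarrow> real" where "n p = N p \<bullet> Yy p"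

text \<open>
  The Gauss curvature times the area density.
\<close>
definition k :: "real \<times> real \<Rightarrow> real" where "k p = (l p * n p - m p * m p) / W p"

text \<open>
  The Weingarten equations, solved for the derivatives of the normal in terms of the flux. In this
  form these derivatives are visibly continuously differentiable.
\<close>
definition Nx :: "real \<times> real \<Rightarrow> real^3" where "Nx p = - (1 / W p) *\<^sub>R (l p *\<^sub>R P p + m p *\<^sub>R Q p)"

definition Ny :: "real \<times> real \<Rightarrow> real^3" where "Ny p = - (1 / W p) *\<^sub>R (m p *\<^sub>R P p + n p *\<^sub>R Q p)"

text \<open>
  The functions \<open>v \<bullet> w\<close> are the normal components of the infinitesimal rotations \<open>v \<times> u\<close>, up to sign.
\<close>
definition w :: "real \<times> real \<Rightarrow> real^3" where "w p = u p \<times> N p"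

lemma cross_eq_W_N: "p \<in> strip T \<Longrightarrow> X p \<times> Y p = W p *\<^sub>R N p"
  using W_pos[of p] by (simp add: N_def)

lemma N_frame:
  assumes p: "p \<in> strip T"
  shows "N p \<bullet> X p = 0" "N p \<bullet> Y p = 0" "N p \<bullet> N p = 1" "X p \<bullet> N p = 0" "Y p \<bullet> N p = 0"
proof -
  show "N p \<bullet> X p = 0" "N p \<bullet> Y p = 0" "X p \<bullet> N p = 0" "Y p \<bullet> N p = 0"
    by (simp_all add: N_def dot_cross_self)
  have "(X p \<times> Y p) \<bullet> (X p \<times> Y p) = W p * W p"
    using norm_cross_dot[of "X p" "Y p"] W_square[OF p]
    by (simp add: power2_norm_eq_inner power_mult_distrib power2_eq_square[of "_ \<bullet> _"])
  then show "N p \<bullet> N p = 1" using W_pos[OF p] by (simp add: N_def)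
qed

lemma frame_eq:
  assumes p: "p \<in> strip T" and "v \<bullet> X p = v' \<bullet> X p" "v \<bullet> Y p = v' \<bullet> Y p" "v \<bullet> N p = v' \<bullet> N p"
  shows "v = v'"
proof -
  let ?z = "v - v'"
  have z: "?z \<bullet> X p = 0" "?z \<bullet> Y p = 0" "?z \<bullet> N p = 0" using assms by (auto simp: inner_diff_left)
  have "?z \<times> (X p \<times> Y p) = 0" using z by (simp add: Lagrange)
  moreover have "?z \<bullet> (X p \<times> Y p) = 0" using z(3) by (simp add: cross_eq_W_N[OF p])
  ultimately have "?z = 0 \<or> X p \<times> Y p = 0" using norm_and_cross_eq_0 by blast
  then show ?thesis using N_frame(3)[OF p] W_pos[OF p] by (auto simp: cross_eq_W_N[OF p])
qed

lemma N_C1: "is_C1 T N"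
  unfolding N_def[abs_def]
  by (intro is_C1_scaleR is_C1_divide is_C1_const W_C1 is_C1_cross XY_C1) (use W_pos in fastforce)

text \<open>
  The cross product with \<open>N\<close> is the rotation by a right angle in the tangent plane, so it exchanges
  the two coordinate directions with their fluxes.
\<close>
lemma triple_products:
  assumes p: "p \<in> strip T"
  shows "P p = Y p \<times> N p" "Q p = N p \<times> X p"
proof -
  have t: "X p \<bullet> (Y p \<times> N p) = W p" "Y p \<bullet> (N p \<times> X p) = W p"
  proof -
    have "X p \<bullet> (Y p \<times> N p) = (X p \<times> Y p) \<bullet> N p" "Y p \<bullet> (N p \<times> X p) = (X p \<times> Y p) \<bullet> N p"
      by (simp_all add: cross3_simps)
    then show "X p \<bullet> (Y p \<times> N p) = W p" "Y p \<bullet> (N p \<times> X p) = W p"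
      by (simp_all add: cross_eq_W_N[OF p] N_frame[OF p])
  qed
  show "P p = Y p \<times> N p"
    by (rule frame_eq[OF p])
      (use t flux_products[OF p] N_frame[OF p] in \<open>simp_all add: P_def inner_add_left inner_add_right dot_cross_self inner_commute\<close>)
  show "Q p = N p \<times> X p"
    by (rule frame_eq[OF p])
      (use t flux_products[OF p] N_frame[OF p] in \<open>simp_all add: Q_def inner_add_left inner_add_right dot_cross_self inner_commute\<close>)
qed

lemma flux_gram:
  assumes p: "p \<in> strip T"
  shows "P p \<bullet> P p = a p * W p" "P p \<bullet> Q p = b p * W p" "Q p \<bullet> P p = b p * W p" "Q p \<bullet> Q p = c p * W p"
    "P p \<bullet> N p = 0" "Q p \<bullet> N p = 0"
proof -
  show "P p \<bullet> P p = a p * W p"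
    using flux_products[OF p] by (subst (2) P_def) (simp add: inner_add_right)
  show "P p \<bullet> Q p = b p * W p"
    using flux_products[OF p] by (subst Q_def) (simp add: inner_add_right)
  show "Q p \<bullet> P p = b p * W p"
    using flux_products[OF p] by (subst P_def) (simp add: inner_add_right)
  show "Q p \<bullet> Q p = c p * W p"
    using flux_products[OF p] by (subst (2) Q_def) (simp add: inner_add_right)
  show "P p \<bullet> N p = 0" "Q p \<bullet> N p = 0"
    by (simp_all add: P_def Q_def inner_add_left N_frame[OF p])
qed

lemma shape_products:
  assumes p: "p \<in> strip T"
  shows "Nx p \<bullet> X p = - l p" "Nx p \<bullet> Y p = - m p" "Nx p \<bullet> N p = 0"
    "Ny p \<bullet> X p = - m p" "Ny p \<bullet> Y p = - n p" "Ny p \<bullet> N p = 0"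
    "Nx p \<bullet> P p = - (l p * a p + m p * b p)" "Nx p \<bullet> Q p = - (l p * b p + m p * c p)"
    "Ny p \<bullet> P p = - (m p * a p + n p * b p)" "Ny p \<bullet> Q p = - (m p * b p + n p * c p)"
  using W_pos[OF p]
  by (simp_all add: Nx_def Ny_def inner_add_left flux_products[OF p] flux_gram[OF p] distrib_right[symmetric]
      mult.assoc[symmetric])

lemma N_partials: "has_partials T N Nx Ny"
proof -
  note hN = is_C1_partials(1)[OF T_pos N_C1]
  have "d_t T N p = Nx p \<and> d_theta T N p = Ny p" if p: "p \<in> strip T" for p
  proof -
    note zero = has_partials_const[of T "0::real"] and one = has_partials_const[of T "1::real"]
    note eX = has_partials_eq[OF T_pos has_partials_inner[OF hN X] zero N_frame(1) p]
    note eY = has_partials_eq[OF T_pos has_partials_inner[OF hN Y] zero N_frame(2) p]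
    note eN = has_partials_eq[OF T_pos has_partials_inner[OF hN hN] one N_frame(3) p]
    have "d_t T N p = Nx p"
    proof (rule frame_eq[OF p])
      show "d_t T N p \<bullet> X p = Nx p \<bullet> X p" "d_t T N p \<bullet> Y p = Nx p \<bullet> Y p"
        using eX(1) eY(1) by (simp_all add: shape_products[OF p] l_def m_def)
      show "d_t T N p \<bullet> N p = Nx p \<bullet> N p"
        using eN(1) shape_products(3)[OF p] by (simp add: inner_commute)
    qed
    moreover have "d_theta T N p = Ny p"
    proof (rule frame_eq[OF p])
      show "d_theta T N p \<bullet> X p = Ny p \<bullet> X p" "d_theta T N p \<bullet> Y p = Ny p \<bullet> Y p"
        using eX(2) eY(2) by (simp_all add: shape_products[OF p] m_def n_def)
      show "d_theta T N p \<bullet> N p = Ny p \<bullet> N p"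
        using eN(2) shape_products(6)[OF p] by (simp add: inner_commute)
    qed
    ultimately show ?thesis by simp
  qed
  then show ?thesis using hN by (simp add: has_partials_def)
qed

lemma lmn_C1: "is_C1 T l" "is_C1 T m" "is_C1 T n"
  unfolding l_def[abs_def] m_def[abs_def] n_def[abs_def] by (intro is_C1_inner N_C1 second_C1)+

lemma NxNy_C1: "is_C1 T Nx" "is_C1 T Ny"
proof -
  have nz: "W p \<noteq> 0" if "p \<in> strip T" for p using W_pos[OF that] by simp
  have "is_C1 T (\<lambda>p. ((- 1) / W p) *\<^sub>R (l p *\<^sub>R P p + m p *\<^sub>R Q p))"
    "is_C1 T (\<lambda>p. ((- 1) / W p) *\<^sub>R (m p *\<^sub>R P p + n p *\<^sub>R Q p))"
    by (rule is_C1_scaleR[OF is_C1_divide[OF is_C1_const W_C1 nz] is_C1_add[OF is_C1_scaleR is_C1_scaleR]],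
        (assumption | rule lmn_C1 PQ_C1)+)+
  then show "is_C1 T Nx" "is_C1 T Ny" by (simp_all add: Nx_def[abs_def] Ny_def[abs_def])
qed

lemma k_C1: "is_C1 T k"
  unfolding k_def[abs_def]
  by (rule is_C1_divide[OF is_C1_diff[OF is_C1_mult is_C1_mult] W_C1]) (use W_pos in \<open>auto intro: lmn_C1 simp: less_imp_neq[symmetric]\<close>)

lemma trace_free:
  assumes p: "p \<in> strip T"
  shows "l p * a p + 2 * m p * b p + n p * c p = 0"
proof -
  have "orthogonal (N p) ((Y p \<bullet> Y p) *\<^sub>R Xx p - (2 * (X p \<bullet> Y p)) *\<^sub>R Xy p + (X p \<bullet> X p) *\<^sub>R Yy p)"
    by (rule orthogonal_to_span[OF minimal[OF p]]) (auto simp: orthogonal_def N_frame[OF p])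
  then have "(Y p \<bullet> Y p) * l p - (2 * (X p \<bullet> Y p)) * m p + (X p \<bullet> X p) * n p = 0"
    by (simp add: orthogonal_def inner_add_right inner_diff_right l_def m_def n_def)
  then show ?thesis using W_pos[OF p] by (simp add: a_def b_def c_def field_simps)
qed

text \<open>
  The same relation as \<open>triple_products\<close>, for \<open>N\<close> in place of \<open>u\<close> and with the opposite orientation:
  the Gauss map of a minimal surface is anticonformal.
\<close>
lemma normal_flux:
  assumes p: "p \<in> strip T"
  shows "a p *\<^sub>R Nx p + b p *\<^sub>R Ny p = N p \<times> Ny p" "b p *\<^sub>R Nx p + c p *\<^sub>R Ny p = Nx p \<times> N p"
proof -
  note tr = trace_free[OF p]
  have t: "(v \<times> v') \<bullet> z = v' \<bullet> (z \<times> v)" "(v \<times> v') \<bullet> z = v \<bullet> (v' \<times> z)" for v v' z :: "real^3"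
    by (simp_all add: cross3_simps)
  have neg: "X p \<times> N p = - Q p" "N p \<times> Y p = - P p"
    using triple_products[OF p] cross_skew[of "X p" "N p"] cross_skew[of "N p" "Y p"] by simp_all
  show "a p *\<^sub>R Nx p + b p *\<^sub>R Ny p = N p \<times> Ny p"
  proof (rule frame_eq[OF p])
    show "(a p *\<^sub>R Nx p + b p *\<^sub>R Ny p) \<bullet> X p = (N p \<times> Ny p) \<bullet> X p"
      unfolding t(1) neg using tr by (simp add: inner_add_left shape_products[OF p] algebra_simps)
    show "(a p *\<^sub>R Nx p + b p *\<^sub>R Ny p) \<bullet> Y p = (N p \<times> Ny p) \<bullet> Y p"
      unfolding t(1) triple_products(1)[OF p, symmetric] by (simp add: inner_add_left shape_products[OF p] algebra_simps)
    show "(a p *\<^sub>R Nx p + b p *\<^sub>R Ny p) \<bullet> N p = (N p \<times> Ny p) \<bullet> N p"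
      by (simp add: inner_add_left shape_products[OF p] dot_cross_self)
  qed
  show "b p *\<^sub>R Nx p + c p *\<^sub>R Ny p = Nx p \<times> N p"
  proof (rule frame_eq[OF p])
    show "(b p *\<^sub>R Nx p + c p *\<^sub>R Ny p) \<bullet> X p = (Nx p \<times> N p) \<bullet> X p"
      unfolding t(2) triple_products(2)[OF p, symmetric] by (simp add: inner_add_left shape_products[OF p] algebra_simps)
    show "(b p *\<^sub>R Nx p + c p *\<^sub>R Ny p) \<bullet> Y p = (Nx p \<times> N p) \<bullet> Y p"
      unfolding t(2) neg using tr by (simp add: inner_add_left shape_products[OF p] algebra_simps)
    show "(b p *\<^sub>R Nx p + c p *\<^sub>R Ny p) \<bullet> N p = (Nx p \<times> N p) \<bullet> N p"
      by (simp add: inner_add_left shape_products[OF p] dot_cross_self)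
  qed
qed

lemma cross_normal_derivatives:
  assumes p: "p \<in> strip T"
  shows "Nx p \<times> Ny p = k p *\<^sub>R N p"
proof (rule frame_eq[OF p])
  have tri: "(Nx p \<times> Ny p) \<bullet> v = 0" if "v \<in> {X p, Y p}" for v
  proof -
    have "N p \<times> (Nx p \<times> Ny p) = 0" by (simp add: Lagrange shape_products[OF p] inner_commute[of "N p"])
    then have "v \<bullet> (N p \<times> (N p \<times> (Nx p \<times> Ny p))) = 0" by simp
    moreover have "v \<bullet> (N p \<times> (N p \<times> z)) = - (z \<bullet> v)" for z
      using that by (auto simp: Lagrange inner_diff_right N_frame[OF p] inner_commute)
    ultimately show ?thesis by simp
  qed
  show "(Nx p \<times> Ny p) \<bullet> X p = (k p *\<^sub>R N p) \<bullet> X p" "(Nx p \<times> Ny p) \<bullet> Y p = (k p *\<^sub>R N p) \<bullet> Y p"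
    by (simp_all add: tri N_frame[OF p])
  have "(v1 \<times> v2) \<bullet> (v3 \<times> v4) = (v1 \<bullet> v3) * (v2 \<bullet> v4) - (v1 \<bullet> v4) * (v2 \<bullet> v3)" for v1 v2 v3 v4 :: "real^3"
    by (simp add: cross3_simps)
  from this[of "Nx p" "Ny p" "X p" "Y p"]
  have "W p * ((Nx p \<times> Ny p) \<bullet> N p) = l p * n p - m p * m p"
    by (simp add: cross_eq_W_N[OF p] shape_products[OF p])
  then show "(Nx p \<times> Ny p) \<bullet> N p = (k p *\<^sub>R N p) \<bullet> N p"
    using W_pos[OF p] by (simp add: k_def N_frame[OF p] field_simps)
qed

lemma N_periodic: "t \<in> {-T..T} \<Longrightarrow> N (t, \<theta> + 2 * pi) = N (t, \<theta>)"
  by (simp add: N_def W_def XY_periodic)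

lemma NxNy_periodic:
  assumes t: "t \<in> {-T..T}"
  shows "Nx (t, \<theta> + 2 * pi) = Nx (t, \<theta>)" "Ny (t, \<theta> + 2 * pi) = Ny (t, \<theta>)"
  using has_partials_periodic[OF T_pos N_partials N_periodic t] by auto

text \<open>
  The flux of \<open>w\<close>, rewritten with \<open>normal_flux\<close> and \<open>triple_products\<close>.
\<close>
definition Pw :: "real \<times> real \<Rightarrow> real^3" where "Pw p = u p \<times> (N p \<times> Ny p) - Y p"

definition Qw :: "real \<times> real \<Rightarrow> real^3" where "Qw p = u p \<times> (Nx p \<times> N p) + X p"

lemma w_partials: "has_partials T w (\<lambda>p. u p \<times> Nx p + X p \<times> N p) (\<lambda>p. u p \<times> Ny p + Y p \<times> N p)"
  unfolding w_def[abs_def] by (rule has_partials_cross[OF u N_partials])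

lemma w_flux:
  assumes p: "p \<in> strip T"
  shows "a p *\<^sub>R (u p \<times> Nx p + X p \<times> N p) + b p *\<^sub>R (u p \<times> Ny p + Y p \<times> N p) = Pw p"
    "b p *\<^sub>R (u p \<times> Nx p + X p \<times> N p) + c p *\<^sub>R (u p \<times> Ny p + Y p \<times> N p) = Qw p"
proof -
  have "P p \<times> N p = - Y p"
    unfolding triple_products(1)[OF p] cross_skew[of _ "N p"] by (simp add: Lagrange N_frame[OF p])
  moreover have "a p *\<^sub>R (u p \<times> Nx p + X p \<times> N p) + b p *\<^sub>R (u p \<times> Ny p + Y p \<times> N p)
      = u p \<times> (a p *\<^sub>R Nx p + b p *\<^sub>R Ny p) + P p \<times> N p"
    by (simp add: P_def cross_add_left cross_add_right cross_mult_left cross_mult_right scaleR_add_right)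
  ultimately show "a p *\<^sub>R (u p \<times> Nx p + X p \<times> N p) + b p *\<^sub>R (u p \<times> Ny p + Y p \<times> N p) = Pw p"
    by (simp add: normal_flux[OF p] Pw_def)
  have "Q p \<times> N p = X p"
    unfolding triple_products(2)[OF p] cross_skew[of _ "N p"] by (simp add: Lagrange N_frame[OF p])
  moreover have "b p *\<^sub>R (u p \<times> Nx p + X p \<times> N p) + c p *\<^sub>R (u p \<times> Ny p + Y p \<times> N p)
      = u p \<times> (b p *\<^sub>R Nx p + c p *\<^sub>R Ny p) + Q p \<times> N p"
    by (simp add: Q_def cross_add_left cross_add_right cross_mult_left cross_mult_right scaleR_add_right)
  ultimately show "b p *\<^sub>R (u p \<times> Nx p + X p \<times> N p) + c p *\<^sub>R (u p \<times> Ny p + Y p \<times> N p) = Qw p"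
    by (simp add: normal_flux[OF p] Qw_def)
qed

text \<open>
  The Jacobi equation \<open>\<Delta> w + |A|\<^sup>2 w = 0\<close>, with \<open>|A|\<^sup>2 = - 2 K\<close>. The terms with one derivative on
  \<open>u\<close> and one on \<open>N\<close> cancel by the symmetry of the second fundamental form.
\<close>
lemma w_jacobi:
  assumes p: "p \<in> strip T"
  shows "d_t T Pw p + d_theta T Qw p = (2 * k p) *\<^sub>R w p"
proof -
  note hNx = is_C1_partials(1)[OF T_pos NxNy_C1(1)] and hNy = is_C1_partials(1)[OF T_pos NxNy_C1(2)]
  note h1 = has_partials_diff[OF has_partials_cross[OF u has_partials_cross[OF N_partials hNy]] Y]
  note h2 = has_partials_add[OF has_partials_cross[OF u has_partials_cross[OF hNx N_partials]] X]
  have mixed: "d_theta T Nx p = d_t T Ny p"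
    by (rule mixed_partials_eq[OF T_pos N_partials hNx hNy is_C1_partials(2)[OF T_pos NxNy_C1(2)] p])
  have 1: "d_t T Pw p = u p \<times> (N p \<times> d_t T Ny p + Nx p \<times> Ny p) + X p \<times> (N p \<times> Ny p) - Xy p"
    using has_partials_unique(1)[OF T_pos h1 p] by (simp add: Pw_def[abs_def])
  have 2: "d_theta T Qw p = u p \<times> (Nx p \<times> Ny p + d_t T Ny p \<times> N p) + Y p \<times> (Nx p \<times> N p) + Xy p"
    using has_partials_unique(2)[OF T_pos h2 p] by (simp add: Qw_def[abs_def] mixed)
  have "X p \<times> (N p \<times> Ny p) = - m p *\<^sub>R N p"
    by (simp add: Lagrange N_frame[OF p] shape_products[OF p] inner_commute[of "X p" "Ny p"])
  moreover have "Y p \<times> (Nx p \<times> N p) = m p *\<^sub>R N p"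
    by (simp add: Lagrange N_frame[OF p] shape_products[OF p] inner_commute[of "Y p" "Nx p"])
  moreover have "d_t T Ny p \<times> N p = - (N p \<times> d_t T Ny p)" by (rule cross_skew)
  ultimately have "d_t T Pw p + d_theta T Qw p = 2 *\<^sub>R (u p \<times> (Nx p \<times> Ny p))"
    unfolding 1 2 by (simp add: cross_add_right Cross3.right_diff_distrib scaleR_2)
  then show ?thesis by (simp add: cross_normal_derivatives[OF p] w_def cross_mult_right)
qed

lemma u_dot_N_boundary:
  assumes s: "s \<in> {1, -1}"
  shows "u (s * T, \<theta>) \<bullet> N (s * T, \<theta>) = 0"
proof -
  have p: "(s * T, \<theta>) \<in> strip T" using s T_pos by auto
  have "(s * norm (Y (s * T, \<theta>))) * (u (s * T, \<theta>) \<bullet> N (s * T, \<theta>)) = 0"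
    using flux_gram(5)[OF p] flux_boundary[OF s, of \<theta>] by simp
  moreover have "Y (s * T, \<theta>) \<noteq> 0" using regular[OF p] by auto
  ultimately show ?thesis using s by auto
qed

text \<open>
  Rotations preserve the ball, so \<open>w\<close> satisfies the linearized boundary condition. In formulas:
  along the boundary curve \<open>u \<bullet> N = 0\<close>, hence \<open>u \<bullet> Ny = 0\<close>, which reduces the flux to \<open>- Y = P \<times> N\<close>.
\<close>
lemma w_boundary:
  assumes s: "s \<in> {1, -1}"
  shows "Pw (s * T, \<theta>) = (s * norm (Y (s * T, \<theta>))) *\<^sub>R w (s * T, \<theta>)"
proof -
  let ?p = "(s * T, \<theta>)"
  have p: "?p \<in> strip T" and sT: "s * T \<in> {-T..T}" using s T_pos by auto
  have "((\<lambda>\<theta>. u (s * T, \<theta>) \<bullet> N (s * T, \<theta>)) has_vector_derivative u ?p \<bullet> Ny ?p + Y ?p \<bullet> N ?p) (at \<theta>)"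
    by (rule has_partials_theta[OF has_partials_inner[OF u N_partials] sT])
  then have "((\<lambda>\<theta>. 0::real) has_vector_derivative u ?p \<bullet> Ny ?p + Y ?p \<bullet> N ?p) (at \<theta>)"
    by (simp add: u_dot_N_boundary[OF s])
  then have "u ?p \<bullet> Ny ?p + Y ?p \<bullet> N ?p = 0"
    using has_vector_derivative_const vector_derivative_unique_at by blast
  then have "u ?p \<bullet> Ny ?p = 0" by (simp add: N_frame[OF p])
  then have "Pw ?p = - Y ?p" by (simp add: Pw_def Lagrange u_dot_N_boundary[OF s])
  also have "\<dots> = P ?p \<times> N ?p"
    unfolding triple_products(1)[OF p] cross_skew[of _ "N ?p"] by (simp add: Lagrange N_frame[OF p])
  also have "\<dots> = (s * norm (Y ?p)) *\<^sub>R w ?p"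
    by (simp add: flux_boundary[OF s] w_def cross_mult_left)
  finally show ?thesis .
qed

lemma rotation_C1_annulus:
  "C1_annulus T (\<lambda>p. v \<bullet> w p) (\<lambda>p. v \<bullet> (u p \<times> Nx p + X p \<times> N p)) (\<lambda>p. v \<bullet> (u p \<times> Ny p + Y p \<times> N p))"
proof -
  note c = is_C1_continuous[OF XY_C1(1)] is_C1_continuous[OF XY_C1(2)] is_C1_continuous[OF XY_C1(3)]
    is_C1_continuous[OF N_C1] is_C1_continuous[OF NxNy_C1(1)] is_C1_continuous[OF NxNy_C1(2)]
  have "continuous_on (strip T) (\<lambda>p. v \<bullet> (u p \<times> Nx p + X p \<times> N p))"
    "continuous_on (strip T) (\<lambda>p. v \<bullet> (u p \<times> Ny p + Y p \<times> N p))"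
    by (intro continuous_intros continuous_on_cross c)+
  then show ?thesis
    using has_partials_linear[OF bounded_linear_inner_right w_partials, of v]
    by (auto simp: C1_annulus_def w_def periodic N_periodic)
qed

lemma energy_add_rotation:
  assumes \<psi>: "C1_annulus T \<psi> \<psi>x \<psi>y"
  shows "energy T a b c (\<lambda>p. 2 * k p) (\<lambda>p. norm (Y p)) (\<lambda>p. v \<bullet> w p + \<psi> p)
      (\<lambda>p. v \<bullet> (u p \<times> Nx p + X p \<times> N p) + \<psi>x p) (\<lambda>p. v \<bullet> (u p \<times> Ny p + Y p \<times> N p) + \<psi>y p)
    = energy T a b c (\<lambda>p. 2 * k p) (\<lambda>p. norm (Y p)) \<psi> \<psi>x \<psi>y"
proof (rule energy_add_null[OF T_pos rotation_C1_annulus \<psi>])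
  have C1: "is_C1 T Pw" "is_C1 T Qw"
    unfolding Pw_def[abs_def] Qw_def[abs_def]
    by (intro is_C1_add is_C1_diff is_C1_cross XY_C1 N_C1 NxNy_C1)+
  note hP = is_C1_partials(1)[OF T_pos C1(1)] and hQ = is_C1_partials(1)[OF T_pos C1(2)]
  let ?P = "\<lambda>p. v \<bullet> Pw p" and ?Q = "\<lambda>p. v \<bullet> Qw p"
  show "is_C1 T ?P" "is_C1 T ?Q" by (intro is_C1_inner is_C1_const C1)+
  show "?Q (t, \<theta> + 2 * pi) = ?Q (t, \<theta>)" if "t \<in> {-T..T}" for t \<theta>
    by (simp add: Qw_def periodic[OF that] N_periodic[OF that] NxNy_periodic[OF that] XY_periodic[OF that])
  show "?P p = a p * (v \<bullet> (u p \<times> Nx p + X p \<times> N p)) + b p * (v \<bullet> (u p \<times> Ny p + Y p \<times> N p))"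
    "?Q p = b p * (v \<bullet> (u p \<times> Nx p + X p \<times> N p)) + c p * (v \<bullet> (u p \<times> Ny p + Y p \<times> N p))" if "p \<in> strip T" for p
    unfolding w_flux[OF that, symmetric] by (simp_all only: inner_add_right inner_scaleR_right)
  show "d_t T ?P p + d_theta T ?Q p = 2 * k p * (v \<bullet> w p)" if p: "p \<in> strip T" for p
    using has_partials_unique(1)[OF T_pos has_partials_linear[OF bounded_linear_inner_right hP] p]
      has_partials_unique(2)[OF T_pos has_partials_linear[OF bounded_linear_inner_right hQ] p]
      w_jacobi[OF p] by (simp flip: inner_add_right)
  show "?P (T, \<theta>) = norm (Y (T, \<theta>)) * (v \<bullet> w (T, \<theta>))" for \<theta>
    using w_boundary[of 1 \<theta>] by simp
  show "?P (-T, \<theta>) = - norm (Y (-T, \<theta>)) * (v \<bullet> w (-T, \<theta>))" for \<theta>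
    using w_boundary[of "-1" \<theta>] by simp
qed (auto intro!: coefficients_continuous continuous_intros is_C1_continuous[OF k_C1])

lemma energy_potential:
  assumes f: "C1_annulus T f fx fy"
  shows "energy T a b c (\<lambda>p. 2 * k p) (\<lambda>p. norm (Y p)) f fx fy
    = energy T a b c (\<lambda>_. 0) (\<lambda>p. norm (Y p)) f fx fy + integral (rect T) (\<lambda>p. 2 * k p * (f p)\<^sup>2)"
proof -
  have cf: "continuous_on (strip T) f" "continuous_on (strip T) fx" "continuous_on (strip T) fy"
    using f by (auto simp: C1_annulus_def intro: has_partials_continuous)
  have "integral (rect T) (\<lambda>p. a p * (fx p)\<^sup>2 + 2 * b p * (fx p * fy p) + c p * (fy p)\<^sup>2 + 0 * (f p)\<^sup>2)
      + integral (rect T) (\<lambda>p. 2 * k p * (f p)\<^sup>2)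
    = integral (rect T) (\<lambda>p. (a p * (fx p)\<^sup>2 + 2 * b p * (fx p * fy p) + c p * (fy p)\<^sup>2 + 0 * (f p)\<^sup>2) + 2 * k p * (f p)\<^sup>2)"
    by (rule integral_add[symmetric])
      (intro rect_integrable continuous_intros cf coefficients_continuous is_C1_continuous[OF k_C1])+
  then show ?thesis by (simp add: energy_def)
qed

lemma strip_to_rect:
  assumes "p \<in> strip T"
  obtains q where "q \<in> rect T" "u p = u q"
proof -
  obtain t \<theta> where p: "p = (t, \<theta>)" "t \<in> {-T..T}" using assms by (cases p) auto
  obtain \<theta>' where "\<theta>' \<in> {0..2 * pi}" "u (t, \<theta>) = u (t, \<theta>')"
    using periodic_reduce[of "\<lambda>\<theta>. u (t, \<theta>)" \<theta>, OF periodic[OF p(2)]] by auto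
  then show ?thesis using p that[of "(t, \<theta>')"] by (auto simp: cbox_Pair_eq)
qed

text \<open>
  Otherwise \<open>v\<close> would be normal to the surface everywhere, and the second fundamental form would
  vanish.
\<close>
lemma not_planar:
  assumes v: "v \<noteq> 0" and plane: "\<And>p. p \<in> rect T \<Longrightarrow> v \<bullet> u p = 0" and k: "\<And>p. p \<in> rect T \<Longrightarrow> k p \<noteq> 0"
  shows False
proof -
  note vu = has_partials_linear[OF bounded_linear_inner_right u, of v]
    and vX = has_partials_linear[OF bounded_linear_inner_right X, of v]
    and vY = has_partials_linear[OF bounded_linear_inner_right Y, of v]
  have zero: "has_partials T (\<lambda>_. 0) (\<lambda>_. 0) (\<lambda>_. 0::real)" by (rule has_partials_const)
  have 0: "v \<bullet> u p = 0" if p: "p \<in> strip T" for p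
  proof -
    obtain q where "q \<in> rect T" "u p = u q" by (rule strip_to_rect[OF p])
    then show ?thesis using plane by simp
  qed
  have 1: "v \<bullet> X p = 0" "v \<bullet> Y p = 0" if "p \<in> strip T" for p
    using has_partials_eq[OF T_pos vu zero 0 that] by auto
  have 2: "v \<bullet> Xx p = 0" "v \<bullet> Xy p = 0" "v \<bullet> Yy p = 0" if "p \<in> strip T" for p
    using has_partials_eq[OF T_pos vX zero 1(1) that] has_partials_eq[OF T_pos vY zero 1(2) that] by auto
  define p where "p = (0::real, 0::real)"
  have p: "p \<in> strip T" "p \<in> rect T" using T_pos by (auto simp: p_def cbox_Pair_eq)
  have vN: "v = (v \<bullet> N p) *\<^sub>R N p"
    by (rule frame_eq[OF p(1)]) (simp_all add: 1[OF p(1)] N_frame[OF p(1)])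
  have nz: "v \<bullet> N p \<noteq> 0"
  proof
    assume "v \<bullet> N p = 0"
    then have "(v \<bullet> N p) *\<^sub>R N p = 0" by simp
    from trans[OF vN this] show False using v by simp
  qed
  have "v \<bullet> z = (v \<bullet> N p) * (N p \<bullet> z)" for z
    by (rule trans[OF arg_cong[OF vN, of "\<lambda>v. v \<bullet> z"]]) simp
  from this[of "Xx p"] this[of "Xy p"]
  have "(v \<bullet> N p) * l p = v \<bullet> Xx p" "(v \<bullet> N p) * m p = v \<bullet> Xy p"
    unfolding l_def m_def by (simp_all only:)
  then have "l p = 0" "m p = 0" using 2[OF p(1)] nz by auto
  then show False using k[OF p(2)] by (simp add: k_def)
qed

text \<open>
  The functions \<open>v \<bullet> w\<close> lie in the kernel of the second variation, which is not positive on the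
  functions \<open>d \<bullet> u + s\<close>. These are seven parameters, so some nonzero choice satisfies the six
  conditions for coercivity. Its energy is then both nonnegative and nonpositive, which forces \<open>v \<bullet>
  w + d \<bullet> u + s = 0\<close>, \<open>s = 0\<close> and, since the curvature is negative, \<open>d \<bullet> u = 0\<close>. As the surface is
  not planar, \<open>v \<noteq> 0\<close>.
\<close>
lemma exists_tangent_rotation:
  assumes T: "T = critical_T" and \<delta>: "\<delta> > 0"
    and kneg: "\<And>p. p \<in> rect critical_T \<Longrightarrow> k p < 0"
    and coercive: "\<And>f fx fy. C1_annulus critical_T f fx fy \<Longrightarrow>
      (\<And>s. s \<in> {critical_T / 2, - critical_T / 2} \<Longrightarrow> harmonic0 (\<lambda>\<theta>. f (s, \<theta>)) = 0
        \<and> harmonic_cos (\<lambda>\<theta>. f (s, \<theta>)) = 0 \<and> harmonic_sin (\<lambda>\<theta>. f (s, \<theta>)) = 0) \<Longrightarrow>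
      \<delta> * h1_norm2 f fx fy \<le> energy critical_T a b c (\<lambda>p. 2 * k p) (\<lambda>p. norm (Y p)) f fx fy"
  obtains v where "v \<noteq> 0" "\<And>p. p \<in> rect T \<Longrightarrow> v \<bullet> w p = 0"
proof -
  let ?f = "\<lambda>x p. fst x \<bullet> w p + (fst (snd x) \<bullet> u p + snd (snd x)) :: real"
  let ?H = "\<lambda>x s. (harmonic0 (\<lambda>\<theta>. ?f x (s, \<theta>)), harmonic_cos (\<lambda>\<theta>. ?f x (s, \<theta>)), harmonic_sin (\<lambda>\<theta>. ?f x (s, \<theta>)))"
  let ?L = "\<lambda>x. (?H x (critical_T / 2), ?H x (- critical_T / 2))"
  have cw: "continuous_on (strip T) w" by (rule has_partials_continuous[OF w_partials])
  have cu: "continuous_on {0..2 * pi} (\<lambda>\<theta>. ?f x (t, \<theta>))" if "t \<in> {-T..T}" for x t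
    by (intro continuous_intros strip_slice_continuous(1)[OF has_partials_continuous[OF u] that]
        strip_slice_continuous(1)[OF cw that])
  have mem: "critical_T / 2 \<in> {-T..T}" "- critical_T / 2 \<in> {-T..T}"
    using critical_T_pos by (auto simp: T)
  have lin: "linear ?L"
  proof (rule linearI)
    fix x y :: "(real^3) \<times> (real^3) \<times> real" and r :: real
    have e: "?f (x + y) p = ?f x p + ?f y p" "?f (r *\<^sub>R x) p = r * ?f x p" for p
      by (simp_all add: inner_add_left algebra_simps)
    show "?L (x + y) = ?L x + ?L y"
      unfolding e by (simp only: harmonic_linear(1-3)[OF cu[OF mem(1)] cu[OF mem(1)]]
          harmonic_linear(1-3)[OF cu[OF mem(2)] cu[OF mem(2)]] add_Pair)
    show "?L (r *\<^sub>R x) = r *\<^sub>R ?L x"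
      unfolding e by (simp only: harmonic_linear(4-6)[OF cu[OF mem(1)] cu[OF mem(1)]]
          harmonic_linear(4-6)[OF cu[OF mem(2)] cu[OF mem(2)]] scaleR_Pair real_scaleR_def)
  qed
  have d: "dim (UNIV :: ((real^3) * (real^3) * real) set) > DIM((real * real * real) * (real * real * real))"
    by simp
  obtain x where x: "x \<noteq> 0" "?L x = 0"
    using linear_kernel_nontrivial[OF lin subspace_UNIV d] by blast
  obtain v d s where vds: "x = (v, d, s)" by (cases x)
  let ?g = "\<lambda>p. d \<bullet> u p + s" and ?gx = "\<lambda>p. d \<bullet> X p" and ?gy = "\<lambda>p. d \<bullet> Y p"
  let ?h = "\<lambda>p. v \<bullet> w p + (d \<bullet> u p + s)" and ?hx = "\<lambda>p. v \<bullet> (u p \<times> Nx p + X p \<times> N p) + d \<bullet> X p"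
    and ?hy = "\<lambda>p. v \<bullet> (u p \<times> Ny p + Y p \<times> N p) + d \<bullet> Y p"
  have Cg: "C1_annulus critical_T ?g ?gx ?gy" using affine_C1_annulus[of d s] by (simp add: T)
  have Ch: "C1_annulus critical_T ?h ?hx ?hy"
    using C1_annulus_add[OF rotation_C1_annulus Cg[folded T]] by (simp add: T)
  have n: "h1_norm2 ?h ?hx ?hy \<ge> 0" by (rule h1_norm2_nonneg[OF Ch])
  let ?M = "integral {0..2 * pi} (\<lambda>\<theta>. norm (Y (T, \<theta>)) + norm (Y (-T, \<theta>)))"
  let ?K = "integral (rect T) (\<lambda>p. - (2 * k p * (?g p)\<^sup>2))"
  have "\<delta> * h1_norm2 ?h ?hx ?hy \<le> energy critical_T a b c (\<lambda>p. 2 * k p) (\<lambda>p. norm (Y p)) ?h ?hx ?hy"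
  proof (rule coercive[OF Ch])
    have z: "?H x (critical_T / 2) = (0, 0, 0)" "?H x (- critical_T / 2) = (0, 0, 0)"
      using x(2) by (simp_all add: zero_prod_def)
    fix r assume r: "r \<in> {critical_T / 2, - critical_T / 2}"
    then have "?H x r = (0, 0, 0)" by (elim insertE emptyE) (simp_all only: z)
    then show "harmonic0 (\<lambda>\<theta>. ?h (r, \<theta>)) = 0 \<and> harmonic_cos (\<lambda>\<theta>. ?h (r, \<theta>)) = 0 \<and> harmonic_sin (\<lambda>\<theta>. ?h (r, \<theta>)) = 0"
      by (simp add: vds)
  qed
  also have "\<dots> = energy T a b c (\<lambda>p. 2 * k p) (\<lambda>p. norm (Y p)) ?g ?gx ?gy"
    using energy_add_rotation[OF Cg[folded T], of v] by (simp only: T)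
  also have "\<dots> = - s\<^sup>2 * ?M - ?K"
    unfolding energy_potential[OF Cg[folded T]] energy_affine by simp
  finally have le: "\<delta> * h1_norm2 ?h ?hx ?hy + s\<^sup>2 * ?M + ?K \<le> 0" by simp
  have cK: "continuous_on (strip T) (\<lambda>p. - (2 * k p * (?g p)\<^sup>2))"
    by (intro continuous_intros is_C1_continuous[OF k_C1] has_partials_continuous[OF u])
  have Kpos: "- (2 * k p * (?g p)\<^sup>2) \<ge> 0" if "p \<in> rect T" for p
    using kneg[of p] that by (simp add: T mult_le_0_iff)
  have K: "?K \<ge> 0" by (rule integral_nonneg[OF rect_integrable[OF cK] Kpos])
  have sM: "s\<^sup>2 * ?M \<ge> 0" using boundary_length_pos by simp
  have \<delta>h: "\<delta> * h1_norm2 ?h ?hx ?hy \<ge> 0" using n \<delta> by simp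
  have "s\<^sup>2 * ?M = 0" "?K = 0" "\<delta> * h1_norm2 ?h ?hx ?hy = 0" using le K sM \<delta>h by linarith+
  then have "s = 0" "h1_norm2 ?h ?hx ?hy \<le> 0" using boundary_length_pos \<delta> by auto
  have g0: "?g p = 0" if p: "p \<in> rect T" for p
  proof -
    have c': "continuous_on (rect T) (\<lambda>p. - (2 * k p * (?g p)\<^sup>2))"
      by (rule continuous_on_subset[OF cK rect_subset_strip])
    have "((\<lambda>p. - (2 * k p * (?g p)\<^sup>2)) has_integral 0) (rect T)"
      using integrable_integral[OF rect_integrable[OF cK]] \<open>?K = 0\<close> by simp
    then have "- (2 * k p * (?g p)\<^sup>2) = 0"
      by (rule has_integral_0_cbox_imp_0[OF c' Kpos, rotated])
        (use p T_pos box_subset_cbox in \<open>auto simp: box_ne_empty Basis_prod_def\<close>)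
    then show ?thesis using kneg[of p] p by (simp add: T)
  qed
  have "v \<noteq> 0"
  proof
    assume "v = 0"
    then have "d \<noteq> 0" using x(1) vds \<open>s = 0\<close> by (auto simp: zero_prod_def)
    moreover have "d \<bullet> u p = 0" if "p \<in> rect T" for p using g0[OF that] \<open>s = 0\<close> by simp
    moreover have "k p \<noteq> 0" if "p \<in> rect T" for p using kneg[of p] that unfolding T by simp
    ultimately show False by (rule not_planar)
  qed
  moreover have "v \<bullet> w p = 0" if p: "p \<in> rect T" for p
    using h1_norm2_zero_imp[OF Ch \<open>h1_norm2 ?h ?hx ?hy \<le> 0\<close>, of p] g0[OF p] p by (simp add: T)
  ultimately show thesis by (rule that)
qed

end

section \<open>Rotational free boundary minimal surfaces\<close>

text \<open>
  On the positive axis both \<open>coth\<close> and \<open>- id\<close> decrease.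
\<close>
lemma coth_minus_id_inj:
  fixes s s' :: real
  assumes s: "s > 0" "s' > 0" and eq: "cosh s / sinh s - s = cosh s' / sinh s' - s'"
  shows "s = s'"
proof -
  have less: "cosh y / sinh y < cosh x / sinh x" if "0 < x" "x < y" for x y :: real
  proof -
    have "sinh (y - x) > 0" using that by simp
    then have "cosh y * sinh x < cosh x * sinh y" by (simp add: sinh_diff mult.commute)
    then show ?thesis using that by (simp add: divide_simps)
  qed
  show ?thesis using less[of s s'] less[of s' s] s eq by (cases s s' rule: linorder_cases) auto
qed

text \<open>
  Here \<open>C\<close> and \<open>d\<close> are the scale and the centre of a catenoid, \<open>s\<close> and \<open>s'\<close> its boundary parameters.
  In \<open>y = sinh\<^sup>2 s\<close>, hypothesis \<open>h\<close> says \<open>2 + y + 1 / y = 1 / C\<^sup>2\<close>. The left-hand side is injective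
  for \<open>y > 1\<close>, which is what \<open>small\<close> gives, so \<open>s' = - s\<close>; then \<open>k\<close> yields \<open>coth s = s\<close>.
\<close>
lemma critical_parameters:
  fixes s s' C d :: real
  assumes C: "C > 0" and s: "s > 0" "s' < 0"
    and k: "C * s + d = C * (cosh s / sinh s)" "C * s' + d = C * (cosh s' / sinh s')"
    and h: "(C * cosh s)\<^sup>2 + (C * (cosh s / sinh s))\<^sup>2 = 1" "(C * cosh s')\<^sup>2 + (C * (cosh s' / sinh s'))\<^sup>2 = 1"
    and small: "(C * (cosh s / sinh s))\<^sup>2 < 1 / 2" "(C * (cosh s' / sinh s'))\<^sup>2 < 1 / 2"
  shows "s = critical_T" "s' = - critical_T" "d = 0" "C = 1 / sqrt ((cosh critical_T)\<^sup>2 + critical_T\<^sup>2)"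
proof -
  have sinh_gt: "(sinh x)\<^sup>2 > 1"
    if "x \<noteq> 0" "(C * cosh x)\<^sup>2 + (C * (cosh x / sinh x))\<^sup>2 = 1" "(C * (cosh x / sinh x))\<^sup>2 < 1 / 2" for x
  proof -
    have y: "(sinh x)\<^sup>2 > 0" using that(1) by simp
    have pos: "(C * cosh x)\<^sup>2 > 0" using C by simp
    have "(C * (cosh x / sinh x))\<^sup>2 < (C * cosh x)\<^sup>2" using that(2,3) by linarith
    then have "(C * cosh x)\<^sup>2 / (sinh x)\<^sup>2 < (C * cosh x)\<^sup>2" by (simp add: power_divide)
    then have "(C * cosh x)\<^sup>2 * 1 < (C * cosh x)\<^sup>2 * (sinh x)\<^sup>2" using y by (simp add: divide_less_eq)
    then show ?thesis using pos by simp
  qed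
  define y y' where "y = (sinh s)\<^sup>2" and "y' = (sinh s')\<^sup>2"
  have y: "y > 1" "y' > 1"
    using sinh_gt[OF _ h(1) small(1)] sinh_gt[OF _ h(2) small(2)] s by (auto simp: y_def y'_def)
  have e: "C\<^sup>2 * (2 + y + 1 / y) = 1" "C\<^sup>2 * (2 + y' + 1 / y') = 1"
  proof -
    have alg: "C\<^sup>2 * (Y + 1) + C\<^sup>2 * ((Y + 1) / Y) = C\<^sup>2 * (2 + Y + 1 / Y)" if "Y > 1" for Y
      using that by (simp add: field_simps)
    show "C\<^sup>2 * (2 + y + 1 / y) = 1" "C\<^sup>2 * (2 + y' + 1 / y') = 1"
      using h unfolding power_mult_distrib power_divide cosh_square_eq y_def[symmetric] y'_def[symmetric]
        alg[OF y(1)] alg[OF y(2)] by simp_all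
  qed
  then have "C\<^sup>2 * (2 + y + 1 / y) = C\<^sup>2 * (2 + y' + 1 / y')" by simp
  then have "2 + y + 1 / y = 2 + y' + 1 / y'" using C by simp
  then have "y * y * y' + y' = y' * y' * y + y" using y by (simp add: field_simps)
  then have "(y - y') * (y * y' - 1) = 0" by algebra
  moreover have "y * y' > 1" using y by (simp add: less_1_mult)
  ultimately have "y = y'" by simp
  then have "sinh s = sinh s' \<or> sinh s = - sinh s'" unfolding y_def y'_def power2_eq_iff .
  then have "sinh s = sinh (- s')" using s by auto
  then have ss': "s = - s'" by (simp only: strict_mono_eq[OF sinh_real_strict_mono])
  have s'eq: "s' = - s" using ss' by simp
  have "C * (cosh s / sinh s) = C * s"
    using k unfolding s'eq cosh_minus sinh_minus divide_minus_right mult_minus_right by linarith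
  then have cs: "cosh s / sinh s = s" using C by (metis less_irrefl mult_left_cancel)
  then have "s > 0 \<and> s = cosh s / sinh s" using s by simp
  then show sT: "s = critical_T"
    using critical_T_ex1 critical_T_pos critical_T_eq by blast
  then show "s' = - critical_T" using ss' by simp
  show "d = 0" using k(1) unfolding cs by simp
  have "C\<^sup>2 * ((cosh critical_T)\<^sup>2 + critical_T\<^sup>2) = 1"
    using h(1) critical_T_eq unfolding sT by (simp add: power_mult_distrib distrib_left)
  then have "(C * sqrt ((cosh critical_T)\<^sup>2 + critical_T\<^sup>2))\<^sup>2 = 1\<^sup>2" by (simp add: power_mult_distrib)
  then have "C * sqrt ((cosh critical_T)\<^sup>2 + critical_T\<^sup>2) = 1"
    by (subst (asm) power2_eq_iff_nonneg) (use C in auto)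
  then show "C = 1 / sqrt ((cosh critical_T)\<^sup>2 + critical_T\<^sup>2)"
    by (metis eq_divide_imp mult_zero_right zero_neq_one)
qed

lemma tanh_artanh:
  fixes x :: real
  assumes "\<bar>x\<bar> < 1"
  shows "tanh (artanh x) = x"
proof -
  have x: "1 + x > 0" "1 - x > 0" using assms by (auto simp: abs_less_iff)
  define y where "y = (1 + x) / (1 - x)"
  have y: "y > 0" using x by (simp add: y_def)
  have "exp (- 2 * artanh x) = inverse y"
    using y by (simp add: artanh_def y_def[symmetric] exp_minus)
  then have "tanh (artanh x) = (1 - inverse y) / (1 + inverse y)" by (simp add: tanh_real_altdef)
  also have "inverse y = (1 - x) / (1 + x)" by (simp add: y_def)
  also have "(1 - (1 - x) / (1 + x)) / (1 + (1 - x) / (1 + x)) = x" using x by (simp add: field_simps)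
  finally show ?thesis .
qed

text \<open>
  The field \<open>e \<times> u\<close> of rotations about the axis \<open>e\<close> is tangent to the surface. The last assumption
  is what remains of closeness to the critical catenoid: midpoints of opposite boundary points are
  low.
\<close>
locale rotational_surface = free_boundary_surface_3 +
  fixes e :: "real^3"
  assumes unit: "e \<bullet> e = 1"
    and tangent: "\<And>p. p \<in> strip T \<Longrightarrow> e \<bullet> w p = 0"
    and curved: "\<And>p. p \<in> strip T \<Longrightarrow> k p \<noteq> 0"
    and antipodal: "\<And>s \<theta>. s \<in> {1, -1} \<Longrightarrow> norm (u (s * T, \<theta>) + u (s * T, \<theta> + pi)) < sqrt 2"
begin

definition z :: "real \<times> real \<Rightarrow> real" where "z p = e \<bullet> u p"

definition \<nu> :: "real \<times> real \<Rightarrow> real" where "\<nu> p = e \<bullet> N p"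

text \<open>
  The horizontal part of \<open>u\<close>.
\<close>
definition h :: "real \<times> real \<Rightarrow> real^3" where "h p = u p - z p *\<^sub>R e"

text \<open>
  Up to sign and the factor \<open>2 \<pi>\<close>, the flux of the constant field \<open>e\<close> through the circle about the
  axis that passes through the point. On a minimal surface it does not depend on the circle.
\<close>
definition \<Phi> :: "real \<times> real \<Rightarrow> real" where "\<Phi> p = N p \<bullet> h p"

lemma e_h: "e \<bullet> h p = 0"
  by (simp add: h_def z_def inner_diff_right unit)

text \<open>
  Tangency \<open>e \<bullet> (u \<times> N) = 0\<close> says that the horizontal parts of \<open>u\<close> and \<open>N\<close> are parallel.
\<close>
lemma horizontal_parallel:
  assumes p: "p \<in> strip T"
  shows "(1 - (\<nu> p)\<^sup>2) *\<^sub>R h p = \<Phi> p *\<^sub>R (N p - \<nu> p *\<^sub>R e)"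
    and "(h p \<bullet> h p) *\<^sub>R (N p - \<nu> p *\<^sub>R e) = \<Phi> p *\<^sub>R h p"
    and "(h p \<bullet> h p) * (1 - (\<nu> p)\<^sup>2) = (\<Phi> p)\<^sup>2"
proof -
  let ?n = "N p - \<nu> p *\<^sub>R e"
  have en: "e \<bullet> ?n = 0" by (simp add: \<nu>_def inner_diff_right unit)
  have "e \<times> (?n \<times> h p) = 0" using en by (simp add: Lagrange e_h)
  moreover have "e \<bullet> (?n \<times> h p) = 0"
  proof -
    have "e \<bullet> (?n \<times> h p) = - (e \<bullet> w p)"
      by (simp add: h_def w_def Cross3.left_diff_distrib Cross3.right_diff_distrib cross_mult_left cross_mult_right
          inner_diff_right dot_cross_self cross_skew[of "N p" "u p"])
    then show ?thesis by (simp add: tangent[OF p])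
  qed
  ultimately have "e = 0 \<or> ?n \<times> h p = 0" using norm_and_cross_eq_0 by blast
  then have par: "?n \<times> h p = 0" "h p \<times> ?n = 0" using unit cross_skew[of "h p" ?n] by auto
  have nn: "?n \<bullet> ?n = 1 - (\<nu> p)\<^sup>2"
    by (simp add: inner_diff_left inner_diff_right N_frame[OF p] unit inner_commute[of "N p" e]
        flip: \<nu>_def) (simp add: power2_eq_square)
  have nh: "?n \<bullet> h p = \<Phi> p" "h p \<bullet> ?n = \<Phi> p"
    by (simp_all add: \<Phi>_def inner_diff_left inner_diff_right e_h inner_commute[of "h p"])
  have "?n \<times> (?n \<times> h p) = 0" using par by simp
  then show 1: "(1 - (\<nu> p)\<^sup>2) *\<^sub>R h p = \<Phi> p *\<^sub>R ?n"
    unfolding Lagrange nn nh by simp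
  have "h p \<times> (h p \<times> ?n) = 0" using par by simp
  then show "(h p \<bullet> h p) *\<^sub>R ?n = \<Phi> p *\<^sub>R h p"
    unfolding Lagrange nh by simp
  have "h p \<bullet> ((1 - (\<nu> p)\<^sup>2) *\<^sub>R h p) = h p \<bullet> (\<Phi> p *\<^sub>R ?n)" by (simp only: 1)
  then show "(h p \<bullet> h p) * (1 - (\<nu> p)\<^sup>2) = (\<Phi> p)\<^sup>2"
    by (simp add: nh mult.commute power2_eq_square del: inner_diff_right)
qed

lemma ac_minus_b2:
  assumes p: "p \<in> strip T"
  shows "a p * c p - b p * b p = 1"
proof -
  have "a p * c p - b p * b p = ((X p \<bullet> X p) * (Y p \<bullet> Y p) - (X p \<bullet> Y p) * (X p \<bullet> Y p)) / (W p * W p)"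
    by (simp add: a_def b_def c_def diff_divide_distrib mult.commute)
  then show ?thesis unfolding W_square[OF p, symmetric] using W_pos[OF p] by simp
qed

text \<open>
  The field \<open>V = e \<times> u\<close> is tangent, and differentiating \<open>V \<bullet> N = 0\<close> gives the second fundamental
  form on \<open>V\<close>. As the Gauss map is anticonformal (\<open>normal_flux\<close>), this determines it on the profile
  direction \<open>N \<times> V\<close> too.
\<close>
lemma shape_on_profile:
  assumes p: "p \<in> strip T"
  shows "Nx p \<bullet> (N p \<times> (e \<times> u p)) = - (e \<bullet> X p)" "Ny p \<bullet> (N p \<times> (e \<times> u p)) = - (e \<bullet> Y p)"
proof -
  have tangent': "(\<lambda>p. e \<bullet> (u p \<times> N p)) q = 0" if "q \<in> strip T" for q
    using tangent[OF that] by (simp add: w_def)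
  note d = has_partials_eq[OF T_pos has_partials_linear[OF bounded_linear_inner_right has_partials_cross[OF u N_partials], of e]
      has_partials_const tangent' p]
  have t: "v \<bullet> (e \<times> u p) = e \<bullet> (u p \<times> v)" for v :: "real^3" by (simp add: cross3_simps)
  have neg: "X p \<times> N p = - Q p" "Y p \<times> N p = P p"
    using triple_products[OF p] cross_skew[of "X p" "N p"] by simp_all
  have V: "Nx p \<bullet> (e \<times> u p) = e \<bullet> Q p" "Ny p \<bullet> (e \<times> u p) = - (e \<bullet> P p)"
    using d unfolding t by (simp_all add: neg inner_add_right inner_diff_right)
  have r: "v \<bullet> (N p \<times> v') = v' \<bullet> (v \<times> N p)" for v v' :: "real^3" by (simp add: cross3_simps)
  have abc: "a p * c p = 1 + b p * b p" using ac_minus_b2[OF p] by simp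
  have "Nx p \<bullet> (N p \<times> (e \<times> u p)) = (e \<times> u p) \<bullet> (b p *\<^sub>R Nx p + c p *\<^sub>R Ny p)"
    unfolding r normal_flux(2)[OF p] ..
  also have "\<dots> = b p * (e \<bullet> Q p) - c p * (e \<bullet> P p)"
    using V by (simp add: inner_add_right inner_commute[of "e \<times> u p"])
  also have "\<dots> = (b p * b p - a p * c p) * (e \<bullet> X p)"
    by (simp add: P_def Q_def inner_add_right algebra_simps)
  finally show "Nx p \<bullet> (N p \<times> (e \<times> u p)) = - (e \<bullet> X p)" by (simp add: abc)
  have "Ny p \<bullet> (N p \<times> (e \<times> u p)) = - ((e \<times> u p) \<bullet> (a p *\<^sub>R Nx p + b p *\<^sub>R Ny p))"
    by (subst r, subst cross_skew[of "Ny p" "N p"], subst normal_flux(1)[OF p]) simp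
  also have "\<dots> = - (a p * (e \<bullet> Q p) - b p * (e \<bullet> P p))"
    using V by (simp add: inner_add_right inner_commute[of "e \<times> u p"])
  also have "\<dots> = - ((a p * c p - b p * b p) * (e \<bullet> Y p))"
    by (simp add: P_def Q_def inner_add_right algebra_simps)
  finally show "Ny p \<bullet> (N p \<times> (e \<times> u p)) = - (e \<bullet> Y p)" by (simp add: abc)
qed

text \<open>
  The profile direction is \<open>N \<times> (e \<times> u) = \<Phi> e - \<nu> h\<close>, and \<open>h = \<Phi> N - \<nu> (N \<times> (e \<times> u))\<close>. Substituting
  these turns \<open>shape_on_profile\<close> into equations for the components of the derivatives of \<open>N\<close> along
  \<open>h\<close> and \<open>e\<close>.
\<close>
lemma profile_equations:
  assumes p: "p \<in> strip T"
  shows "Nx p \<bullet> h p = \<nu> p * (e \<bullet> X p)" "Ny p \<bullet> h p = \<nu> p * (e \<bullet> Y p)"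
    "\<Phi> p * (e \<bullet> Nx p) = - (1 - (\<nu> p)\<^sup>2) * (e \<bullet> X p)" "\<Phi> p * (e \<bullet> Ny p) = - (1 - (\<nu> p)\<^sup>2) * (e \<bullet> Y p)"
proof -
  have eu: "e \<times> u p = e \<times> h p" by (simp add: h_def Cross3.right_diff_distrib cross_mult_right)
  have NV: "N p \<times> (e \<times> u p) = \<Phi> p *\<^sub>R e - \<nu> p *\<^sub>R h p"
    unfolding eu Lagrange by (simp add: \<Phi>_def \<nu>_def inner_commute[of "N p" e])
  have hT: "h p = \<Phi> p *\<^sub>R N p - \<nu> p *\<^sub>R (N p \<times> (e \<times> u p))"
    unfolding NV using horizontal_parallel(1)[OF p]
    by (simp add: algebra_simps power2_eq_square)
  have S: "v \<bullet> h p = - \<nu> p * (v \<bullet> (N p \<times> (e \<times> u p)))"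
    "v \<bullet> (N p \<times> (e \<times> u p)) = \<Phi> p * (e \<bullet> v) - \<nu> p * (v \<bullet> h p)" if "v \<bullet> N p = 0" for v
  proof -
    show "v \<bullet> h p = - \<nu> p * (v \<bullet> (N p \<times> (e \<times> u p)))"
      by (subst hT) (simp add: inner_diff_right that)
    show "v \<bullet> (N p \<times> (e \<times> u p)) = \<Phi> p * (e \<bullet> v) - \<nu> p * (v \<bullet> h p)"
      unfolding NV by (simp add: inner_diff_right inner_commute)
  qed
  note sx = S[OF shape_products(3)[OF p], unfolded shape_on_profile[OF p]]
    and sy = S[OF shape_products(6)[OF p], unfolded shape_on_profile[OF p]]
  show 1: "Nx p \<bullet> h p = \<nu> p * (e \<bullet> X p)" "Ny p \<bullet> h p = \<nu> p * (e \<bullet> Y p)"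
    using sx(1) sy(1) by simp_all
  show "\<Phi> p * (e \<bullet> Nx p) = - (1 - (\<nu> p)\<^sup>2) * (e \<bullet> X p)" "\<Phi> p * (e \<bullet> Ny p) = - (1 - (\<nu> p)\<^sup>2) * (e \<bullet> Y p)"
    using sx(2) sy(2) unfolding 1 by (simp_all add: power2_eq_square algebra_simps)
qed

lemma z_partials: "has_partials T z (\<lambda>p. e \<bullet> X p) (\<lambda>p. e \<bullet> Y p)"
  unfolding z_def[abs_def] by (rule has_partials_linear[OF bounded_linear_inner_right u])

lemma \<nu>_partials: "has_partials T \<nu> (\<lambda>p. e \<bullet> Nx p) (\<lambda>p. e \<bullet> Ny p)"
  unfolding \<nu>_def[abs_def] by (rule has_partials_linear[OF bounded_linear_inner_right N_partials])

lemma h_partials: "has_partials T h (\<lambda>p. X p - (e \<bullet> X p) *\<^sub>R e) (\<lambda>p. Y p - (e \<bullet> Y p) *\<^sub>R e)"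
  using has_partials_diff[OF u has_partials_scaleR[OF z_partials has_partials_const[of T e]]]
  by (simp add: h_def[abs_def])

lemma zero_partials_const:
  assumes f: "has_partials T f fx fy" and 0: "\<And>p. p \<in> strip T \<Longrightarrow> fx p = 0 \<and> fy p = 0"
    and p: "p \<in> strip T" "q \<in> strip T"
  shows "f p = f (q :: real \<times> real)"
proof -
  have "convex (strip T)" unfolding strip_def by (intro convex_Times) auto
  moreover have "(f has_derivative (\<lambda>h. 0)) (at x within strip T)" if "x \<in> strip T" for x
    using f 0[OF that] that unfolding has_partials_def by force
  ultimately show ?thesis using has_derivative_zero_unique[of "strip T" f p q] p by blast
qed

lemma \<Phi>_const:
  assumes "p \<in> strip T" "q \<in> strip T"
  shows "\<Phi> p = \<Phi> q"
proof (rule zero_partials_const[OF _ _ assms])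
  show "has_partials T \<Phi> (\<lambda>p. N p \<bullet> (X p - (e \<bullet> X p) *\<^sub>R e) + Nx p \<bullet> h p) (\<lambda>p. N p \<bullet> (Y p - (e \<bullet> Y p) *\<^sub>R e) + Ny p \<bullet> h p)"
    unfolding \<Phi>_def[abs_def] by (rule has_partials_inner[OF N_partials h_partials])
  fix p assume p: "p \<in> strip T"
  show "N p \<bullet> (X p - (e \<bullet> X p) *\<^sub>R e) + Nx p \<bullet> h p = 0 \<and> N p \<bullet> (Y p - (e \<bullet> Y p) *\<^sub>R e) + Ny p \<bullet> h p = 0"
    by (simp add: profile_equations[OF p] inner_diff_right N_frame[OF p] \<nu>_def inner_commute[of "N p" e])
qed

text \<open>
  If the flux vanishes, then \<open>(1 - \<nu>\<^sup>2) h = 0\<close> everywhere. Where \<open>\<nu>\<^sup>2 \<noteq> 1\<close> the derivative of this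
  makes \<open>X\<close> and \<open>Y\<close> both parallel to \<open>e\<close>; so \<open>N = \<plusminus> e\<close> and the surface is flat.
\<close>
lemma \<Phi>_nonzero:
  assumes p: "p \<in> strip T"
  shows "\<Phi> p \<noteq> 0"
proof
  assume "\<Phi> p = 0"
  then have zero: "\<Phi> q = 0" if "q \<in> strip T" for q using \<Phi>_const[OF that p] by simp
  have "has_partials T (\<lambda>q. (1 - \<nu> q * \<nu> q) *\<^sub>R h q)
      (\<lambda>q. (1 - \<nu> q * \<nu> q) *\<^sub>R (X q - (e \<bullet> X q) *\<^sub>R e) + (0 - (\<nu> q * (e \<bullet> Nx q) + (e \<bullet> Nx q) * \<nu> q)) *\<^sub>R h q)
      (\<lambda>q. (1 - \<nu> q * \<nu> q) *\<^sub>R (Y q - (e \<bullet> Y q) *\<^sub>R e) + (0 - (\<nu> q * (e \<bullet> Ny q) + (e \<bullet> Ny q) * \<nu> q)) *\<^sub>R h q)"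
    by (rule has_partials_scaleR[OF has_partials_diff[OF has_partials_const has_partials_mult[OF \<nu>_partials \<nu>_partials]] h_partials])
  moreover have hz: "(1 - \<nu> q * \<nu> q) *\<^sub>R h q = 0" if "q \<in> strip T" for q
    using horizontal_parallel(1)[OF that] zero[OF that] by (simp add: power2_eq_square)
  ultimately have d: "(1 - \<nu> q * \<nu> q) *\<^sub>R (X q - (e \<bullet> X q) *\<^sub>R e) + (0 - (\<nu> q * (e \<bullet> Nx q) + (e \<bullet> Nx q) * \<nu> q)) *\<^sub>R h q = 0"
    "(1 - \<nu> q * \<nu> q) *\<^sub>R (Y q - (e \<bullet> Y q) *\<^sub>R e) + (0 - (\<nu> q * (e \<bullet> Ny q) + (e \<bullet> Ny q) * \<nu> q)) *\<^sub>R h q = 0"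
    if "q \<in> strip T" for q
    using has_partials_eq[OF T_pos _ has_partials_const _ that] by blast+
  have \<nu>1: "\<nu> q * \<nu> q = 1" if q: "q \<in> strip T" for q
  proof (rule ccontr)
    assume ne: "\<nu> q * \<nu> q \<noteq> 1"
    then have "h q = 0" using hz[OF q] by simp
    then have XY: "X q = (e \<bullet> X q) *\<^sub>R e" "Y q = (e \<bullet> Y q) *\<^sub>R e" using d[OF q] ne by simp_all
    have "X q \<times> Y q = 0" by (subst XY(1), subst XY(2)) (simp add: cross_mult_left cross_mult_right)
    then show False using N_frame(3)[OF q] W_pos[OF q] by (simp add: cross_eq_W_N[OF q])
  qed
  have Ne: "N q = \<nu> q *\<^sub>R e" if q: "q \<in> strip T" for q
  proof -
    have "(N q - \<nu> q *\<^sub>R e) \<bullet> (N q - \<nu> q *\<^sub>R e) = 1 - \<nu> q * \<nu> q"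
      by (simp add: inner_diff_left inner_diff_right N_frame[OF q] unit inner_commute[of "N q" e] flip: \<nu>_def)
    then show ?thesis using \<nu>1[OF q] by simp
  qed
  have "Nx p = (e \<bullet> Nx p) *\<^sub>R e"
    using has_partials_eq(1)[OF T_pos N_partials has_partials_scaleR[OF \<nu>_partials has_partials_const] Ne p] by simp
  moreover have "\<nu> p * (e \<bullet> Nx p) = 0"
    using shape_products(3)[OF p] unfolding Ne[OF p] by (simp add: inner_commute)
  then have "e \<bullet> Nx p = 0" using \<nu>1[OF p] by auto
  ultimately have "Nx p = 0" by simp
  then have "l p = 0" "m p = 0" using shape_products(1,2)[OF p] by auto
  then show False using curved[OF p] by (simp add: k_def)
qed

lemma \<nu>_lt_1:
  assumes p: "p \<in> strip T"
  shows "h p \<bullet> h p > 0" "(\<nu> p)\<^sup>2 < 1"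
proof -
  have pos: "(h p \<bullet> h p) * (1 - (\<nu> p)\<^sup>2) > 0"
    unfolding horizontal_parallel(3)[OF p] using \<Phi>_nonzero[OF p] by simp
  then have "h p \<bullet> h p \<noteq> 0" by auto
  then show hp: "h p \<bullet> h p > 0" using inner_ge_zero[of "h p"] by linarith
  show "(\<nu> p)\<^sup>2 < 1" using pos hp by (simp add: zero_less_mult_iff)
qed

text \<open>
  On the boundary the rotation field is tangent to the sphere and to the surface, hence to the boundary
  curve. So the height is constant along each boundary curve, and equal to the height of the midpoint of
  two opposite points.
\<close>
lemma low_boundary:
  assumes p: "p \<in> strip T" and bd: "\<bar>fst p\<bar> = T"
  shows "(e \<bullet> u p)\<^sup>2 < 1 / 2"
proof -
  obtain s where s: "s \<in> {1, -1}" "p = (s * T, snd p)"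
  proof (cases "fst p \<ge> 0")
    case True
    then show ?thesis using that[of 1] bd by (simp add: prod_eq_iff)
  next
    case False
    then show ?thesis using that[of "-1"] bd by (simp add: prod_eq_iff)
  qed
  have st: "(s * T, \<theta>) \<in> strip T" "s * T \<in> {-T..T}" for \<theta> using s(1) T_pos by auto
  have eY: "e \<bullet> Y q = 0" if q: "q = (s * T, \<theta>)" for q \<theta>
  proof -
    have qS: "q \<in> strip T" using st q by simp
    let ?V = "e \<times> u q"
    have "?V \<bullet> N q = e \<bullet> w q" by (simp add: w_def cross3_simps)
    then have VN: "?V \<bullet> N q = 0" using tangent[OF qS] by simp
    have VP: "?V \<bullet> P q = 0" using flux_boundary[OF s(1), of \<theta>] by (simp add: q dot_cross_self)
    have "P q \<times> N q = - Y q"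
      unfolding triple_products(1)[OF qS] cross_skew[of _ "N q"] by (simp add: Lagrange N_frame[OF qS])
    then have "?V \<times> (- Y q) = 0" using VN VP Lagrange[of ?V "P q" "N q"] by simp
    then have "?V \<times> (?V \<times> Y q) = 0" by simp
    then have "(?V \<bullet> ?V) *\<^sub>R Y q = (?V \<bullet> Y q) *\<^sub>R ?V" by (simp add: Lagrange)
    then have "e \<bullet> ((?V \<bullet> ?V) *\<^sub>R Y q) = e \<bullet> ((?V \<bullet> Y q) *\<^sub>R ?V)" by (simp only:)
    then have prod: "(?V \<bullet> ?V) * (e \<bullet> Y q) = 0" by (simp add: dot_cross_self)
    have "?V = e \<times> h q" by (simp add: h_def Cross3.right_diff_distrib cross_mult_right)
    then have "(norm ?V)\<^sup>2 = (norm (h q))\<^sup>2"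
      using norm_cross_dot[of e "h q"] unit by (simp add: e_h power_mult_distrib power2_norm_eq_inner)
    then have "?V \<bullet> ?V > 0" using \<nu>_lt_1(1)[OF qS] by (simp add: power2_norm_eq_inner)
    then show ?thesis using prod by simp
  qed
  have "((\<lambda>\<theta>. z (s * T, \<theta>)) has_vector_derivative 0) (at \<theta> within UNIV)" for \<theta>
    using has_partials_theta[OF z_partials st(2), of \<theta>] eY by simp
  then obtain k where k: "\<And>\<theta>. z (s * T, \<theta>) = k"
    using has_vector_derivative_zero_constant[of UNIV "\<lambda>\<theta>. z (s * T, \<theta>)"] by auto
  have "2 * (e \<bullet> u p) = e \<bullet> (u (s * T, snd p) + u (s * T, snd p + pi))"
    using k[of "snd p"] k[of "snd p + pi"] s(2) by (simp add: z_def inner_add_right)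
  then have "\<bar>2 * (e \<bullet> u p)\<bar> \<le> norm e * norm (u (s * T, snd p) + u (s * T, snd p + pi))"
    by (simp only: Cauchy_Schwarz_ineq2)
  also have "\<dots> < sqrt 2" using antipodal[OF s(1), of "snd p"] unit norm_eq_1[of e] by simp
  finally have "\<bar>2 * (e \<bullet> u p)\<bar>\<^sup>2 < (sqrt 2)\<^sup>2" by (intro power_strict_mono) auto
  then show ?thesis by (simp add: power_mult_distrib)
qed

text \<open>
  The equations for \<open>z\<close> and \<open>\<nu>\<close> say that \<open>z + \<Phi> artanh \<nu>\<close> is constant; call it \<open>d\<close>. The radius
  follows from \<open>|h|\<^sup>2 (1 - \<nu>\<^sup>2) = \<Phi>\<^sup>2\<close>. On the boundary \<open>u \<bullet> N = 0\<close>, that is \<open>\<Phi> = - z \<nu>\<close>: the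
  tangent lines of the profile there pass through the origin.
\<close>
lemma profile_is_catenary:
  obtains C d where "C > 0"
    "\<And>p. p \<in> strip T \<Longrightarrow> h p \<bullet> h p = (C * cosh ((z p - d) / C))\<^sup>2"
    "\<And>p. p \<in> strip T \<Longrightarrow> \<bar>fst p\<bar> = T \<Longrightarrow> z p \<noteq> d \<and> z p = C * (cosh ((z p - d) / C) / sinh ((z p - d) / C))"
proof -
  define o' where "o' = (0::real, 0::real)"
  have o': "o' \<in> strip T" using T_pos by (simp add: o'_def)
  define c0 where "c0 = \<Phi> o'"
  have \<Phi>c: "\<Phi> p = c0" if "p \<in> strip T" for p using \<Phi>_const[OF that o'] by (simp add: c0_def)
  have c0: "c0 \<noteq> 0" using \<Phi>_nonzero[OF o'] by (simp add: c0_def)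
  let ?\<tau> = "\<lambda>p. artanh (\<nu> p)"
  have \<nu>b: "\<bar>\<nu> p\<bar> < 1" if "p \<in> strip T" for p
    using \<nu>_lt_1(2)[OF that] by (simp add: abs_square_less_1)
  have "has_partials T ?\<tau> (\<lambda>p. 1 / (1 - (\<nu> p)\<^sup>2) * (e \<bullet> Nx p)) (\<lambda>p. 1 / (1 - (\<nu> p)\<^sup>2) * (e \<bullet> Ny p))"
    by (rule has_partials_real_compose[OF _ \<nu>_partials, where g' = "\<lambda>x. 1 / (1 - x\<^sup>2)"])
      (auto intro!: derivative_eq_intros \<nu>b)
  then have hp: "has_partials T (\<lambda>p. z p + c0 * ?\<tau> p)
      (\<lambda>p. e \<bullet> X p + (c0 * (1 / (1 - (\<nu> p)\<^sup>2) * (e \<bullet> Nx p)) + 0 * ?\<tau> p))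
      (\<lambda>p. e \<bullet> Y p + (c0 * (1 / (1 - (\<nu> p)\<^sup>2) * (e \<bullet> Ny p)) + 0 * ?\<tau> p))"
    by (intro has_partials_add z_partials has_partials_mult has_partials_const)
  define d where "d = z o' + c0 * ?\<tau> o'"
  have zd: "z p + c0 * ?\<tau> p = d" if p: "p \<in> strip T" for p
    unfolding d_def
  proof (rule zero_partials_const[OF hp _ p o'])
    fix q assume q: "q \<in> strip T"
    have "1 - (\<nu> q)\<^sup>2 \<noteq> 0" using \<nu>_lt_1(2)[OF q] by simp
    then show "e \<bullet> X q + (c0 * (1 / (1 - (\<nu> q)\<^sup>2) * (e \<bullet> Nx q)) + 0 * ?\<tau> q) = 0 \<and>
        e \<bullet> Y q + (c0 * (1 / (1 - (\<nu> q)\<^sup>2) * (e \<bullet> Ny q)) + 0 * ?\<tau> q) = 0"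
      using profile_equations(3,4)[OF q] unfolding \<Phi>c[OF q] by (simp add: field_simps)
  qed
  define C where "C = \<bar>c0\<bar>"
  have C: "C > 0" using c0 by (simp add: C_def)
  define \<sigma> where "\<sigma> = sgn c0"
  have \<sigma>: "c0 = \<sigma> * C" "\<sigma> = 1 \<or> \<sigma> = -1" using c0 by (auto simp: \<sigma>_def C_def sgn_if)
  have s: "(z p - d) / C = - (\<sigma> * ?\<tau> p)" if "p \<in> strip T" for p
    using zd[OF that] C unfolding \<sigma>(1) by (simp add: field_simps)
  have cosh1: "(cosh (?\<tau> p))\<^sup>2 * (1 - (\<nu> p)\<^sup>2) = 1" if p: "p \<in> strip T" for p
  proof -
    have "tanh (?\<tau> p) * cosh (?\<tau> p) = sinh (?\<tau> p)" by (simp add: tanh_def)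
    then have "\<nu> p * cosh (?\<tau> p) = sinh (?\<tau> p)" by (simp only: tanh_artanh[OF \<nu>b[OF p]])
    then have "(\<nu> p)\<^sup>2 * (cosh (?\<tau> p))\<^sup>2 = (sinh (?\<tau> p))\<^sup>2" by (metis power_mult_distrib)
    then show ?thesis using cosh_square_eq[of "?\<tau> p"] by (simp add: algebra_simps)
  qed
  show thesis
  proof (rule that[OF C])
    fix p assume p: "p \<in> strip T"
    have cs: "cosh ((z p - d) / C) = cosh (?\<tau> p)" unfolding s[OF p] using \<sigma>(2) by auto
    have C2: "c0\<^sup>2 = C\<^sup>2" by (simp add: C_def)
    have nz: "1 - (\<nu> p)\<^sup>2 \<noteq> 0" using \<nu>_lt_1(2)[OF p] by simp
    have "(h p \<bullet> h p) * (1 - (\<nu> p)\<^sup>2) = C\<^sup>2 * ((cosh (?\<tau> p))\<^sup>2 * (1 - (\<nu> p)\<^sup>2))"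
      unfolding cosh1[OF p] using horizontal_parallel(3)[OF p] by (simp add: \<Phi>c[OF p] C2)
    then show "h p \<bullet> h p = (C * cosh ((z p - d) / C))\<^sup>2"
      using nz unfolding cs by (simp add: power_mult_distrib)
    assume bd: "\<bar>fst p\<bar> = T"
    obtain sg where sg: "sg \<in> {1, -1}" "p = (sg * T, snd p)"
    proof (cases "fst p \<ge> 0")
      case True
      then show ?thesis using that[of 1] bd by (simp add: prod_eq_iff)
    next
      case False
      then show ?thesis using that[of "-1"] bd by (simp add: prod_eq_iff)
    qed
    have "u p \<bullet> N p = 0" using u_dot_N_boundary[OF sg(1), of "snd p"] sg(2) by simp
    then have "c0 = - z p * \<nu> p"
      using \<Phi>c[OF p] by (simp add: \<Phi>_def h_def inner_diff_right \<nu>_def inner_commute)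
    moreover have "\<nu> p = tanh (?\<tau> p)" using tanh_artanh[OF \<nu>b[OF p]] by simp
    ultimately have eq: "\<sigma> * C = - z p * tanh (?\<tau> p)" using \<sigma>(1) by simp
    then have "?\<tau> p \<noteq> 0" using C \<sigma>(2) by auto
    then have ne: "(z p - d) / C \<noteq> 0" unfolding s[OF p] using \<sigma>(2) by auto
    have "tanh ((z p - d) / C) = - (\<sigma> * tanh (?\<tau> p))" unfolding s[OF p] using \<sigma>(2) by auto
    then have "z p * tanh ((z p - d) / C) = \<sigma> * (\<sigma> * C)" unfolding eq by simp
    then have "z p * tanh ((z p - d) / C) = C" using \<sigma>(2) by auto
    then have "z p = C * (cosh ((z p - d) / C) / sinh ((z p - d) / C))"
      using ne by (simp add: tanh_def field_simps)
    then show "z p \<noteq> d \<and> z p = C * (cosh ((z p - d) / C) / sinh ((z p - d) / C))" using ne by auto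
  qed
qed

text \<open>
  At a critical point of the height, \<open>e\<close> would be normal to the surface, but \<open>\<nu>\<^sup>2 < 1\<close>.
\<close>
lemma z_no_critical_point:
  assumes p: "p \<in> strip T" and "e \<bullet> X p = 0" "e \<bullet> Y p = 0"
  shows False
proof -
  have eN: "e = \<nu> p *\<^sub>R N p" by (rule frame_eq[OF p]) (use assms N_frame[OF p] in \<open>auto simp: \<nu>_def\<close>)
  have "e \<bullet> e = (\<nu> p)\<^sup>2"
    by (rule trans[OF arg_cong[OF eN, of "\<lambda>v. e \<bullet> v"]]) (simp add: power2_eq_square \<nu>_def)
  then show False using \<nu>_lt_1(2)[OF p] unit by simp
qed

lemma z_interior_extremum:
  assumes t: "\<bar>fst p\<bar> < T" and ext: "(\<forall>q\<in>strip T. z q \<le> z p) \<or> (\<forall>q\<in>strip T. z p \<le> z q)"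
  shows False
proof -
  let ?S = "{q :: real * real. \<bar>fst q\<bar> < T}"
  have S: "open ?S" "p \<in> ?S" "?S \<subseteq> strip T"
    using t by (auto simp: strip_def intro!: open_Collect_less continuous_intros)
  then have p: "p \<in> strip T" by auto
  have "(z has_derivative (\<lambda>v. fst v *\<^sub>R (e \<bullet> X p) + snd v *\<^sub>R (e \<bullet> Y p))) (at p within strip T)"
    using z_partials p by (auto simp: has_partials_def)
  then have "(z has_derivative (\<lambda>v. fst v *\<^sub>R (e \<bullet> X p) + snd v *\<^sub>R (e \<bullet> Y p))) (at p)"
    using has_derivative_subset[OF _ S(3)] at_within_open[OF S(2,1)] by metis
  then have "(\<lambda>v. fst v *\<^sub>R (e \<bullet> X p) + snd v *\<^sub>R (e \<bullet> Y p)) = (\<lambda>v. 0)"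
    by (rule differential_zero_maxmin[OF S(2,1)]) (use ext S(3) in blast)
  from fun_cong[OF this, of "(1, 0)"] fun_cong[OF this, of "(0, 1)"]
  show False using z_no_critical_point[OF p] by simp
qed

text \<open>
  The height has no interior critical point, so its maximum and minimum are attained on the
  boundary, with different values. By \<open>profile_is_catenary\<close> every boundary parameter \<open>s\<close> solves
  \<open>coth s - s = d / C\<close>, which has at most one solution of each sign. So one solution of each sign
  occurs, and the parameters are those of \<open>critical_parameters\<close>.
\<close>
lemma on_critical_catenoid:
  fixes C :: real
  defines "C \<equiv> 1 / sqrt ((cosh critical_T)\<^sup>2 + critical_T\<^sup>2)"
  assumes p: "p \<in> strip T"
  shows "u p \<bullet> u p - (e \<bullet> u p)\<^sup>2 = (C * cosh ((e \<bullet> u p) / C))\<^sup>2"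
proof -
  obtain c0 d where c0: "c0 > 0"
    and cat: "\<And>p. p \<in> strip T \<Longrightarrow> h p \<bullet> h p = (c0 * cosh ((z p - d) / c0))\<^sup>2"
    and bd: "\<And>p. p \<in> strip T \<Longrightarrow> \<bar>fst p\<bar> = T \<Longrightarrow> z p \<noteq> d \<and> z p = c0 * (cosh ((z p - d) / c0) / sinh ((z p - d) / c0))"
    by (rule profile_is_catenary) (rule that, assumption+)
  let ?s = "\<lambda>p. (z p - d) / c0"
  have hh: "h p \<bullet> h p = u p \<bullet> u p - (z p)\<^sup>2" for p
    by (simp add: h_def inner_diff_left inner_diff_right unit inner_commute[of "u p" e] flip: z_def) (simp add: power2_eq_square)
  have zs: "z p = c0 * ?s p + d" for p using c0 by simp
  have bd2: "(c0 * cosh (?s p))\<^sup>2 + (c0 * (cosh (?s p) / sinh (?s p)))\<^sup>2 = 1"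
    "(c0 * (cosh (?s p) / sinh (?s p)))\<^sup>2 < 1 / 2" "c0 * ?s p + d = c0 * (cosh (?s p) / sinh (?s p))" "?s p \<noteq> 0"
    if "p \<in> strip T" "\<bar>fst p\<bar> = T" for p
  proof -
    have "u p \<bullet> u p = 1" using sphere(2)[OF that(1)] that(2) by (simp add: norm_eq_1)
    then show "(c0 * cosh (?s p))\<^sup>2 + (c0 * (cosh (?s p) / sinh (?s p)))\<^sup>2 = 1"
      using cat[OF that(1)] hh[of p] bd[OF that] by simp
    show "(c0 * (cosh (?s p) / sinh (?s p)))\<^sup>2 < 1 / 2"
      using low_boundary[OF that] bd[OF that] by (simp add: z_def)
    show "c0 * ?s p + d = c0 * (cosh (?s p) / sinh (?s p))" using bd[OF that] zs[of p] by simp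
    show "?s p \<noteq> 0" using bd[OF that] c0 by simp
  qed
  have same: "z q = z q'" if q: "q \<in> strip T" "\<bar>fst q\<bar> = T" "q' \<in> strip T" "\<bar>fst q'\<bar> = T" and sg: "?s q > 0 \<longleftrightarrow> ?s q' > 0" for q q'
  proof -
    have k: "cosh (?s x) / sinh (?s x) - ?s x = d / c0" if "x \<in> strip T" "\<bar>fst x\<bar> = T" for x
      using bd2(3)[OF that] c0 by (simp add: field_simps)
    have "?s q = ?s q'"
    proof (cases "?s q > 0")
      case True
      then show ?thesis using coth_minus_id_inj[of "?s q" "?s q'"] sg k[OF q(1,2)] k[OF q(3,4)] by simp
    next
      case False
      have "?s q < 0" using False bd2(4)[OF q(1,2)] by linarith
      moreover have "?s q' < 0" using False sg bd2(4)[OF q(3,4)] by linarith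
      ultimately have neg: "- ?s q > 0" "- ?s q' > 0" by (simp_all only: neg_0_less_iff_less)
      have "cosh (- ?s q) / sinh (- ?s q) - (- ?s q) = cosh (- ?s q') / sinh (- ?s q') - (- ?s q')"
        using k[OF q(1,2)] k[OF q(3,4)] by (simp only: cosh_minus sinh_minus divide_minus_right)
      from coth_minus_id_inj[OF neg this] show ?thesis by simp
    qed
    then show ?thesis using c0 by simp
  qed
  have cz: "continuous_on (rect T) z"
    using has_partials_continuous[OF z_partials] rect_subset_strip continuous_on_subset by blast
  have ne: "compact (rect T)" by (rule compact_cbox)
  have ne': "rect T \<noteq> {}" using T_pos by (auto simp: cbox_Pair_eq)
  obtain p1 where p1: "p1 \<in> rect T" "\<And>q. q \<in> rect T \<Longrightarrow> z q \<le> z p1"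
    using continuous_attains_sup[OF ne ne' cz] by blast
  obtain p2 where p2: "p2 \<in> rect T" "\<And>q. q \<in> rect T \<Longrightarrow> z p2 \<le> z q"
    using continuous_attains_inf[OF ne ne' cz] by blast
  have ext: "z q \<le> z p1" "z p2 \<le> z q" if q: "q \<in> strip T" for q
  proof -
    obtain q' where "q' \<in> rect T" "u q = u q'" by (rule strip_to_rect[OF q])
    then show "z q \<le> z p1" "z p2 \<le> z q" using p1 p2 by (auto simp: z_def)
  qed
  have S: "p1 \<in> strip T" "p2 \<in> strip T" using p1 p2 rect_subset_strip by blast+
  have "\<not> \<bar>fst p1\<bar> < T" "\<not> \<bar>fst p2\<bar> < T"
    using z_interior_extremum[of p1] z_interior_extremum[of p2] ext by blast+
  moreover have "\<bar>fst p1\<bar> \<le> T" "\<bar>fst p2\<bar> \<le> T" using S by (auto simp: strip_def)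
  ultimately have b12: "\<bar>fst p1\<bar> = T" "\<bar>fst p2\<bar> = T" by auto
  have "z p1 \<noteq> z p2"
  proof
    assume "z p1 = z p2"
    then have "z q = z p1" if "q \<in> strip T" for q using ext[OF that] by simp
    then show False using z_interior_extremum[of "(0, 0)"] T_pos by auto
  qed
  then have lt: "z p2 < z p1" using ext(1)[OF S(2)] by simp
  then have "\<not> (?s p2 > 0 \<longleftrightarrow> ?s p1 > 0)" using same[OF S(2) b12(2) S(1) b12(1)] by auto
  moreover have "?s p2 < ?s p1" using lt c0 by (simp add: divide_strict_right_mono)
  ultimately have sg: "?s p1 > 0" "?s p2 < 0" using bd2(4)[OF S(2) b12(2)] by auto
  note cp = critical_parameters[OF c0 sg bd2(3)[OF S(1) b12(1)] bd2(3)[OF S(2) b12(2)] bd2(1)[OF S(1) b12(1)]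
      bd2(1)[OF S(2) b12(2)] bd2(2)[OF S(1) b12(1)] bd2(2)[OF S(2) b12(2)]]
  show ?thesis
    using cat[OF p] hh[of p] cp(3) cp(4) by (simp add: C_def z_def)
qed

end

unbundle no cross3_syntax

section \<open>Filling the critical catenoid\<close>

definition catenoid_scale :: real where
  "catenoid_scale = 1 / sqrt ((cosh critical_T)\<^sup>2 + critical_T\<^sup>2)"

lemma catenoid_scale_pos: "catenoid_scale > 0"
  using critical_T_pos unfolding catenoid_scale_def by (simp add: add_pos_pos)

lemma critical_catenoid_nth:
  "critical_catenoid (t, z) $ 1 = catenoid_scale * (cosh t * Re z)"
  "critical_catenoid (t, z) $ 2 = catenoid_scale * (cosh t * Im z)"
  "critical_catenoid (t, z) $ 3 = catenoid_scale * t"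
  by (simp_all add: critical_catenoid_def catenoid_scale_def vector_3)

lemma vec3_eq: "x = y \<longleftrightarrow> x $ 1 = y $ 1 \<and> x $ 2 = y $ 2 \<and> x $ 3 = (y $ 3 :: real)"
  for x y :: "real^3"
  by (simp add: vec_eq_iff forall_3)

lemma norm_critical_catenoid:
  assumes "norm z = 1"
  shows "norm (critical_catenoid (t, z)) < 1 \<longleftrightarrow> \<bar>t\<bar> < critical_T"
    and "norm (critical_catenoid (t, z)) \<le> 1 \<longleftrightarrow> \<bar>t\<bar> \<le> critical_T"
proof -
  let ?f = "\<lambda>t. (cosh t)\<^sup>2 + t\<^sup>2 :: real"
  have z: "(Re z)\<^sup>2 + (Im z)\<^sup>2 = 1" using assms by (simp add: cmod_def)
  have "(norm (critical_catenoid (t, z)))\<^sup>2 = catenoid_scale\<^sup>2 * ((cosh t)\<^sup>2 * ((Re z)\<^sup>2 + (Im z)\<^sup>2) + t\<^sup>2)"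
    unfolding power2_norm_eq_inner inner_vec_def sum_3
    by (simp add: critical_catenoid_nth power2_eq_square algebra_simps)
  also have "\<dots> = ?f t / ?f critical_T" by (simp add: z catenoid_scale_def power_divide)
  finally have n: "(norm (critical_catenoid (t, z)))\<^sup>2 = ?f t / ?f critical_T" .
  have pos: "?f critical_T > 0" using critical_T_pos by (simp add: add_pos_pos)
  have mono: "?f x < ?f y" if "\<bar>x\<bar> < \<bar>y\<bar>" for x y :: real
  proof -
    have "cosh \<bar>x\<bar> < cosh \<bar>y\<bar>" using that cosh_real_nonneg_less_iff[of "\<bar>x\<bar>" "\<bar>y\<bar>"] by simp
    then have "(cosh x)\<^sup>2 < (cosh y)\<^sup>2" by (simp add: power_strict_mono)
    moreover have "x\<^sup>2 < y\<^sup>2" using power_strict_mono[of "\<bar>x\<bar>" "\<bar>y\<bar>" 2] that by simp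
    ultimately show ?thesis by simp
  qed
  have eq: "?f x = ?f y" if "\<bar>x\<bar> = \<bar>y\<bar>" for x y :: real
    using that by (auto simp: abs_eq_iff)
  have lt: "?f t < ?f critical_T \<longleftrightarrow> \<bar>t\<bar> < critical_T" "?f t \<le> ?f critical_T \<longleftrightarrow> \<bar>t\<bar> \<le> critical_T"
    using mono[of t critical_T] mono[of critical_T t] eq[of t critical_T] critical_T_pos
    by (cases "\<bar>t\<bar>" critical_T rule: linorder_cases, auto)+
  have "norm (critical_catenoid (t, z)) < 1 \<longleftrightarrow> (norm (critical_catenoid (t, z)))\<^sup>2 < 1"
    "norm (critical_catenoid (t, z)) \<le> 1 \<longleftrightarrow> (norm (critical_catenoid (t, z)))\<^sup>2 \<le> 1"
    by (auto simp: abs_square_less_1 abs_square_le_1)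
  then show "norm (critical_catenoid (t, z)) < 1 \<longleftrightarrow> \<bar>t\<bar> < critical_T"
    "norm (critical_catenoid (t, z)) \<le> 1 \<longleftrightarrow> \<bar>t\<bar> \<le> critical_T"
    unfolding n lt[symmetric] using pos by (simp_all add: divide_less_eq divide_le_eq)
qed

lemma on_catenoid_obtain:
  assumes "(x $ 1)\<^sup>2 + (x $ 2)\<^sup>2 = (catenoid_scale * cosh (x $ 3 / catenoid_scale))\<^sup>2"
  obtains z where "norm z = 1" "x = critical_catenoid (x $ 3 / catenoid_scale, z)"
proof
  define r where "r = catenoid_scale * cosh (x $ 3 / catenoid_scale)"
  let ?z = "Complex (x $ 1 / r) (x $ 2 / r)"
  have r: "r > 0" using catenoid_scale_pos by (simp add: r_def)
  have "(x $ 1 / r)\<^sup>2 + (x $ 2 / r)\<^sup>2 = ((x $ 1)\<^sup>2 + (x $ 2)\<^sup>2) / r\<^sup>2"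
    by (simp only: power_divide add_divide_distrib)
  also have "\<dots> = 1" unfolding assms r_def[symmetric] using r by simp
  finally show "norm ?z = 1" by (simp add: cmod_def)
  have "catenoid_scale * (cosh (x $ 3 / catenoid_scale) * (y / r)) = y" for y
    unfolding mult.assoc[symmetric] r_def[symmetric] using r by simp
  then show "x = critical_catenoid (x $ 3 / catenoid_scale, ?z)"
    unfolding vec3_eq critical_catenoid_nth using catenoid_scale_pos by simp
qed

text \<open>
  The image of \<open>v\<close> is compact. It is also open in the catenoid away from the boundary of the piece,
  because \<open>v\<close> is an immersion. The interior of the piece is connected, so it is covered.
\<close>
lemma fills_catenoid:
  fixes v vx vy :: "real \<times> real \<Rightarrow> real^3"
  assumes v: "has_partials critical_T v vx vy"
    and inj: "\<And>p h. p \<in> strip critical_T \<Longrightarrow> fst h *\<^sub>R vx p + snd h *\<^sub>R vy p = 0 \<Longrightarrow> h = 0"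
    and cat: "\<And>p. p \<in> strip critical_T \<Longrightarrow>
      (v p $ 1)\<^sup>2 + (v p $ 2)\<^sup>2 = (catenoid_scale * cosh (v p $ 3 / catenoid_scale))\<^sup>2"
    and le1: "\<And>p. p \<in> strip critical_T \<Longrightarrow> norm (v p) \<le> 1"
    and eq1: "\<And>p. p \<in> strip critical_T \<Longrightarrow> norm (v p) = 1 \<longleftrightarrow> \<bar>fst p\<bar> = critical_T"
    and rect: "v ` strip critical_T = v ` rect critical_T"
  shows "v ` strip critical_T = critical_catenoid ` annulus critical_T"
proof
  let ?T = critical_T and ?C = catenoid_scale
  have T: "?T > 0" by (rule critical_T_pos)
  have C: "?C > 0" by (rule catenoid_scale_pos)
  show "v ` strip ?T \<subseteq> critical_catenoid ` annulus ?T"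
  proof
    fix x assume "x \<in> v ` strip ?T"
    then obtain p where p: "p \<in> strip ?T" "x = v p" by blast
    obtain z where z: "norm z = 1" "x = critical_catenoid (x $ 3 / ?C, z)"
      using on_catenoid_obtain[of x] cat[OF p(1)] p(2) by blast
    have "norm (critical_catenoid (x $ 3 / ?C, z)) \<le> 1" using z(2) le1[OF p(1)] p(2) by simp
    then have "\<bar>x $ 3 / ?C\<bar> \<le> ?T" using norm_critical_catenoid(2)[OF z(1)] by simp
    then have "- ?T \<le> x $ 3 / ?C \<and> x $ 3 / ?C \<le> ?T" unfolding abs_le_iff by linarith
    then have "(x $ 3 / ?C, z) \<in> annulus ?T" using z(1) by (simp only: annulus_def) simp
    then show "x \<in> critical_catenoid ` annulus ?T" using z(2) by blast
  qed
  let ?\<kappa> = "\<lambda>q. critical_catenoid (fst q, cis (snd q)) :: real^3"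
  let ?D = "{-?T<..<?T} \<times> (UNIV :: real set)"
  let ?V = "v ` strip ?T"
  have "continuous_on (rect ?T) v"
    using has_partials_continuous[OF v] rect_subset_strip continuous_on_subset by blast
  then have closed: "closed ?V"
    unfolding rect by (intro compact_imp_closed compact_continuous_image compact_cbox)
  have c\<kappa>: "continuous_on UNIV ?\<kappa>"
  proof -
    have "\<forall>i. continuous_on UNIV (\<lambda>q. ?\<kappa> q $ i)"
      unfolding forall_3 critical_catenoid_nth cis.sel by (intro conjI continuous_intros)
    then have "continuous_on UNIV (\<lambda>q. \<chi> i. ?\<kappa> q $ i)" by (intro continuous_on_vec_lambda) simp
    then show ?thesis by simp
  qed
  have openS: "open {q \<in> ?D. ?\<kappa> q \<in> ?V}"
  proof (subst open_subopen, intro ballI)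
    fix q0 assume q0: "q0 \<in> {q \<in> ?D. ?\<kappa> q \<in> ?V}"
    obtain \<tau>0 \<alpha>0 where q0e: "q0 = (\<tau>0, \<alpha>0)" by (cases q0)
    obtain p0 where p0: "p0 \<in> strip ?T" "v p0 = ?\<kappa> q0" using q0 by auto
    have x0: "v p0 $ 1 = ?C * (cosh \<tau>0 * cos \<alpha>0)" "v p0 $ 2 = ?C * (cosh \<tau>0 * sin \<alpha>0)" "v p0 $ 3 = ?C * \<tau>0"
      unfolding p0(2) q0e by (simp_all add: critical_catenoid_nth)
    have "norm (v p0) < 1" unfolding p0(2)
      by (subst norm_critical_catenoid(1)) (use q0 in auto)
    then have p0i: "\<bar>fst p0\<bar> < ?T" using eq1[OF p0(1)] p0(1) by (auto simp: strip_def)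
    let ?U = "{p :: real * real. \<bar>fst p\<bar> < ?T}"
    have U: "open ?U" "?U \<subseteq> strip ?T"
      by (auto simp: strip_def intro!: open_Collect_less continuous_intros)
    have cv: "continuous_on ?U v" using has_partials_continuous[OF v] U(2) continuous_on_subset by blast
    have dv: "(v has_derivative (\<lambda>h. fst h *\<^sub>R vx p0 + snd h *\<^sub>R vy p0)) (at p0)"
    proof -
      have "(v has_derivative (\<lambda>h. fst h *\<^sub>R vx p0 + snd h *\<^sub>R vy p0)) (at p0 within ?U)"
        by (rule has_derivative_subset[OF _ U(2)]) (use v p0(1) in \<open>auto simp: has_partials_def\<close>)
      then show ?thesis using at_within_open[OF _ U(1)] p0i by simp
    qed
    \<comment> \<open>Near the given point, the height and the signed distance from its meridian plane are coordinates on the catenoid.\<close>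
    let ?M = "\<lambda>x :: real^3. (x $ 3 / ?C, x $ 2 * cos \<alpha>0 - x $ 1 * sin \<alpha>0)"
    have M: "bounded_linear ?M"
      by (intro bounded_linear_Pair bounded_linear_sub bounded_linear_mult_const bounded_linear_divide[THEN bounded_linear_compose]
          bounded_linear_vec_nth)
    let ?f = "\<lambda>p. ?M (v p)" and ?f' = "\<lambda>h. ?M (fst h *\<^sub>R vx p0 + snd h *\<^sub>R vy p0)"
    have df: "(?f has_derivative ?f') (at p0)" by (rule bounded_linear.has_derivative[OF M dv])
    have lin: "linear ?f'" by (rule has_derivative_linear[OF df])
    have constraint: "v p0 $ 1 * y $ 1 + v p0 $ 2 * y $ 2 = ?C * cosh \<tau>0 * sinh \<tau>0 * y $ 3"
      if y: "y = fst h *\<^sub>R vx p0 + snd h *\<^sub>R vy p0" for y h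
    proof -
      have dn: "((\<lambda>p. v p $ i) has_derivative (\<lambda>h. (fst h *\<^sub>R vx p0 + snd h *\<^sub>R vy p0) $ i)) (at p0)" for i
        by (rule bounded_linear.has_derivative[OF bounded_linear_vec_nth dv])
      have "(cosh has_real_derivative sinh (v p0 $ 3 / ?C)) (at (v p0 $ 3 / ?C))"
        by (auto intro!: derivative_eq_intros)
      then have dcosh: "((\<lambda>p. cosh (v p $ 3 / ?C)) has_derivative
          (\<lambda>h. (fst h *\<^sub>R vx p0 + snd h *\<^sub>R vy p0) $ 3 / ?C * sinh (v p0 $ 3 / ?C))) (at p0)"
        by (rule DERIV_compose_FDERIV[of cosh _ "\<lambda>p. v p $ 3 / ?C"]) (rule bounded_linear.has_derivative[OF bounded_linear_divide dn])
      have "((\<lambda>p. (v p $ 1)\<^sup>2 + (v p $ 2)\<^sup>2 - (?C * cosh (v p $ 3 / ?C))\<^sup>2) has_derivative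
        (\<lambda>h. 2 * (v p0 $ 1) * ((fst h *\<^sub>R vx p0 + snd h *\<^sub>R vy p0) $ 1) + 2 * (v p0 $ 2) * ((fst h *\<^sub>R vx p0 + snd h *\<^sub>R vy p0) $ 2)
          - 2 * (?C * cosh (v p0 $ 3 / ?C)) * (sinh (v p0 $ 3 / ?C) * ((fst h *\<^sub>R vx p0 + snd h *\<^sub>R vy p0) $ 3)))) (at p0)"
        using C by (auto intro!: derivative_eq_intros dn dcosh simp: fun_eq_iff field_simps power2_eq_square)
      moreover have "((\<lambda>p. (v p $ 1)\<^sup>2 + (v p $ 2)\<^sup>2 - (?C * cosh (v p $ 3 / ?C))\<^sup>2) has_derivative (\<lambda>h. 0)) (at p0)"
        by (rule has_derivative_transform_within_open[OF has_derivative_const[of 0] U(1)])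
          (use p0i U(2) cat in auto)
      ultimately have "(\<lambda>h. 2 * (v p0 $ 1) * ((fst h *\<^sub>R vx p0 + snd h *\<^sub>R vy p0) $ 1) + 2 * (v p0 $ 2) * ((fst h *\<^sub>R vx p0 + snd h *\<^sub>R vy p0) $ 2)
          - 2 * (?C * cosh (v p0 $ 3 / ?C)) * (sinh (v p0 $ 3 / ?C) * ((fst h *\<^sub>R vx p0 + snd h *\<^sub>R vy p0) $ 3))) = (\<lambda>h. 0)"
        by (rule has_derivative_unique)
      from fun_cong[OF this, of h] show ?thesis
        unfolding y[symmetric] x0(3) using C by simp
    qed
    have cs: "cos \<alpha>0 * cos \<alpha>0 + sin \<alpha>0 * sin \<alpha>0 = 1" by (rule sin_cos_squared_add3)
    have "inj ?f'"
    proof (subst linear_injective_0[OF lin], intro allI impI)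
      fix h assume h0: "?f' h = 0"
      define y where "y = fst h *\<^sub>R vx p0 + snd h *\<^sub>R vy p0"
      have y3: "y $ 3 = 0" and y12: "y $ 2 * cos \<alpha>0 - y $ 1 * sin \<alpha>0 = 0"
        using h0 C unfolding y_def[symmetric] by (auto simp: zero_prod_def)
      have "?C * cosh \<tau>0 * (y $ 1 * cos \<alpha>0 + y $ 2 * sin \<alpha>0) = 0"
        using constraint[OF y_def] y3 unfolding x0 by (simp add: algebra_simps)
      then have y12': "y $ 1 * cos \<alpha>0 + y $ 2 * sin \<alpha>0 = 0" using C by simp
      have "y $ 1 * (cos \<alpha>0 * cos \<alpha>0 + sin \<alpha>0 * sin \<alpha>0)
          = cos \<alpha>0 * (y $ 1 * cos \<alpha>0 + y $ 2 * sin \<alpha>0) - sin \<alpha>0 * (y $ 2 * cos \<alpha>0 - y $ 1 * sin \<alpha>0)"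
        "y $ 2 * (cos \<alpha>0 * cos \<alpha>0 + sin \<alpha>0 * sin \<alpha>0)
          = sin \<alpha>0 * (y $ 1 * cos \<alpha>0 + y $ 2 * sin \<alpha>0) + cos \<alpha>0 * (y $ 2 * cos \<alpha>0 - y $ 1 * sin \<alpha>0)"
        by (simp_all add: algebra_simps del: sin_cos_squared_add3)
      then have "y $ 1 = 0" "y $ 2 = 0" unfolding y12 y12' cs by simp_all
      then have "y = 0" using y3 by (simp add: vec3_eq)
      then show "h = 0" using inj[OF p0(1), of h] y_def by simp
    qed
    then obtain g' where g': "linear g'" "\<And>x. ?f' (g' x) = x"
      using linear_injective_isomorphism[OF lin] by blast
    have cf: "continuous_on ?U ?f" by (intro bounded_linear.continuous_on[OF M] cv)
    \<comment> \<open>Points of the catenoid on the positive side of this half-space are determined by the two coordinates.\<close>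
    let ?A = "\<lambda>p. v p $ 1 * cos \<alpha>0 + v p $ 2 * sin \<alpha>0"
    define G where "G = {p \<in> ?U. ?A p > 0}"
    have "continuous_on ?U ?A" by (intro continuous_intros cv)
    from continuous_open_preimage[OF this U(1) open_greaterThan[of 0]]
    have "open G" by (simp add: G_def vimage_def Int_def)
    have "?A p0 = ?C * cosh \<tau>0 * (cos \<alpha>0 * cos \<alpha>0 + sin \<alpha>0 * sin \<alpha>0)"
      unfolding x0 by (simp only: distrib_left mult_ac)
    then have "?A p0 > 0" unfolding cs using C by simp
    then have p0G: "p0 \<in> G" using p0i by (simp add: G_def)
    have int: "?f p0 \<in> interior (?f ` G)"
      by (rule sussmann_open_mapping[OF U(1) cf _ df linear_conv_bounded_linear[THEN iffD1, OF g'(1)]])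
        (use p0i p0G \<open>open G\<close> g' in \<open>auto simp: interior_open fun_eq_iff G_def\<close>)
    have fp0: "?f p0 = (\<tau>0, 0)" unfolding x0 using C by (simp add: algebra_simps)
    let ?g = "\<lambda>q. (fst q, ?C * cosh (fst q) * sin (snd q - \<alpha>0)) :: real * real"
    define H where "H = ?D \<inter> {q. cos (snd q - \<alpha>0) > 0} \<inter> ?g -` interior (?f ` G)"
    have "open H"
    proof -
      have "open {q :: real * real. cos (snd q - \<alpha>0) > 0}" by (intro open_Collect_less continuous_intros)
      moreover have "open (?g -` interior (?f ` G))"
        by (intro open_vimage open_interior continuous_intros)
      ultimately show ?thesis unfolding H_def by (intro open_Int open_Times open_greaterThanLessThan open_UNIV)
    qed
    moreover have "q0 \<in> H" using q0 int fp0 by (simp add: H_def q0e)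
    moreover have "H \<subseteq> {q \<in> ?D. ?\<kappa> q \<in> ?V}"
    proof
      fix q assume q: "q \<in> H"
      obtain \<tau> \<alpha> where qe: "q = (\<tau>, \<alpha>)" by (cases q)
      have "?g q \<in> ?f ` G" using q interior_subset by (auto simp: H_def)
      then obtain p where p: "p \<in> G" "?g q = ?f p" by blast
      have pS: "p \<in> strip ?T" using p(1) U(2) by (auto simp: G_def)
      let ?R = "?C * cosh \<tau>"
      have R: "?R > 0" using C by simp
      have x3: "v p $ 3 = ?C * \<tau>" and i: "v p $ 2 * cos \<alpha>0 - v p $ 1 * sin \<alpha>0 = ?R * sin (\<alpha> - \<alpha>0)"
        using p(2) C by (auto simp: qe field_simps)
      have cq: "cos (\<alpha> - \<alpha>0) > 0" using q by (simp add: H_def qe)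
      have "(v p $ 1)\<^sup>2 + (v p $ 2)\<^sup>2 = ?R\<^sup>2" using cat[OF pS] C by (simp add: x3)
      moreover have "(?A p)\<^sup>2 + (v p $ 2 * cos \<alpha>0 - v p $ 1 * sin \<alpha>0)\<^sup>2
          = ((v p $ 1)\<^sup>2 + (v p $ 2)\<^sup>2) * (cos \<alpha>0 * cos \<alpha>0 + sin \<alpha>0 * sin \<alpha>0)"
        by (simp add: power2_eq_square algebra_simps del: sin_cos_squared_add3)
      ultimately have "(?A p)\<^sup>2 = ?R\<^sup>2 - (v p $ 2 * cos \<alpha>0 - v p $ 1 * sin \<alpha>0)\<^sup>2" unfolding cs by simp
      also have "\<dots> = ?R\<^sup>2 * (1 - (sin (\<alpha> - \<alpha>0))\<^sup>2)" unfolding i by (simp add: power_mult_distrib algebra_simps)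
      also have "\<dots> = (?R * cos (\<alpha> - \<alpha>0))\<^sup>2" by (simp add: cos_squared_eq power_mult_distrib)
      finally have Ap: "?A p = ?R * cos (\<alpha> - \<alpha>0)"
        by (rule power2_eq_imp_eq) (use p(1) R cq in \<open>auto simp: G_def\<close>)
      have e: "\<alpha> = (\<alpha> - \<alpha>0) + \<alpha>0" by simp
      have ca: "cos \<alpha> = cos (\<alpha> - \<alpha>0) * cos \<alpha>0 - sin (\<alpha> - \<alpha>0) * sin \<alpha>0"
        and sa: "sin \<alpha> = sin (\<alpha> - \<alpha>0) * cos \<alpha>0 + cos (\<alpha> - \<alpha>0) * sin \<alpha>0"
        using cos_add[of "\<alpha> - \<alpha>0" \<alpha>0] sin_add[of "\<alpha> - \<alpha>0" \<alpha>0] by simp_all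
      have "v p $ 1 * (cos \<alpha>0 * cos \<alpha>0 + sin \<alpha>0 * sin \<alpha>0)
          = cos \<alpha>0 * ?A p - sin \<alpha>0 * (v p $ 2 * cos \<alpha>0 - v p $ 1 * sin \<alpha>0)"
        by (simp add: algebra_simps del: sin_cos_squared_add3)
      then have "v p $ 1 = ?R * cos \<alpha>" unfolding ca Ap i cs by (simp add: algebra_simps)
      moreover have "v p $ 2 * (cos \<alpha>0 * cos \<alpha>0 + sin \<alpha>0 * sin \<alpha>0)
          = sin \<alpha>0 * ?A p + cos \<alpha>0 * (v p $ 2 * cos \<alpha>0 - v p $ 1 * sin \<alpha>0)"
        by (simp add: algebra_simps del: sin_cos_squared_add3)
      then have "v p $ 2 = ?R * sin \<alpha>" unfolding sa Ap i cs by (simp add: algebra_simps)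
      ultimately have "?\<kappa> q = v p" by (simp add: vec3_eq critical_catenoid_nth qe x3)
      then show "q \<in> {q \<in> ?D. ?\<kappa> q \<in> ?V}" using q pS by (auto simp: H_def)
    qed
    ultimately show "\<exists>T. open T \<and> q0 \<in> T \<and> T \<subseteq> {q \<in> ?D. ?\<kappa> q \<in> ?V}" by blast
  qed
  have D: "?\<kappa> ` ?D \<subseteq> ?V"
  proof -
    have conn: "connected ?D" by (intro connected_Times) auto
    have "open (?\<kappa> -` (- ?V))" using closed c\<kappa> by (intro open_vimage) auto
    from connectedD[OF conn openS this]
    have alt: "{q \<in> ?D. ?\<kappa> q \<in> ?V} \<inter> ?D = {} \<or> ?\<kappa> -` (- ?V) \<inter> ?D = {}" by blast
    have p: "(0, 0) \<in> strip ?T" using T by simp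
    obtain z where z: "norm z = 1" "v (0, 0) = critical_catenoid (v (0, 0) $ 3 / ?C, z)"
      using on_catenoid_obtain[of "v (0, 0)"] cat[OF p] by blast
    have "norm (v (0, 0)) < 1" using le1[OF p] eq1[OF p] T by auto
    then have "\<bar>v (0, 0) $ 3 / ?C\<bar> < ?T" using norm_critical_catenoid(1)[OF z(1)] z(2) by metis
    then have b: "- ?T < v (0, 0) $ 3 / ?C" "v (0, 0) $ 3 / ?C < ?T" unfolding abs_less_iff by linarith+
    obtain \<alpha> where \<alpha>: "z = cis \<alpha>" using complex_unimodular_polar[OF z(1)] cis.ctr by metis
    have q: "(v (0, 0) $ 3 / ?C, \<alpha>) \<in> ?D" "?\<kappa> (v (0, 0) $ 3 / ?C, \<alpha>) = v (0, 0)"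
      using z(2) unfolding \<alpha> by (simp_all only: mem_Times_iff greaterThanLessThan_iff fst_conv snd_conv UNIV_I b)
    have "?\<kappa> (v (0, 0) $ 3 / ?C, \<alpha>) \<in> ?V" unfolding q(2) by (rule imageI[OF p])
    then show ?thesis using q(1) alt by blast
  qed
  have cl: "?\<kappa> ` closure ?D \<subseteq> ?V"
    by (rule image_closure_subset[OF continuous_on_subset[OF c\<kappa>] closed D]) simp
  show "critical_catenoid ` annulus ?T \<subseteq> ?V"
  proof
    fix x assume "x \<in> critical_catenoid ` annulus ?T"
    then obtain t z where tz: "t \<in> {-?T..?T}" "norm z = 1" "x = critical_catenoid (t, z)"
      by (auto simp: annulus_def)
    obtain \<alpha> where \<alpha>: "z = cis \<alpha>" using complex_unimodular_polar[OF tz(2)] cis.ctr by metis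
    have "(t, \<alpha>) \<in> closure ?D" using tz(1) T by (simp add: closure_Times)
    then show "x \<in> ?V" using cl tz(3) \<alpha> by force
  qed
qed

section \<open>Dependence on the coefficients\<close>

text \<open>
  Half of the coercivity constant absorbs the perturbation.
\<close>
lemma jacobi_coercive_near:
  obtains \<epsilon> \<delta> where "\<epsilon> > 0" "\<delta> > 0"
    "\<And>\<alpha> \<beta> \<gamma> \<kappa> \<mu> f fx fy.
      continuous_on (strip critical_T) \<alpha> \<Longrightarrow> continuous_on (strip critical_T) \<beta> \<Longrightarrow> continuous_on (strip critical_T) \<gamma> \<Longrightarrow>
      continuous_on (strip critical_T) \<kappa> \<Longrightarrow> continuous_on (strip critical_T) \<mu> \<Longrightarrow>
      (\<And>p. p \<in> rect critical_T \<Longrightarrow> \<bar>\<alpha> p - 1\<bar> \<le> \<epsilon> \<and> \<bar>\<beta> p\<bar> \<le> \<epsilon> \<and> \<bar>\<gamma> p - 1\<bar> \<le> \<epsilon> \<and> \<bar>\<kappa> p + 2 / (cosh (fst p))\<^sup>2\<bar> \<le> \<epsilon>) \<Longrightarrow>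
      (\<And>\<theta>. \<bar>\<mu> (critical_T, \<theta>) - 1 / critical_T\<bar> \<le> \<epsilon>) \<Longrightarrow> (\<And>\<theta>. \<bar>\<mu> (- critical_T, \<theta>) - 1 / critical_T\<bar> \<le> \<epsilon>) \<Longrightarrow>
      C1_annulus critical_T f fx fy \<Longrightarrow>
      (\<And>s. s \<in> {critical_T / 2, - critical_T / 2} \<Longrightarrow> harmonic0 (\<lambda>\<theta>. f (s, \<theta>)) = 0
        \<and> harmonic_cos (\<lambda>\<theta>. f (s, \<theta>)) = 0 \<and> harmonic_sin (\<lambda>\<theta>. f (s, \<theta>)) = 0) \<Longrightarrow>
      \<delta> * h1_norm2 f fx fy \<le> energy critical_T \<alpha> \<beta> \<gamma> \<kappa> \<mu> f fx fy"
proof (rule jacobi_coercive_L2, goal_cases)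
  case (1 c)
  note c = this(2,3)
  define e where "e = c / (2 * c + 11)"
  have e: "e > 0" using c(1) by (simp add: e_def)
  have cq: "continuous_on {-critical_T..critical_T} (\<lambda>t. 2 / (cosh t)\<^sup>2 :: real)"
    by (intro continuous_intros) auto
  show ?case
  proof (rule that[of "e / 16" "e / 2"])
    fix \<alpha> \<beta> \<gamma> \<kappa> \<mu> f fx fy
    assume cont: "continuous_on (strip critical_T) \<alpha>" "continuous_on (strip critical_T) \<beta>" "continuous_on (strip critical_T) \<gamma>"
      "continuous_on (strip critical_T) \<kappa>" "continuous_on (strip critical_T) \<mu>"
      and cl: "\<And>p. p \<in> rect critical_T \<Longrightarrow> \<bar>\<alpha> p - 1\<bar> \<le> e / 16 \<and> \<bar>\<beta> p\<bar> \<le> e / 16 \<and> \<bar>\<gamma> p - 1\<bar> \<le> e / 16 \<and> \<bar>\<kappa> p + 2 / (cosh (fst p))\<^sup>2\<bar> \<le> e / 16"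
      "\<And>\<theta>. \<bar>\<mu> (critical_T, \<theta>) - 1 / critical_T\<bar> \<le> e / 16" "\<And>\<theta>. \<bar>\<mu> (- critical_T, \<theta>) - 1 / critical_T\<bar> \<le> e / 16"
      and f: "C1_annulus critical_T f fx fy"
      and z: "\<And>s. s \<in> {critical_T / 2, - critical_T / 2} \<Longrightarrow> harmonic0 (\<lambda>\<theta>. f (s, \<theta>)) = 0
        \<and> harmonic_cos (\<lambda>\<theta>. f (s, \<theta>)) = 0 \<and> harmonic_sin (\<lambda>\<theta>. f (s, \<theta>)) = 0"
    have "e * h1_norm2 f fx fy \<le> model_energy (\<lambda>t. 2 / (cosh t)\<^sup>2) f fx fy"
      unfolding e_def by (rule coercive_H1[OF f cq two_div_cosh_sq_le c(1) c(2)[OF f z]])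
    moreover have "model_energy (\<lambda>t. 2 / (cosh t)\<^sup>2) f fx fy - 8 * (e / 16) * h1_norm2 f fx fy
        \<le> energy critical_T \<alpha> \<beta> \<gamma> \<kappa> \<mu> f fx fy"
      by (rule energy_perturbation[OF f cq cont cl])
    ultimately show "e / 2 * h1_norm2 f fx fy \<le> energy critical_T \<alpha> \<beta> \<gamma> \<kappa> \<mu> f fx fy" by simp
  qed (use e in auto)
qed

lemma steklov_coercive_near:
  obtains \<epsilon> \<delta> where "\<epsilon> > 0" "\<delta> > 0"
    "\<And>\<alpha> \<beta> \<gamma> \<mu> f fx fy.
      continuous_on (strip critical_T) \<alpha> \<Longrightarrow> continuous_on (strip critical_T) \<beta> \<Longrightarrow> continuous_on (strip critical_T) \<gamma> \<Longrightarrow>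
      continuous_on (strip critical_T) \<mu> \<Longrightarrow>
      (\<And>p. p \<in> rect critical_T \<Longrightarrow> \<bar>\<alpha> p - 1\<bar> \<le> \<epsilon> \<and> \<bar>\<beta> p\<bar> \<le> \<epsilon> \<and> \<bar>\<gamma> p - 1\<bar> \<le> \<epsilon>) \<Longrightarrow>
      (\<And>\<theta>. \<bar>\<mu> (critical_T, \<theta>) - 1 / critical_T\<bar> \<le> \<epsilon>) \<Longrightarrow> (\<And>\<theta>. \<bar>\<mu> (- critical_T, \<theta>) - 1 / critical_T\<bar> \<le> \<epsilon>) \<Longrightarrow>
      C1_annulus critical_T f fx fy \<Longrightarrow>
      (\<And>s. s \<in> {critical_T / 2, - critical_T / 2} \<Longrightarrow> harmonic0 (\<lambda>\<theta>. f (s, \<theta>)) = 0) \<Longrightarrow>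
      harmonic_cos (\<lambda>\<theta>. f (0, \<theta>)) = 0 \<Longrightarrow> harmonic_sin (\<lambda>\<theta>. f (0, \<theta>)) = 0 \<Longrightarrow>
      \<delta> * h1_norm2 f fx fy \<le> energy critical_T \<alpha> \<beta> \<gamma> (\<lambda>_. 0) \<mu> f fx fy"
proof (rule steklov_coercive_L2, goal_cases)
  case (1 c)
  note c = this(2,3)
  define e where "e = c / (2 * c + 11)"
  have e: "e > 0" using c(1) by (simp add: e_def)
  have cq: "continuous_on {-critical_T..critical_T} (\<lambda>t. 0 :: real)" by (intro continuous_intros)
  show ?case
  proof (rule that[of "e / 16" "e / 2"])
    fix \<alpha> \<beta> \<gamma> \<mu> f fx fy
    assume cont: "continuous_on (strip critical_T) \<alpha>" "continuous_on (strip critical_T) \<beta>" "continuous_on (strip critical_T) \<gamma>"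
      and cmu: "continuous_on (strip critical_T) \<mu>"
      and cl: "\<And>p. p \<in> rect critical_T \<Longrightarrow> \<bar>\<alpha> p - 1\<bar> \<le> e / 16 \<and> \<bar>\<beta> p\<bar> \<le> e / 16 \<and> \<bar>\<gamma> p - 1\<bar> \<le> e / 16"
      and clm: "\<And>\<theta>. \<bar>\<mu> (critical_T, \<theta>) - 1 / critical_T\<bar> \<le> e / 16" "\<And>\<theta>. \<bar>\<mu> (- critical_T, \<theta>) - 1 / critical_T\<bar> \<le> e / 16"
      and f: "C1_annulus critical_T f fx fy"
      and z: "\<And>s. s \<in> {critical_T / 2, - critical_T / 2} \<Longrightarrow> harmonic0 (\<lambda>\<theta>. f (s, \<theta>)) = 0"
        "harmonic_cos (\<lambda>\<theta>. f (0, \<theta>)) = 0" "harmonic_sin (\<lambda>\<theta>. f (0, \<theta>)) = 0"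
    have "e * h1_norm2 f fx fy \<le> model_energy (\<lambda>t. 0) f fx fy"
      unfolding e_def by (rule coercive_H1[OF f cq _ c(1) c(2)[OF f z]]) simp
    moreover have "model_energy (\<lambda>t. 0) f fx fy - 8 * (e / 16) * h1_norm2 f fx fy
        \<le> energy critical_T \<alpha> \<beta> \<gamma> (\<lambda>_. 0) \<mu> f fx fy"
      by (rule energy_perturbation[OF f cq cont _ cmu _ clm]) (use cl e in auto)
    ultimately show "e / 2 * h1_norm2 f fx fy \<le> energy critical_T \<alpha> \<beta> \<gamma> (\<lambda>_. 0) \<mu> f fx fy" by simp
  qed (use e in auto)
qed

lemma uniform_continuity_near_compact:
  fixes c :: "'a::euclidean_space \<Rightarrow> 'b::metric_space"
  assumes K: "compact K" and G: "open G" "K \<subseteq> G" and c: "continuous_on G c" and \<epsilon>: "\<epsilon> > 0"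
  obtains \<delta> where "\<delta> > 0" "\<And>x y. x \<in> K \<Longrightarrow> dist y x < \<delta> \<Longrightarrow> y \<in> G \<and> dist (c y) (c x) < \<epsilon>"
proof -
  obtain e where e: "e > 0" "(\<Union>x\<in>K. cball x e) \<subseteq> G"
    by (rule compact_subset_open_imp_cball_epsilon_subset[OF K G])
  define K' where "K' = {x + y | x y. x \<in> K \<and> y \<in> cball 0 e}"
  have K': "compact K'" unfolding K'_def by (rule compact_sums[OF K compact_cball])
  have ball: "y \<in> K'" if "x \<in> K" "dist y x \<le> e" for x y
    unfolding K'_def by (rule CollectI, rule exI[of _ x], rule exI[of _ "y - x"]) (use that in \<open>auto simp: dist_norm norm_minus_commute\<close>)
  have "K' \<subseteq> G"
  proof
    fix y assume "y \<in> K'"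
    then obtain x z where "y = x + z" "x \<in> K" "z \<in> cball 0 e" by (auto simp: K'_def)
    then have "y \<in> cball x e" by (simp add: dist_norm)
    then show "y \<in> G" using e(2) \<open>x \<in> K\<close> by blast
  qed
  then have "uniformly_continuous_on K' c"
    using compact_uniformly_continuous[OF continuous_on_subset[OF c] K'] by blast
  then obtain d where d: "d > 0" "\<And>x y. x \<in> K' \<Longrightarrow> y \<in> K' \<Longrightarrow> dist y x < d \<Longrightarrow> dist (c y) (c x) < \<epsilon>"
    using \<epsilon> unfolding uniformly_continuous_on_def by metis
  show thesis
  proof (rule that[of "min e d"])
    fix x y assume x: "x \<in> K" and y: "dist y x < min e d"
    have "x \<in> K'" "y \<in> K'" using ball[OF x, of x] ball[OF x, of y] y e(1) by auto
    then show "y \<in> G \<and> dist (c y) (c x) < \<epsilon>" using d(2)[of x y] y \<open>K' \<subseteq> G\<close> by auto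
  qed (use e d in auto)
qed

text \<open>
  The determinant of the mutual inner products of \<open>(v, x, y)\<close> with \<open>(v', x, y)\<close>.
\<close>
definition gram3 :: "'a::real_inner \<Rightarrow> 'a \<Rightarrow> 'a \<Rightarrow> 'a \<Rightarrow> real" where
  "gram3 x y v v' = (v \<bullet> v') * ((x \<bullet> x) * (y \<bullet> y) - (x \<bullet> y)\<^sup>2)
     - (v \<bullet> x) * ((x \<bullet> v') * (y \<bullet> y) - (x \<bullet> y) * (y \<bullet> v'))
     + (v \<bullet> y) * ((x \<bullet> v') * (x \<bullet> y) - (x \<bullet> x) * (y \<bullet> v'))"

text \<open>
  The coefficients of the forms as functions of the derivatives \<open>X\<close>, \<open>Y\<close>, \<open>Xx\<close>, \<open>Xy\<close>, \<open>Yy\<close>. They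
  only involve inner products, so isometries do not change them. By the Gauss equation the fourth is
  twice the Gauss curvature times the area density.
\<close>
definition jet_coefficients :: "'a::real_inner \<times> 'a \<times> 'a \<times> 'a \<times> 'a \<Rightarrow> real \<times> real \<times> real \<times> real \<times> real" where
  "jet_coefficients = (\<lambda>(x, y, xx, xy, yy).
     ((y \<bullet> y) / area_density x y, - (x \<bullet> y) / area_density x y, (x \<bullet> x) / area_density x y,
      2 * (gram3 x y xx yy - gram3 x y xy xy) / (area_density x y) ^ 3, norm y))"

definition regular_jets :: "('a::real_inner \<times> 'a \<times> 'a \<times> 'a \<times> 'a) set" where
  "regular_jets = {j. (fst j \<bullet> fst j) * (fst (snd j) \<bullet> fst (snd j)) - (fst j \<bullet> fst (snd j))\<^sup>2 > 0}"

lemma open_regular_jets: "open regular_jets"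
  unfolding regular_jets_def by (intro open_Collect_less continuous_intros)

lemma continuous_jet_coefficients: "continuous_on regular_jets jet_coefficients"
  unfolding jet_coefficients_def case_prod_unfold gram3_def area_density_def
  by (intro continuous_intros) (auto simp: regular_jets_def)

lemma inner_coord_inclusion:
  fixes \<sigma> :: "3 \<Rightarrow> 'n::finite"
  assumes "inj \<sigma>"
  shows "coord_inclusion \<sigma> x \<bullet> coord_inclusion \<sigma> y = x \<bullet> y"
proof -
  have ne: "\<sigma> 1 \<noteq> \<sigma> 2" "\<sigma> 1 \<noteq> \<sigma> 3" "\<sigma> 2 \<noteq> \<sigma> 3" "\<sigma> 2 \<noteq> \<sigma> 1" "\<sigma> 3 \<noteq> \<sigma> 1" "\<sigma> 3 \<noteq> \<sigma> 2"
    using assms by (auto dest!: injD)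
  have "x \<bullet> y = x $ 1 * y $ 1 + x $ 2 * y $ 2 + x $ 3 * y $ 3" by (simp add: inner_vec_def sum_3)
  then show ?thesis
    by (simp add: coord_inclusion_def sum_3 inner_add_left inner_add_right inner_axis_axis ne)
qed

lemma linear_coord_inclusion: "linear (coord_inclusion \<sigma>)"
  by (rule linearI) (simp_all add: coord_inclusion_def scaleR_add_left sum.distrib scaleR_sum_right)

definition scaled_vec :: "(3 \<Rightarrow> 'n::finite) \<Rightarrow> real \<Rightarrow> real \<Rightarrow> real \<Rightarrow> real ^ 'n" where
  "scaled_vec \<sigma> r s t = coord_inclusion \<sigma> (catenoid_scale *\<^sub>R vector [r, s, t])"

lemma scaled_vec_expand:
  "scaled_vec \<sigma> r s t = r *\<^sub>R (catenoid_scale *\<^sub>R axis (\<sigma> 1) 1) + s *\<^sub>R (catenoid_scale *\<^sub>R axis (\<sigma> 2) 1)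
    + t *\<^sub>R (catenoid_scale *\<^sub>R axis (\<sigma> 3) 1)"
  by (simp add: scaled_vec_def coord_inclusion_def sum_3 vector_3 mult.commute)

lemma inner_scaled_vec:
  assumes "inj \<sigma>"
  shows "scaled_vec \<sigma> r s t \<bullet> scaled_vec \<sigma> r' s' t' = catenoid_scale\<^sup>2 * (r * r' + s * s' + t * t')"
  unfolding scaled_vec_def inner_coord_inclusion[OF assms]
  by (simp add: inner_vec_def sum_3 vector_3 power2_eq_square algebra_simps)

lemma has_partials_scaled_vec:
  assumes "has_partials T f fx fy" "has_partials T g gx gy" "has_partials T h hx hy"
  shows "has_partials T (\<lambda>p. scaled_vec \<sigma> (f p) (g p) (h p)) (\<lambda>p. scaled_vec \<sigma> (fx p) (gx p) (hx p))
    (\<lambda>p. scaled_vec \<sigma> (fy p) (gy p) (hy p))"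
proof -
  note c = has_partials_const[of T]
  show ?thesis
    unfolding scaled_vec_expand
    by (rule has_partials_add[OF has_partials_add[OF has_partials_scaleR[OF assms(1) c] has_partials_scaleR[OF assms(2) c]]
        has_partials_scaleR[OF assms(3) c], unfolded scaleR_zero_right add_0_left])
qed

text \<open>
  The derivatives of the critical catenoid, as functions of the point of the compact annulus rather
  than of an angle.
\<close>
definition catenoid_jet :: "(3 \<Rightarrow> 'n::finite) \<Rightarrow> real \<times> complex \<Rightarrow> (real^'n) \<times> (real^'n) \<times> (real^'n) \<times> (real^'n) \<times> (real^'n)" where
  "catenoid_jet \<sigma> q =
    (scaled_vec \<sigma> (sinh (fst q) * Re (snd q)) (sinh (fst q) * Im (snd q)) 1,
     scaled_vec \<sigma> (cosh (fst q) * - Im (snd q)) (cosh (fst q) * Re (snd q)) 0,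
     scaled_vec \<sigma> (cosh (fst q) * Re (snd q)) (cosh (fst q) * Im (snd q)) 0,
     scaled_vec \<sigma> (sinh (fst q) * - Im (snd q)) (sinh (fst q) * Re (snd q)) 0,
     scaled_vec \<sigma> (cosh (fst q) * - Re (snd q)) (cosh (fst q) * - Im (snd q)) 0)"

lemma continuous_catenoid_jet: "continuous_on S (catenoid_jet \<sigma>)"
  unfolding catenoid_jet_def[abs_def] scaled_vec_expand by (intro continuous_intros)

lemma catenoid_jet_coefficients:
  assumes "inj \<sigma>" and z: "norm z = 1"
  shows "catenoid_jet \<sigma> (t, z) \<in> regular_jets"
    and "jet_coefficients (catenoid_jet \<sigma> (t, z)) = (1, 0, 1, - 2 / (cosh t)\<^sup>2, catenoid_scale * cosh t)"
proof -
  let ?C = catenoid_scale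
  have C: "?C > 0" by (rule catenoid_scale_pos)
  have zz: "Re z * Re z + Im z * Im z = 1"
  proof -
    have "(Re z)\<^sup>2 + (Im z)\<^sup>2 = 1" using z by (simp add: cmod_def)
    then show ?thesis by (simp add: power2_eq_square)
  qed
  have rot: "a * Re z * (b * Re z) + a * Im z * (b * Im z) = a * b" for a b
  proof -
    have "a * Re z * (b * Re z) + a * Im z * (b * Im z) = a * b * (Re z * Re z + Im z * Im z)" by (simp add: algebra_simps)
    then show ?thesis by (simp add: zz)
  qed
  have rot': "- (a * Im z * (b * Im z)) - a * Re z * (b * Re z) = - (a * b)"
    "- (a * Re z * (b * Re z)) - a * Im z * (b * Im z) = - (a * b)" for a b
    using rot[of a b] by simp_all
  have sc: "sinh t * sinh t + 1 = cosh t * cosh t"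
    using cosh_square_eq[of t] by (simp add: power2_eq_square)
  define x y xx xy yy where j: "x = scaled_vec \<sigma> (sinh t * Re z) (sinh t * Im z) 1"
    "y = scaled_vec \<sigma> (cosh t * - Im z) (cosh t * Re z) 0"
    "xx = scaled_vec \<sigma> (cosh t * Re z) (cosh t * Im z) 0"
    "xy = scaled_vec \<sigma> (sinh t * - Im z) (sinh t * Re z) 0"
    "yy = scaled_vec \<sigma> (cosh t * - Re z) (cosh t * - Im z) 0"
  have jet: "catenoid_jet \<sigma> (t, z) = (x, y, xx, xy, yy)"
    by (simp add: catenoid_jet_def j)
  have i: "x \<bullet> x = ?C\<^sup>2 * (cosh t * cosh t)" "x \<bullet> y = 0" "y \<bullet> x = 0" "y \<bullet> y = ?C\<^sup>2 * (cosh t * cosh t)"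
    "xx \<bullet> x = ?C\<^sup>2 * (cosh t * sinh t)" "xx \<bullet> y = 0" "xx \<bullet> yy = - (?C\<^sup>2 * (cosh t * cosh t))"
    "x \<bullet> yy = - (?C\<^sup>2 * (sinh t * cosh t))" "y \<bullet> yy = 0"
    "xy \<bullet> xy = ?C\<^sup>2 * (sinh t * sinh t)" "xy \<bullet> x = 0" "x \<bullet> xy = 0" "xy \<bullet> y = ?C\<^sup>2 * (sinh t * cosh t)" "y \<bullet> xy = ?C\<^sup>2 * (cosh t * sinh t)"
    unfolding j inner_scaled_vec[OF assms(1)] using rot sc rot' by (simp_all add: add.commute)
  have det: "(x \<bullet> x) * (y \<bullet> y) - (x \<bullet> y)\<^sup>2 = (?C\<^sup>2 * (cosh t * cosh t))\<^sup>2"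
    unfolding i by (simp add: power2_eq_square)
  have pos: "?C\<^sup>2 * (cosh t * cosh t) > 0" using C by simp
  then have A: "area_density x y = ?C\<^sup>2 * (cosh t * cosh t)"
    unfolding area_density_def det by (simp only: real_sqrt_abs abs_of_pos)
  show "catenoid_jet \<sigma> (t, z) \<in> regular_jets"
  proof -
    have "(x \<bullet> x) * (y \<bullet> y) - (x \<bullet> y)\<^sup>2 > 0" unfolding det by (rule zero_less_power[OF pos])
    then show ?thesis unfolding jet regular_jets_def by simp
  qed
  have n: "norm y = ?C * cosh t"
  proof -
    have "norm y = sqrt ((?C * cosh t)\<^sup>2)" unfolding norm_eq_sqrt_inner i by (simp add: power2_eq_square mult_ac)
    then show ?thesis using C by (simp only: real_sqrt_abs) (simp add: abs_mult)
  qed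
  define D s where "D = ?C\<^sup>2" and "s = sinh t"
  define h where "h = cosh t"
  have hs: "h * h = s * s + 1" using sc by (simp add: h_def s_def)
  have g: "gram3 x y xx yy - gram3 x y xy xy = - (D ^ 3 * h ^ 4)"
  proof -
    have "gram3 x y xx yy - gram3 x y xy xy = - (D ^ 3 * h ^ 4 * (h * h - s * s))"
      unfolding gram3_def i D_def[symmetric] h_def[symmetric] s_def[symmetric]
      by (simp add: eval_nat_numeral algebra_simps)
    then show ?thesis by (simp add: hs)
  qed
  have "2 * (gram3 x y xx yy - gram3 x y xy xy) / (area_density x y) ^ 3 = - 2 / (cosh t)\<^sup>2"
  proof -
    have Dh: "D > 0" "h > 0" using C by (auto simp: D_def h_def)
    have "2 * - (D ^ 3 * h ^ 4) / (D * (h * h)) ^ 3 = - 2 / h\<^sup>2"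
      using Dh by (simp add: field_simps eval_nat_numeral)
    then show ?thesis unfolding g A D_def[symmetric] h_def[symmetric] .
  qed
  then show "jet_coefficients (catenoid_jet \<sigma> (t, z)) = (1, 0, 1, - 2 / (cosh t)\<^sup>2, ?C * cosh t)"
    unfolding jet jet_coefficients_def using C by (simp add: A n i)
qed

text \<open>
  The radius of the boundary circles.
\<close>
lemma catenoid_scale_cosh: "catenoid_scale * cosh critical_T = 1 / critical_T"
proof -
  let ?T = critical_T
  have T: "?T > 0" by (rule critical_T_pos)
  have "sinh ?T > 0" using T by simp
  then have "?T * sinh ?T = cosh ?T" using critical_T_eq by (metis less_irrefl nonzero_eq_divide_eq)
  then have "(?T * sinh ?T)\<^sup>2 = (cosh ?T)\<^sup>2" by simp
  then have "(cosh ?T)\<^sup>2 + ?T\<^sup>2 = (?T * cosh ?T)\<^sup>2"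
    by (simp add: power_mult_distrib cosh_square_eq algebra_simps)
  then have "sqrt ((cosh ?T)\<^sup>2 + ?T\<^sup>2) = ?T * cosh ?T" using T by (simp add: abs_mult)
  then show ?thesis unfolding catenoid_scale_def by simp
qed

text \<open>
  The jets of the critical catenoid form a compact subset of the open set of regular jets, near
  which the coefficients are uniformly continuous.
\<close>
lemma jets_near_catenoid:
  fixes \<sigma> :: "3 \<Rightarrow> 'n::finite"
  assumes \<sigma>: "inj \<sigma>" and \<epsilon>: "\<epsilon> > 0"
  obtains \<delta> where "\<delta> > 0"
    "\<And>t z j \<alpha> \<beta> \<gamma> \<kappa> \<mu>. t \<in> {-critical_T..critical_T} \<Longrightarrow> norm z = 1 \<Longrightarrow> dist j (catenoid_jet \<sigma> (t, z)) < \<delta> \<Longrightarrow>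
      jet_coefficients j = (\<alpha>, \<beta>, \<gamma>, \<kappa>, \<mu>) \<Longrightarrow>
      \<bar>\<alpha> - 1\<bar> \<le> \<epsilon> \<and> \<bar>\<beta>\<bar> \<le> \<epsilon> \<and> \<bar>\<gamma> - 1\<bar> \<le> \<epsilon> \<and> \<bar>\<kappa> + 2 / (cosh t)\<^sup>2\<bar> \<le> \<epsilon> \<and> \<bar>\<mu> - catenoid_scale * cosh t\<bar> \<le> \<epsilon>"
proof -
  let ?K = "catenoid_jet \<sigma> ` ({-critical_T..critical_T} \<times> sphere 0 1)"
  have K: "compact ?K" by (intro compact_continuous_image continuous_catenoid_jet compact_Times) auto
  have KG: "?K \<subseteq> regular_jets" using catenoid_jet_coefficients(1)[OF \<sigma>] by auto
  obtain \<delta> where \<delta>: "\<delta> > 0"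
    "\<And>x y. x \<in> ?K \<Longrightarrow> dist y x < \<delta> \<Longrightarrow> y \<in> regular_jets \<and> dist (jet_coefficients y) (jet_coefficients x) < \<epsilon>"
    using uniform_continuity_near_compact[OF K open_regular_jets KG continuous_jet_coefficients \<epsilon>] by blast
  show thesis
  proof (rule that[OF \<delta>(1)])
    fix t :: real and z :: complex and j :: "(real^'n) \<times> (real^'n) \<times> (real^'n) \<times> (real^'n) \<times> (real^'n)" and \<alpha> \<beta> \<gamma> \<kappa> \<mu>
    assume t: "t \<in> {-critical_T..critical_T}" and z: "norm z = 1" and d: "dist j (catenoid_jet \<sigma> (t, z)) < \<delta>"
      and c: "jet_coefficients j = (\<alpha>, \<beta>, \<gamma>, \<kappa>, \<mu>)"
    have "catenoid_jet \<sigma> (t, z) \<in> ?K" using t z by auto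
    from \<delta>(2)[OF this d]
    have D: "dist (\<alpha>, \<beta>, \<gamma>, \<kappa>, \<mu>) (1, 0, 1, - 2 / (cosh t)\<^sup>2, catenoid_scale * cosh t) < \<epsilon>"
      unfolding c catenoid_jet_coefficients(2)[OF \<sigma> z] by blast
    note D1 = le_less_trans[OF dist_snd_le D, simplified snd_conv]
    note D2 = le_less_trans[OF dist_snd_le D1, simplified snd_conv]
    note D3 = le_less_trans[OF dist_snd_le D2, simplified snd_conv]
    show "\<bar>\<alpha> - 1\<bar> \<le> \<epsilon> \<and> \<bar>\<beta>\<bar> \<le> \<epsilon> \<and> \<bar>\<gamma> - 1\<bar> \<le> \<epsilon> \<and> \<bar>\<kappa> + 2 / (cosh t)\<^sup>2\<bar> \<le> \<epsilon> \<and> \<bar>\<mu> - catenoid_scale * cosh t\<bar> \<le> \<epsilon>"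
      using le_less_trans[OF dist_fst_le D] le_less_trans[OF dist_fst_le D1] le_less_trans[OF dist_fst_le D2]
        le_less_trans[OF dist_fst_le D3] le_less_trans[OF dist_snd_le D3]
      by (auto simp: dist_real_def)
  qed
qed

section \<open>Immersions close to the critical catenoid\<close>

lemma Basis_real_real: "(Basis :: (real * real) set) = {(1, 0), (0, 1)}"
  by (auto simp: Basis_prod_def)

lemma smooth_partials:
  assumes f: "\<And>k. Ck_on k (strip T) f"
  shows "has_partials T f (d_t T f) (d_theta T f)"
    and "Ck_on k (strip T) (d_t T f)" "Ck_on k (strip T) (d_theta T f)"
proof -
  have S: "f differentiable_on strip T" "\<forall>e\<in>Basis. Ck_on k (strip T) (partial (strip T) e f)"
    using f[of "Suc k"] by auto
  then show "Ck_on k (strip T) (d_t T f)" "Ck_on k (strip T) (d_theta T f)"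
    by (auto simp: d_t_def d_theta_def Basis_real_real)
  show "has_partials T f (d_t T f) (d_theta T f)"
    unfolding has_partials_def
  proof
    fix p assume "p \<in> strip T"
    then have D: "(f has_derivative frechet_derivative f (at p within strip T)) (at p within strip T)"
      using S(1) frechet_derivative_works by (auto simp: differentiable_on_def)
    interpret D: bounded_linear "frechet_derivative f (at p within strip T)"
      by (rule has_derivative_bounded_linear[OF D])
    have "frechet_derivative f (at p within strip T) h = fst h *\<^sub>R d_t T f p + snd h *\<^sub>R d_theta T f p" for h
    proof -
      have "h = fst h *\<^sub>R (1, 0) + snd h *\<^sub>R (0, 1)" by (simp add: prod_eq_iff)
      then have "frechet_derivative f (at p within strip T) h
          = frechet_derivative f (at p within strip T) (fst h *\<^sub>R (1, 0) + snd h *\<^sub>R (0, 1))" by (simp only:)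
      then show ?thesis by (simp only: D.add D.scaleR d_t_def d_theta_def partial_def)
    qed
    then show "(f has_derivative (\<lambda>h. fst h *\<^sub>R d_t T f p + snd h *\<^sub>R d_theta T f p)) (at p within strip T)"
      using D by presburger
  qed
qed

lemma smooth_is_C1:
  assumes f: "\<And>k. Ck_on k (strip T) f"
  shows "is_C1 T f"
  using is_C1_I[OF smooth_partials(1)[OF f]] smooth_partials(2,3)[OF f, of 0] by simp

lemma derivative_sign_at_end:
  fixes f :: "real \<Rightarrow> real"
  assumes T: "T > 0" and s: "s \<in> {1, -1}"
    and d: "(f has_real_derivative D) (at (s * T) within {-T..T})"
    and max: "\<And>t. t \<in> {-T..T} \<Longrightarrow> f t \<le> f (s * T)"
  shows "s * D \<ge> 0"
proof (rule ccontr)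
  assume neg: "\<not> s * D \<ge> 0"
  show False
  proof (cases "s = 1")
    case True
    then have "D < 0" "(f has_real_derivative D) (at T within {-T..T})" using neg d by auto
    from has_real_derivative_neg_dec_left[OF this(2,1)]
    obtain e where e: "e > 0" "\<And>h. 0 < h \<Longrightarrow> T - h \<in> {-T..T} \<Longrightarrow> h < e \<Longrightarrow> f T < f (T - h)" by blast
    define h where "h = min (e / 2) T"
    have "0 < h" "h < e" "T - h \<in> {-T..T}" using e(1) T by (auto simp: h_def)
    then show False using e(2)[of h] max[of "T - h"] True by fastforce
  next
    case False
    then have s: "s = -1" using s by simp
    then have "D > 0" "(f has_real_derivative D) (at (-T) within {-T..T})" using neg d by auto
    from has_real_derivative_pos_inc_right[OF this(2,1)]
    obtain e where e: "e > 0" "\<And>h. 0 < h \<Longrightarrow> -T + h \<in> {-T..T} \<Longrightarrow> h < e \<Longrightarrow> f (-T) < f (-T + h)" by blast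
    define h where "h = min (e / 2) T"
    have "0 < h" "h < e" "-T + h \<in> {-T..T}" using e(1) T by (auto simp: h_def)
    then show False using e(2)[of h] max[of "-T + h"] s by fastforce
  qed
qed

text \<open>
  For the boundary condition, consider the tangent vector \<open>\<eta> = |Y|\<^sup>2 X - (X \<bullet> Y) Y\<close>, which is
  perpendicular to \<open>Y\<close>. Orthogonality makes it a multiple of \<open>u\<close>. Its length is the area density
  times \<open>|Y|\<close>, and its sign is that of the derivative of \<open>|u|\<^sup>2\<close>, which is largest on the boundary.
\<close>
lemma free_boundary_surface_of_immersion:
  fixes u :: "real \<times> complex \<Rightarrow> 'a::euclidean_space"
  assumes T: "T > 0" and fb: "free_boundary_minimal_immersion T u"
  defines "U \<equiv> lift u"
  shows "free_boundary_surface T U (d_t T U) (d_theta T U) (d_t T (d_t T U)) (d_theta T (d_t T U)) (d_theta T (d_theta T U))"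
proof -
  have sm: "Ck_on k (strip T) U" for k
    using fb by (auto simp: free_boundary_minimal_immersion_def minimal_immersion_def immersion_def
        smooth_annulus_map_def U_def)
  define X Y where "X = d_t T U" and "Y = d_theta T U"
  have smX: "Ck_on k (strip T) X" and smY: "Ck_on k (strip T) Y" for k
    unfolding X_def Y_def by (rule smooth_partials[OF sm])+
  have pu: "has_partials T U X Y" unfolding X_def Y_def by (rule smooth_partials(1)[OF sm])
  note pX = smooth_partials(1)[OF smX] and pY = smooth_partials(1)[OF smY]
  have mixed: "d_theta T X p = d_t T Y p" if "p \<in> strip T" for p
    by (rule mixed_partials_eq[OF T pu pX pY _ that]) (use smooth_partials(2)[OF smY, of 0] in simp)
  have pY': "has_partials T Y (d_theta T X) (d_theta T Y)"
    using pY mixed by (simp add: has_partials_def)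
  have frechet: "frechet_derivative U (at p within strip T) = (\<lambda>h. fst h *\<^sub>R X p + snd h *\<^sub>R Y p)" if "p \<in> strip T" for p
    by (rule has_partials_unique(3)[OF T pu that])
  have inj: "inj (\<lambda>h::real \<times> real. fst h *\<^sub>R X p + snd h *\<^sub>R Y p)" if "p \<in> strip T" for p
    using fb that frechet[OF that]
    by (auto simp: free_boundary_minimal_immersion_def minimal_immersion_def immersion_def U_def)
  have lin: "linear (\<lambda>h::real \<times> real. fst h *\<^sub>R X p + snd h *\<^sub>R Y p)" for p
    by (rule linearI) (simp_all add: algebra_simps)
  have regular: "(X p \<bullet> X p) * (Y p \<bullet> Y p) - (X p \<bullet> Y p)\<^sup>2 > 0" if p: "p \<in> strip T" for p
  proof (rule ccontr)
    assume neg: "\<not> ?thesis"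
    have ker: "h = 0" if "fst h *\<^sub>R X p + snd h *\<^sub>R Y p = 0" for h :: "real \<times> real"
      using inj[OF p] that linear_injective_0[OF lin] by blast
    let ?v = "(Y p \<bullet> Y p) *\<^sub>R X p + (- (X p \<bullet> Y p)) *\<^sub>R Y p"
    have "?v \<bullet> ?v = (Y p \<bullet> Y p) * ((X p \<bullet> X p) * (Y p \<bullet> Y p) - (X p \<bullet> Y p)\<^sup>2)"
      by (simp add: inner_add_left inner_add_right inner_diff_left inner_diff_right inner_commute power2_eq_square algebra_simps)
    also have "\<dots> \<le> 0" using neg by (intro mult_nonneg_nonpos) auto
    finally have "?v \<bullet> ?v = 0" using inner_ge_zero[of ?v] by linarith
    then have "?v = 0" by (simp only: inner_eq_zero_iff)
    with ker[of "(Y p \<bullet> Y p, - (X p \<bullet> Y p))"] have "Y p = 0" by (simp add: zero_prod_def)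
    then show False using ker[of "(0, 1)"] by (simp add: zero_prod_def)
  qed
  have plane: "tangent_plane T U p \<subseteq> span {X p, Y p}" "subspace (tangent_plane T U p)" if p: "p \<in> strip T" for p
  proof -
    have "fst h *\<^sub>R X p + snd h *\<^sub>R Y p \<in> span {X p, Y p}" for h :: "real \<times> real"
      by (intro span_add span_mul) (auto intro: span_base)
    then show "tangent_plane T U p \<subseteq> span {X p, Y p}" unfolding tangent_plane_def frechet[OF p] by auto
    show "subspace (tangent_plane T U p)"
      unfolding tangent_plane_def frechet[OF p] by (rule linear_subspace_image[OF lin subspace_UNIV])
  qed
  have per: "U (t, \<theta> + 2 * pi) = U (t, \<theta>)" for t \<theta>
    by (simp add: U_def lift_def flip: cis_mult)
  have annulus: "(t, cis \<theta>) \<in> annulus T" if "(t, \<theta>) \<in> strip T" for t \<theta>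
    using that by (auto simp: annulus_def)
  have ball: "norm (U p) \<le> 1" if "p \<in> strip T" for p
  proof -
    obtain t \<theta> where p: "p = (t, \<theta>)" by (cases p)
    have "u (t, cis \<theta>) \<in> cball 0 1"
      using fb annulus[of t \<theta>] that p by (auto simp: free_boundary_minimal_immersion_def)
    then show ?thesis by (simp add: U_def lift_def p)
  qed
  have sphere: "norm (U p) = 1 \<longleftrightarrow> \<bar>fst p\<bar> = T" if "p \<in> strip T" for p
  proof -
    obtain t \<theta> where p: "p = (t, \<theta>)" by (cases p)
    have "(t, cis \<theta>) \<in> {q \<in> annulus T. u q \<in> sphere 0 1} \<longleftrightarrow> (t, cis \<theta>) \<in> annulus_boundary T"
      using fb by (simp add: free_boundary_minimal_immersion_def)
    then have "norm (u (t, cis \<theta>)) = 1 \<longleftrightarrow> t = - T \<or> t = T"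
      using annulus[of t \<theta>] that p by (auto simp: annulus_boundary_def)
    then show ?thesis using T by (auto simp: p U_def lift_def abs_if)
  qed
  have "free_boundary_surface T U X Y (d_t T X) (d_theta T X) (d_theta T Y)"
  proof
    show "is_C1 T (d_t T X)" "is_C1 T (d_theta T X)" "is_C1 T (d_theta T Y)"
      by (intro smooth_is_C1 smooth_partials(2,3) smX smY)+
    fix p assume p: "p \<in> strip T"
    let ?E = "X p \<bullet> X p" and ?F = "X p \<bullet> Y p" and ?G = "Y p \<bullet> Y p"
    let ?c = "closest_point (tangent_plane T U p)"
    have "mean_curvature T U p = 0"
      using fb p by (auto simp: free_boundary_minimal_immersion_def minimal_immersion_def U_def)
    then have "(1 / (?E * ?G - ?F\<^sup>2)) *\<^sub>R (?G *\<^sub>R (d_t T X p - ?c (d_t T X p)) - (2 * ?F) *\<^sub>R (d_t T Y p - ?c (d_t T Y p))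
        + ?E *\<^sub>R (d_theta T Y p - ?c (d_theta T Y p))) = 0"
      by (simp add: mean_curvature_def Let_def normal_part_def X_def Y_def)
    then have "?G *\<^sub>R (d_t T X p - ?c (d_t T X p)) - (2 * ?F) *\<^sub>R (d_t T Y p - ?c (d_t T Y p))
        + ?E *\<^sub>R (d_theta T Y p - ?c (d_theta T Y p)) = 0"
      using regular[OF p] by simp
    then have eq: "?G *\<^sub>R d_t T X p - (2 * ?F) *\<^sub>R d_t T Y p + ?E *\<^sub>R d_theta T Y p
        = ?G *\<^sub>R ?c (d_t T X p) - (2 * ?F) *\<^sub>R ?c (d_t T Y p) + ?E *\<^sub>R ?c (d_theta T Y p)"
      by (simp add: scaleR_diff_right algebra_simps)
    have "?c v \<in> span {X p, Y p}" for v
    proof -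
      have "?c v \<in> tangent_plane T U p"
        by (rule closest_point_in_set[OF closed_subspace[OF plane(2)[OF p]]])
          (use subspace_0[OF plane(2)[OF p]] in auto)
      then show ?thesis using plane(1)[OF p] by blast
    qed
    then have "?G *\<^sub>R ?c (d_t T X p) - (2 * ?F) *\<^sub>R ?c (d_t T Y p) + ?E *\<^sub>R ?c (d_theta T Y p) \<in> span {X p, Y p}"
      by (intro span_add span_diff span_mul)
    then show "?G *\<^sub>R d_t T X p - (2 * ?F) *\<^sub>R d_theta T X p + ?E *\<^sub>R d_theta T Y p \<in> span {X p, Y p}"
      unfolding mixed[OF p] eq .
  next
    fix s \<theta> :: real assume s: "s \<in> {1, -1}"
    let ?p = "(s * T, \<theta>)"
    have p: "?p \<in> strip T" and sT: "s * T \<in> {-T..T}" and pb: "?p \<in> {-T, T} \<times> UNIV" using s T by auto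
    let ?E = "X ?p \<bullet> X ?p" and ?F = "X ?p \<bullet> Y ?p" and ?G = "Y ?p \<bullet> Y ?p"
    let ?\<eta> = "?G *\<^sub>R X ?p - ?F *\<^sub>R Y ?p"
    have "?\<eta> = (\<lambda>h. fst h *\<^sub>R X ?p + snd h *\<^sub>R Y ?p) (?G, - ?F)" by simp
    then have "?\<eta> \<in> tangent_plane T U ?p" unfolding tangent_plane_def frechet[OF p] by blast
    moreover have "orthogonal ?\<eta> (Y ?p)" by (simp add: orthogonal_def inner_diff_left)
    ultimately have orth: "orthogonal ?\<eta> v" if "orthogonal v (U ?p)" for v
      using fb that pb unfolding free_boundary_minimal_immersion_def meets_sphere_orthogonally_def U_def[symmetric] Y_def
      by blast
    have U1: "U (s * T, t) \<bullet> U (s * T, t) = 1" for t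
    proof -
      have "norm (U (s * T, t)) = 1" using sphere[of "(s * T, t)"] s T by auto
      then show ?thesis by (simp add: norm_eq_1)
    qed
    have "((\<lambda>t. U (s * T, t) \<bullet> U (s * T, t)) has_vector_derivative U ?p \<bullet> Y ?p + Y ?p \<bullet> U ?p) (at \<theta>)"
      by (rule has_partials_theta[OF has_partials_inner[OF pu pu] sT])
    then have "((\<lambda>t. 1::real) has_vector_derivative U ?p \<bullet> Y ?p + Y ?p \<bullet> U ?p) (at \<theta>)" by (simp add: U1)
    then have "U ?p \<bullet> Y ?p + Y ?p \<bullet> U ?p = 0"
      using has_vector_derivative_const vector_derivative_unique_at by blast
    then have UY: "Y ?p \<bullet> U ?p = 0" by (simp add: inner_commute)
    have "((\<lambda>t. U (t, \<theta>) \<bullet> U (t, \<theta>)) has_vector_derivative U ?p \<bullet> X ?p + X ?p \<bullet> U ?p) (at (s * T) within {-T..T})"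
      by (rule has_partials_t[OF has_partials_inner[OF pu pu] sT])
    then have "((\<lambda>t. U (t, \<theta>) \<bullet> U (t, \<theta>)) has_real_derivative U ?p \<bullet> X ?p + X ?p \<bullet> U ?p) (at (s * T) within {-T..T})"
      by (simp add: has_real_derivative_iff_has_vector_derivative)
    moreover have "U (t, \<theta>) \<bullet> U (t, \<theta>) \<le> U (s * T, \<theta>) \<bullet> U (s * T, \<theta>)" if "t \<in> {-T..T}" for t
      using ball[of "(t, \<theta>)"] that unfolding U1 by (simp add: norm_le_square)
    ultimately have "s * (U ?p \<bullet> X ?p + X ?p \<bullet> U ?p) \<ge> 0"
      by (intro derivative_sign_at_end[OF T s])
    then have UX: "s * (X ?p \<bullet> U ?p) \<ge> 0" by (simp add: inner_commute)
    have \<eta>u: "?\<eta> = (?\<eta> \<bullet> U ?p) *\<^sub>R U ?p"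
    proof -
      let ?v = "?\<eta> - (?\<eta> \<bullet> U ?p) *\<^sub>R U ?p"
      have v: "?v \<bullet> U ?p = 0" using U1[of \<theta>] by (simp add: inner_diff_left)
      then have "?\<eta> \<bullet> ?v = 0" using orth[of ?v] by (simp add: orthogonal_def)
      then have "?v \<bullet> ?v = 0" using v by (simp add: inner_diff_left[of _ _ ?v] inner_commute[of "U ?p" ?v])
      then show ?thesis by simp
    qed
    let ?W = "area_density (X ?p) (Y ?p)"
    have W: "?W > 0" "?W\<^sup>2 = ?E * ?G - ?F\<^sup>2" using regular[OF p] by (auto simp: area_density_def)
    have G: "?G > 0" using regular[OF p] by (cases "Y ?p = 0") auto
    have "?\<eta> \<bullet> ?\<eta> = ?G * ?W\<^sup>2"
      unfolding W by (simp add: inner_diff_left inner_diff_right inner_commute power2_eq_square algebra_simps)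
    moreover have "?\<eta> \<bullet> ?\<eta> = (?\<eta> \<bullet> U ?p)\<^sup>2"
      by (rule trans[OF arg_cong[OF \<eta>u, of "\<lambda>v. ?\<eta> \<bullet> v"]]) (simp only: inner_scaleR_right power2_eq_square)
    ultimately have "(s * (?\<eta> \<bullet> U ?p))\<^sup>2 = (?W * norm (Y ?p))\<^sup>2"
      using s by (auto simp: power_mult_distrib power2_norm_eq_inner)
    moreover have "s * (?\<eta> \<bullet> U ?p) \<ge> 0"
    proof -
      have eq: "s * (?\<eta> \<bullet> U ?p) = ?G * (s * (X ?p \<bullet> U ?p))" using UY by (simp add: inner_diff_left)
      show ?thesis unfolding eq by (rule mult_nonneg_nonneg[OF less_imp_le[OF G] UX])
    qed
    ultimately have "s * (?\<eta> \<bullet> U ?p) = ?W * norm (Y ?p)" using W(1) by (simp add: power2_eq_iff_nonneg)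
    then have "s * (s * (?\<eta> \<bullet> U ?p)) = s * (?W * norm (Y ?p))" by simp
    then have "?\<eta> \<bullet> U ?p = s * ?W * norm (Y ?p)" using s by auto
    then have "(?\<eta> \<bullet> U ?p) *\<^sub>R U ?p = (s * ?W * norm (Y ?p)) *\<^sub>R U ?p" by (simp only:)
    with \<eta>u show "?\<eta> = (s * ?W * norm (Y ?p)) *\<^sub>R U ?p" by (rule trans)
  next
    show "T > 0" by (rule T)
    show "has_partials T U X Y" "has_partials T X (d_t T X) (d_theta T X)" "has_partials T Y (d_theta T X) (d_theta T Y)"
      by (rule pu pX pY')+
    show "U (t, \<theta> + 2 * pi) = U (t, \<theta>)" for t \<theta> by (rule per)
    show "(X p \<bullet> X p) * (Y p \<bullet> Y p) - (X p \<bullet> Y p)\<^sup>2 > 0" "norm (U p) \<le> 1" "norm (U p) = 1 \<longleftrightarrow> \<bar>fst p\<bar> = T"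
      if "p \<in> strip T" for p by (rule regular[OF that] ball[OF that] sphere[OF that])+
  qed
  then show ?thesis by (simp add: X_def Y_def)
qed

text \<open>
  Periodicity reduces the supremum over the strip to a compact rectangle, so that it is finite.
\<close>
lemma sup_norm_bound:
  fixes G :: "real \<times> real \<Rightarrow> 'a::real_normed_vector"
  assumes G: "continuous_on (strip T) G" and per: "\<And>t \<theta>. t \<in> {-T..T} \<Longrightarrow> G (t, \<theta> + 2 * pi) = G (t, \<theta>)"
    and eq: "\<And>p. p \<in> strip T \<Longrightarrow> F p = G p" and p: "p \<in> strip T"
  shows "norm (G p) \<le> sup_norm_on (strip T) F"
proof -
  have "compact ((\<lambda>q. norm (G q)) ` rect T)"
    by (intro compact_continuous_image compact_cbox continuous_on_norm continuous_on_subset[OF G rect_subset_strip])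
  then have "bdd_above ((\<lambda>q. norm (G q)) ` rect T)" by (intro bounded_imp_bdd_above compact_imp_bounded)
  then obtain M where M: "\<And>q. q \<in> rect T \<Longrightarrow> norm (G q) \<le> M" by (auto simp: bdd_above_def)
  have "norm (F q) \<le> M" if q: "q \<in> strip T" for q
  proof -
    obtain t \<theta> where qe: "q = (t, \<theta>)" "t \<in> {-T..T}" using q by (cases q) auto
    obtain \<theta>' where "\<theta>' \<in> {0..2 * pi}" "G (t, \<theta>) = G (t, \<theta>')"
      using periodic_reduce[of "\<lambda>\<theta>. G (t, \<theta>)" \<theta>, OF per[OF qe(2)]] by auto
    then show ?thesis using M[of "(t, \<theta>')"] eq[OF q] qe by (auto simp: cbox_Pair_eq)
  qed
  then have "bdd_above ((\<lambda>q. norm (F q)) ` strip T)" by (rule bdd_aboveI2)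
  from cSUP_upper[OF p this] show ?thesis unfolding sup_norm_on_def eq[OF p] .
qed

lemma C2_norm_bounds:
  fixes w :: "real \<times> complex \<Rightarrow> 'a::real_normed_vector"
  assumes T: "T > 0" and g: "has_partials T (lift w) gx gy" and gx: "has_partials T gx gxx gxy" and gy: "has_partials T gy gyx gyy"
    and c: "continuous_on (strip T) gxx" "continuous_on (strip T) gxy" "continuous_on (strip T) gyx" "continuous_on (strip T) gyy"
    and p: "p \<in> strip T"
  shows "norm (lift w p) \<le> C2_norm T w" "norm (gx p) \<le> C2_norm T w" "norm (gy p) \<le> C2_norm T w"
    "norm (gxx p) \<le> C2_norm T w" "norm (gxy p) \<le> C2_norm T w" "norm (gyy p) \<le> C2_norm T w"
proof -
  let ?s = "sup_norm_on (strip T)" and ?g = "lift w"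
  have per: "?g (t, \<theta> + 2 * pi) = ?g (t, \<theta>)" for t \<theta>
    by (simp add: lift_def flip: cis_mult)
  note per1 = has_partials_periodic[OF T g per] and eq1 = has_partials_unique(1,2)[OF T g]
  note per2 = has_partials_periodic[OF T gx per1(1)] and per3 = has_partials_periodic[OF T gy per1(2)]
  have hx: "has_partials T (d_t T ?g) gxx gxy" and hy: "has_partials T (d_theta T ?g) gyx gyy"
    unfolding has_partials_def
  proof safe
    fix t \<theta> assume q: "(t, \<theta>) \<in> strip T"
    show "(d_t T ?g has_derivative (\<lambda>h. fst h *\<^sub>R gxx (t, \<theta>) + snd h *\<^sub>R gxy (t, \<theta>))) (at (t, \<theta>) within strip T)"
      by (rule has_derivative_transform[OF q eq1(1)]) (use gx q in \<open>auto simp: has_partials_def\<close>)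
    show "(d_theta T ?g has_derivative (\<lambda>h. fst h *\<^sub>R gyx (t, \<theta>) + snd h *\<^sub>R gyy (t, \<theta>))) (at (t, \<theta>) within strip T)"
      by (rule has_derivative_transform[OF q eq1(2)]) (use gy q in \<open>auto simp: has_partials_def\<close>)
  qed
  note eqx = has_partials_unique(1,2)[OF T hx] and eqy = has_partials_unique(1,2)[OF T hy]
  have C2: "C2_norm T w = ?s ?g + (?s (d_t T ?g) + ?s (d_theta T ?g))
      + ((?s (d_t T (d_t T ?g)) + ?s (d_t T (d_theta T ?g))) + (?s (d_theta T (d_t T ?g)) + ?s (d_theta T (d_theta T ?g))))"
    by (simp add: C2_norm_def Basis_real_real d_t_def d_theta_def)
  note b = sup_norm_bound[OF has_partials_continuous[OF g] per refl p]
    sup_norm_bound[OF has_partials_continuous[OF gx] per1(1) eq1(1) p]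
    sup_norm_bound[OF has_partials_continuous[OF gy] per1(2) eq1(2) p]
    sup_norm_bound[OF c(1) per2(1) eqx(1) p] sup_norm_bound[OF c(2) per2(2) eqx(2) p]
    sup_norm_bound[OF c(3) per3(1) eqy(1) p] sup_norm_bound[OF c(4) per3(2) eqy(2) p]
  note n = norm_ge_zero[of "?g p"] norm_ge_zero[of "gx p"] norm_ge_zero[of "gy p"] norm_ge_zero[of "gxx p"]
    norm_ge_zero[of "gxy p"] norm_ge_zero[of "gyx p"] norm_ge_zero[of "gyy p"]
  show "norm (?g p) \<le> C2_norm T w" "norm (gx p) \<le> C2_norm T w" "norm (gy p) \<le> C2_norm T w"
    "norm (gxx p) \<le> C2_norm T w" "norm (gxy p) \<le> C2_norm T w" "norm (gyy p) \<le> C2_norm T w"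
    unfolding C2 using b n by linarith+
qed

lemma has_partials_product:
  assumes F: "\<And>x. (F has_real_derivative F' x) (at x)" and G: "\<And>x. (G has_real_derivative G' x) (at x)"
  shows "has_partials T (\<lambda>p. F (fst p) * G (snd p)) (\<lambda>p. F' (fst p) * G (snd p)) (\<lambda>p. F (fst p) * G' (snd p))"
proof -
  have f: "has_partials T (fst :: real \<times> real \<Rightarrow> real) (\<lambda>_. 1) (\<lambda>_. 0)" "has_partials T (snd :: real \<times> real \<Rightarrow> real) (\<lambda>_. 0) (\<lambda>_. 1)"
    unfolding has_partials_def by (auto intro!: derivative_eq_intros)
  show ?thesis
    using has_partials_mult[OF has_partials_real_compose[OF F f(1)] has_partials_real_compose[OF G f(2)]] by simp
qed

lemma catenoid_lift:
  "lift (\<lambda>p. coord_inclusion \<sigma> (critical_catenoid p)) =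
    (\<lambda>p. scaled_vec \<sigma> (cosh (fst p) * cos (snd p)) (cosh (fst p) * sin (snd p)) (fst p))"
  by (auto simp: lift_def scaled_vec_def critical_catenoid_def catenoid_scale_def)

text \<open>
  The factor five counts the components of the jet.
\<close>
lemma jets_of_close_map:
  fixes u :: "real \<times> complex \<Rightarrow> real ^ 'n::finite" and \<sigma> :: "3 \<Rightarrow> 'n"
  assumes T: "T > 0" and sm: "smooth_annulus_map T u"
  defines "U \<equiv> lift u" and "\<rho> \<equiv> C2_norm T (\<lambda>p. u p - coord_inclusion \<sigma> (critical_catenoid p))"
  assumes p: "(t, \<theta>) \<in> strip T"
  shows "norm (U (t, \<theta>) - scaled_vec \<sigma> (cosh t * cos \<theta>) (cosh t * sin \<theta>) t) \<le> \<rho>"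
    and "dist (d_t T U (t, \<theta>), d_theta T U (t, \<theta>), d_t T (d_t T U) (t, \<theta>), d_theta T (d_t T U) (t, \<theta>), d_theta T (d_theta T U) (t, \<theta>))
      (catenoid_jet \<sigma> (t, cis \<theta>)) \<le> 5 * \<rho>"
proof -
  have smU: "Ck_on k (strip T) U" for k using sm by (simp add: smooth_annulus_map_def U_def)
  define X Y where "X = d_t T U" and "Y = d_theta T U"
  have smX: "Ck_on k (strip T) X" and smY: "Ck_on k (strip T) Y" for k
    unfolding X_def Y_def by (rule smooth_partials[OF smU])+
  have pu: "has_partials T U X Y" unfolding X_def Y_def by (rule smooth_partials(1)[OF smU])
  note pX = smooth_partials(1)[OF smX] and pY = smooth_partials(1)[OF smY]
  have cXY: "continuous_on (strip T) (d_t T X)" "continuous_on (strip T) (d_theta T X)"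
    "continuous_on (strip T) (d_t T Y)" "continuous_on (strip T) (d_theta T Y)"
    using smooth_partials(2,3)[OF smX, of 0] smooth_partials(2,3)[OF smY, of 0] by simp_all
  have dch: "(cosh has_real_derivative sinh x) (at x)" "(sinh has_real_derivative cosh x) (at x)"
    "(cos has_real_derivative - sin x) (at x)" "(sin has_real_derivative cos x) (at x)"
    "((\<lambda>x. - sin x) has_real_derivative - cos x) (at x)" "((\<lambda>x. - cos x) has_real_derivative sin x) (at x)" for x :: real
    by (auto intro!: derivative_eq_intros)
  have dfst: "has_partials T (fst :: real \<times> real \<Rightarrow> real) (\<lambda>_. 1) (\<lambda>_. 0)"
    unfolding has_partials_def by (auto intro!: derivative_eq_intros)
  note dc = has_partials_const[of T "1::real"] has_partials_const[of T "0::real"]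
  note s0 = has_partials_scaled_vec[where \<sigma> = \<sigma>, OF has_partials_product[where T = T, OF dch(1) dch(3)]
      has_partials_product[where T = T, OF dch(1) dch(4)] dfst]
  note s1 = has_partials_scaled_vec[where \<sigma> = \<sigma>, OF has_partials_product[where T = T, OF dch(2) dch(3)]
      has_partials_product[where T = T, OF dch(2) dch(4)] dc(1)]
  note s2 = has_partials_scaled_vec[where \<sigma> = \<sigma>, OF has_partials_product[where T = T, OF dch(1) dch(5)]
      has_partials_product[where T = T, OF dch(1) dch(3)] dc(2)]
  have cs: "continuous_on (strip T) (\<lambda>p. scaled_vec \<sigma> (f p) (g p) (h p))"
    if "continuous_on (strip T) f" "continuous_on (strip T) g" "continuous_on (strip T) h" for f g h :: "real \<times> real \<Rightarrow> real"
    unfolding scaled_vec_expand by (intro continuous_intros that)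
  let ?w = "\<lambda>p. u p - coord_inclusion \<sigma> (critical_catenoid p)"
  have lw: "lift ?w = (\<lambda>p. U p - scaled_vec \<sigma> (cosh (fst p) * cos (snd p)) (cosh (fst p) * sin (snd p)) (fst p))"
    using catenoid_lift[of \<sigma>] by (auto simp: U_def lift_def fun_eq_iff)
  note g = has_partials_diff[OF pu s0, folded lw] and gx = has_partials_diff[OF pX s1] and gy = has_partials_diff[OF pY s2]
  have cc: "continuous_on (strip T) (\<lambda>p. d_t T X p - scaled_vec \<sigma> (cosh (fst p) * cos (snd p)) (cosh (fst p) * sin (snd p)) 0)"
    "continuous_on (strip T) (\<lambda>p. d_theta T X p - scaled_vec \<sigma> (sinh (fst p) * - sin (snd p)) (sinh (fst p) * cos (snd p)) 0)"
    "continuous_on (strip T) (\<lambda>p. d_t T Y p - scaled_vec \<sigma> (sinh (fst p) * - sin (snd p)) (sinh (fst p) * cos (snd p)) 0)"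
    "continuous_on (strip T) (\<lambda>p. d_theta T Y p - scaled_vec \<sigma> (cosh (fst p) * - cos (snd p)) (cosh (fst p) * - sin (snd p)) 0)"
    by (intro continuous_on_diff cXY cs continuous_intros)+
  have bounds: "norm (lift ?w (t, \<theta>)) \<le> \<rho>"
    "norm (X (t, \<theta>) - scaled_vec \<sigma> (sinh t * cos \<theta>) (sinh t * sin \<theta>) 1) \<le> \<rho>"
    "norm (Y (t, \<theta>) - scaled_vec \<sigma> (cosh t * - sin \<theta>) (cosh t * cos \<theta>) 0) \<le> \<rho>"
    "norm (d_t T X (t, \<theta>) - scaled_vec \<sigma> (cosh t * cos \<theta>) (cosh t * sin \<theta>) 0) \<le> \<rho>"
    "norm (d_theta T X (t, \<theta>) - scaled_vec \<sigma> (sinh t * - sin \<theta>) (sinh t * cos \<theta>) 0) \<le> \<rho>"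
    "norm (d_theta T Y (t, \<theta>) - scaled_vec \<sigma> (cosh t * - cos \<theta>) (cosh t * - sin \<theta>) 0) \<le> \<rho>"
    unfolding \<rho>_def using C2_norm_bounds[OF T g gx gy cc p] by simp_all
  show "norm (U (t, \<theta>) - scaled_vec \<sigma> (cosh t * cos \<theta>) (cosh t * sin \<theta>) t) \<le> \<rho>"
    using bounds(1) unfolding lw by simp
  have N: "norm (a, b, c, d, e) \<le> norm a + norm b + norm c + norm d + norm e" for a b c d e :: "real ^ 'n"
    using norm_Pair_le[of a "(b, c, d, e)"] norm_Pair_le[of b "(c, d, e)"] norm_Pair_le[of c "(d, e)"] norm_Pair_le[of d e]
    by linarith
  show "dist (d_t T U (t, \<theta>), d_theta T U (t, \<theta>), d_t T (d_t T U) (t, \<theta>), d_theta T (d_t T U) (t, \<theta>), d_theta T (d_theta T U) (t, \<theta>))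
      (catenoid_jet \<sigma> (t, cis \<theta>)) \<le> 5 * \<rho>"
    unfolding dist_norm catenoid_jet_def X_def[symmetric] Y_def[symmetric] diff_Pair fst_conv snd_conv cis.sel
    by (rule order_trans[OF N]) (use bounds in linarith)
qed

section \<open>Isometric images and rigidity\<close>

lemma isometry_inner:
  assumes f: "linear f" and V: "subspace V" and n: "\<And>x. x \<in> V \<Longrightarrow> norm (f x) = norm x"
    and xy: "x \<in> V" "y \<in> V"
  shows "f x \<bullet> f y = x \<bullet> y"
  unfolding dot_norm linear_add[OF f, symmetric] by (simp add: n xy subspace_add[OF V xy])

text \<open>
  The orthogonal complements of \<open>V\<close> and \<open>f V\<close> have the same dimension, so \<open>f\<close> on \<open>V\<close> can be combined
  with an isometry between them.
\<close>
lemma extend_isometry: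
  fixes f :: "'a::euclidean_space \<Rightarrow> 'a"
  assumes f: "linear f" and V: "subspace V" and n: "\<And>x. x \<in> V \<Longrightarrow> norm (f x) = norm x"
  obtains R where "orthogonal_transformation R" "\<And>x. x \<in> V \<Longrightarrow> R x = f x"
proof -
  obtain B where B: "B \<subseteq> V" "pairwise orthogonal B" "\<And>x. x \<in> B \<Longrightarrow> norm x = 1" "independent B" "span B = V"
    by (rule orthonormal_basis_subspace[OF V]) blast
  have fin: "finite B" by (rule independent_imp_finite[OF B(4)])
  define \<pi> where "\<pi> x = (\<Sum>b\<in>B. (x \<bullet> b) *\<^sub>R b)" for x
  have lin\<pi>: "linear \<pi>"
    by (rule linearI) (simp_all add: \<pi>_def inner_add_left scaleR_add_left sum.distrib scaleR_sum_right)
  have \<pi>V: "\<pi> x \<in> V" for x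
    unfolding \<pi>_def using B(1) by (intro subspace_sum[OF V] subspace_mul[OF V]) auto
  have "orthogonal (x - \<pi> x) b" if b: "b \<in> B" for x b
  proof -
    have "b' \<bullet> b = (if b' = b then 1 else 0)" if "b' \<in> B" for b'
      using B(2,3) b that by (auto simp: pairwise_def orthogonal_def dot_square_norm)
    then have "\<pi> x \<bullet> b = (\<Sum>b'\<in>B. (x \<bullet> b') * (if b' = b then 1 else 0))"
      unfolding \<pi>_def inner_sum_left by (intro sum.cong) auto
    also have "\<dots> = x \<bullet> b" using b fin by (simp add: sum.delta if_distrib cong: if_cong)
    finally show ?thesis by (simp add: orthogonal_def inner_diff_left)
  qed
  then have orth: "orthogonal (x - \<pi> x) y" if "y \<in> V" for x y
    using orthogonal_to_span[of y B] that B(5) by blast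
  have \<pi>id: "\<pi> x = x" if "x \<in> V" for x
    using orth[OF subspace_diff[OF V that \<pi>V], of x x] by (simp add: orthogonal_def)
  let ?V' = "{y \<in> UNIV. \<forall>x \<in> V. orthogonal x y}" and ?W' = "{y \<in> UNIV. \<forall>x \<in> f ` V. orthogonal x y}"
  have fV: "subspace (f ` V)" by (rule linear_subspace_image[OF f V])
  have "inj_on f V"
    unfolding linear_injective_on_subspace_0[OF f V]
  proof (intro ballI impI)
    fix x assume "x \<in> V" "f x = 0"
    then have "norm x = norm (0::'a)" using n[of x] by simp
    then show "x = 0" by simp
  qed
  then have "dim (f ` V) = dim V"
    using dim_image_eq[OF f, of V] V by (simp add: span_eq_iff[THEN iffD2])
  moreover have "dim ?V' + dim V = dim ?W' + dim (f ` V)"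
    by (simp only: dim_subspace_orthogonal_to_vectors[OF V subspace_UNIV subset_UNIV]
        dim_subspace_orthogonal_to_vectors[OF fV subspace_UNIV subset_UNIV])
  ultimately have dim: "dim ?V' \<le> dim ?W'" by simp
  have VW': "subspace ?V'" "subspace ?W'"
    using subspace_orthogonal_to_vectors[of V] subspace_orthogonal_to_vectors[of "f ` V"] by simp_all
  obtain g where g: "linear g" "g \<in> ?V' \<rightarrow> ?W'" "\<And>x. x \<in> ?V' \<Longrightarrow> norm (g x) = norm x"
    by (rule isometry_subset_subspace[OF VW' dim]) blast
  define R where "R x = f (\<pi> x) + g (x - \<pi> x)" for x
  have linR: "linear R"
    unfolding R_def using linear_compose[OF lin\<pi> f] linear_compose[OF linear_compose_sub[OF linear_id lin\<pi>] g(1)]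
    by (intro linear_compose_add) (simp_all add: o_def)
  have "norm (R x) = norm x" for x
  proof -
    have m: "x - \<pi> x \<in> ?V'" using orth[of _ x] by (auto simp: orthogonal_commute)
    then have "g (x - \<pi> x) \<in> ?W'" using g(2) by blast
    then have "orthogonal (f (\<pi> x)) (g (x - \<pi> x))" using \<pi>V by blast
    then have "(norm (R x))\<^sup>2 = (norm (\<pi> x))\<^sup>2 + (norm (x - \<pi> x))\<^sup>2"
      unfolding R_def by (simp add: norm_add_Pythagorean n[OF \<pi>V] g(3)[OF m])
    also have "orthogonal (\<pi> x) (x - \<pi> x)" using orth[OF \<pi>V] by (simp add: orthogonal_commute)
    then have "(norm (\<pi> x))\<^sup>2 + (norm (x - \<pi> x))\<^sup>2 = (norm (\<pi> x + (x - \<pi> x)))\<^sup>2"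
      by (rule norm_add_Pythagorean[symmetric])
    finally show ?thesis by simp
  qed
  then have "orthogonal_transformation R" using linR by (simp add: orthogonal_transformation)
  moreover have "R x = f x" if "x \<in> V" for x using \<pi>id[OF that] linear_0[OF g(1)] by (simp add: R_def)
  ultimately show thesis by (rule that)
qed

text \<open>
  A vector orthogonal to \<open>V\<close> is orthogonal to all values of \<open>F\<close>, hence to the derivatives.
\<close>
lemma partials_in_subspace:
  fixes F :: "real \<times> real \<Rightarrow> 'a::euclidean_space"
  assumes T: "T > 0" and F: "has_partials T F Fx Fy" and V: "subspace V" and m: "\<And>p. p \<in> strip T \<Longrightarrow> F p \<in> V"
    and p: "p \<in> strip T"
  shows "Fx p \<in> V" "Fy p \<in> V"
proof -
  have sp: "span V = V" using V by (simp add: span_eq_iff)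
  have orth0: "v \<bullet> Fx p = 0 \<and> v \<bullet> Fy p = 0" if v: "\<And>w. w \<in> V \<Longrightarrow> orthogonal v w" for v
  proof -
    have "v \<bullet> F q = 0" if "q \<in> strip T" for q using v[OF m[OF that]] by (simp add: orthogonal_def)
    then show ?thesis
      using has_partials_eq[OF T has_partials_linear[OF bounded_linear_inner_right F, of v] has_partials_const[of T 0] _ p]
      by auto
  qed
  have "x \<in> V" if x: "\<And>v. (\<And>w. w \<in> V \<Longrightarrow> orthogonal v w) \<Longrightarrow> v \<bullet> x = 0" for x
  proof -
    obtain y z where yz: "y \<in> span V" "\<And>w. w \<in> span V \<Longrightarrow> orthogonal z w" "x = y + z"
      by (rule orthogonal_subspace_decomp_exists[of V x]) blast
    then have "z \<bullet> x = 0" using x[of z] sp by simp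
    moreover have "z \<bullet> y = 0" using yz(1,2) by (simp add: orthogonal_def)
    ultimately have "z = 0" using yz(3) by (simp add: inner_add_right)
    then show ?thesis using yz sp by simp
  qed
  then show "Fx p \<in> V" "Fy p \<in> V" using orth0 by blast+
qed

lemma jet_coefficients_isometry:
  assumes f: "linear f" and V: "subspace V" and n: "\<And>x. x \<in> V \<Longrightarrow> norm (f x) = norm x"
    and m: "x \<in> V" "y \<in> V" "xx \<in> V" "xy \<in> V" "yy \<in> V"
  shows "jet_coefficients (f x, f y, f xx, f xy, f yy) = jet_coefficients (x, y, xx, xy, yy)"
  by (simp add: jet_coefficients_def gram3_def area_density_def isometry_inner[OF f V n] n m)

lemma (in free_boundary_surface) isometric_image:
  fixes f :: "'a \<Rightarrow> 'b::euclidean_space"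
  assumes f: "linear f" and V: "subspace V" and n: "\<And>x. x \<in> V \<Longrightarrow> norm (f x) = norm x"
    and m: "\<And>p. p \<in> strip T \<Longrightarrow> u p \<in> V"
  shows "free_boundary_surface T (\<lambda>p. f (u p)) (\<lambda>p. f (X p)) (\<lambda>p. f (Y p)) (\<lambda>p. f (Xx p)) (\<lambda>p. f (Xy p)) (\<lambda>p. f (Yy p))"
proof
  have bl: "bounded_linear f" using f by (simp add: linear_conv_bounded_linear)
  have mXY: "X p \<in> V" "Y p \<in> V" if "p \<in> strip T" for p
    by (rule partials_in_subspace[OF T_pos u V _ that], rule m, assumption)+
  note i = isometry_inner[OF f V n]
  show "is_C1 T (\<lambda>p. f (Xx p))" "is_C1 T (\<lambda>p. f (Xy p))" "is_C1 T (\<lambda>p. f (Yy p))"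
  proof -
    have "is_C1 T (\<lambda>p. f (F p))" if "is_C1 T F" for F :: "real \<times> real \<Rightarrow> 'a"
      by (rule is_C1_I[OF has_partials_linear[OF bl is_C1_partials(1)[OF T_pos that]]])
        (intro bounded_linear.continuous_on[OF bl] is_C1_partials[OF T_pos that])+
    then show "is_C1 T (\<lambda>p. f (Xx p))" "is_C1 T (\<lambda>p. f (Xy p))" "is_C1 T (\<lambda>p. f (Yy p))"
      using second_C1 by auto
  qed
  show "T > 0" by (rule T_pos)
  show "has_partials T (\<lambda>p. f (u p)) (\<lambda>p. f (X p)) (\<lambda>p. f (Y p))" "has_partials T (\<lambda>p. f (X p)) (\<lambda>p. f (Xx p)) (\<lambda>p. f (Xy p))"
    "has_partials T (\<lambda>p. f (Y p)) (\<lambda>p. f (Xy p)) (\<lambda>p. f (Yy p))"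
    by (rule has_partials_linear[OF bl] u X Y)+
  show "f (u (t, \<theta> + 2 * pi)) = f (u (t, \<theta>))" if "t \<in> {-T..T}" for t \<theta> using periodic[OF that] by simp
  fix p assume p: "p \<in> strip T"
  show "(f (X p) \<bullet> f (X p)) * (f (Y p) \<bullet> f (Y p)) - (f (X p) \<bullet> f (Y p))\<^sup>2 > 0"
    using regular[OF p] by (simp add: i mXY[OF p])
  have "f ((Y p \<bullet> Y p) *\<^sub>R Xx p - (2 * (X p \<bullet> Y p)) *\<^sub>R Xy p + (X p \<bullet> X p) *\<^sub>R Yy p) \<in> f ` span {X p, Y p}"
    by (rule imageI[OF minimal[OF p]])
  also have "f ` span {X p, Y p} = span {f (X p), f (Y p)}"
    using linear_span_image[OF f, of "{X p, Y p}"] by simp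
  finally show "(f (Y p) \<bullet> f (Y p)) *\<^sub>R f (Xx p) - (2 * (f (X p) \<bullet> f (Y p))) *\<^sub>R f (Xy p) + (f (X p) \<bullet> f (X p)) *\<^sub>R f (Yy p)
      \<in> span {f (X p), f (Y p)}"
    by (simp add: linear_add[OF f] linear_diff[OF f] linear_scale[OF f] i mXY[OF p])
  show "norm (f (u p)) \<le> 1" "norm (f (u p)) = 1 \<longleftrightarrow> \<bar>fst p\<bar> = T"
    using sphere[OF p] by (simp_all add: n m[OF p])
next
  have mXY: "X p \<in> V" "Y p \<in> V" if "p \<in> strip T" for p
    by (rule partials_in_subspace[OF T_pos u V _ that], rule m, assumption)+
  note i = isometry_inner[OF f V n]
  fix s \<theta> :: real assume s: "s \<in> {1, -1}"
  have p: "(s * T, \<theta>) \<in> strip T" using s T_pos by auto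
  have "area_density (f (X (s * T, \<theta>))) (f (Y (s * T, \<theta>))) = area_density (X (s * T, \<theta>)) (Y (s * T, \<theta>))"
    by (simp add: area_density_def i mXY[OF p])
  then show "(f (Y (s * T, \<theta>)) \<bullet> f (Y (s * T, \<theta>))) *\<^sub>R f (X (s * T, \<theta>)) - (f (X (s * T, \<theta>)) \<bullet> f (Y (s * T, \<theta>))) *\<^sub>R f (Y (s * T, \<theta>))
        = (s * area_density (f (X (s * T, \<theta>))) (f (Y (s * T, \<theta>))) * norm (f (Y (s * T, \<theta>)))) *\<^sub>R f (u (s * T, \<theta>))"
    using arg_cong[OF conormal[OF s, of \<theta>], of f]
    by (simp add: linear_diff[OF f] linear_scale[OF f] i mXY[OF p] n)
qed

lemma (in free_boundary_surface) jet_coefficients_eq: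
  "jet_coefficients (X p, Y p, Xx p, Xy p, Yy p) =
    (a p, b p, c p, 2 * (gram3 (X p) (Y p) (Xx p) (Yy p) - gram3 (X p) (Y p) (Xy p) (Xy p)) / (W p) ^ 3, norm (Y p))"
  by (simp add: jet_coefficients_def a_def b_def c_def W_def)

unbundle cross3_syntax

text \<open>
  The product of two determinants is the determinant of the inner products.
\<close>
lemma triple_product_gram3:
  fixes x y v v' :: "real^3"
  shows "((x \<times> y) \<bullet> v) * ((x \<times> y) \<bullet> v') = gram3 x y v v'"
  by (simp add: gram3_def cross3_simps power2_eq_square)

unbundle no cross3_syntax

lemma (in free_boundary_surface_3) jet_coefficients_eq_3:
  assumes p: "p \<in> strip T"
  shows "jet_coefficients (X p, Y p, Xx p, Xy p, Yy p) = (a p, b p, c p, 2 * k p, norm (Y p))"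
proof -
  have W: "W p \<noteq> 0" using W_pos[OF p] by simp
  have i: "cross3 (X p) (Y p) \<bullet> v = W p * (N p \<bullet> v)" for v
    by (simp add: cross_eq_W_N[OF p])
  have "gram3 (X p) (Y p) (Xx p) (Yy p) - gram3 (X p) (Y p) (Xy p) (Xy p) = (W p)\<^sup>2 * (l p * n p - m p * m p)"
    unfolding triple_product_gram3[symmetric] i by (simp add: l_def m_def n_def power2_eq_square algebra_simps)
  also have "\<dots> = (W p) ^ 3 * k p" using W by (simp add: k_def eval_nat_numeral)
  finally have "gram3 (X p) (Y p) (Xx p) (Yy p) - gram3 (X p) (Y p) (Xy p) (Xy p) = (W p) ^ 3 * k p" .
  then show ?thesis unfolding jet_coefficients_eq using W by simp
qed

theorem theorem3p3:
  fixes \<sigma> :: "3 \<Rightarrow> 'n::finite"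
  assumes "CARD('n) \<ge> 3" and "inj \<sigma>"
  shows "\<exists>\<delta>>0. \<forall>u :: real \<times> complex \<Rightarrow> real ^ 'n.
    free_boundary_minimal_immersion critical_T u \<and>
    C2_norm critical_T (\<lambda>p. u p - coord_inclusion \<sigma> (critical_catenoid p)) < \<delta> \<longrightarrow>
    (\<exists>R. orthogonal_transformation R \<and>
         u ` annulus critical_T =
           R ` coord_inclusion \<sigma> ` critical_catenoid ` annulus critical_T)"
proof (rule jacobi_coercive_near, rule steklov_coercive_near, goal_cases)
  case (1 \<epsilon>J \<delta>J \<epsilon>S \<delta>S)
  note J = 1(1-3) and S = 1(4-6)
  let ?T = critical_T and ?C = catenoid_scale
  have T: "?T > 0" by (rule critical_T_pos)
  have C: "?C > 0" by (rule catenoid_scale_pos)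
  \<comment> \<open>The third bound keeps the Gauss curvature negative: on the catenoid the potential is at most \<open>- 2 / cosh\<^sup>2 T\<close>.\<close>
  define \<epsilon> where "\<epsilon> = min (min \<epsilon>J \<epsilon>S) (1 / (cosh ?T)\<^sup>2)"
  have \<epsilon>: "\<epsilon> > 0" "\<epsilon> \<le> \<epsilon>J" "\<epsilon> \<le> \<epsilon>S" "\<epsilon> \<le> 1 / (cosh ?T)\<^sup>2"
    using J(1) S(1) by (auto simp: \<epsilon>_def)
  obtain \<delta>1 where \<delta>1: "\<delta>1 > 0"
    "\<And>t z j \<alpha> \<beta> \<gamma> \<kappa> \<mu>. t \<in> {-?T..?T} \<Longrightarrow> norm z = 1 \<Longrightarrow> dist j (catenoid_jet \<sigma> (t, z)) < \<delta>1 \<Longrightarrow>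
      jet_coefficients j = (\<alpha>, \<beta>, \<gamma>, \<kappa>, \<mu>) \<Longrightarrow>
      \<bar>\<alpha> - 1\<bar> \<le> \<epsilon> \<and> \<bar>\<beta>\<bar> \<le> \<epsilon> \<and> \<bar>\<gamma> - 1\<bar> \<le> \<epsilon> \<and> \<bar>\<kappa> + 2 / (cosh t)\<^sup>2\<bar> \<le> \<epsilon> \<and> \<bar>\<mu> - ?C * cosh t\<bar> \<le> \<epsilon>"
    by (rule jets_near_catenoid[OF assms(2) \<epsilon>(1)]) blast
  \<comment> \<open>The boundary circles of the critical catenoid lie at the heights \<open>\<plusminus> C T\<close>, where \<open>C\<close> is the scale of the catenoid.\<close>
  have low: "?C * ?T < sqrt 2 / 2"
  proof -
    have "(?C * ?T)\<^sup>2 + (?C * cosh ?T)\<^sup>2 = ?C\<^sup>2 * ((cosh ?T)\<^sup>2 + ?T\<^sup>2)" by (simp add: power_mult_distrib algebra_simps)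
    also have "\<dots> = 1"
    proof -
      have "(cosh ?T)\<^sup>2 + ?T\<^sup>2 > 0" using T by (simp add: add_pos_pos)
      then show ?thesis by (simp add: catenoid_scale_def power_divide)
    qed
    finally have "(?C * ?T)\<^sup>2 = 1 - (1 / ?T)\<^sup>2" unfolding catenoid_scale_cosh by simp
    moreover have "(1 / ?T)\<^sup>2 > 1 / 2" using critical_T_square_lt_2 T by (simp add: power_divide field_simps)
    moreover have "(sqrt 2 / 2)\<^sup>2 = 1 / (2::real)" by (simp add: power_divide)
    ultimately have "(?C * ?T)\<^sup>2 < (sqrt 2 / 2)\<^sup>2" by simp
    then show ?thesis by (rule power_less_imp_less_base) simp
  qed
  \<comment> \<open>The first bound controls the jets. By the second, midpoints of opposite boundary points stay below the height \<open>1 / \<surd>2\<close>.\<close>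
  define \<delta> where "\<delta> = min (\<delta>1 / 5) (sqrt 2 / 2 - ?C * ?T)"
  have \<delta>_le: "\<delta> \<le> \<delta>1 / 5" "\<delta> \<le> sqrt 2 / 2 - ?C * ?T" unfolding \<delta>_def by (rule min.cobounded1, rule min.cobounded2)
  have "\<delta> > 0" using \<delta>1(1) low by (simp add: \<delta>_def)
  then have \<delta>: "\<delta> > 0" "5 * \<delta> \<le> \<delta>1" "?C * ?T + \<delta> \<le> sqrt 2 / 2"
    using \<delta>_le by simp_all
  have main: "\<exists>R. orthogonal_transformation R \<and> u ` annulus ?T = R ` coord_inclusion \<sigma> ` critical_catenoid ` annulus ?T"
    if fb: "free_boundary_minimal_immersion ?T u"
      and near: "C2_norm ?T (\<lambda>p. u p - coord_inclusion \<sigma> (critical_catenoid p)) < \<delta>" for u :: "real \<times> complex \<Rightarrow> real ^ 'n"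
  proof -
    define U where "U = lift u"
    define X Y Xx Xy Yy where "X = d_t ?T U" and "Y = d_theta ?T U" and "Xx = d_t ?T (d_t ?T U)"
      and "Xy = d_theta ?T (d_t ?T U)" and "Yy = d_theta ?T (d_theta ?T U)"
    note defs = U_def X_def Y_def Xx_def Xy_def Yy_def
    interpret S: free_boundary_surface ?T U X Y Xx Xy Yy
      unfolding defs by (rule free_boundary_surface_of_immersion[OF T fb])
    have sm: "smooth_annulus_map ?T u"
      using fb by (auto simp: free_boundary_minimal_immersion_def minimal_immersion_def immersion_def)
    have jet: "dist (X (t, \<theta>), Y (t, \<theta>), Xx (t, \<theta>), Xy (t, \<theta>), Yy (t, \<theta>)) (catenoid_jet \<sigma> (t, cis \<theta>)) < \<delta>1"
      if "(t, \<theta>) \<in> strip ?T" for t \<theta>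
      using jets_of_close_map(2)[OF T sm that, where \<sigma> = \<sigma>] near \<delta>(2) unfolding defs by linarith
    have close: "\<bar>S.a (t, \<theta>) - 1\<bar> \<le> \<epsilon> \<and> \<bar>S.b (t, \<theta>)\<bar> \<le> \<epsilon> \<and> \<bar>S.c (t, \<theta>) - 1\<bar> \<le> \<epsilon> \<and> \<bar>norm (Y (t, \<theta>)) - ?C * cosh t\<bar> \<le> \<epsilon>"
      if "(t, \<theta>) \<in> strip ?T" for t \<theta>
      using \<delta>1(2)[OF _ _ jet[OF that] S.jet_coefficients_eq] that by simp
    have \<mu>: "\<bar>norm (Y (?T, \<theta>)) - 1 / ?T\<bar> \<le> \<epsilon>" "\<bar>norm (Y (- ?T, \<theta>)) - 1 / ?T\<bar> \<le> \<epsilon>" for \<theta>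
      using close[of ?T \<theta>] close[of "- ?T" \<theta>] T by (simp_all add: catenoid_scale_cosh)
    have dim3: "dim (U ` rect ?T) \<le> 3"
    proof (rule S.dim_image_le_3[OF refl S(2)])
      fix f fx fy
      assume f: "C1_annulus ?T f fx fy" "\<And>s. s \<in> {?T / 2, - ?T / 2} \<Longrightarrow> harmonic0 (\<lambda>\<theta>. f (s, \<theta>)) = 0"
        "harmonic_cos (\<lambda>\<theta>. f (0, \<theta>)) = 0" "harmonic_sin (\<lambda>\<theta>. f (0, \<theta>)) = 0"
      show "\<delta>S * h1_norm2 f fx fy \<le> energy ?T S.a S.b S.c (\<lambda>_. 0) (\<lambda>p. norm (Y p)) f fx fy"
      proof (rule S(3)[OF S.coefficients_continuous _ _ _ f])
        fix p assume "p \<in> rect ?T"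
        then show "\<bar>S.a p - 1\<bar> \<le> \<epsilon>S \<and> \<bar>S.b p\<bar> \<le> \<epsilon>S \<and> \<bar>S.c p - 1\<bar> \<le> \<epsilon>S"
          using close[of "fst p" "snd p"] \<epsilon>(3) rect_subset_strip[of ?T] by auto
      qed (use \<mu> \<epsilon>(3) order_trans in blast)+
    qed
    \<comment> \<open>From here on the surface is moved to three-space by an isometry of its span.\<close>
    define V where "V = span (U ` rect ?T)"
    have V: "subspace V" by (simp add: V_def)
    have UV: "U p \<in> V" if p: "p \<in> strip ?T" for p
    proof -
      obtain t \<theta> where pt: "p = (t, \<theta>)" "t \<in> {-?T..?T}" using p by (cases p) auto
      obtain \<theta>' where "\<theta>' \<in> {0..2 * pi}" "U (t, \<theta>) = U (t, \<theta>')"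
        using periodic_reduce[of "\<lambda>\<theta>. U (t, \<theta>)" \<theta>, OF S.periodic[OF pt(2)]] by auto
      then show ?thesis using pt by (auto simp: V_def cbox_Pair_eq intro!: span_base)
    qed
    have dimV: "dim V \<le> dim (UNIV :: (real^3) set)" using dim3 by (simp add: V_def)
    obtain f :: "real ^ 'n \<Rightarrow> real ^ 3" where f: "linear f" "\<And>x. x \<in> V \<Longrightarrow> norm (f x) = norm x"
      by (rule isometry_subset_subspace[OF V subspace_UNIV dimV]) blast
    let ?u = "\<lambda>p. f (U p)" and ?X = "\<lambda>p. f (X p)" and ?Y = "\<lambda>p. f (Y p)"
      and ?Xx = "\<lambda>p. f (Xx p)" and ?Xy = "\<lambda>p. f (Xy p)" and ?Yy = "\<lambda>p. f (Yy p)"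
    interpret M: free_boundary_surface ?T ?u ?X ?Y ?Xx ?Xy ?Yy
      by (rule S.isometric_image[OF f(1) V f(2) UV])
    interpret M: free_boundary_surface_3 ?T ?u ?X ?Y ?Xx ?Xy ?Yy ..
    have XYV: "X p \<in> V" "Y p \<in> V" if "p \<in> strip ?T" for p
      by (rule partials_in_subspace[OF T S.u V _ that], rule UV, assumption)+
    have XXV: "Xx p \<in> V" "Xy p \<in> V" if "p \<in> strip ?T" for p
      by (rule partials_in_subspace[OF T S.X V _ that], rule XYV(1), assumption)+
    have YYV: "Yy p \<in> V" if "p \<in> strip ?T" for p
      by (rule partials_in_subspace(2)[OF T S.Y V _ that], rule XYV(2), assumption)
    have closeM: "\<bar>M.a (t, \<theta>) - 1\<bar> \<le> \<epsilon> \<and> \<bar>M.b (t, \<theta>)\<bar> \<le> \<epsilon> \<and> \<bar>M.c (t, \<theta>) - 1\<bar> \<le> \<epsilon>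
        \<and> \<bar>2 * M.k (t, \<theta>) + 2 / (cosh t)\<^sup>2\<bar> \<le> \<epsilon> \<and> \<bar>norm (?Y (t, \<theta>)) - ?C * cosh t\<bar> \<le> \<epsilon>"
      if p: "(t, \<theta>) \<in> strip ?T" for t \<theta>
    proof -
      have "jet_coefficients (X (t, \<theta>), Y (t, \<theta>), Xx (t, \<theta>), Xy (t, \<theta>), Yy (t, \<theta>))
          = (M.a (t, \<theta>), M.b (t, \<theta>), M.c (t, \<theta>), 2 * M.k (t, \<theta>), norm (?Y (t, \<theta>)))"
        using M.jet_coefficients_eq_3[OF p] jet_coefficients_isometry[OF f(1) V f(2) XYV[OF p] XXV[OF p] YYV[OF p]] by simp
      from \<delta>1(2)[OF _ _ jet[OF p] this] show ?thesis using p by simp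
    qed
    have \<mu>M: "\<bar>norm (?Y (?T, \<theta>)) - 1 / ?T\<bar> \<le> \<epsilon>" "\<bar>norm (?Y (- ?T, \<theta>)) - 1 / ?T\<bar> \<le> \<epsilon>" for \<theta>
      using closeM[of ?T \<theta>] closeM[of "- ?T" \<theta>] T by (simp_all add: catenoid_scale_cosh)
    have kneg: "M.k p < 0" if p: "p \<in> strip ?T" for p
    proof -
      obtain t \<theta> where pt: "p = (t, \<theta>)" "\<bar>t\<bar> \<le> ?T" using p by (cases p) auto
      have "cosh t \<le> cosh ?T" using pt(2) T cosh_real_nonneg_le_iff[of "\<bar>t\<bar>" ?T] by simp
      then have "(cosh t)\<^sup>2 \<le> (cosh ?T)\<^sup>2" by (intro power_mono) (auto intro: less_imp_le)
      then have "1 / (cosh ?T)\<^sup>2 \<le> 1 / (cosh t)\<^sup>2" by (intro divide_left_mono) auto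
      moreover have "1 / (cosh t)\<^sup>2 > 0" by simp
      moreover have "2 * M.k p + 2 * (1 / (cosh t)\<^sup>2) \<le> \<epsilon>" using closeM[of t \<theta>] p pt(1) by (simp add: abs_le_iff)
      ultimately show ?thesis using \<epsilon>(4) by linarith
    qed
    have kneg': "M.k p < 0" if "p \<in> rect ?T" for p using kneg that rect_subset_strip by blast
    obtain v where v: "v \<noteq> 0" "\<And>p. p \<in> rect ?T \<Longrightarrow> v \<bullet> M.w p = 0"
    proof (rule M.exists_tangent_rotation[OF refl J(2) kneg'], goal_cases)
      case (2 f fx fy)
      show ?case
      proof (rule J(3)[OF M.coefficients_continuous(1-3) _ M.coefficients_continuous(4) _ _ _ 2(2,3)])
        show "continuous_on (strip ?T) (\<lambda>p. 2 * M.k p)"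
          by (intro continuous_intros is_C1_continuous[OF M.k_C1])
        fix p assume "p \<in> rect ?T"
        then show "\<bar>M.a p - 1\<bar> \<le> \<epsilon>J \<and> \<bar>M.b p\<bar> \<le> \<epsilon>J \<and> \<bar>M.c p - 1\<bar> \<le> \<epsilon>J \<and> \<bar>2 * M.k p + 2 / (cosh (fst p))\<^sup>2\<bar> \<le> \<epsilon>J"
          using closeM[of "fst p" "snd p"] \<epsilon>(2) rect_subset_strip[of ?T] by auto
      qed (use \<mu>M \<epsilon>(2) order_trans in blast)+
    qed auto
    define e where "e = v /\<^sub>R norm v"
    have e1: "norm e = 1" using v(1) by (simp add: e_def)
    have ew: "e \<bullet> M.w p = 0" if p: "p \<in> strip ?T" for p
    proof -
      obtain t \<theta> where pt: "p = (t, \<theta>)" "t \<in> {-?T..?T}" using p by (cases p) auto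
      have "M.w (t, \<theta> + 2 * pi) = M.w (t, \<theta>)" for \<theta>
        by (simp add: M.w_def S.periodic[OF pt(2)] M.N_periodic[OF pt(2)])
      from periodic_reduce[of "\<lambda>\<theta>. M.w (t, \<theta>)" \<theta>, OF this]
      obtain \<theta>' where "\<theta>' \<in> {0..2 * pi}" "M.w (t, \<theta>) = M.w (t, \<theta>')" by auto
      then have "v \<bullet> M.w p = 0" using v(2)[of "(t, \<theta>')"] pt by (auto simp: cbox_Pair_eq)
      then show ?thesis by (simp add: e_def)
    qed
    interpret R: rotational_surface ?T ?u ?X ?Y ?Xx ?Xy ?Yy e
    proof
      show "e \<bullet> e = 1" using e1 by (simp add: norm_eq_1)
      show "e \<bullet> M.w p = 0" if "p \<in> strip ?T" for p by (rule ew[OF that])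
      show "M.k p \<noteq> 0" if "p \<in> strip ?T" for p using kneg[OF that] by simp
      fix s \<theta> :: real assume s: "s \<in> {1, -1}"
      have p: "(s * ?T, \<theta>) \<in> strip ?T" for \<theta> using s T by auto
      let ?c = "\<lambda>\<theta>. scaled_vec \<sigma> (cosh (s * ?T) * cos \<theta>) (cosh (s * ?T) * sin \<theta>) (s * ?T)"
      have n: "norm (U (s * ?T, \<theta>) - ?c \<theta>) < \<delta>" for \<theta>
        using jets_of_close_map(1)[OF T sm p, where \<sigma> = \<sigma>] near unfolding U_def by (rule le_less_trans)
      have "?c \<theta> + ?c (\<theta> + pi) = scaled_vec \<sigma> 0 0 (2 * (s * ?T))"
        by (simp only: scaled_vec_expand cos_periodic_pi sin_periodic_pi mult_minus_right mult_2 scaleR_add_left)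
          (simp only: scaleR_minus_left scaleR_zero_left, simp)
      moreover have "norm (scaled_vec \<sigma> 0 0 (2 * (s * ?T))) = 2 * (?C * ?T)"
      proof -
        have "(norm (scaled_vec \<sigma> 0 0 (2 * (s * ?T))))\<^sup>2 = (2 * (?C * ?T))\<^sup>2"
          unfolding power2_norm_eq_inner inner_scaled_vec[OF assms(2)] using s by (auto simp: power2_eq_square)
        then show ?thesis using C T by (intro power2_eq_imp_eq[of "norm _"]) simp_all
      qed
      ultimately have "norm (?c \<theta> + ?c (\<theta> + pi)) = 2 * (?C * ?T)" by simp
      moreover have "norm (U (s * ?T, \<theta>) + U (s * ?T, \<theta> + pi))
          \<le> norm (?c \<theta> + ?c (\<theta> + pi)) + (norm (U (s * ?T, \<theta>) - ?c \<theta>) + norm (U (s * ?T, \<theta> + pi) - ?c (\<theta> + pi)))"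
      proof -
        have "U (s * ?T, \<theta>) + U (s * ?T, \<theta> + pi) = (?c \<theta> + ?c (\<theta> + pi)) + ((U (s * ?T, \<theta>) - ?c \<theta>) + (U (s * ?T, \<theta> + pi) - ?c (\<theta> + pi)))"
          by simp
        then show ?thesis by (simp only:) (intro norm_triangle_le add_left_mono norm_triangle_ineq)
      qed
      ultimately have "norm (U (s * ?T, \<theta>) + U (s * ?T, \<theta> + pi)) < sqrt 2"
        using n[of \<theta>] n[of "\<theta> + pi"] \<delta>(3) by linarith
      moreover have "norm (?u (s * ?T, \<theta>) + ?u (s * ?T, \<theta> + pi)) = norm (U (s * ?T, \<theta>) + U (s * ?T, \<theta> + pi))"
        unfolding linear_add[OF f(1), symmetric] by (rule f(2)[OF subspace_add[OF V UV[OF p] UV[OF p]]])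
      ultimately show "norm (?u (s * ?T, \<theta>) + ?u (s * ?T, \<theta> + pi)) < sqrt 2" by simp
    qed
    have cat: "?u p \<bullet> ?u p - (e \<bullet> ?u p)\<^sup>2 = (?C * cosh ((e \<bullet> ?u p) / ?C))\<^sup>2" if "p \<in> strip ?T" for p
      using R.on_critical_catenoid[OF that] by (simp add: catenoid_scale_def)
    \<comment> \<open>Turn the axis into the third coordinate axis, which is the axis of the critical catenoid.\<close>
    obtain r :: "real^3 \<Rightarrow> real^3" where r: "orthogonal_transformation r" "r e = axis 3 1"
      using orthogonal_transformation_exists_1[OF e1, of "axis 3 1"] by auto
    have linr: "linear r" and nr: "norm (r x) = norm x" for x
      using r(1) by (simp_all add: orthogonal_transformation)
    have ir: "r x \<bullet> r y = x \<bullet> y" for x y using r(1) by (simp add: orthogonal_transformation_def)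
    let ?v = "\<lambda>p. r (?u p)"
    have blr: "bounded_linear r" using linr by (simp add: linear_conv_bounded_linear)
    have fill: "?v ` strip ?T = critical_catenoid ` annulus ?T"
    proof (rule fills_catenoid[OF has_partials_linear[OF blr M.u]])
      fix p assume p: "p \<in> strip ?T"
      have v3: "?v p $ 3 = e \<bullet> ?u p"
      proof -
        have "?v p $ 3 = r e \<bullet> ?v p" unfolding r(2) by (simp add: inner_axis')
        then show ?thesis by (simp add: ir)
      qed
      have "?v p \<bullet> ?v p = (?v p $ 1)\<^sup>2 + (?v p $ 2)\<^sup>2 + (?v p $ 3)\<^sup>2"
        by (simp add: inner_vec_def sum_3 power2_eq_square)
      then have "(?v p $ 1)\<^sup>2 + (?v p $ 2)\<^sup>2 = ?u p \<bullet> ?u p - (e \<bullet> ?u p)\<^sup>2"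
        unfolding ir v3 by simp
      then show "(?v p $ 1)\<^sup>2 + (?v p $ 2)\<^sup>2 = (?C * cosh (?v p $ 3 / ?C))\<^sup>2"
        unfolding v3 cat[OF p] .
      show "norm (?v p) \<le> 1" "norm (?v p) = 1 \<longleftrightarrow> \<bar>fst p\<bar> = ?T" using M.sphere[OF p] by (simp_all add: nr)
      fix h :: "real \<times> real"
      assume "fst h *\<^sub>R r (?X p) + snd h *\<^sub>R r (?Y p) = 0"
      then have "r (f (fst h *\<^sub>R X p + snd h *\<^sub>R Y p)) = 0"
        by (simp add: linear_add[OF linr] linear_scale[OF linr] linear_add[OF f(1)] linear_scale[OF f(1)])
      then have "norm (f (fst h *\<^sub>R X p + snd h *\<^sub>R Y p)) = 0" by (simp flip: nr[of "f (fst h *\<^sub>R X p + snd h *\<^sub>R Y p)"])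
      then have z: "fst h *\<^sub>R X p + snd h *\<^sub>R Y p = 0"
        using f(2)[OF subspace_add[OF V subspace_mul[OF V XYV(1)[OF p]] subspace_mul[OF V XYV(2)[OF p]]]] by simp
      have P: "S.P p \<bullet> (fst h *\<^sub>R X p + snd h *\<^sub>R Y p) = 0" "S.Q p \<bullet> (fst h *\<^sub>R X p + snd h *\<^sub>R Y p) = 0"
        by (simp_all only: z inner_zero_right)
      then show "h = 0"
        using S.W_pos[OF p] by (simp add: inner_add_right S.flux_products[OF p] prod_eq_iff)
    next
      show "?v ` strip ?T = ?v ` rect ?T"
      proof
        show "?v ` strip ?T \<subseteq> ?v ` rect ?T"
        proof
          fix x assume "x \<in> ?v ` strip ?T"
          then obtain p where p: "p \<in> strip ?T" "x = ?v p" by blast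
          obtain q where "q \<in> rect ?T" "?u p = ?u q" by (rule M.strip_to_rect[OF p(1)])
          then show "x \<in> ?v ` rect ?T" using p(2) by auto
        qed
      qed (use rect_subset_strip in blast)
    qed
    let ?g = "\<lambda>x. coord_inclusion \<sigma> (r (f x))"
    have ling: "linear ?g"
      using linear_compose[OF linear_compose[OF f(1) linr] linear_coord_inclusion[of \<sigma>]] by (simp add: o_def)
    have ng: "norm (?g x) = norm x" if "x \<in> V" for x
      using inner_coord_inclusion[OF assms(2), of "r (f x)" "r (f x)"] nr f(2)[OF that] by (simp add: norm_eq_sqrt_inner)
    obtain R where R: "orthogonal_transformation R" "\<And>x. x \<in> V \<Longrightarrow> R x = ?g x"
      by (rule extend_isometry[OF ling V], rule ng, assumption) blast
    have lift_image: "u ` annulus ?T = U ` strip ?T"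
    proof
      show "u ` annulus ?T \<subseteq> U ` strip ?T"
      proof
        fix x assume "x \<in> u ` annulus ?T"
        then obtain t z where tz: "t \<in> {-?T..?T}" "norm z = 1" "x = u (t, z)" by (auto simp: annulus_def)
        obtain \<alpha> where "z = cis \<alpha>" using complex_unimodular_polar[OF tz(2)] cis.ctr by metis
        then have "x = U (t, \<alpha>)" using tz(3) by (simp add: U_def lift_def)
        then show "x \<in> U ` strip ?T" using tz(1) by auto
      qed
      show "U ` strip ?T \<subseteq> u ` annulus ?T" by (auto simp: U_def lift_def annulus_def)
    qed
    have "R ` (u ` annulus ?T) = (\<lambda>p. ?g (U p)) ` strip ?T"
      unfolding lift_image image_image by (rule image_cong[OF refl R(2)[OF UV]])
    also have "\<dots> = coord_inclusion \<sigma> ` (?v ` strip ?T)" by (simp add: image_image)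
    finally have im: "R ` (u ` annulus ?T) = coord_inclusion \<sigma> ` critical_catenoid ` annulus ?T" unfolding fill .
    have "u ` annulus ?T = inv R ` (R ` (u ` annulus ?T))"
      using orthogonal_transformation_inj[OF R(1)] by (simp add: image_inv_f_f)
    then have "u ` annulus ?T = inv R ` coord_inclusion \<sigma> ` critical_catenoid ` annulus ?T" unfolding im .
    then show ?thesis using orthogonal_transformation_inv[OF R(1)] by blast
  qed
  then show ?case using \<delta>(1) by blast
qed

end
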